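(* Assume in addition that $w\ge\underline w>0$ on $\Omega$ for some constant $\underline w$. Let $\epsilon_n>0$ be a vanishing sequence and let $q_n\in L^\alpha(\Omega_{\epsilon_n};\mathbb R^d)$ be the corresponding solutions of the regularized Beckmann problem on $\Omega_{\epsilon_n}$, i.e. minimizers of $$\int_{\Omega_{\epsilon_n}}\hat w\,|q|\,dx+\frac{\epsilon_n}{\alpha}\|q\|^\alpha_{L^\alpha(\Omega_{\epsilon_n})}\quad\text{over } q\in L^\alpha(\Omega_{\epsilon_n};\mathbb R^d)\text{ with }\operatorname{div}q=\tilde\mu\text{ in }W^{-1,\alpha}_\perp(\Omega_{\epsilon_n}).$$ Then $(q_n)$ (extended by zero to $\tilde\Omega$ and regarded as measures) admits a subsequence that converges, with respect to weak-$*$ convergence in $\mathcal M(\tilde\Omega;\mathbb R^d)$, to a solution of the Beckmann problem $$\inf\Big\{\int_\Omega w\,d|q| : q\in\mathcal M(\Omega;\mathbb R^d),\ \operatorname{div}_{\mathcal M}q=\mu\Big\}.$$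
   Context: Setting: $d\in\mathbb N$; $\Omega\subset\mathbb R^d$ is compact and its interior $\Omega^\circ$ is a bounded Lipschitz domain; $\Omega$ is strictly star shaped with respect to $0$: $\lambda x\in\Omega^\circ$ for all $x\in\Omega$, $0\le\lambda<1$; $w:\Omega\to[0,\infty)$ is continuous; $1<\alpha<\frac{d}{d-1}$, $\alpha'=\frac{\alpha}{\alpha-1}$; $\mu^+,\mu^-$ are Borel probability measures on $\Omega$, $\mu:=\mu^+-\mu^-$. $|\cdot|$ is the Euclidean norm, $|q|$ the total variation measure of a vector measure $q$, $dx$ Lebesgue measure, $\mathcal M(K;\mathbb R^d)$ the $\mathbb R^d$-valued Radon measures on a compact set $K$ (weak-$*$ topology as dual of $C(K;\mathbb R^d)$). Spaces, for a compact set $K$ (here $K=\Omega$ or $K=\Omega_\tau$ below; Sobolev spaces on the interior): $W^{1,p}_\emptyset(K)=\{v\in W^{1,p}(K):\int_K v\,dx=0\}$; $W^{-1,p}_\perp(K)=\{v\in(W^{1,p'}(K))^*:\langle v,1\rangle=0\}$ with $p'$ conjugate to $p$; $\operatorname{div}:L^p(K;\mathbb R^d)\to W^{-1,p}_\perp(K)$, $\langle\operatorname{div}q,\phi\rangle=-\int_K q\cdot\nabla\phi\,dx$ for $\phi\in W^{1,p'}_\emptyset(K)$. Measures with total mass zero are regarded as elements of $W^{-1,\alpha}_\perp(K)$ (since $W^{1,\alpha'}(K)\hookrightarrow C(K)$). $C^1_\emptyset(K)=\{v\in C^1(K):\int_Kv\,dx=0\}$; for $q\in\mathcal M(\Omega;\mathbb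 R^d)$, $\operatorname{div}_{\mathcal M}q=\mu$ means $-\int_\Omega\nabla\phi\cdot dq=\int_\Omega\phi\,d\mu$ for all $\phi\in C^1_\emptyset(\Omega)$. Assumption on $\Omega$: for every $\nu\in W^{-1,\alpha'}_\perp(\Omega)$ there is a unique $y\in W^{1,\alpha'}_\emptyset(\Omega)$ with $-\int_\Omega\nabla y\cdot\nabla\phi\,dx=\langle\nu,\phi\rangle$ for all $\phi\in W^{1,\alpha}_\emptyset(\Omega)$. Enlarged domains: fix a sequence of parameters $\tau>0$, $\tau\to0$, and nonnegative mollifiers $\phi_\tau\in C_c^\infty(\mathbb R^d)$ ($\int\phi_\tau=1$, supports shrinking to $\{0\}$). For each $\tau$ choose $s_\tau>0$, $s_\tau\to0$, such that $\Omega_\tau:=(1+s_\tau)\Omega\supset\Omega+\operatorname{supp}\phi_\tau$ and $\Omega_\tau\supset\Omega_\vartheta$ for $\tau>\vartheta$. Put $\tilde\Omega=\bigcup_\tau\Omega_\tau$. $\tilde f$ denotes extension of a function or measure $f$ by zero to $\tilde\Omega$; $\hat w$ is a continuous extension of $w$ to $\tilde\Omega$ with $\min_{\tilde\Omega}\hat w=\min_\Omega w$. The parameters $\epsilon_n$ are taken from this family of parameters, and $\Omega_{\epsilon_n}$ is the domain for $\tau=\epsilon_n$. *)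

theory Defs
  imports "HOL-Analysis.Analysis" "HOL-Probability.Probability_Measure"
begin

(* In every local chart (given by an "upward" unit vector e) the set is the strict
   epigraph of a Lipschitz function on the hyperplane orthogonal to e. *)
definition bounded_lipschitz_domain :: "'a::euclidean_space set \<Rightarrow> bool" where
  "bounded_lipschitz_domain U \<longleftrightarrow>
     open U \<and> connected U \<and> U \<noteq> {} \<and> bounded U \<and>
     (\<forall>x\<in>frontier U. \<exists>r>0. \<exists>e L. \<exists>g :: 'a \<Rightarrow> real.
        norm e = 1 \<and> lipschitz_on L {y. y \<bullet> e = 0} g \<and>
        U \<inter> ball x r = {z \<in> ball x r. g (z - (z \<bullet> e) *\<^sub>R e) < z \<bullet> e})"

definition strictly_star_shaped :: "'a::real_normed_vector set \<Rightarrow> bool" where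
  "strictly_star_shaped K \<longleftrightarrow> (\<forall>x\<in>K. \<forall>l. 0 \<le> l \<and> l < 1 \<longrightarrow> l *\<^sub>R x \<in> interior K)"

definition conj_exp :: "real \<Rightarrow> real" where
  "conj_exp p = p / (p - 1)"


subsection \<open>Test functions\<close>

primrec Ck :: "nat \<Rightarrow> ('a::euclidean_space \<Rightarrow> real) \<Rightarrow> bool" where
  "Ck 0 f = continuous_on UNIV f"
| "Ck (Suc k) f = ((\<forall>x. f differentiable (at x)) \<and>
     (\<forall>b\<in>Basis. Ck k (\<lambda>x. frechet_derivative f (at x) b)))"

definition supp :: "('a::euclidean_space \<Rightarrow> real) \<Rightarrow> 'a set" where
  "supp f = closure (support_on UNIV f)"

definition Cc_infinity :: "'a::euclidean_space set \<Rightarrow> ('a \<Rightarrow> real) set" where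
  "Cc_infinity U = {f. (\<forall>k. Ck k f) \<and> compact (supp f) \<and> supp f \<subseteq> U}"


subsection \<open>Lebesgue and Sobolev spaces\<close>

definition Lp_space :: "real \<Rightarrow> 'a::euclidean_space set \<Rightarrow> ('a \<Rightarrow> 'b::euclidean_space) set" where
  "Lp_space p S = {f \<in> borel_measurable (lebesgue_on S).
     integrable (lebesgue_on S) (\<lambda>x. norm (f x) powr p)}"

definition Lp_norm :: "real \<Rightarrow> 'a::euclidean_space set \<Rightarrow> ('a \<Rightarrow> 'b::euclidean_space) \<Rightarrow> real" where
  "Lp_norm p S f = (LINT x|lebesgue_on S. norm (f x) powr p) powr (1 / p)"

definition has_weak_gradient ::
  "'a::euclidean_space set \<Rightarrow> ('a \<Rightarrow> real) \<Rightarrow> ('a \<Rightarrow> 'a) \<Rightarrow> bool" where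
  "has_weak_gradient U v G \<longleftrightarrow>
     (\<forall>C. compact C \<and> C \<subseteq> U \<longrightarrow> v absolutely_integrable_on C \<and> G absolutely_integrable_on C) \<and>
     (\<forall>\<psi>\<in>Cc_infinity U. \<forall>b\<in>Basis.
        (LINT x|lebesgue_on U. v x * frechet_derivative \<psi> (at x) b)
          = - (LINT x|lebesgue_on U. (G x \<bullet> b) * \<psi> x))"

(* v \<in> W^{1,p}(K) with weak gradient G.  Functions are representatives of almost-everywhere
   classes, so G is determined by v only up to a null set; Sobolev regularity is required
   on the interior of K. *)
definition sobolev :: "real \<Rightarrow> 'a::euclidean_space set \<Rightarrow> ('a \<Rightarrow> real) \<Rightarrow> ('a \<Rightarrow> 'a) \<Rightarrow> bool" where
  "sobolev p K v G \<longleftrightarrow> v \<in> Lp_space p (interior K) \<and> G \<in> Lp_space p (interior K) \<and>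
     has_weak_gradient (interior K) v G"

definition sobolev_mean0 ::
  "real \<Rightarrow> 'a::euclidean_space set \<Rightarrow> ('a \<Rightarrow> real) \<Rightarrow> ('a \<Rightarrow> 'a) \<Rightarrow> bool" where
  "sobolev_mean0 p K v G \<longleftrightarrow> sobolev p K v G \<and> (LINT x|lebesgue_on K. v x) = 0"

(* W^{-1,p}_\<bottom>(K): bounded linear functionals on W^{1,p'}(K) that annihilate constants.
   Boundedness together with linearity makes them respect almost-everywhere equality. *)
definition dual_sobolev_perp ::
  "real \<Rightarrow> 'a::euclidean_space set \<Rightarrow> (('a \<Rightarrow> real) \<Rightarrow> real) set" where
  "dual_sobolev_perp p K = {\<nu>.
     (\<forall>u Gu v Gv. sobolev (conj_exp p) K u Gu \<and> sobolev (conj_exp p) K v Gv \<longrightarrow>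
        \<nu> (\<lambda>x. u x + v x) = \<nu> u + \<nu> v) \<and>
     (\<forall>c v Gv. sobolev (conj_exp p) K v Gv \<longrightarrow> \<nu> (\<lambda>x. c * v x) = c * \<nu> v) \<and>
     (\<exists>C. \<forall>v Gv. sobolev (conj_exp p) K v Gv \<longrightarrow>
        \<bar>\<nu> v\<bar> \<le> C * (Lp_norm (conj_exp p) (interior K) v + Lp_norm (conj_exp p) (interior K) Gv)) \<and>
     \<nu> (\<lambda>_. 1) = 0}"

(* Unique weak solvability of the Neumann problem for the Laplacian in W^{1,p}. *)
definition neumann_regular :: "real \<Rightarrow> 'a::euclidean_space set \<Rightarrow> bool" where
  "neumann_regular p K \<longleftrightarrow> (\<forall>\<nu>\<in>dual_sobolev_perp p K.
     let solution = (\<lambda>y. \<exists>Gy. sobolev_mean0 p K y Gy \<and>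
           (\<forall>\<phi> G\<phi>. sobolev_mean0 (conj_exp p) K \<phi> G\<phi> \<longrightarrow>
              - (LINT x|lebesgue_on K. Gy x \<bullet> G\<phi> x) = \<nu> \<phi>))
     in (\<exists>y. solution y) \<and>
        (\<forall>y z. solution y \<and> solution z \<longrightarrow> (AE x in lebesgue_on (interior K). y x = z x)))"


subsection \<open>Vector measures\<close>

(* Vector-valued Radon measures on K as countably additive set functions on the Borel subsets
   of K.  In finite dimensions these automatically have finite total variation, and on a
   compact K they are automatically regular. *)
definition vector_measures :: "'a::euclidean_space set \<Rightarrow> ('a set \<Rightarrow> 'a) set" where
  "vector_measures K = {q. \<forall>A :: nat \<Rightarrow> 'a set.
     range A \<subseteq> sets (restrict_space borel K) \<and> disjoint_family A \<longrightarrow>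
       (\<lambda>i. q (A i)) sums q (\<Union>i. A i)}"

definition total_variation :: "'a::euclidean_space set \<Rightarrow> ('a set \<Rightarrow> 'a) \<Rightarrow> 'a measure" where
  "total_variation K q = measure_of K (sets (restrict_space borel K))
     (\<lambda>A. SUP P\<in>{P. finite P \<and> P \<subseteq> sets (restrict_space borel K) \<and> pairwise disjnt P \<and> \<Union>P = A}.
        \<Sum>B\<in>P. ennreal (norm (q B)))"

(* The positive part in the Jordan decomposition of a signed measure s. *)
definition pos_variation :: "'a::euclidean_space set \<Rightarrow> ('a set \<Rightarrow> real) \<Rightarrow> 'a measure" where
  "pos_variation K s = measure_of K (sets (restrict_space borel K))
     (\<lambda>A. SUP B\<in>{B \<in> sets (restrict_space borel K). B \<subseteq> A}. ennreal (s B))"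

(* \<integral>\<^sub>K f \<cdot> dq, componentwise through the Jordan decompositions of the components of q. *)
definition vintegral :: "'a::euclidean_space set \<Rightarrow> ('a set \<Rightarrow> 'a) \<Rightarrow> ('a \<Rightarrow> 'a) \<Rightarrow> real" where
  "vintegral K q f = (\<Sum>b\<in>Basis.
     (LINT x|pos_variation K (\<lambda>A. q A \<bullet> b). f x \<bullet> b)
     - (LINT x|pos_variation K (\<lambda>A. - (q A \<bullet> b)). f x \<bullet> b))"

definition weak_star_tendsto ::
  "'a::euclidean_space set \<Rightarrow> (nat \<Rightarrow> 'a set \<Rightarrow> 'a) \<Rightarrow> ('a set \<Rightarrow> 'a) \<Rightarrow> bool" where
  "weak_star_tendsto K Q q \<longleftrightarrow>
     (\<forall>f. continuous_on K f \<longrightarrow> (\<lambda>n. vintegral K (Q n) f) \<longlonglongrightarrow> vintegral K q f)"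

definition vmeasure_zero_ext :: "'a::euclidean_space set \<Rightarrow> ('a set \<Rightarrow> 'a) \<Rightarrow> 'a set \<Rightarrow> 'a" where
  "vmeasure_zero_ext K q = (\<lambda>A. q (A \<inter> K))"

(* The vector field q on K, extended by zero outside K and regarded as a measure. *)
definition density_vmeasure :: "'a::euclidean_space set \<Rightarrow> ('a \<Rightarrow> 'a) \<Rightarrow> 'a set \<Rightarrow> 'a" where
  "density_vmeasure K q = (\<lambda>A. LINT x|lebesgue_on (A \<inter> K). q x)"

(* Pushforward under the inclusion into the larger set L, i.e. extension by zero to L. *)
definition measure_zero_ext :: "'a::euclidean_space set \<Rightarrow> 'a measure \<Rightarrow> 'a measure" where
  "measure_zero_ext L M = distr M (restrict_space borel L) (\<lambda>x. x)"


subsection \<open>The Beckmann problem\<close>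

(* \<phi> \<in> C^1(K): \<phi> is differentiable in the interior of K, and \<phi> and its gradient extend
   continuously to K, the extended gradient being G. *)
definition C1_on :: "'a::euclidean_space set \<Rightarrow> ('a \<Rightarrow> real) \<Rightarrow> ('a \<Rightarrow> 'a) \<Rightarrow> bool" where
  "C1_on K \<phi> G \<longleftrightarrow> continuous_on K \<phi> \<and> continuous_on K G \<and>
     (\<forall>x\<in>interior K. GDERIV \<phi> x :> G x)"

(* div q = \<mu>p - \<mu>m in the sense of measures. *)
definition div_measure_eq ::
  "'a::euclidean_space set \<Rightarrow> ('a set \<Rightarrow> 'a) \<Rightarrow> 'a measure \<Rightarrow> 'a measure \<Rightarrow> bool" where
  "div_measure_eq K q \<mu>p \<mu>m \<longleftrightarrow>
     (\<forall>\<phi> G. C1_on K \<phi> G \<and> (LINT x|lebesgue_on K. \<phi> x) = 0 \<longrightarrow>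
        - vintegral K q G = (LINT x|\<mu>p. \<phi> x) - (LINT x|\<mu>m. \<phi> x))"

definition beckmann_feasible ::
  "'a::euclidean_space set \<Rightarrow> 'a measure \<Rightarrow> 'a measure \<Rightarrow> ('a set \<Rightarrow> 'a) set" where
  "beckmann_feasible K \<mu>p \<mu>m = {q \<in> vector_measures K. div_measure_eq K q \<mu>p \<mu>m}"

definition beckmann_cost ::
  "'a::euclidean_space set \<Rightarrow> ('a \<Rightarrow> real) \<Rightarrow> ('a set \<Rightarrow> 'a) \<Rightarrow> ennreal" where
  "beckmann_cost K w q = (\<integral>\<^sup>+x. ennreal (w x) \<partial>total_variation K q)"

definition beckmann_solution ::
  "'a::euclidean_space set \<Rightarrow> ('a \<Rightarrow> real) \<Rightarrow> 'a measure \<Rightarrow> 'a measure \<Rightarrow> ('a set \<Rightarrow> 'a) \<Rightarrow> bool" where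
  "beckmann_solution K w \<mu>p \<mu>m q \<longleftrightarrow> q \<in> beckmann_feasible K \<mu>p \<mu>m \<and>
     (\<forall>p\<in>beckmann_feasible K \<mu>p \<mu>m. beckmann_cost K w q \<le> beckmann_cost K w p)"


subsection \<open>The regularized Beckmann problem\<close>

(* div q = \<mu>p - \<mu>m in W^{-1,\<alpha>}_\<bottom>(K), for measures \<mu>p, \<mu>m living on a set containing K.
   A measure acts on \<phi> \<in> W^{1,\<alpha>'}(K) by integrating the continuous representative g of \<phi>
   on K; it exists by Morrey's embedding when \<alpha>' exceeds the dimension and the interior of K
   is a bounded Lipschitz domain, and is unique when K is the closure of its interior. *)
definition div_eq_dual ::
  "real \<Rightarrow> 'a::euclidean_space set \<Rightarrow> ('a \<Rightarrow> 'a) \<Rightarrow> 'a measure \<Rightarrow> 'a measure \<Rightarrow> bool" where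
  "div_eq_dual \<alpha> K q \<mu>p \<mu>m \<longleftrightarrow>
     (\<forall>\<phi> G g. sobolev_mean0 (conj_exp \<alpha>) K \<phi> G \<and> continuous_on K g \<and>
        (AE x in lebesgue_on (interior K). g x = \<phi> x) \<longrightarrow>
        - (LINT x|lebesgue_on K. q x \<bullet> G x) = (LINT x:K|\<mu>p. g x) - (LINT x:K|\<mu>m. g x))"

definition reg_feasible ::
  "real \<Rightarrow> 'a::euclidean_space set \<Rightarrow> 'a measure \<Rightarrow> 'a measure \<Rightarrow> ('a \<Rightarrow> 'a) set" where
  "reg_feasible \<alpha> K \<mu>p \<mu>m = {q \<in> Lp_space \<alpha> K. div_eq_dual \<alpha> K q \<mu>p \<mu>m}"

definition reg_cost ::
  "real \<Rightarrow> real \<Rightarrow> 'a::euclidean_space set \<Rightarrow> ('a \<Rightarrow> real) \<Rightarrow> ('a \<Rightarrow> 'a) \<Rightarrow> real" where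
  "reg_cost \<alpha> \<epsilon> K w q =
     (LINT x|lebesgue_on K. w x * norm (q x)) + \<epsilon> / \<alpha> * Lp_norm \<alpha> K q powr \<alpha>"

definition reg_solution ::
  "real \<Rightarrow> real \<Rightarrow> 'a::euclidean_space set \<Rightarrow> ('a \<Rightarrow> real) \<Rightarrow> 'a measure \<Rightarrow> 'a measure
     \<Rightarrow> ('a \<Rightarrow> 'a) \<Rightarrow> bool" where
  "reg_solution \<alpha> \<epsilon> K w \<mu>p \<mu>m q \<longleftrightarrow> q \<in> reg_feasible \<alpha> K \<mu>p \<mu>m \<and>
     (\<forall>p\<in>reg_feasible \<alpha> K \<mu>p \<mu>m. reg_cost \<alpha> \<epsilon> K w q \<le> reg_cost \<alpha> \<epsilon> K w p)"


subsection \<open>Enlarged domains\<close>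

definition enlarged :: "(real \<Rightarrow> real) \<Rightarrow> 'a::euclidean_space set \<Rightarrow> real \<Rightarrow> 'a set" where
  "enlarged s K t = (\<lambda>x. (1 + s t) *\<^sub>R x) ` K"

(* The union over a family T of parameters. *)
definition enlarged_union :: "(real \<Rightarrow> real) \<Rightarrow> 'a::euclidean_space set \<Rightarrow> real set \<Rightarrow> 'a set" where
  "enlarged_union s K T = (\<Union>t\<in>T. enlarged s K t)"

end

theory Submission
  imports Defs "HOL-Probability.Probability"
begin

text \<open>
  Every competitor of the Beckmann problem is approximated, without increasing its cost by more
  than a given amount, by an \<open>L\<^sup>\<alpha>\<close> field on \<open>\<Omega>\<close> with exactly the same divergence.  After localizing with a
  partition of unity, each piece is shifted into the interior along a cone of inner directions and
  mollified.  The divergence errors so produced are differences between a measure and its shifted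
  mollification; they are removed by letting the kernel shrink to a point, which moves the mass along
  a field with a singularity of order \<open>\<bar>z\<bar>\<^bsup>1-d\<^esup>\<close>, and this lies in \<open>L\<^sup>\<alpha>\<close> precisely because
  \<open>\<alpha> < d/(d - 1)\<close>.  One fixed such field is feasible for all \<open>n\<close>, so \<open>w \<ge> w_low > 0\<close> bounds the
  mass of the \<open>q\<^sub>n\<close>, and a subsequence generates a Young measure.  Its barycentre is the weak-* limit, and
  its first moment dominates the cost of the limit.  Testing \<open>q\<^sub>n\<close> against \<open>\<phi>(x/(1 + s))\<close>
  for \<open>\<phi> \<in> C\<^sup>1(\<Omega>)\<close> passes the divergence constraint to the limit.
\<close>

subsection \<open>Weak compactness of measures on a compact metric space\<close>

text \<open>The obstacle is that the regularized problems keep the unsmoothed \<open>\<mu>p\<close>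
  and \<open>\<mu>m\<close>: mollifying a competitor gives an L^\<alpha> field, but with mollified
  data. The defect has to be removed exactly, by a field of small mass that is still in L^\<alpha>,
  and without leaving \<Omega>, hence the one-sided kernels. The constants are fixed in a definite
  order: cover and cutoffs first, the kernel radius \<delta> last, because the transport terms cost
  \<delta> times a bound that involves the gradients of the cutoffs. The gradient terms in the
  divergence itself cancel in the sum, since the cutoffs add up to 1. In the limit the pair
  (position, normalized direction) is treated as a random variable, so that mass becomes the
  integral of a continuous function and costs converge exactly; only the passage from the Young
  measure to its barycentre loses mass, in the favourable direction. Total variation and Jordan
  parts are defined through \<open>measure_of\<close>, so their additivity is established before any
  integral against a vector measure is computed.\<close>

text \<open>Helly's selection theorem is available on the real line only; a Borel code whose inverse is
  uniformly continuous on \<open>C\<close> transfers it to \<open>C\<close>.\<close>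

lemma compact_real_code:
  fixes C :: "'e::{metric_space,second_countable_topology} set"
  assumes "compact C"
  obtains s :: "'e \<Rightarrow> real" where "s \<in> borel_measurable borel" "\<And>x. \<bar>s x\<bar> \<le> 3/2"
    "\<And>e. 0 < e \<Longrightarrow> \<exists>d>0. \<forall>x\<in>C. \<forall>y\<in>C. \<bar>s x - s y\<bar> < d \<longrightarrow> dist x y < e"
proof -
  obtain \<B> :: "'e set set" where \<B>: "countable \<B>" "topological_basis \<B>"
    using ex_countable_basis by auto
  have "\<B> \<noteq> {}" using \<B>(2) by (metis UNIV_I empty_iff open_UNIV topological_basisE)
  define B where "B j = from_nat_into \<B> j" for j :: nat
  have rB: "range B = \<B>" using \<B>(1) \<open>\<B> \<noteq> {}\<close> unfolding B_def
    by (simp add: range_from_nat_into)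
  have oB: "open (B j)" for j using \<B>(2) rB by (metis rangeI topological_basis_open)
  \<comment> \<open>The digits of \<open>s x\<close> in base 3 record which basis sets contain
    \<open>x\<close>. Base 3 leaves a gap: after the first differing digit, worth (1/3)^k, the tail
    is at most (1/3)^k / 2, so different digit sequences have separated codes.\<close>
  define a where "a x j = (indicator (B j) x :: real) * (1/3)^j" for x j
  have a01: "\<bar>a x j\<bar> \<le> (1/3)^j" for x j by (auto simp: a_def indicator_def)
  have g: "summable (\<lambda>j. (1/3::real)^j)" by (rule summable_geometric) auto
  have suma: "summable (a x)" for x
    by (rule summable_comparison_test'[OF g, of 0]) (use a01 in auto)
  define s where "s x = (\<Sum>j. a x j)" for x
  have sm: "s \<in> borel_measurable borel"
    unfolding s_def a_def using oB by (intro borel_measurable_suminf) (auto intro!: borel_measurable_times)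
  have sb: "\<bar>s x\<bar> \<le> 3/2" for x
  proof -
    have s1: "summable (\<lambda>j. \<bar>a x j\<bar>)"
      by (rule summable_comparison_test'[OF g, of 0]) (use a01 in auto)
    have "\<bar>s x\<bar> \<le> (\<Sum>j. \<bar>a x j\<bar>)" unfolding s_def by (rule summable_rabs[OF s1])
    also have "\<dots> \<le> (\<Sum>j. (1/3::real)^j)" by (rule suminf_le[OF a01 s1 g])
    also have "\<dots> = 3/2" by (simp add: suminf_geometric)
    finally show ?thesis .
  qed
  have agree: "\<forall>j\<le>J. (x \<in> B j) = (y \<in> B j)" if d: "\<bar>s x - s y\<bar> < (1/3)^J / 2" for x y J
  proof (rule ccontr)
    assume "\<not> ?thesis"
    then obtain i where i: "i \<le> J" "(x \<in> B i) \<noteq> (y \<in> B i)" by auto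
    define k where "k = (LEAST i. (x \<in> B i) \<noteq> (y \<in> B i))"
    have k: "(x \<in> B k) \<noteq> (y \<in> B k)" unfolding k_def by (rule LeastI[of _ i]) (use i in auto)
    have kJ: "k \<le> J" using Least_le[of "\<lambda>i. (x \<in> B i) \<noteq> (y \<in> B i)" i] i unfolding k_def by linarith
    have lt: "(x \<in> B j) = (y \<in> B j)" if "j < k" for j
      using not_less_Least[of j "\<lambda>i. (x \<in> B i) \<noteq> (y \<in> B i)"] that unfolding k_def by blast
    define c where "c j = a x j - a y j" for j
    have sc: "summable c" unfolding c_def using suma by (intro summable_diff)
    have "s x - s y = (\<Sum>j. c j)" unfolding s_def c_def using suma by (simp add: suminf_diff)
    also have "\<dots> = (\<Sum>j. c (j + Suc k)) + (\<Sum>j<Suc k. c j)"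
      by (rule suminf_split_initial_segment[OF sc])
    also have "(\<Sum>j<Suc k. c j) = c k"
      using lt by (simp add: c_def a_def indicator_def)
    finally have e: "s x - s y = (\<Sum>j. c (j + Suc k)) + c k" .
    have ck: "\<bar>c k\<bar> = (1/3)^k" using k by (auto simp: c_def a_def indicator_def)
    have cb: "\<bar>c j\<bar> \<le> (1/3)^j" for j by (auto simp: c_def a_def indicator_def)
    have g2: "(\<lambda>j. (1/3::real)^(j + Suc k)) sums ((1/3)^k / 2)"
    proof -
      have "(\<lambda>j. (1/3::real)^j) sums (1 / (1 - 1/3))" by (rule geometric_sums) auto
      then have "(\<lambda>j. (1/3::real)^j * (1/3)^Suc k) sums (1 / (1 - 1/3) * (1/3)^Suc k)"
        by (rule sums_mult2)
      then show ?thesis by (simp add: power_add)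
    qed
    have "\<bar>\<Sum>j. c (j + Suc k)\<bar> \<le> (\<Sum>j. (1/3::real)^(j + Suc k))"
    proof -
      have s1: "summable (\<lambda>j. \<bar>c (j + Suc k)\<bar>)"
        by (rule summable_comparison_test'[OF sums_summable[OF g2], of 0]) (use cb in \<open>simp del: power_Suc add_Suc_right\<close>)
      have "\<bar>\<Sum>j. c (j + Suc k)\<bar> \<le> (\<Sum>j. \<bar>c (j + Suc k)\<bar>)" by (rule summable_rabs[OF s1])
      also have "\<dots> \<le> (\<Sum>j. (1/3::real)^(j + Suc k))"
        by (rule suminf_le[OF cb s1 sums_summable[OF g2]])
      finally show ?thesis .
    qed
    also have "\<dots> = (1/3)^k / 2" using sums_unique[OF g2] by simp
    finally have "\<bar>s x - s y\<bar> \<ge> (1/3)^k / 2" using e ck by linarith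
    moreover have "(1/3::real)^J \<le> (1/3)^k" by (rule power_decreasing) (use kJ in auto)
    ultimately show False using d by linarith
  qed
  have "\<exists>d>0. \<forall>x\<in>C. \<forall>y\<in>C. \<bar>s x - s y\<bar> < d \<longrightarrow> dist x y < e" if e: "0 < e" for e
  proof -
    \<comment> \<open>Finitely many basis sets lying in balls of radius e/2 cover \<open>C\<close>.
      Points whose codes agree up to the largest index \<open>J\<close> used lie together in one of
      these sets.\<close>
    define I where "I = {j. \<exists>z. B j \<subseteq> ball z (e/2)}"
    have cov: "C \<subseteq> (\<Union>j\<in>I. B j)"
    proof
      fix x assume "x \<in> C"
      obtain D where "D \<in> \<B>" "x \<in> D" "D \<subseteq> ball x (e/2)"
        using topological_basisE[OF \<B>(2), of "ball x (e/2)" x] e by auto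
      then show "x \<in> (\<Union>j\<in>I. B j)" using rB unfolding I_def by blast
    qed
    obtain I' where I': "I' \<subseteq> I" "finite I'" "C \<subseteq> (\<Union>j\<in>I'. B j)"
      using compactE_image[OF assms, of I B] oB cov by metis
    obtain J where J: "\<And>j. j \<in> I' \<Longrightarrow> j \<le> J" using I'(2) by (meson finite_nat_set_iff_bounded_le)
    show ?thesis
    proof (intro exI[of _ "(1/3)^J / 2"] conjI ballI impI)
      fix x y assume x: "x \<in> C" and y: "y \<in> C" and d: "\<bar>s x - s y\<bar> < (1/3)^J / 2"
      obtain j where j: "j \<in> I'" "x \<in> B j" using I'(3) x by auto
      then have "y \<in> B j" using agree[OF d] J by blast
      moreover obtain z where "B j \<subseteq> ball z (e/2)" using j(1) I'(1) unfolding I_def by auto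
      ultimately have "dist z x < e/2" "dist z y < e/2" using j(2) by auto
      then show "dist x y < e" by (metis dist_commute dist_triangle_half_r)
    qed auto
  qed
  then show ?thesis using that[OF sm sb] by blast
qed

text \<open>Prokhorov compactness for laws carried by one compact set. The codes are bounded by 3/2,
  so the pushed laws on the line are tight. The code \<open>s\<close> is only Borel, but the decoder
  \<open>cc\<close> is continuous and inverts it on \<open>C\<close>; hence it is enough to test
  convergence on the line with f composed with \<open>cc\<close>.\<close>

theorem compact_prob_weak_subseq:
  fixes C :: "'e::euclidean_space set"
  assumes C: "compact C"
    and M: "\<And>n. prob_space (M n)" "\<And>n. sets (M n) = sets borel" "\<And>n. AE x in M n. x \<in> C"
  obtains r :: "nat \<Rightarrow> nat" and M0 where "strict_mono r" "prob_space M0" "sets M0 = sets borel"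
    "AE x in M0. x \<in> C"
    "\<And>f :: 'e \<Rightarrow> real. continuous_on UNIV f \<Longrightarrow>
       (\<lambda>n. \<integral>x. f x \<partial>M (r n)) \<longlonglongrightarrow> (\<integral>x. f x \<partial>M0)"
proof -
  have neC: "C \<noteq> {}"
  proof
    assume "C = {}"
    then have "AE x in M 0. False" using M(3)[of 0] by simp
    then show False using prob_space.AE_False[OF M(1)] by blast
  qed
  obtain s :: "'e \<Rightarrow> real" where sm[measurable]: "s \<in> borel_measurable borel" and
    sb: "\<And>x. \<bar>s x\<bar> \<le> 3/2" and sc: "\<And>e. 0 < e \<Longrightarrow> \<exists>d>0. \<forall>x\<in>C. \<forall>y\<in>C. \<bar>s x - s y\<bar> < d \<longrightarrow> dist x y < e"
    using compact_real_code[OF C] by metis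
  have inj: "inj_on s C"
  proof (rule inj_onI, rule ccontr)
    fix x y assume xy: "x \<in> C" "y \<in> C" "s x = s y" "x \<noteq> y"
    then show False using sc[of "dist x y"] by fastforce
  qed
  define c where "c = inv_into C s"
  have cs: "c (s x) = x" if "x \<in> C" for x using that inj by (simp add: c_def)
  have uc: "uniformly_continuous_on (s ` C) c"
    unfolding uniformly_continuous_on_def
  proof (intro allI impI)
    fix e :: real assume "0 < e"
    then obtain d where d: "d > 0" "\<forall>x\<in>C. \<forall>y\<in>C. \<bar>s x - s y\<bar> < d \<longrightarrow> dist x y < e" using sc by blast
    then show "\<exists>d>0. \<forall>x\<in>s ` C. \<forall>x'\<in>s ` C. dist x' x < d \<longrightarrow> dist (c x') (c x) < e"
      by (intro exI[of _ d]) (auto simp: cs dist_real_def)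
  qed
  obtain g where g: "uniformly_continuous_on (closure (s ` C)) g" "\<And>x. x \<in> s ` C \<Longrightarrow> c x = g x"
    using uniformly_continuous_on_extension_on_closure[OF uc] by metis
  have gc: "continuous_on (closure (s ` C)) g" using g(1) uniformly_continuous_imp_continuous by blast
  have gC: "g ` closure (s ` C) \<subseteq> C"
    by (rule image_closure_subset[OF gc compact_imp_closed[OF C]]) (use g(2) cs in force)
  \<comment> \<open>The decoder is extended from the closure of the set of codes to the whole line
    with values in the compact convex hull of \<open>C\<close>, so that f composed with it is
    bounded for every continuous f.\<close>
  obtain cc where cc: "continuous_on UNIV cc" "cc ` UNIV \<subseteq> convex hull C"
    "\<And>x. x \<in> closure (s ` C) \<Longrightarrow> cc x = g x"
  proof (rule Dugundji[of "convex hull C" UNIV "closure (s ` C)" g])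
    show "g ` closure (s ` C) \<subseteq> convex hull C" using gC hull_subset[of C convex] by blast
  qed (use neC gc in auto)
  have ccs: "cc (s x) = x" if "x \<in> C" for x
    using that cc(3)[of "s x"] g(2)[of "s x"] cs closure_subset[of "s ` C"] by auto
  have ccm[measurable]: "cc \<in> borel_measurable borel" using cc(1) by (rule borel_measurable_continuous_onI)
  have bddf: "\<exists>K. \<forall>y. norm (f (cc y)) \<le> K" if f: "continuous_on UNIV f" for f :: "'e \<Rightarrow> real"
  proof -
    have "compact (f ` (convex hull C))"
      by (rule compact_continuous_image) (use f continuous_on_subset compact_convex_hull[OF C] in blast)+
    then obtain K where "\<And>z. z \<in> f ` (convex hull C) \<Longrightarrow> norm z \<le> K"
      using compact_imp_bounded bounded_iff by metis
    then show ?thesis using cc(2) by (intro exI[of _ K]) blast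
  qed
  define N where "N n = distr (M n) borel s" for n
  have smM[measurable]: "s \<in> borel_measurable (M n)" for n
    using sm measurable_cong_sets[OF M(2)[of n] refl] by blast
  have rd: "real_distribution (N n)" for n
    unfolding N_def using prob_space.real_distribution_distr[OF M(1)] smM by auto
  have "tight N"
    unfolding tight_def
  proof (intro conjI allI impI rd)
    fix e :: real assume "0 < e"
    have "measure (N n) {-2<..2} = 1" for n
    proof -
      have "s -` {-2<..2} = UNIV" 
      proof (intro set_eqI iffI UNIV_I vimageI2)
        show "s x \<in> {-2<..2}" for x using sb[of x] by (simp add: abs_le_iff) linarith
      qed
      then show ?thesis unfolding N_def
        using prob_space.prob_space[OF M(1)[of n]] sets_eq_imp_space_eq[OF M(2)[of n]]
        by (subst measure_distr) auto
    qed
    then show "\<exists>a b. a < b \<and> (\<forall>n. 1 - e < measure (N n) {a<..b})"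
      using \<open>0 < e\<close> by (intro exI[of _ "-2"] exI[of _ 2]) auto
  qed
  then obtain r N0 where r: "strict_mono r" and N0: "real_distribution N0"
    and wc: "weak_conv_m (N \<circ> id \<circ> r) N0"
    using tight_imp_convergent_subsubsequence[of N id] strict_mono_id by blast
  interpret N0: real_distribution N0 by fact
  have smN0[measurable]: "cc \<in> borel_measurable N0" using ccm by simp
  define M0 where "M0 = distr N0 borel cc"
  have conv: "(\<lambda>n. \<integral>x. f x \<partial>M (r n)) \<longlonglongrightarrow> (\<integral>x. f x \<partial>M0)"
    if f: "continuous_on UNIV f" for f :: "'e \<Rightarrow> real"
  proof -
    have fm[measurable]: "f \<in> borel_measurable borel" using f by (rule borel_measurable_continuous_onI)
    have fmM[measurable]: "f \<in> borel_measurable (M n)" for n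
      using fm measurable_cong_sets[OF M(2)[of n] refl] by blast
    obtain K where K: "\<And>y. norm (f (cc y)) \<le> K" using bddf[OF f] by blast
    have "(\<lambda>n. \<integral>y. f (cc y) \<partial>((N \<circ> id \<circ> r) n)) \<longlonglongrightarrow> (\<integral>y. f (cc y) \<partial>N0)"
    proof (rule weak_conv_imp_integral_bdd_continuous_conv[OF _ N0 wc _ K])
      show "real_distribution ((N \<circ> id \<circ> r) n)" for n using rd by simp
      have "continuous_on UNIV (\<lambda>y. f (cc y))"
        by (rule continuous_on_compose2[OF f cc(1)]) auto
      then show "isCont (\<lambda>y. f (cc y)) x" for x by (simp add: continuous_on_eq_continuous_at)
    qed
    moreover have "(\<integral>y. f (cc y) \<partial>((N \<circ> id \<circ> r) n)) = (\<integral>x. f x \<partial>M (r n))" for n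
    proof -
      have "(\<integral>y. f (cc y) \<partial>(N (r n))) = (\<integral>x. f (cc (s x)) \<partial>M (r n))"
        unfolding N_def by (rule integral_distr) auto
      also have "\<dots> = (\<integral>x. f x \<partial>M (r n))"
      proof (rule integral_cong_AE)
        show "AE x in M (r n). f (cc (s x)) = f x" using M(3)[of "r n"] by eventually_elim (simp add: ccs)
      qed auto
      finally show ?thesis by simp
    qed
    moreover have "(\<integral>y. f (cc y) \<partial>N0) = (\<integral>x. f x \<partial>M0)"
      unfolding M0_def by (rule integral_distr[symmetric]) auto
    ultimately show ?thesis by simp
  qed
  have ps: "prob_space M0" unfolding M0_def by (rule N0.prob_space_distr) simp
  \<comment> \<open>Values of \<open>cc\<close> are only known to lie in the convex hull; testing
    with the distance to \<open>C\<close> shows that the limit is carried by \<open>C\<close>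
    itself.\<close>
  have "(\<lambda>n. \<integral>x. infdist x C \<partial>M (r n)) \<longlonglongrightarrow> (\<integral>x. infdist x C \<partial>M0)"
    by (rule conv) (intro continuous_intros)
  moreover have "(\<integral>x. infdist x C \<partial>M (r n)) = 0" for n
    by (rule integral_eq_zero_AE) (use M(3)[of "r n"] in \<open>eventually_elim, simp\<close>)
  ultimately have z: "(\<integral>x. infdist x C \<partial>M0) = 0" by (simp add: LIMSEQ_const_iff)
  have "AE y in N0. infdist (cc y) C = 0"
  proof -
    have "continuous_on UNIV (\<lambda>x. infdist x C)" by (intro continuous_intros)
    then obtain K where K: "\<And>y. norm (infdist (cc y) C) \<le> K" using bddf by blast
    have [measurable]: "(\<lambda>x. infdist x C) \<in> borel_measurable borel"
      by (intro borel_measurable_continuous_onI continuous_intros)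
    have "integrable N0 (\<lambda>y. infdist (cc y) C)"
      by (rule N0.integrable_const_bound[of _ K]) (use K in auto)
    moreover have "(\<integral>y. infdist (cc y) C \<partial>N0) = 0"
      using z unfolding M0_def by (subst (asm) integral_distr) auto
    ultimately show ?thesis by (subst (asm) integral_nonneg_eq_0_iff_AE) (auto simp: infdist_nonneg)
  qed
  then have "AE y in N0. cc y \<in> C"
    by eventually_elim (use compact_imp_closed[OF C] neC in_closed_iff_infdist_zero in blast)
  then have "AE x in M0. x \<in> C"
    unfolding M0_def using compact_imp_closed[OF C] by (subst AE_distr_iff) auto
  then show ?thesis using that[OF r ps _ _ conv] by (simp add: M0_def)
qed


subsection \<open>Variations of vector measures\<close>

lemma space_restrict_borel [simp]: "space (restrict_space borel K) = K"
  by (simp add: space_restrict_space)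

lemma vector_measure_empty: "q \<in> vector_measures K \<Longrightarrow> q {} = 0"
proof -
  assume q: "q \<in> vector_measures K"
  have "(\<lambda>i::nat. q {}) sums q (\<Union>i::nat. {})"
    using q[unfolded vector_measures_def, simplified, rule_format, of "\<lambda>_. {}"]
    by (simp add: disjoint_family_on_def)
  then have "summable (\<lambda>i::nat. q {})" by (rule sums_summable)
  then show ?thesis by (simp add: summable_const_iff)
qed

lemma vector_measure_sums:
  "q \<in> vector_measures K \<Longrightarrow> range A \<subseteq> sets (restrict_space borel K) \<Longrightarrow> disjoint_family A \<Longrightarrow>
    (\<lambda>i::nat. q (A i)) sums q (\<Union>i. A i)"
  by (simp add: vector_measures_def)

lemma ennreal_norm_sums_le:
  fixes f :: "nat \<Rightarrow> 'v::real_normed_vector"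
  assumes "f sums x"
  shows "ennreal (norm x) \<le> (\<Sum>i. ennreal (norm (f i)))"
proof -
  have "(\<lambda>n. ennreal (norm (\<Sum>i<n. f i))) \<longlonglongrightarrow> ennreal (norm x)"
    using assms unfolding sums_def by (intro tendsto_intros) auto
  moreover have "ennreal (norm (\<Sum>i<n. f i)) \<le> (\<Sum>i. ennreal (norm (f i)))" for n
  proof -
    have "ennreal (norm (\<Sum>i<n. f i)) \<le> ennreal (\<Sum>i<n. norm (f i))"
      by (intro ennreal_leI norm_sum)
    also have "\<dots> = (\<Sum>i<n. ennreal (norm (f i)))" by (simp add: sum_ennreal)
    also have "\<dots> \<le> (\<Sum>i. ennreal (norm (f i)))" by (rule sum_le_suminf) auto
    finally show ?thesis .
  qed
  ultimately show ?thesis using LIMSEQ_le_const2 by blast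
qed

text \<open>The set function inside \<open>total_variation\<close>: \<open>measure_of\<close> returns the zero measure unless this function is
  countably additive.\<close>

definition partition_variation :: "'a::euclidean_space set \<Rightarrow> ('a set \<Rightarrow> 'a) \<Rightarrow> 'a set \<Rightarrow> ennreal" where
  "partition_variation K q A =
     (SUP P\<in>{P. finite P \<and> P \<subseteq> sets (restrict_space borel K) \<and> pairwise disjnt P \<and> \<Union>P = A}.
        \<Sum>B\<in>P. ennreal (norm (q B)))"

lemma partition_variation_upper:
  assumes "finite P" "P \<subseteq> sets (restrict_space borel K)" "pairwise disjnt P" "\<Union>P = A"
  shows "(\<Sum>B\<in>P. ennreal (norm (q B))) \<le> partition_variation K q A"
  unfolding partition_variation_def by (rule SUP_upper) (use assms in auto)

lemma partition_variation_add:
  assumes q: "q \<in> vector_measures K"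
    and A: "A \<in> sets (restrict_space borel K)" and B: "B \<in> sets (restrict_space borel K)"
    and AB: "A \<inter> B = {}"
  shows "partition_variation K q A + partition_variation K q B \<le> partition_variation K q (A \<union> B)"
proof -
  let ?S = "sets (restrict_space borel K)"
  let ?I = "\<lambda>A. {P. finite P \<and> P \<subseteq> ?S \<and> pairwise disjnt P \<and> \<Union>P = A}"
  have ne: "?I A \<noteq> {}" if "A \<in> ?S" for A
    using that by (auto intro!: exI[of _ "{A}"])
  have *: "(\<Sum>X\<in>P. ennreal (norm (q X))) + (\<Sum>X\<in>Q. ennreal (norm (q X))) \<le> partition_variation K q (A \<union> B)"
    if P: "P \<in> ?I A" and Q: "Q \<in> ?I B" for P Q
  proof -
    \<comment> \<open>The empty set may belong to both partitions. It is their only possible common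
      member, and \<open>q {} = 0\<close>.\<close>
    have PQ: "P \<inter> Q \<subseteq> {{}}" using P Q AB by blast
    have "(\<Sum>X\<in>P \<union> Q. ennreal (norm (q X))) = (\<Sum>X\<in>P. ennreal (norm (q X))) + (\<Sum>X\<in>Q. ennreal (norm (q X)))"
      by (rule sum.union_inter_neutral) (use P Q PQ vector_measure_empty[OF q] in auto)
    moreover have "(\<Sum>X\<in>P \<union> Q. ennreal (norm (q X))) \<le> partition_variation K q (A \<union> B)"
    proof (rule partition_variation_upper)
      show "pairwise disjnt (P \<union> Q)"
        using P Q AB unfolding pairwise_def disjnt_def by auto blast+
    qed (use P Q in auto)
    ultimately show ?thesis by simp
  qed
  have "(SUP P\<in>?I A. \<Sum>X\<in>P. ennreal (norm (q X))) + (SUP Q\<in>?I B. \<Sum>X\<in>Q. ennreal (norm (q X)))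
     = (SUP P\<in>?I A. (SUP Q\<in>?I B. (\<Sum>X\<in>P. ennreal (norm (q X))) + (\<Sum>X\<in>Q. ennreal (norm (q X)))))"
    by (subst ennreal_SUP_add_left[OF ne[OF A], symmetric], subst ennreal_SUP_add_right[OF ne[OF B]]) simp
  also have "\<dots> \<le> partition_variation K q (A \<union> B)"
    by (intro SUP_least *)
  finally show ?thesis by (simp add: partition_variation_def)
qed

text \<open>Superadditivity on disjoint sets gives monotonicity and, through finite unions, one
  inequality. For the other, a finite partition of the union is cut along the sets
  \<open>A i\<close>, and countable additivity of \<open>q\<close> on each piece bounds its norm by
  the sum over the cuts.\<close>

lemma partition_variation_countably_additive:
  assumes q: "q \<in> vector_measures K"
  shows "countably_additive (sets (restrict_space borel K)) (partition_variation K q)"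
proof (rule countably_additiveI)
  let ?S = "sets (restrict_space borel K)"
  let ?v = "partition_variation K q"
  fix A :: "nat \<Rightarrow> _" assume A: "range A \<subseteq> ?S" "disjoint_family A" "(\<Union>i. A i) \<in> ?S"
  have AS: "A i \<in> ?S" for i using A(1) by auto
  have mono: "?v X \<le> ?v Y" if "X \<in> ?S" "Y \<in> ?S" "X \<subseteq> Y" for X Y
  proof -
    have "?v X \<le> ?v X + ?v (Y - X)" by simp
    also have "\<dots> \<le> ?v (X \<union> (Y - X))"
      by (rule partition_variation_add[OF q that(1)]) (use that in auto)
    also have "X \<union> (Y - X) = Y" using that by auto
    finally show ?thesis .
  qed
  have fin: "(\<Sum>i<n. ?v (A i)) \<le> ?v (\<Union>i<n. A i)" for n
  proof (induction n)
    case (Suc n)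
    have "(\<Sum>i<Suc n. ?v (A i)) \<le> ?v (\<Union>i<n. A i) + ?v (A n)" using Suc by (auto intro: add_right_mono)
    also have "\<dots> \<le> ?v ((\<Union>i<n. A i) \<union> A n)"
    proof (rule partition_variation_add[OF q])
      show "(\<Union>i<n. A i) \<inter> A n = {}"
      proof -
        have "A i \<inter> A n = {}" if "i < n" for i using disjoint_family_onD[OF A(2), of i n] that by simp
        then show ?thesis by auto
      qed
    qed (use AS in auto)
    also have "(\<Union>i<n. A i) \<union> A n = (\<Union>i<Suc n. A i)" by (auto simp: lessThan_Suc)
    finally show ?case .
  qed simp
  show "(\<Sum>i. ?v (A i)) = ?v (\<Union>i. A i)"
  proof (rule antisym)
    show "(\<Sum>i. ?v (A i)) \<le> ?v (\<Union>i. A i)"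
    proof (rule suminf_le_const)
      fix n
      show "(\<Sum>i<n. ?v (A i)) \<le> ?v (\<Union>i. A i)"
        by (rule order_trans[OF fin mono]) (use A AS in auto)
    qed auto
    show "?v (\<Union>i. A i) \<le> (\<Sum>i. ?v (A i))"
      unfolding partition_variation_def[of K q "\<Union>i. A i"]
    proof (rule SUP_least, clarify)
      fix P assume P: "finite P" "P \<subseteq> ?S" "pairwise disjnt P" "\<Union>P = (\<Union>i. A i)"
      have "(\<Sum>B\<in>P. ennreal (norm (q B))) \<le> (\<Sum>B\<in>P. \<Sum>i. ennreal (norm (q (B \<inter> A i))))"
      proof (rule sum_mono, rule ennreal_norm_sums_le)
        fix B assume B: "B \<in> P"
        have "(\<lambda>i. q (B \<inter> A i)) sums q (\<Union>i. B \<inter> A i)"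
        proof (rule vector_measure_sums[OF q])
          show "disjoint_family (\<lambda>i. B \<inter> A i)" using A(2) unfolding disjoint_family_on_def by blast
        qed (use P(2) B AS in auto)
        moreover have "(\<Union>i. B \<inter> A i) = B" using P(4) B by auto
        ultimately show "(\<lambda>i. q (B \<inter> A i)) sums q B" by simp
      qed
      also have "\<dots> = (\<Sum>i. \<Sum>B\<in>P. ennreal (norm (q (B \<inter> A i))))"
        by (rule suminf_sum[symmetric]) auto
      also have "\<dots> \<le> (\<Sum>i. ?v (A i))"
      proof (rule suminf_le)
        fix i
        \<comment> \<open>Passing to the image merges only pieces with the same trace on
          \<open>A i\<close>; by disjointness such a trace is empty and contributes 0.\<close>
        have "(\<Sum>B\<in>P. ennreal (norm (q (B \<inter> A i)))) = (\<Sum>X\<in>(\<lambda>B. B \<inter> A i) ` P. ennreal (norm (q X)))"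
        proof (subst sum.reindex_nontrivial[OF P(1)])
          fix X Y assume XY: "X \<in> P" "Y \<in> P" "X \<noteq> Y" "X \<inter> A i = Y \<inter> A i"
          then have "X \<inter> A i = {}" using P(3) unfolding pairwise_def disjnt_def by blast
          then show "ennreal (norm (q (X \<inter> A i))) = 0" using vector_measure_empty[OF q] by simp
        qed simp
        also have "\<dots> \<le> ?v (A i)"
        proof (rule partition_variation_upper)
          show "(\<lambda>B. B \<inter> A i) ` P \<subseteq> ?S" using P(2) AS by auto
          show "pairwise disjnt ((\<lambda>B. B \<inter> A i) ` P)"
            using P(3) unfolding pairwise_def disjnt_def by blast
          show "\<Union> ((\<lambda>B. B \<inter> A i) ` P) = A i" using P(4) by blast
        qed (use P in auto)
        finally show "(\<Sum>B\<in>P. ennreal (norm (q (B \<inter> A i)))) \<le> ?v (A i)" .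
      qed auto
      finally show "(\<Sum>B\<in>P. ennreal (norm (q B))) \<le> (\<Sum>i. ?v (A i))" .
    qed
  qed
qed

lemma sets_total_variation [simp]: "sets (total_variation K q) = sets (restrict_space borel K)"
  unfolding total_variation_def using sets.sigma_sets_eq[of "restrict_space borel K"] sets.space_closed[of "restrict_space borel K"]
  by (simp add: sets_measure_of)

lemma space_total_variation [simp]: "space (total_variation K q) = K"
  using sets_eq_imp_space_eq[OF sets_total_variation] by simp

lemma emeasure_total_variation:
  assumes q: "q \<in> vector_measures K" and A: "A \<in> sets (restrict_space borel K)"
  shows "emeasure (total_variation K q) A = partition_variation K q A"
  unfolding total_variation_def partition_variation_def[symmetric]
proof (rule emeasure_measure_of_sigma)
  show "sigma_algebra K (sets (restrict_space borel K))"
    using sets.sigma_algebra_axioms[of "restrict_space borel K"] by simp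
  have "partition_variation K q {} \<le> 0"
    unfolding partition_variation_def
  proof (rule SUP_least, clarify)
    fix P assume P: "finite P" "\<Union>P = ({}::'a set)"
    have "(\<Sum>B\<in>P. ennreal (norm (q B))) = 0"
      by (rule sum.neutral) (use P vector_measure_empty[OF q] in auto)
    then show "(\<Sum>B\<in>P. ennreal (norm (q B))) \<le> 0" by simp
  qed
  then show "positive (sets (restrict_space borel K)) (partition_variation K q)"
    by (simp add: positive_def)
qed (use A partition_variation_countably_additive[OF q] in auto)

lemma norm_le_total_variation:
  assumes q: "q \<in> vector_measures K" and A: "A \<in> sets (restrict_space borel K)"
  shows "ennreal (norm (q A)) \<le> emeasure (total_variation K q) A"
  using partition_variation_upper[of "{A}" K A q] A emeasure_total_variation[OF q A] by simp

text \<open>The total variation is the least measure dominating the norms, because the values of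
  \<open>m\<close> add up over a finite partition. This bounds the cost of a pushforward without
  computing its variation.\<close>

lemma total_variation_le:
  assumes q: "q \<in> vector_measures K" and m: "sets m = sets (restrict_space borel K)"
    and le: "\<And>A. A \<in> sets m \<Longrightarrow> ennreal (norm (q A)) \<le> emeasure m A"
  shows "total_variation K q \<le> m"
proof (rule le_measure[THEN iffD2])
  show "\<forall>A\<in>sets (total_variation K q). emeasure (total_variation K q) A \<le> emeasure m A"
  proof
    fix A
    show "emeasure (total_variation K q) A \<le> emeasure m A"
    proof (cases "A \<in> sets (restrict_space borel K)")
      case True
      show ?thesis
        unfolding emeasure_total_variation[OF q True] partition_variation_def
      proof (rule SUP_least, clarify)
        fix P assume P: "finite P" "P \<subseteq> sets (restrict_space borel K)" "pairwise disjnt P" "A = \<Union>P"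
        have "(\<Sum>B\<in>P. ennreal (norm (q B))) \<le> (\<Sum>B\<in>P. emeasure m B)"
          by (rule sum_mono) (use P le m in auto)
        also have "\<dots> = emeasure m (\<Union>P)"
          using sum_emeasure[of "\<lambda>x. x" P m] P m
          by (simp add: disjoint_family_on_def pairwise_def disjnt_def subset_iff)
        finally show "(\<Sum>B\<in>P. ennreal (norm (q B))) \<le> emeasure m (\<Union>P)" .
      qed
    qed (simp add: emeasure_notin_sets)
  qed
qed (simp add: m)

subsection \<open>Integration against a vector measure with a density\<close>

text \<open>The supremum is attained on the part of \<open>A\<close> where \<open>k\<close> is
  positive (Hahn decomposition). \<open>ennreal\<close> sends negative reals to 0, so
  \<open>ennreal (k x)\<close> is the density of the positive part of \<open>k\<close>.\<close>

lemma pos_variation_density: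
  assumes T: "sets T = sets (restrict_space borel K)"
    and k: "integrable T k"
    and s: "\<And>A. A \<in> sets T \<Longrightarrow> s A = (LINT x:A|T. k x)"
  shows "pos_variation K s = density T (\<lambda>x. ennreal (k x))"
proof -
  have [measurable]: "k \<in> borel_measurable T" using k by simp
  have sp: "space T = K" using sets_eq_imp_space_eq[OF T] by simp
  have sup: "(SUP B\<in>{B \<in> sets T. B \<subseteq> A}. ennreal (s B)) = emeasure (density T (\<lambda>x. ennreal (k x))) A"
    if A: "A \<in> sets T" for A
  proof (rule antisym)
    show "(SUP B\<in>{B \<in> sets T. B \<subseteq> A}. ennreal (s B)) \<le> emeasure (density T (\<lambda>x. ennreal (k x))) A"
    proof (rule SUP_least, clarify)
      fix B assume B: "B \<in> sets T" "B \<subseteq> A"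
      have "s B \<le> (LINT x:B|T. max 0 (k x))"
        unfolding s[OF B(1)]
        by (rule set_integral_mono)
           (use integrable_mult_indicator[OF B(1) k]
              integrable_mult_indicator[OF B(1) Bochner_Integration.integrable_max[OF integrable_zero k]]
            in \<open>auto simp: set_integrable_def\<close>)
      then have "ennreal (s B) \<le> ennreal (LINT x|T. indicator B x * max 0 (k x))"
        by (simp add: set_lebesgue_integral_def ennreal_leI)
      also have "\<dots> = (\<integral>\<^sup>+x. ennreal (indicator B x * max 0 (k x)) \<partial>T)"
        by (rule nn_integral_eq_integral[symmetric])
           (use B(1) integrable_mult_indicator[OF B(1) Bochner_Integration.integrable_max[OF integrable_zero k]] in auto)
      also have "\<dots> \<le> (\<integral>\<^sup>+x. ennreal (k x) * indicator A x \<partial>T)"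
        by (rule nn_integral_mono) (use B(2) in \<open>auto simp: indicator_def max_def ennreal_neg\<close>)
      also have "\<dots> = emeasure (density T (\<lambda>x. ennreal (k x))) A"
        by (rule emeasure_density[symmetric]) (use A in auto)
      finally show "ennreal (s B) \<le> emeasure (density T (\<lambda>x. ennreal (k x))) A" .
    qed
    define B where "B = A \<inter> {x \<in> space T. 0 < k x}"
    have B: "B \<in> sets T" "B \<subseteq> A" using A by (auto simp: B_def)
    have "emeasure (density T (\<lambda>x. ennreal (k x))) A = (\<integral>\<^sup>+x. ennreal (k x) * indicator A x \<partial>T)"
      by (rule emeasure_density) (use A in auto)
    also have "\<dots> = (\<integral>\<^sup>+x. ennreal (indicator B x * k x) \<partial>T)"
      by (rule nn_integral_cong) (auto simp: B_def indicator_def ennreal_neg not_less)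
    also have "\<dots> = ennreal (LINT x|T. indicator B x * k x)"
    proof (rule nn_integral_eq_integral)
      show "integrable T (\<lambda>x. indicator B x * k x)"
        using integrable_mult_indicator[OF B(1) k] by simp
      show "AE x in T. 0 \<le> indicator B x * k x" by (auto simp: B_def indicator_def)
    qed
    also have "\<dots> = ennreal (s B)" unfolding s[OF B(1)] by (simp add: set_lebesgue_integral_def)
    also have "\<dots> \<le> (SUP B\<in>{B \<in> sets T. B \<subseteq> A}. ennreal (s B))"
      by (rule SUP_upper) (use B in auto)
    finally show "emeasure (density T (\<lambda>x. ennreal (k x))) A \<le> (SUP B\<in>{B \<in> sets T. B \<subseteq> A}. ennreal (s B))" .
  qed
  have "pos_variation K s = measure_of K (sets T) (emeasure (density T (\<lambda>x. ennreal (k x))))"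
    unfolding pos_variation_def T[symmetric]
  proof (rule measure_of_eq)
    show "sets T \<subseteq> Pow K" using sets.space_closed[of T] sp by simp
    fix A assume "A \<in> sigma_sets K (sets T)"
    then have "A \<in> sets T" using sets.sigma_sets_eq[of T] sp by simp
    then show "(SUP B\<in>{B \<in> sets T. B \<subseteq> A}. ennreal (s B)) = emeasure (density T (\<lambda>x. ennreal (k x))) A"
      by (rule sup)
  qed
  also have "\<dots> = density T (\<lambda>x. ennreal (k x))"
    using measure_of_of_measure[of "density T (\<lambda>x. ennreal (k x))"] sp by simp
  finally show ?thesis .
qed

lemma integral_pos_variation_diff:
  fixes f :: "'a::euclidean_space \<Rightarrow> real"
  assumes T: "sets T = sets (restrict_space borel K)"
    and k: "integrable T k"
    and s: "\<And>A. A \<in> sets T \<Longrightarrow> s A = (LINT x:A|T. k x)"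
    and f: "f \<in> borel_measurable T" "\<And>x. x \<in> K \<Longrightarrow> \<bar>f x\<bar> \<le> C"
  shows "(LINT x|pos_variation K s. f x) - (LINT x|pos_variation K (\<lambda>A. - s A). f x) = (LINT x|T. f x * k x)"
proof -
  have [measurable]: "k \<in> borel_measurable T" "f \<in> borel_measurable T" using k f by auto
  have sp: "space T = K" using sets_eq_imp_space_eq[OF T] by simp
  have d: "density T (\<lambda>x. ennreal (k' x)) = density T (\<lambda>x. ennreal (max 0 (k' x)))" for k'
    by (intro arg_cong[of _ _ "density T"] ext) (auto simp: max_def ennreal_neg)
  have int: "integrable T (\<lambda>x. max 0 (k' x) * f x)" if k': "integrable T k'" for k'
  proof (rule Bochner_Integration.integrable_bound[OF integrable_mult_right[of C T "\<lambda>x. \<bar>k' x\<bar>"]])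
    show "integrable T (\<lambda>x. \<bar>k' x\<bar>)" using k' by (rule integrable_abs)
    have [measurable]: "k' \<in> borel_measurable T" using k' by simp
    show "(\<lambda>x. max 0 (k' x) * f x) \<in> borel_measurable T" by measurable
    show "AE x in T. norm (max 0 (k' x) * f x) \<le> norm (C * \<bar>k' x\<bar>)"
    proof (rule AE_I2)
      fix x assume "x \<in> space T"
      then have "\<bar>f x\<bar> \<le> C" using f(2) sp by simp
      then have "\<bar>max 0 (k' x)\<bar> * \<bar>f x\<bar> \<le> \<bar>k' x\<bar> * C"
        by (intro mult_mono) auto
      moreover have "0 \<le> C" using \<open>\<bar>f x\<bar> \<le> C\<close> by linarith
      ultimately show "norm (max 0 (k' x) * f x) \<le> norm (C * \<bar>k' x\<bar>)" by (simp add: abs_mult mult.commute)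
    qed
  qed
  have "pos_variation K s = density T (\<lambda>x. ennreal (k x))"
    by (rule pos_variation_density[OF T k s])
  then have "pos_variation K s = density T (\<lambda>x. ennreal (max 0 (k x)))"
    using d[of k] by (rule trans)
  then have "(LINT x|pos_variation K s. f x) = (LINT x|T. max 0 (k x) * f x)"
    by (simp only:) (subst integral_density, auto)
  moreover have "(LINT x|pos_variation K (\<lambda>A. - s A). f x) = (LINT x|T. max 0 (- k x) * f x)"
  proof -
    have "pos_variation K (\<lambda>A. - s A) = density T (\<lambda>x. ennreal (- k x))"
      by (rule pos_variation_density[OF T]) (use k s in \<open>auto simp: set_lebesgue_integral_def\<close>)
    then have "pos_variation K (\<lambda>A. - s A) = density T (\<lambda>x. ennreal (max 0 (- k x)))"
      using d[of "\<lambda>x. - k x"] by (rule trans)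
    then show ?thesis by (simp only:) (subst integral_density, auto)
  qed
  moreover have "(LINT x|T. max 0 (k x) * f x) - (LINT x|T. max 0 (- k x) * f x) = (LINT x|T. f x * k x)"
    by (subst Bochner_Integration.integral_diff[OF int int, symmetric])
       (use k in \<open>auto intro!: Bochner_Integration.integral_cong simp: max_def algebra_simps\<close>)
  ultimately show ?thesis by simp
qed

lemma vintegral_density:
  fixes f h :: "'a::euclidean_space \<Rightarrow> 'a"
  assumes T: "sets T = sets (restrict_space borel K)"
    and h: "integrable T h"
    and q: "\<And>A. A \<in> sets T \<Longrightarrow> q A = (LINT x:A|T. h x)"
    and f: "f \<in> borel_measurable T" "\<And>x. x \<in> K \<Longrightarrow> norm (f x) \<le> C"
  shows "vintegral K q f = (LINT x|T. f x \<bullet> h x)"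
proof -
  have sp: "space T = K" using sets_eq_imp_space_eq[OF T] by simp
  have hb: "integrable T (\<lambda>x. h x \<bullet> b)" for b using h by simp
  have fb: "\<bar>f x \<bullet> b\<bar> \<le> C" if "x \<in> K" "b \<in> Basis" for x b
    using Basis_le_norm[OF that(2), of "f x"] f(2)[OF that(1)] by linarith
  have qb: "q A \<bullet> b = (LINT x:A|T. h x \<bullet> b)" if "A \<in> sets T" for A b
  proof -
    have "integrable T (\<lambda>x. indicator A x *\<^sub>R h x)" by (rule integrable_mult_indicator[OF that h])
    then show ?thesis unfolding q[OF that] set_lebesgue_integral_def
      by (subst integral_inner_left[symmetric]) auto
  qed
  have int: "integrable T (\<lambda>x. (f x \<bullet> b) * (h x \<bullet> b))" if "b \<in> Basis" for b
  proof (rule Bochner_Integration.integrable_bound[OF integrable_mult_right[of C T "\<lambda>x. \<bar>h x \<bullet> b\<bar>"]])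
    show "integrable T (\<lambda>x. \<bar>h x \<bullet> b\<bar>)" using hb by (rule integrable_abs)
    show "(\<lambda>x. (f x \<bullet> b) * (h x \<bullet> b)) \<in> borel_measurable T" using f(1) h by measurable
    show "AE x in T. norm ((f x \<bullet> b) * (h x \<bullet> b)) \<le> norm (C * \<bar>h x \<bullet> b\<bar>)"
    proof (rule AE_I2)
      fix x assume "x \<in> space T"
      then have "\<bar>f x \<bullet> b\<bar> \<le> C" using fb that sp by simp
      then have "\<bar>f x \<bullet> b\<bar> * \<bar>h x \<bullet> b\<bar> \<le> C * \<bar>h x \<bullet> b\<bar>" by (intro mult_right_mono) auto
      moreover have "0 \<le> C" using \<open>\<bar>f x \<bullet> b\<bar> \<le> C\<close> by linarith
      ultimately show "norm ((f x \<bullet> b) * (h x \<bullet> b)) \<le> norm (C * \<bar>h x \<bullet> b\<bar>)" by (simp add: abs_mult)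
    qed
  qed
  have "vintegral K q f = (\<Sum>b\<in>Basis. LINT x|T. (f x \<bullet> b) * (h x \<bullet> b))"
    unfolding vintegral_def
  proof (rule sum.cong)
    fix b :: 'a assume b: "b \<in> Basis"
    show "(LINT x|pos_variation K (\<lambda>A. q A \<bullet> b). f x \<bullet> b) -
       (LINT x|pos_variation K (\<lambda>A. - (q A \<bullet> b)). f x \<bullet> b) = (LINT x|T. (f x \<bullet> b) * (h x \<bullet> b))"
      by (rule integral_pos_variation_diff[OF T hb qb, of "\<lambda>x. f x \<bullet> b" C]) (use f(1) fb[OF _ b] in auto)
  qed simp
  also have "\<dots> = (LINT x|T. f x \<bullet> h x)"
    by (subst Bochner_Integration.integral_sum[symmetric])
       (use int in \<open>auto simp: euclidean_inner[symmetric]\<close>)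
  finally show ?thesis .
qed


text \<open>Adding \<open>T\<close> turns the signed set function into a positive measure,
  absolutely continuous with respect to \<open>T\<close>; subtracting 1 from its Radon-Nikodym
  derivative gives the density of \<open>f\<close>.\<close>

lemma dominated_set_function_density:
  fixes f :: "'a set \<Rightarrow> real"
  assumes "finite_measure T"
    and f: "\<And>A. range A \<subseteq> sets T \<Longrightarrow> disjoint_family A \<Longrightarrow> (\<lambda>i::nat. f (A i)) sums f (\<Union>i. A i)"
    and le: "\<And>A. A \<in> sets T \<Longrightarrow> \<bar>f A\<bar> \<le> measure T A"
  obtains k where "integrable T k" "\<And>A. A \<in> sets T \<Longrightarrow> f A = (LINT x:A|T. k x)"
proof -
  interpret finite_measure T by fact
  define N where "N = measure_of (space T) (sets T) (\<lambda>A. ennreal (measure T A + f A))"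
  have nn: "0 \<le> measure T A + f A" if "A \<in> sets T" for A using le[OF that] by linarith
  have eN: "emeasure N A = ennreal (measure T A + f A)" if A: "A \<in> sets T" for A
    unfolding N_def
  proof (rule emeasure_measure_of_sigma[OF sets.sigma_algebra_axioms _ _ A])
    have "f {} = 0" using le[of "{}"] by simp
    then show "positive (sets T) (\<lambda>A. ennreal (measure T A + f A))" by (simp add: positive_def)
    show "countably_additive (sets T) (\<lambda>A. ennreal (measure T A + f A))"
    proof (rule countably_additiveI)
      fix A :: "nat \<Rightarrow> _" assume A: "range A \<subseteq> sets T" "disjoint_family A" "(\<Union>i. A i) \<in> sets T"
      have "(\<lambda>i. measure T (A i) + f (A i)) sums (measure T (\<Union>i. A i) + f (\<Union>i. A i))"
        by (intro sums_add f A finite_measure_UNION)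
      then show "(\<Sum>i. ennreal (measure T (A i) + f (A i))) = ennreal (measure T (\<Union>i. A i) + f (\<Union>i. A i))"
        by (intro suminf_ennreal_eq nn) (use A(1) in auto)
    qed
  qed
  have sN: "sets N = sets T" unfolding N_def
    using sets.space_closed[of T] by (simp add: sets_measure_of sets.sigma_sets_eq)
  have "absolutely_continuous T N"
    unfolding absolutely_continuous_def null_sets_def
  proof clarsimp
    fix A assume A: "A \<in> sets T" "emeasure T A = 0"
    then have "measure T A = 0" by (simp add: measure_def)
    then show "A \<in> sets N \<and> emeasure N A = 0" using le[OF A(1)] eN[OF A(1)] sN A(1) by simp
  qed
  then obtain d where d[measurable]: "d \<in> borel_measurable T" and dN: "density T d = N"
    using Radon_Nikodym sN by blast
  have dA: "(\<integral>\<^sup>+x. d x * indicator A x \<partial>T) = ennreal (measure T A + f A)" if "A \<in> sets T" for A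
    using eN[OF that] emeasure_density[OF d that] dN by simp
  have "(\<integral>\<^sup>+x. d x \<partial>T) = (\<integral>\<^sup>+x. d x * indicator (space T) x \<partial>T)"
    by (rule nn_integral_cong) simp
  then have fin: "(\<integral>\<^sup>+x. d x \<partial>T) < \<infinity>" using dA[OF sets.top] by simp
  then have ae: "AE x in T. d x \<noteq> \<infinity>" by (intro nn_integral_PInf_AE) auto
  have di: "integrable T (\<lambda>x. enn2real (d x))"
  proof (rule integrableI_bounded)
    have "(\<integral>\<^sup>+ x. ennreal (norm (enn2real (d x))) \<partial>T) \<le> (\<integral>\<^sup>+ x. d x \<partial>T)"
      by (rule nn_integral_mono) (simp add: ennreal_enn2real_if)
    then show "(\<integral>\<^sup>+ x. ennreal (norm (enn2real (d x))) \<partial>T) < \<infinity>" using fin by (rule le_less_trans)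
  qed measurable
  define k where "k x = enn2real (d x) - 1" for x
  have ki: "integrable T k" unfolding k_def using di by simp
  have "f A = (LINT x:A|T. k x)" if A: "A \<in> sets T" for A
  proof -
    have iA: "integrable T (indicator A :: _ \<Rightarrow> real)"
      by (rule integrable_real_indicator[OF A]) (metis emeasure_finite infinity_ennreal_def top.not_eq_extremum)
    have i1: "integrable T (\<lambda>x. indicator A x * enn2real (d x))"
      using integrable_mult_indicator[OF A di] by simp
    have "ennreal (LINT x|T. indicator A x * enn2real (d x)) = (\<integral>\<^sup>+x. ennreal (indicator A x * enn2real (d x)) \<partial>T)"
      by (rule nn_integral_eq_integral[symmetric, OF i1]) auto
    also have "\<dots> = (\<integral>\<^sup>+x. d x * indicator A x \<partial>T)"
      by (rule nn_integral_cong_AE) (use ae in \<open>eventually_elim, auto simp: indicator_def ennreal_enn2real_if\<close>)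
    also have "\<dots> = ennreal (measure T A + f A)" by (rule dA[OF A])
    finally have "(LINT x|T. indicator A x * enn2real (d x)) = measure T A + f A"
      using nn[OF A] by (subst (asm) ennreal_inj) (auto intro!: Bochner_Integration.integral_nonneg)
    moreover have "(LINT x:A|T. k x) = (LINT x|T. indicator A x * enn2real (d x)) - (LINT x|T. indicator A x)"
      unfolding set_lebesgue_integral_def k_def
      using i1 iA by (subst Bochner_Integration.integral_diff[symmetric]) (auto simp: right_diff_distrib)
    ultimately show ?thesis using A by simp
  qed
  then show ?thesis using that ki by blast
qed

lemma set_integral_sums:
  fixes h :: "'a \<Rightarrow> 'b::{banach, second_countable_topology}"
  assumes h: "integrable T h" and A: "range A \<subseteq> sets T" "disjoint_family A"
  shows "(\<lambda>i::nat. LINT x:A i|T. h x) sums (LINT x:(\<Union>i. A i)|T. h x)"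
proof -
  have [measurable]: "h \<in> borel_measurable T" "A i \<in> sets T" for i using h A by auto
  have p: "(\<lambda>i. indicator (A i) x *\<^sub>R h x) sums (indicator (\<Union>i. A i) x *\<^sub>R h x)" for x
    by (intro sums_scaleR_left indicator_sums) (use A(2) in \<open>auto simp: disjoint_family_on_def\<close>)
  have int: "integrable T (\<lambda>x. indicator (A i) x *\<^sub>R h x)" for i by (rule integrable_mult_indicator[OF _ h]) simp
  have "(\<lambda>n. LINT x|T. (\<Sum>i<n. indicator (A i) x *\<^sub>R h x)) \<longlonglongrightarrow> (LINT x|T. indicator (\<Union>i. A i) x *\<^sub>R h x)"
  proof (rule integral_dominated_convergence[where w="\<lambda>x. norm (h x)"])
    show "AE x in T. norm (\<Sum>i<n. indicator (A i) x *\<^sub>R h x) \<le> norm (h x)" for n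
    proof (rule AE_I2)
      fix x
      have "(\<Sum>i<n. indicator (A i) x :: real) = indicator (\<Union>i<n. A i) x"
        by (rule indicator_UN_disjoint[symmetric])
           (use A(2) in \<open>auto simp: disjoint_family_on_def\<close>)
      then show "norm (\<Sum>i<n. indicator (A i) x *\<^sub>R h x) \<le> norm (h x)"
        by (simp add: scaleR_left.sum[symmetric] indicator_def)
    qed
    show "AE x in T. (\<lambda>n. \<Sum>i<n. indicator (A i) x *\<^sub>R h x) \<longlonglongrightarrow> indicator (\<Union>i. A i) x *\<^sub>R h x"
      using p by (simp add: sums_def)
  qed (use h in \<open>auto simp del: sum_indicator_scaleR intro!: borel_measurable_sum\<close>)
  then show ?thesis unfolding sums_def set_lebesgue_integral_def using int by (simp del: sum_indicator_scaleR)
qed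

text \<open>On the set where h . u exceeds |u|, the integral of h . u would be larger than the
  domination allows unless the set is null; this is applied to countably many u. If |h x| > 1, then
  u = h x violates h x . u \<le> |u|, and as the violation is an open condition, some u of the dense
  set violates it too.\<close>

lemma norm_density_le_1:
  fixes h :: "'a \<Rightarrow> 'b::euclidean_space"
  assumes T: "finite_measure T" and h: "integrable T h"
    and le: "\<And>A. A \<in> sets T \<Longrightarrow> norm (LINT x:A|T. h x) \<le> measure T A"
  shows "AE x in T. norm (h x) \<le> 1"
proof -
  interpret finite_measure T by fact
  have [measurable]: "h \<in> borel_measurable T" using h by simp
  obtain D :: "'b set" where D: "countable D" "\<And>X. open X \<Longrightarrow> X \<noteq> {} \<Longrightarrow> \<exists>d\<in>D. d \<in> X"
    using countable_dense_exists by metis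
  have "AE x in T. h x \<bullet> u \<le> norm u" for u
  proof -
    define A where "A = {x \<in> space T. norm u < h x \<bullet> u}"
    have A[measurable]: "A \<in> sets T" unfolding A_def by measurable
    have iA: "integrable T (indicator A :: _ \<Rightarrow> real)"
      by (rule integrable_real_indicator[OF A]) (metis emeasure_finite infinity_ennreal_def top.not_eq_extremum)
    have hi: "integrable T (\<lambda>x. indicator A x *\<^sub>R h x)" by (rule integrable_mult_indicator[OF A h])
    have i1: "integrable T (\<lambda>x. indicator A x * (h x \<bullet> u))"
      using integrable_inner_left[of u, OF hi] by simp
    have i2: "integrable T (\<lambda>x. indicator A x * norm u)" using iA by simp
    have "(LINT x|T. indicator A x * (h x \<bullet> u)) = (LINT x:A|T. h x) \<bullet> u"
      unfolding set_lebesgue_integral_def using integral_inner_left[of u, OF hi] by simp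
    also have "\<dots> \<le> norm (LINT x:A|T. h x) * norm u" by (rule norm_cauchy_schwarz)
    also have "\<dots> \<le> measure T A * norm u" by (rule mult_right_mono[OF le[OF A]]) simp
    also have "\<dots> = (LINT x|T. indicator A x * norm u)" using A by simp
    finally have "(LINT x|T. indicator A x * (h x \<bullet> u - norm u)) \<le> 0"
      using i1 i2 by (simp add: right_diff_distrib)
    moreover have nn: "0 \<le> indicator A x * (h x \<bullet> u - norm u)" for x by (auto simp: A_def indicator_def)
    ultimately have "(LINT x|T. indicator A x * (h x \<bullet> u - norm u)) = 0"
      by (intro antisym Bochner_Integration.integral_nonneg)
    then have "AE x in T. indicator A x * (h x \<bullet> u - norm u) = 0"
      using i1 i2 nn by (subst (asm) integral_nonneg_eq_0_iff_AE) (auto simp: right_diff_distrib)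
    then show ?thesis
      using AE_space by eventually_elim (auto simp: A_def indicator_def split: if_splits)
  qed
  then have "AE x in T. \<forall>u\<in>D. h x \<bullet> u \<le> norm u"
    using D(1) by (simp add: AE_ball_countable)
  then show ?thesis
  proof eventually_elim
    fix x assume *: "\<forall>u\<in>D. h x \<bullet> u \<le> norm u"
    show "norm (h x) \<le> 1"
    proof (rule ccontr)
      assume "\<not> ?thesis"
      then have "norm (h x) < h x \<bullet> h x"
        
        unfolding dot_square_norm power2_eq_square
        by (subst mult_less_cancel_left1) (auto simp: not_le intro: order_trans)
      then have "{u. norm u < h x \<bullet> u} \<noteq> {}" by auto
      moreover have "open {u. norm u < h x \<bullet> u}"
        by (intro open_Collect_less continuous_intros)
      ultimately obtain u where "u \<in> D" "norm u < h x \<bullet> u" using D(2) by blast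
      then show False using * by fastforce
    qed
  qed
qed

text \<open>Polar decomposition with respect to the total variation. Only the upper bound |h| \<le>
  1 is recorded: it is the boundedness that the competitor construction asks of a velocity, and it
  keeps the cost from growing.\<close>

lemma vector_measure_polar:
  fixes q :: "'a::euclidean_space set \<Rightarrow> 'a"
  assumes q: "q \<in> vector_measures K" and fin: "emeasure (total_variation K q) K < \<infinity>"
  obtains h where "h \<in> borel_measurable (total_variation K q)" "\<And>x. norm (h x) \<le> 1"
    "\<And>A. A \<in> sets (total_variation K q) \<Longrightarrow> q A = (LINT x:A|total_variation K q. h x)"
proof -
  let ?T = "total_variation K q"
  interpret T: finite_measure ?T
    by (rule finite_measureI) (use fin in auto)
  have qle: "norm (q A) \<le> measure ?T A" if "A \<in> sets ?T" for A
    using norm_le_total_variation[OF q, of A] that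
    by (simp add: T.emeasure_eq_measure del: sets_total_variation) (simp add: T.emeasure_eq_measure)
  have "\<exists>k. integrable ?T k \<and> (\<forall>A\<in>sets ?T. q A \<bullet> b = (LINT x:A|?T. k x))" if b: "b \<in> Basis" for b
  proof (rule dominated_set_function_density[OF T.finite_measure_axioms, of "\<lambda>A. q A \<bullet> b"])
    show "(\<lambda>i. q (A i) \<bullet> b) sums (q (\<Union>i. A i) \<bullet> b)" if "range A \<subseteq> sets ?T" "disjoint_family A" for A :: "nat \<Rightarrow> _"
      using bounded_linear.sums[OF bounded_linear_inner_left vector_measure_sums[OF q]] that by simp
    show "\<bar>q A \<bullet> b\<bar> \<le> measure ?T A" if "A \<in> sets ?T" for A
      using Basis_le_norm[OF b, of "q A"] qle[OF that] by linarith
  qed blast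
  then obtain k where k: "\<And>b. b \<in> Basis \<Longrightarrow> integrable ?T (k b)"
    "\<And>b A. b \<in> Basis \<Longrightarrow> A \<in> sets ?T \<Longrightarrow> q A \<bullet> b = (LINT x:A|?T. k b x)" by metis
  define h0 where "h0 x = (\<Sum>b\<in>Basis. k b x *\<^sub>R b)" for x
  have h0: "integrable ?T h0" unfolding h0_def using k(1) by (intro Bochner_Integration.integrable_sum integrable_scaleR_left) auto
  have q0: "q A = (LINT x:A|?T. h0 x)" if A: "A \<in> sets ?T" for A
  proof (rule euclidean_eqI)
    fix b :: 'a assume b: "b \<in> Basis"
    have "integrable ?T (\<lambda>x. indicator A x *\<^sub>R h0 x)" by (rule integrable_mult_indicator[OF A h0])
    then have "(LINT x:A|?T. h0 x) \<bullet> b = (LINT x|?T. (indicator A x *\<^sub>R h0 x) \<bullet> b)"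
      unfolding set_lebesgue_integral_def by (rule integral_inner_left[symmetric])
    also have "\<dots> = (LINT x:A|?T. k b x)"
      unfolding set_lebesgue_integral_def
      by (rule Bochner_Integration.integral_cong) (use b in \<open>auto simp: h0_def inner_sum_left inner_Basis if_distrib cong: if_cong\<close>)
    finally show "q A \<bullet> b = (LINT x:A|?T. h0 x) \<bullet> b" using k(2)[OF b A] by simp
  qed
  have ae: "AE x in ?T. norm (h0 x) \<le> 1"
    by (rule norm_density_le_1[OF T.finite_measure_axioms h0]) (use q0 qle in metis)
  \<comment> \<open>The bound on \<open>h0\<close> holds almost everywhere; resetting
    \<open>h0\<close> to 0 on the exceptional null set makes it hold everywhere.\<close>
  define h where "h x = (if norm (h0 x) \<le> 1 then h0 x else 0)" for x
  have hm[measurable]: "h0 \<in> borel_measurable ?T" using h0 by simp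
  have hm: "h \<in> borel_measurable ?T" unfolding h_def by measurable
  moreover have "norm (h x) \<le> 1" for x by (simp add: h_def)
  moreover have "q A = (LINT x:A|?T. h x)" if A: "A \<in> sets ?T" for A
    unfolding q0[OF A] set_lebesgue_integral_def
    by (rule integral_cong_AE) (use ae hm A in \<open>auto simp: h_def elim: eventually_mono simp del: sets_total_variation\<close>)
  ultimately show ?thesis using that by blast
qed


subsection \<open>Test functions and weak gradients\<close>

lemma Ck_Suc_imp_Ck: "Ck (Suc k) f \<Longrightarrow> Ck k f"
proof (induction k arbitrary: f)
  case 0
  then show ?case by (auto simp: continuous_on_eq_continuous_at intro: differentiable_imp_continuous_within)
next
  case (Suc k)
  show ?case unfolding Ck.simps(2)[of k]
  proof (intro conjI allI ballI)
    show "f differentiable at x" for x using Suc.prems by simp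
    fix b :: 'a assume "b \<in> Basis"
    then have "Ck (Suc k) (\<lambda>x. frechet_derivative f (at x) b)" using Suc.prems by (subst (asm) Ck.simps(2)) auto
    then show "Ck k (\<lambda>x. frechet_derivative f (at x) b)" by (rule Suc.IH)
  qed
qed

lemma Ck_const: "Ck k (\<lambda>x. c)"
  by (induction k arbitrary: c) (auto simp: frechet_derivative_const)

lemma Ck_add: "Ck k f \<Longrightarrow> Ck k g \<Longrightarrow> Ck k (\<lambda>x. f x + g x)"
proof (induction k arbitrary: f g)
  case 0 then show ?case by (auto intro: continuous_on_add)
next
  case (Suc k)
  have "frechet_derivative (\<lambda>x. f x + g x) (at x) b = frechet_derivative f (at x) b + frechet_derivative g (at x) b" for x b
    using Suc.prems by (subst frechet_derivative_at[OF has_derivative_add, symmetric])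
      (auto simp: frechet_derivative_works[symmetric])
  then show ?case using Suc by auto
qed

lemma Ck_mult: "Ck k f \<Longrightarrow> Ck k g \<Longrightarrow> Ck k (\<lambda>x. f x * g x)"
proof (induction k arbitrary: f g)
  case 0 then show ?case by (auto intro: continuous_on_mult)
next
  case (Suc k)
  have "frechet_derivative (\<lambda>x. f x * g x) (at x) b =
     f x * frechet_derivative g (at x) b + frechet_derivative f (at x) b * g x" for x b
    using Suc.prems by (subst frechet_derivative_at[OF has_derivative_mult, symmetric])
      (auto simp: frechet_derivative_works[symmetric])
  then show ?case using Suc Ck_Suc_imp_Ck[of k f] Ck_Suc_imp_Ck[of k g]
    by (auto intro!: Ck_add differentiable_mult)
qed

lemma has_derivative_frechet_affine:
  fixes f :: "'a::euclidean_space \<Rightarrow> real"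
  assumes "f differentiable (at (c *\<^sub>R x + d))"
  shows "((\<lambda>z. f (c *\<^sub>R z + d)) has_derivative (\<lambda>h. c * frechet_derivative f (at (c *\<^sub>R x + d)) h)) (at x)"
proof -
  have l: "linear (frechet_derivative f (at (c *\<^sub>R x + d)))" using assms by (rule linear_frechet_derivative)
  have "((\<lambda>z. c *\<^sub>R z + d) has_derivative (\<lambda>h. c *\<^sub>R h)) (at x)" by (auto intro!: derivative_eq_intros)
  from has_derivative_compose[OF this assms[unfolded frechet_derivative_works]]
  show ?thesis by (simp add: linear_cmul[OF l])
qed

lemma Ck_affine: "Ck k f \<Longrightarrow> Ck k (\<lambda>z. f (c *\<^sub>R z + d))"
proof (induction k arbitrary: f)
  case 0 then show ?case
    by (auto intro!: continuous_on_compose2[of UNIV f] continuous_intros)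
next
  case (Suc k)
  have "frechet_derivative (\<lambda>z. f (c *\<^sub>R z + d)) (at x) b = c * frechet_derivative f (at (c *\<^sub>R x + d)) b" for x b
    by (rule fun_cong[OF frechet_derivative_at[symmetric, OF has_derivative_frechet_affine]])
       (use Suc.prems in simp)
  moreover have "(\<lambda>z. f (c *\<^sub>R z + d)) differentiable at x" for x
    using has_derivative_frechet_affine[of f c x d] Suc.prems by (auto simp: differentiable_def)
  moreover have "Ck k (\<lambda>x. frechet_derivative f (at (c *\<^sub>R x + d)) b)" if "b \<in> Basis" for b
    using Suc.IH[of "\<lambda>x. frechet_derivative f (at x) b"] Suc.prems that by simp
  ultimately show ?case by (auto intro!: Ck_mult[OF Ck_const])
qed

lemma Ck_inner: "Ck k (\<lambda>z. z \<bullet> v)"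
proof (cases k)
  case 0 then show ?thesis by (auto intro!: continuous_intros)
next
  case (Suc j)
  have "frechet_derivative (\<lambda>z. z \<bullet> v) (at x) b = b \<bullet> v" for x b
    by (rule fun_cong[OF frechet_derivative_at[symmetric]]) (auto intro!: derivative_eq_intros)
  then show ?thesis unfolding Suc by (auto simp: Ck_const)
qed

lemma Cc_infinityI:
  assumes "\<And>k. Ck k f" "compact S" "S \<subseteq> U" "\<And>x. f x \<noteq> 0 \<Longrightarrow> x \<in> S"
  shows "f \<in> Cc_infinity U"
proof -
  have "supp f \<subseteq> S" unfolding supp_def support_on_def
    by (rule closure_minimal) (use assms in \<open>auto intro: compact_imp_closed\<close>)
  moreover from this have "compact (supp f)"
    using bounded_subset[OF compact_imp_bounded[OF assms(2)]] by (simp add: compact_eq_bounded_closed supp_def)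
  ultimately show ?thesis using assms unfolding Cc_infinity_def by auto
qed

lemma Cc_infinityD:
  assumes "f \<in> Cc_infinity U"
  shows "Ck k f" "compact (supp f)" "supp f \<subseteq> U" "f x \<noteq> 0 \<Longrightarrow> x \<in> supp f"
    "continuous_on UNIV f" "f differentiable at x" "b \<in> Basis \<Longrightarrow> continuous_on UNIV (\<lambda>x. frechet_derivative f (at x) b)"
proof -
  show a: "Ck k f" "compact (supp f)" "supp f \<subseteq> U" using assms by (auto simp: Cc_infinity_def)
  show "f x \<noteq> 0 \<Longrightarrow> x \<in> supp f" unfolding supp_def support_on_def using closure_subset by fastforce
  have "Ck 0 f" "Ck (Suc 0) f" using assms unfolding Cc_infinity_def by blast+
  then show "continuous_on UNIV f" "f differentiable at x" "b \<in> Basis \<Longrightarrow> continuous_on UNIV (\<lambda>x. frechet_derivative f (at x) b)"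
    by auto
qed

lemma integral_lborel_translate:
  fixes f :: "'a::euclidean_space \<Rightarrow> 'b::{banach, second_countable_topology}"
  assumes "f \<in> borel_measurable borel"
  shows "(LINT x|lborel. f (c + x)) = (LINT x|lborel. f x)"
proof -
  have "(LINT x|lborel. f x) = (LINT x|distr lborel borel ((+) c). f x)" by (simp add: lborel_distr_plus)
  also have "\<dots> = (LINT x|lborel. f (c + x))" by (rule integral_distr) (use assms in auto)
  finally show ?thesis by simp
qed

lemma integrable_lborel_bounded_support:
  fixes f :: "'a::euclidean_space \<Rightarrow> 'b::{banach, second_countable_topology}"
  assumes "f \<in> borel_measurable borel" "bounded S" "\<And>x. x \<notin> S \<Longrightarrow> f x = 0" "\<And>x. norm (f x) \<le> M"
  shows "integrable lborel f"
proof -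
  obtain R where R: "S \<subseteq> cball 0 R" using assms(2) by (auto simp: bounded_iff subset_iff)
  have "integrable lborel (\<lambda>x. indicator (cball 0 R) x * M :: real)"
    by (intro integrable_mult_left integrable_real_indicator) (use emeasure_lborel_cball_finite in auto)
  then show ?thesis
  proof (rule Bochner_Integration.integrable_bound)
    show "f \<in> borel_measurable lborel" using assms(1) by simp
    show "AE x in lborel. norm (f x) \<le> norm (indicator (cball 0 R) x * M :: real)"
    proof (rule AE_I2)
      fix x :: 'a
      show "norm (f x) \<le> norm (indicator (cball 0 R) x * M :: real)"
        using assms(3)[of x] assms(4)[of x] R by (cases "x \<in> S") (auto simp: indicator_def)
    qed
  qed
qed

text \<open>Difference quotients in direction \<open>b\<close> have integral 0 by translation
  invariance of Lebesgue measure. The mean value theorem bounds them by the supremum of the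
  derivative, and dominated convergence passes to the limit.\<close>

lemma integral_directional_derivative_eq_0:
  fixes f :: "'a::euclidean_space \<Rightarrow> real"
  assumes f: "\<And>x. (f has_derivative f' x) (at x)" and f': "continuous_on UNIV (\<lambda>x. f' x b)"
    and S: "compact S" "\<And>x. x \<notin> S \<Longrightarrow> f x = 0"
  shows "(LINT x|lborel. f' x b) = 0"
proof -
  obtain R where R: "S \<subseteq> cball 0 R" "0 < R" using compact_imp_bounded[OF S(1)] by (auto simp: bounded_pos subset_iff)
  \<comment> \<open>The increments \<open>h n\<close> are at most 1, so all difference quotients
    vanish outside the ball enlarged by |b|.\<close>
  define R' where "R' = R + norm b"
  have fz: "f x = 0" if "R < norm x" for x by (rule S(2)) (use R that in auto)
  have f'z: "f' x b = 0" if "R < norm x" for x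
  proof -
    have "((\<lambda>x. 0) has_derivative f' x) (at x)"
    proof (rule has_derivative_transform_eventually[OF f])
      have "eventually (\<lambda>y. y \<in> {y. R < norm y}) (at x)"
        by (rule eventually_at_in_open'[rotated]) (use that in \<open>auto intro!: open_Collect_less continuous_intros\<close>)
      then show "\<forall>\<^sub>F y in at x. f y = 0" by eventually_elim (use fz in auto)
    qed (use fz that in auto)
    then have "f' x = (\<lambda>h. 0)" by (rule has_derivative_unique[OF _ has_derivative_const])
    then show ?thesis by simp
  qed
  have cf: "continuous_on UNIV f"
    by (meson f continuous_at_imp_continuous_on has_derivative_continuous)
  have "compact ((\<lambda>x. f' x b) ` cball 0 R)"
    by (rule compact_continuous_image) (use f' continuous_on_subset in auto)
  then obtain M where M0: "\<And>y. y \<in> (\<lambda>x. f' x b) ` cball 0 R \<Longrightarrow> norm y \<le> M" using compact_imp_bounded bounded_iff by metis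
  have Mpos: "0 \<le> M" using M0[of "f' 0 b"] R(2) by force
  have M: "norm (f' x b) \<le> M" for x
    using M0[of "f' x b"] f'z[of x] Mpos by (cases "R < norm x") auto
  define h where "h n = 1 / real (Suc n)" for n
  have h: "0 < h n" "h n \<le> 1" for n by (auto simp: h_def field_simps)
  have h0: "h \<longlonglongrightarrow> 0" unfolding h_def by (rule LIMSEQ_inverse_real_of_nat[simplified inverse_eq_divide])
  define g where "g n x = (f (h n *\<^sub>R b + x) - f x) / h n" for n x
  have gb: "\<bar>g n x\<bar> \<le> M" for n x
  proof -
    have d: "((\<lambda>t. f (t *\<^sub>R b + x)) has_real_derivative f' (t *\<^sub>R b + x) b) (at t)" for t
    proof -
      have l: "linear (f' (t *\<^sub>R b + x))" using f has_derivative_linear by blast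
      have "((\<lambda>t. t *\<^sub>R b + x) has_derivative (\<lambda>s. s *\<^sub>R b)) (at t)" by (auto intro!: derivative_eq_intros)
      from has_derivative_compose[OF this f]
      show ?thesis by (simp add: linear_cmul[OF l] has_field_derivative_def mult_commute_abs)
    qed
    obtain z where "f (h n *\<^sub>R b + x) - f (0 *\<^sub>R b + x) = (h n - 0) * f' (z *\<^sub>R b + x) b"
      using MVT2[of 0 "h n" "\<lambda>t. f (t *\<^sub>R b + x)" "\<lambda>t. f' (t *\<^sub>R b + x) b"] h(1) d by blast
    then have "g n x = f' (z *\<^sub>R b + x) b" unfolding g_def using h(1)[of n] by simp
    then show ?thesis using M by simp
  qed
  have gz: "g n x = 0" if "x \<notin> cball 0 R'" for n x
  proof -
    have "norm x \<le> norm (h n *\<^sub>R b + x) + norm (h n *\<^sub>R b)" by (metis add_diff_cancel_left' norm_triangle_ineq4 add.commute)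
    moreover have "norm (h n *\<^sub>R b) \<le> norm b" using h(1)[of n] h(2)[of n] mult_left_le_one_le[of "norm b" "h n"] by simp
    ultimately have "R < norm (h n *\<^sub>R b + x)" using that unfolding R'_def by simp
    moreover have "R < norm x" using that norm_ge_zero[of b] unfolding R'_def by (simp del: norm_ge_zero)
    ultimately show ?thesis unfolding g_def by (simp add: fz)
  qed
  have fm: "f \<in> borel_measurable borel" using cf by (rule borel_measurable_continuous_onI)
  have gm: "g n \<in> borel_measurable borel" for n unfolding g_def using fm by measurable
  have fi: "integrable lborel f"
  proof -
    have "compact (f ` cball 0 R)" by (rule compact_continuous_image) (use cf continuous_on_subset in auto)
    then obtain B where B: "\<And>y. y \<in> f ` cball 0 R \<Longrightarrow> norm y \<le> B" using compact_imp_bounded bounded_iff by metis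
    show ?thesis
    proof (rule integrable_lborel_bounded_support[OF fm bounded_cball[of 0 R]])
      show "norm (f x) \<le> max B 0" for x using B[of "f x"] fz[of x] by (cases "R < norm x") auto
    qed (use fz in auto)
  qed
  have int0: "(LINT x|lborel. g n x) = 0" for n
  proof -
    have fi2: "integrable lborel (\<lambda>x. f (h n *\<^sub>R b + x))"
    proof -
      have "integrable (distr lborel borel ((+) (h n *\<^sub>R b))) f" using fi by (simp add: lborel_distr_plus)
      then show ?thesis by (subst (asm) integrable_distr_eq) (use fm in auto)
    qed
    show ?thesis unfolding g_def using fi fi2 integral_lborel_translate[OF fm] by simp
  qed
  have "(\<lambda>n. LINT x|lborel. g n x) \<longlonglongrightarrow> (LINT x|lborel. f' x b)"
  proof (rule integral_dominated_convergence[where w="\<lambda>x. indicator (cball 0 R') x * M"])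
    show "(\<lambda>x. f' x b) \<in> borel_measurable lborel"
      using borel_measurable_continuous_onI[OF f'] by simp
    show "integrable lborel (\<lambda>x. indicator (cball 0 R') x * M :: real)"
      by (intro integrable_mult_left integrable_real_indicator) (use emeasure_lborel_cball_finite in auto)
    show "AE x in lborel. norm (g n x) \<le> indicator (cball 0 R') x * M" for n
      using gb gz by (intro AE_I2) (auto simp: indicator_def)
    show "AE x in lborel. (\<lambda>n. g n x) \<longlonglongrightarrow> f' x b"
    proof (rule AE_I2)
      fix x
      have l: "linear (f' x)" using f has_derivative_linear by blast
      have "((\<lambda>t. t *\<^sub>R b + x) has_derivative (\<lambda>s. s *\<^sub>R b)) (at 0)" by (auto intro!: derivative_eq_intros)
      from has_derivative_compose[OF this, of f "f' x"] f[of x]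
      have "((\<lambda>t. f (t *\<^sub>R b + x)) has_real_derivative f' x b) (at 0)"
        by (simp add: linear_cmul[OF l] has_field_derivative_def mult_commute_abs)
      then have "((\<lambda>t. (f (t *\<^sub>R b + x) - f x) / t) \<longlongrightarrow> f' x b) (at 0)"
        by (simp add: DERIV_def)
      moreover have "filterlim h (at 0) sequentially"
        by (rule filterlim_atI[OF h0 always_eventually]) (use h(1) in \<open>simp add: order_less_imp_not_eq2\<close>)
      ultimately show "(\<lambda>n. g n x) \<longlonglongrightarrow> f' x b"
        unfolding g_def by (rule filterlim_compose)
    qed
  qed (use gm in auto)
  then show ?thesis using int0 by (simp add: LIMSEQ_const_iff)
qed


section \<open>Integration by parts for C^1 functions\<close>

lemma integrable_lebesgue_on_iff_lborel:
  fixes f :: "'a::euclidean_space \<Rightarrow> 'b::{banach, second_countable_topology}"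
  assumes "S \<in> sets borel" "(\<lambda>x. indicator S x *\<^sub>R f x) \<in> borel_measurable borel"
  shows "integrable (lebesgue_on S) f \<longleftrightarrow> integrable lborel (\<lambda>x. indicator S x *\<^sub>R f x)"
    "(LINT x|lebesgue_on S. f x) = (LINT x|lborel. indicator S x *\<^sub>R f x)"
    "f \<in> borel_measurable (lebesgue_on S)"
proof -
  have S: "S \<in> sets lebesgue" "S \<inter> space lebesgue \<in> sets lebesgue" using assms(1) by auto
  have m: "(\<lambda>x. indicator S x *\<^sub>R f x) \<in> borel_measurable lborel" using assms(2) by simp
  show "integrable (lebesgue_on S) f \<longleftrightarrow> integrable lborel (\<lambda>x. indicator S x *\<^sub>R f x)"
    using integrable_restrict_space[OF S(2), of f] integrable_completion[OF m] by (simp add: set_integrable_def)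
  show "(LINT x|lebesgue_on S. f x) = (LINT x|lborel. indicator S x *\<^sub>R f x)"
    using integral_restrict_space[OF S(2), of f] integral_completion[OF m] by (simp add: set_lebesgue_integral_def)
  show "f \<in> borel_measurable (lebesgue_on S)"
    using borel_measurable_restrict_space_iff[OF S(2), of f] measurable_completion[OF m] by simp
qed

lemma continuous_on_indicator_borel:
  fixes f :: "'a::euclidean_space \<Rightarrow> 'b::euclidean_space"
  assumes "S \<in> sets borel" "continuous_on S f"
  shows "(\<lambda>x. indicator S x *\<^sub>R f x) \<in> borel_measurable borel"
  using borel_measurable_continuous_on_indicator[OF assms] .

text \<open>\<open>\<phi>\<close> is differentiable on \<open>U\<close> only, but
  \<open>\<psi>\<close> has compact support in \<open>U\<close>, so the product extended by 0 is C^1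
  on the whole space and its directional derivatives integrate to 0.\<close>

lemma C1_integration_by_parts:
  fixes \<phi> :: "'a::euclidean_space \<Rightarrow> real"
  assumes U: "open U" and \<phi>: "\<And>x. x \<in> U \<Longrightarrow> GDERIV \<phi> x :> G x" and G: "continuous_on U G"
    and \<psi>: "\<psi> \<in> Cc_infinity U" and b: "b \<in> Basis"
  shows "(LINT x|lebesgue_on U. \<phi> x * frechet_derivative \<psi> (at x) b)
          = - (LINT x|lebesgue_on U. (G x \<bullet> b) * \<psi> x)"
proof -
  note \<psi>D = Cc_infinityD[OF \<psi>]
  let ?D = "\<lambda>x. frechet_derivative \<psi> (at x)"
  have \<psi>d: "(\<psi> has_derivative ?D x) (at x)" for x
    using \<psi>D(6) by (simp add: frechet_derivative_works[symmetric])
  have clS: "closed (supp \<psi>)" using \<psi>D(2) by (rule compact_imp_closed)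
  define f where "f x = (if x \<in> U then \<phi> x * \<psi> x else 0)" for x
  define f' where "f' x = (if x \<in> U then (\<lambda>h. \<phi> x * ?D x h + (h \<bullet> G x) * \<psi> x) else (\<lambda>h. 0))" for x
  have z: "\<psi> x = 0" if "x \<notin> supp \<psi>" for x using \<psi>D(4) that by blast
  have Dz: "?D x h = 0" if "x \<notin> supp \<psi>" for x h
  proof -
    have "((\<lambda>x. 0) has_derivative ?D x) (at x)"
    proof (rule has_derivative_transform_within_open[OF \<psi>d])
      show "open (- supp \<psi>)" using clS by (simp add: open_Compl)
    qed (use z that in auto)
    then have "?D x = (\<lambda>h. 0)" by (rule has_derivative_unique[OF _ has_derivative_const])
    then show ?thesis by simp
  qed
  have fz: "f x = 0" if "x \<notin> supp \<psi>" for x using z[OF that] by (simp add: f_def)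
  have fd: "(f has_derivative f' x) (at x)" for x
  proof (cases "x \<in> U")
    case True
    have "((\<lambda>x. \<phi> x * \<psi> x) has_derivative f' x) (at x)"
      using has_derivative_mult[OF \<phi>[OF True, unfolded gderiv_def] \<psi>d] True
      by (simp add: f'_def inner_commute)
    then show ?thesis
      by (rule has_derivative_transform_within_open[OF _ U True]) (simp add: f_def)
  next
    case False
    then have x: "x \<in> - supp \<psi>" using \<psi>D(3) by auto
    have "((\<lambda>x. 0) has_derivative f' x) (at x)" using False by (simp add: f'_def)
    then show ?thesis
      by (rule has_derivative_transform_within_open[OF _ _ x]) (use clS fz in \<open>auto simp: open_Compl\<close>)
  qed
  have c\<phi>: "continuous_on U \<phi>"
    using \<phi>[unfolded gderiv_def] by (meson has_derivative_continuous continuous_at_imp_continuous_on)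
  have cU: "continuous_on U (\<lambda>x. f' x b)"
  proof (rule continuous_on_eq)
    show "continuous_on U (\<lambda>x. \<phi> x * ?D x b + (b \<bullet> G x) * \<psi> x)"
      by (intro continuous_intros c\<phi> G continuous_on_subset[OF \<psi>D(5)] continuous_on_subset[OF \<psi>D(7)[OF b]]) auto
  qed (simp add: f'_def)
  have cS: "continuous_on (- supp \<psi>) (\<lambda>x. f' x b)"
    by (rule continuous_on_eq[of _ "\<lambda>x. 0"]) (auto simp: f'_def z Dz)
  have "continuous_on (U \<union> - supp \<psi>) (\<lambda>x. f' x b)"
    by (rule continuous_on_open_Un[OF U _ cU cS]) (use clS in \<open>simp add: open_Compl\<close>)
  moreover have "U \<union> - supp \<psi> = UNIV" using \<psi>D(3) by auto
  ultimately have cf': "continuous_on UNIV (\<lambda>x. f' x b)" by simp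
  have z0: "(LINT x|lborel. f' x b) = 0"
    by (rule integral_directional_derivative_eq_0[OF fd cf' \<psi>D(2) fz])
  have c1: "continuous_on U (\<lambda>x. \<phi> x * ?D x b)" "continuous_on U (\<lambda>x. (G x \<bullet> b) * \<psi> x)"
    by (intro continuous_intros c\<phi> G continuous_on_subset[OF \<psi>D(5)] continuous_on_subset[OF \<psi>D(7)[OF b]]; auto)+
  have bU: "U \<in> sets borel" using U by simp
  have i: "integrable lborel (\<lambda>x. indicator U x *\<^sub>R g x)"
    if g: "continuous_on U g" "\<And>x. x \<notin> supp \<psi> \<Longrightarrow> g x = 0" for g :: "'a \<Rightarrow> real"
  proof -
    have "integrable lborel (\<lambda>x. indicator (supp \<psi>) x *\<^sub>R g x)"
      by (rule borel_integrable_compact[OF \<psi>D(2) continuous_on_subset[OF g(1) \<psi>D(3)]])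
    moreover have "indicator (supp \<psi>) x *\<^sub>R g x = indicator U x *\<^sub>R g x" for x
      using g(2)[of x] \<psi>D(3) by (auto simp: indicator_def)
    ultimately show ?thesis by (simp only:)
  qed
  have "(LINT x|lborel. f' x b) = (LINT x|lborel. indicator U x *\<^sub>R (\<phi> x * ?D x b) + indicator U x *\<^sub>R ((G x \<bullet> b) * \<psi> x))"
    by (rule Bochner_Integration.integral_cong) (auto simp: f'_def indicator_def inner_commute)
  also have "\<dots> = (LINT x|lborel. indicator U x *\<^sub>R (\<phi> x * ?D x b)) + (LINT x|lborel. indicator U x *\<^sub>R ((G x \<bullet> b) * \<psi> x))"
    by (rule Bochner_Integration.integral_add) (rule i; use c1 z Dz in auto)+
  also have "(LINT x|lborel. indicator U x *\<^sub>R (\<phi> x * ?D x b)) = (LINT x|lebesgue_on U. \<phi> x * ?D x b)"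
    by (rule integrable_lebesgue_on_iff_lborel(2)[symmetric, OF bU continuous_on_indicator_borel[OF bU c1(1)]])
  also have "(LINT x|lborel. indicator U x *\<^sub>R ((G x \<bullet> b) * \<psi> x)) = (LINT x|lebesgue_on U. (G x \<bullet> b) * \<psi> x)"
    by (rule integrable_lebesgue_on_iff_lborel(2)[symmetric, OF bU continuous_on_indicator_borel[OF bU c1(2)]])
  finally show ?thesis using z0 by linarith
qed

text \<open>Supplies the test functions through which the constraint of the regularized problem is
  exploited. Compactness of \<open>K\<close> turns continuity up to the boundary into L^p
  integrability.\<close>

lemma C1_on_imp_sobolev:
  fixes K :: "'a::euclidean_space set"
  assumes K: "compact K" and C1: "C1_on K \<phi> G" and p: "1 < p"
  shows "sobolev p K \<phi> G"
proof -
  let ?U = "interior K"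
  have c: "continuous_on K \<phi>" "continuous_on K G" and d: "\<And>x. x \<in> ?U \<Longrightarrow> GDERIV \<phi> x :> G x"
    using C1 by (auto simp: C1_on_def)
  have bU: "?U \<in> sets borel" by simp
  have Lp: "f \<in> Lp_space p ?U" if f: "continuous_on K f" for f :: "'a \<Rightarrow> 'b::euclidean_space"
  proof -
    have fU: "continuous_on ?U f" using f interior_subset continuous_on_subset by blast
    have cp: "continuous_on K (\<lambda>x. norm (f x) powr p)"
      by (rule continuous_on_powr') (use f p in \<open>auto intro: continuous_on_norm\<close>)
    have cpU: "continuous_on ?U (\<lambda>x. norm (f x) powr p)"
      using cp interior_subset continuous_on_subset by blast
    have "set_integrable lborel K (\<lambda>x. norm (f x) powr p)"
      unfolding set_integrable_def by (rule borel_integrable_compact[OF K cp])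
    then have "set_integrable lborel ?U (\<lambda>x. norm (f x) powr p)"
      by (rule set_integrable_subset) (auto simp: interior_subset)
    then have "integrable (lebesgue_on ?U) (\<lambda>x. norm (f x) powr p)"
      using integrable_lebesgue_on_iff_lborel(1)[OF bU continuous_on_indicator_borel[OF bU cpU]]
      by (simp add: set_integrable_def)
    then show ?thesis
      using integrable_lebesgue_on_iff_lborel(3)[OF bU continuous_on_indicator_borel[OF bU fU]]
      by (simp add: Lp_space_def)
  qed
  have ai: "f absolutely_integrable_on C" if "compact C" "C \<subseteq> ?U" "continuous_on K f" for f :: "'a \<Rightarrow> 'b::euclidean_space" and C
  proof -
    have "continuous_on C f" using that interior_subset continuous_on_subset by (metis subset_trans)
    then have "integrable lborel (\<lambda>x. indicator C x *\<^sub>R f x)"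
      by (rule borel_integrable_compact[OF that(1)])
    then show ?thesis unfolding set_integrable_def by (subst integrable_completion) auto
  qed
  have "has_weak_gradient ?U \<phi> G"
    unfolding has_weak_gradient_def
  proof (intro conjI allI impI ballI)
    show "\<phi> absolutely_integrable_on C" "G absolutely_integrable_on C" if "compact C \<and> C \<subseteq> ?U" for C
      using that ai[OF _ _ c(1)] ai[OF _ _ c(2)] by simp_all
  qed (rule C1_integration_by_parts[OF open_interior d continuous_on_subset[OF c(2) interior_subset]])
  then show ?thesis using Lp[OF c(1)] Lp[OF c(2)] by (simp add: sobolev_def)
qed


subsection \<open>Interior cones and partitions of unity\<close>

text \<open>Links \<Omega> with its interior: the Lipschitz hypothesis speaks of the interior, while
  the measures may charge boundary points of \<Omega>.\<close>

lemma strictly_star_shaped_subset_closure_interior: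
  assumes "strictly_star_shaped K" shows "K \<subseteq> closure (interior K)"
proof
  fix x assume x: "x \<in> K"
  define l where "l n = 1 - 1 / real (Suc n)" for n
  have "l \<longlonglongrightarrow> 1 - 0" unfolding l_def
    by (rule tendsto_diff[OF tendsto_const LIMSEQ_inverse_real_of_nat[simplified inverse_eq_divide]])
  then have "(\<lambda>n. l n *\<^sub>R x) \<longlonglongrightarrow> (1 - 0) *\<^sub>R x" by (rule tendsto_scaleR[OF _ tendsto_const])
  then have "(\<lambda>n. l n *\<^sub>R x) \<longlonglongrightarrow> x" by simp
  moreover have "l n *\<^sub>R x \<in> interior K" for n
    using assms x unfolding strictly_star_shaped_def l_def by (simp add: field_simps)
  ultimately show "x \<in> closure (interior K)" unfolding closure_sequential
    by (intro exI[of _ "\<lambda>n. l n *\<^sub>R x"]) simp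
qed

text \<open>At an interior point every small shift works, so e = 0 is allowed. At a frontier point
  the chart is a strict epigraph of a Lipschitz function, and moving up along e, or along any
  direction close to e, enters the interior. The same cone serves all points of \<Omega> near
  \<open>x\<close>, as a mollifier with one fixed shift requires.\<close>

lemma interior_cone_at:
  fixes \<Omega> :: "'a::euclidean_space set"
  assumes \<Omega>: "compact \<Omega>" "bounded_lipschitz_domain (interior \<Omega>)" "strictly_star_shaped \<Omega>" and x: "x \<in> \<Omega>"
  shows "\<exists>r>0. \<exists>\<rho>>0. \<exists>h>0. \<exists>e. norm e \<le> 1 \<and>
    (\<forall>z\<in>\<Omega> \<inter> ball x r. \<forall>t. 0 < t \<and> t \<le> h \<longrightarrow> (\<forall>v\<in>ball e \<rho>. z + t *\<^sub>R v \<in> interior \<Omega>))"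
proof (cases "x \<in> interior \<Omega>")
  case True
  then obtain d where d: "d > 0" "ball x d \<subseteq> interior \<Omega>" using open_contains_ball[of "interior \<Omega>"] by auto
  have "z + t *\<^sub>R v \<in> interior \<Omega>" if "dist x z < d/2" "0 < t" "t \<le> d/2" "norm v < 1" for z t v
  proof -
    have "t * norm v \<le> d/2 * norm v" by (rule mult_right_mono) (use that in auto)
    also have "\<dots> < d/2" using that d(1) by simp
    finally have "norm (t *\<^sub>R v) < d/2" using that by simp
    moreover have "dist x (z + t *\<^sub>R v) \<le> dist x z + norm (t *\<^sub>R v)"
      by (metis add_diff_cancel_left' dist_commute dist_norm dist_triangle)
    ultimately show ?thesis using that(1) d(2) by (auto simp: subset_iff)
  qed
  then show ?thesis using d(1)
    by (rule_tac exI[of _ "d/2"], rule_tac conjI, simp, rule_tac exI[of _ 1], rule_tac conjI, simp,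
        rule_tac exI[of _ "d/2"], rule_tac conjI, simp, rule_tac exI[of _ 0]) simp
next
  case False
  let ?U = "interior \<Omega>"
  have cl: "\<Omega> \<subseteq> closure ?U" by (rule strictly_star_shaped_subset_closure_interior[OF \<Omega>(3)])
  then have "x \<in> frontier ?U" using False x unfolding frontier_def by auto
  then obtain r e L g where r: "r > 0" and e: "norm e = 1" and g: "lipschitz_on L {y. y \<bullet> e = 0} g"
    and U: "?U \<inter> ball x r = {z \<in> ball x r. g (z - (z \<bullet> e) *\<^sub>R e) < z \<bullet> e}"
    using \<Omega>(2) unfolding bounded_lipschitz_domain_def by meson
  have L: "0 \<le> L" using g by (rule lipschitz_on_nonneg)
  \<comment> \<open>Per unit step, a direction within \<rho> of e raises the graph function by at
    most L \<rho> and the height by more than 1 - \<rho>; this choice gives L \<rho> < 1 -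
    \<rho>.\<close>
  define \<rho> where "\<rho> = 1 / (2 * (L + 1))"
  have \<rho>: "0 < \<rho>" "\<rho> \<le> 1" "L * \<rho> + \<rho> < 1" using L by (auto simp: \<rho>_def field_simps)
  have ee: "e \<bullet> e = 1" using e by (simp add: dot_square_norm)
  let ?p = "\<lambda>z. z - (z \<bullet> e) *\<^sub>R e"
  have po: "?p z \<in> {y. y \<bullet> e = 0}" for z by (simp add: inner_diff_left ee)
  have gc: "continuous_on UNIV (\<lambda>z. g (?p z))"
    by (rule continuous_on_compose2[OF lipschitz_on_continuous_on[OF g]]) (use po in \<open>auto intro!: continuous_intros\<close>)
  \<comment> \<open>Points of \<Omega> are limits of interior points, so they satisfy the epigraph
    inequality in its weak form.\<close>
  have epi: "g (?p z) \<le> z \<bullet> e" if z: "z \<in> \<Omega>" "z \<in> ball x r" for z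
  proof (rule ccontr)
    assume "\<not> ?thesis"
    then have "z \<in> {z. z \<bullet> e < g (?p z)} \<inter> ball x r" using z by auto
    moreover have "open ({z. z \<bullet> e < g (?p z)} \<inter> ball x r)"
      by (intro open_Int open_Collect_less continuous_intros gc open_ball)
    moreover have "z \<in> closure ?U" using cl z by auto
    ultimately obtain y where "y \<in> ?U" and "y \<in> {z. z \<bullet> e < g (?p z)} \<inter> ball x r"
      using open_Int_closure_eq_empty[of "{z. z \<bullet> e < g (?p z)} \<inter> ball x r" ?U] by blast
    moreover from this have "y \<in> {z \<in> ball x r. g (?p z) < z \<bullet> e}" unfolding U[symmetric] by blast
    ultimately show False by simp
  qed
  \<comment> \<open>Directions have norm below 2, so the shift is at most r/4 and points starting
    within r/2 of \<open>x\<close> stay in the chart ball.\<close>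
  define h where "h = r / 8"
  have "z + t *\<^sub>R v \<in> ?U" if z: "z \<in> \<Omega>" "dist x z < r/2" and t: "0 < t" "t \<le> h" and v: "dist e v < \<rho>" for z t v
  proof -
    have zr: "z \<in> ball x r" using z(2) r by auto
    have nv: "norm v < 2" using v \<rho>(2) e norm_triangle_ineq2[of v e] by (simp add: dist_norm norm_minus_commute)
    have "t * norm v \<le> h * 2" by (rule mult_mono) (use t nv in auto)
    then have "norm (t *\<^sub>R v) \<le> h * 2" using t by simp
    then have "dist x (z + t *\<^sub>R v) < r"
      using z(2) r dist_triangle[of x "z + t *\<^sub>R v" z] unfolding h_def by (simp add: dist_norm)
    then have inb: "z + t *\<^sub>R v \<in> ball x r" by simp
    have "\<bar>(v - e) \<bullet> e\<bar> \<le> norm (v - e) * norm e" by (rule Cauchy_Schwarz_ineq2)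
    then have ve: "1 - \<rho> < v \<bullet> e" using v e ee by (simp add: inner_diff_left dist_norm norm_minus_commute)
    have "norm (?p v) \<le> \<rho>"
    proof -
      have "?p v = ?p (v - e)" by (simp add: inner_diff_left ee scaleR_diff_left)
      moreover have "(norm (?p (v - e)))\<^sup>2 \<le> (norm (v - e))\<^sup>2"
      proof -
        have *: "(norm (?p u))\<^sup>2 = (norm u)\<^sup>2 - (u \<bullet> e)\<^sup>2" for u
          unfolding power2_norm_eq_inner
          by (simp add: inner_diff_left inner_diff_right ee inner_commute power2_eq_square)
        show ?thesis unfolding * by simp
      qed
      ultimately have "norm (?p v) \<le> norm (v - e)" using power2_le_imp_le norm_ge_zero by metis
      then show ?thesis using v by (simp add: dist_norm norm_minus_commute)
    qed
    then have "g (?p (z + t *\<^sub>R v)) \<le> g (?p z) + L * (t * \<rho>)"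
    proof -
      have "?p (z + t *\<^sub>R v) - ?p z = t *\<^sub>R ?p v"
        by (simp add: inner_add_left scaleR_add_left scaleR_diff_right)
      then have "dist (?p (z + t *\<^sub>R v)) (?p z) = t * norm (?p v)" using t by (simp add: dist_norm)
      moreover have "dist (g (?p (z + t *\<^sub>R v))) (g (?p z)) \<le> L * dist (?p (z + t *\<^sub>R v)) (?p z)"
        by (rule lipschitz_onD[OF g po po])
      moreover have "L * (t * norm (?p v)) \<le> L * (t * \<rho>)"
        using \<open>norm (?p v) \<le> \<rho>\<close> t L by (intro mult_left_mono) auto
      ultimately show ?thesis by (simp add: dist_real_def)
    qed
    also have "\<dots> \<le> z \<bullet> e + L * (t * \<rho>)" using epi[OF z(1) zr] by simp
    also have "\<dots> < z \<bullet> e + t * (1 - \<rho>)"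
      using mult_strict_left_mono[of "L * \<rho>" "1 - \<rho>" t] \<rho>(3) t(1) by (simp add: algebra_simps)
    also have "\<dots> \<le> (z + t *\<^sub>R v) \<bullet> e" using ve t(1) by (simp add: inner_add_left)
    finally show ?thesis using U inb by blast
  qed
  moreover have "0 < h" using r by (simp add: h_def)
  ultimately show ?thesis using r \<rho>(1) e
    by (rule_tac exI[of _ "r/2"], rule_tac conjI, simp, rule_tac exI[of _ \<rho>], rule_tac conjI, simp,
        rule_tac exI[of _ h], rule_tac conjI, simp, rule_tac exI[of _ e]) simp
qed

lemma GDERIV_sum:
  fixes f :: "_ \<Rightarrow> _ \<Rightarrow> real"
  assumes "\<And>i. i \<in> I \<Longrightarrow> GDERIV (f i) x :> g i"
  shows "GDERIV (\<lambda>x. \<Sum>i\<in>I. f i x) x :> (\<Sum>i\<in>I. g i)"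
  using assms unfolding gderiv_def inner_sum_right by (rule has_derivative_sum)

text \<open>The squared positive part is C^1 across 0 because its derivative 2 max(0, s) vanishes
  there; one continuous derivative is what \<open>C1_on\<close> demands of a cutoff.\<close>

lemma GDERIV_bump:
  fixes c :: "'a::euclidean_space"
  shows "GDERIV (\<lambda>x. (max 0 (r - (norm (x - c))\<^sup>2))\<^sup>2) x :> (- 4 * max 0 (r - (norm (x - c))\<^sup>2)) *\<^sub>R (x - c)"
proof -
  have D: "DERIV (\<lambda>s::real. (max 0 s)\<^sup>2) s :> 2 * max 0 s" for s
  proof -
    consider "s < 0" | "s > 0" | "s = 0" by linarith
    then show ?thesis
    proof cases
      case 1
      have "DERIV (\<lambda>s. 0) s :> (0::real)" by simp
      then have "DERIV (\<lambda>s::real. (max 0 s)\<^sup>2) s :> 0"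
        by (rule has_field_derivative_transform_within_open[of _ _ _ "{..<0}"]) (use 1 in auto)
      then show ?thesis using 1 by simp
    next
      case 2
      have "DERIV (\<lambda>s. s\<^sup>2) s :> 2 * s" by (auto intro!: derivative_eq_intros)
      then have "DERIV (\<lambda>s::real. (max 0 s)\<^sup>2) s :> 2 * s"
        by (rule has_field_derivative_transform_within_open[of _ _ _ "{0<..}"]) (use 2 in auto)
      then show ?thesis using 2 by simp
    next
      case 3
      have "((\<lambda>h::real. (max 0 h)\<^sup>2 / h) \<longlongrightarrow> 0) (at 0)"
      proof (rule Lim_null_comparison)
        show "\<forall>\<^sub>F h in at 0. norm ((max 0 h)\<^sup>2 / h) \<le> \<bar>h\<bar>"
          by (rule always_eventually) (auto simp: max_def power2_eq_square)
        show "((\<lambda>h::real. \<bar>h\<bar>) \<longlongrightarrow> 0) (at 0)" by (intro tendsto_eq_intros) auto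
      qed
      then show ?thesis using 3 by (simp add: DERIV_def)
    qed
  qed
  have "((\<lambda>x. r - (norm (x - c))\<^sup>2) has_derivative (\<lambda>h. - 2 * (h \<bullet> (x - c)))) (at x)"
    unfolding power2_norm_eq_inner by (auto intro!: derivative_eq_intros simp: inner_commute)
  from has_derivative_compose[OF this D[of "r - (norm (x - c))\<^sup>2", unfolded has_field_derivative_def]]
  show ?thesis unfolding gderiv_def by (simp add: algebra_simps)
qed

text \<open>Bumps divided by their sum, which is positive on \<Omega> by the covering. The identity
  for the gradients is stated separately because it is what makes the gradient terms of the local
  competitors cancel.\<close>

lemma C1_partition_of_unity:
  fixes \<Omega> :: "'a::euclidean_space set" and rad :: "'a \<Rightarrow> real"
  assumes "finite I" "\<Omega> \<subseteq> (\<Union>i\<in>I. ball i (rad i))"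
  obtains cut :: "'a \<Rightarrow> 'a \<Rightarrow> real" and dcut where
    "\<And>i. i \<in> I \<Longrightarrow> continuous_on \<Omega> (cut i)" "\<And>i. i \<in> I \<Longrightarrow> continuous_on \<Omega> (dcut i)"
    "\<And>i x. i \<in> I \<Longrightarrow> x \<in> \<Omega> \<Longrightarrow> GDERIV (cut i) x :> dcut i x"
    "\<And>i x. i \<in> I \<Longrightarrow> x \<in> \<Omega> \<Longrightarrow> 0 \<le> cut i x"
    "\<And>i x. i \<in> I \<Longrightarrow> x \<in> \<Omega> \<Longrightarrow> x \<notin> ball i (rad i) \<Longrightarrow> cut i x = 0 \<and> dcut i x = 0"
    "\<And>x. x \<in> \<Omega> \<Longrightarrow> (\<Sum>i\<in>I. cut i x) = 1" "\<And>x. x \<in> \<Omega> \<Longrightarrow> (\<Sum>i\<in>I. dcut i x) = 0"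
proof -
  \<comment> \<open>The radius enters only squared, so nonpositive radii, whose balls are empty, are
    treated apart.\<close>
  define b where "b i x = (if rad i \<le> 0 then 0 else (max 0 ((rad i)\<^sup>2 - (norm (x - i))\<^sup>2))\<^sup>2)" for i x :: 'a
  define db where "db i x = (if rad i \<le> 0 then 0 else (- 4 * max 0 ((rad i)\<^sup>2 - (norm (x - i))\<^sup>2)) *\<^sub>R (x - i))" for i x :: 'a
  define S where "S x = (\<Sum>i\<in>I. b i x)" for x
  define dS where "dS x = (\<Sum>i\<in>I. db i x)" for x
  have b: "GDERIV (b i) x :> db i x" for i x
    unfolding b_def db_def using GDERIV_bump[of "(rad i)\<^sup>2" i x] by (auto simp: GDERIV_const)
  have bnn: "0 \<le> b i x" for i x by (simp add: b_def)
  have bc: "continuous_on \<Omega> (b i)" "continuous_on \<Omega> (db i)" for i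
    unfolding b_def db_def by (cases "rad i \<le> 0"; auto intro!: continuous_intros)+
  have Sd: "GDERIV S x :> dS x" for x unfolding S_def dS_def by (rule GDERIV_sum) (rule b)
  have Sc: "continuous_on \<Omega> S" "continuous_on \<Omega> dS" unfolding S_def dS_def by (intro continuous_on_sum bc)+
  have S0: "S x > 0" if x: "x \<in> \<Omega>" for x
  proof -
    obtain i where i: "i \<in> I" "dist i x < rad i" using subsetD[OF assms(2) x] by auto
    then have "rad i > 0" using zero_le_dist[of i x] by linarith
    moreover have "(norm (x - i))\<^sup>2 < (rad i)\<^sup>2"
      using i(2) by (intro power_strict_mono) (auto simp: dist_norm norm_minus_commute)
    ultimately have "0 < b i x" unfolding b_def by (auto intro!: zero_less_power)
    then show ?thesis unfolding S_def using assms(1) i(1) bnn by (meson sum_pos2)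
  qed
  have out: "b i x = 0 \<and> db i x = 0" if "x \<notin> ball i (rad i)" for i x
  proof (cases "rad i \<le> 0")
    case False
    have "(rad i)\<^sup>2 \<le> (norm (x - i))\<^sup>2"
      using that False by (intro power_mono) (auto simp: dist_norm norm_minus_commute)
    then show ?thesis by (simp add: b_def db_def)
  qed (simp add: b_def db_def)
  define cut where "cut i x = b i x / S x" for i x
  define dcut where "dcut i x = (1 / S x) *\<^sub>R db i x - (b i x / (S x)\<^sup>2) *\<^sub>R dS x" for i x
  show ?thesis
  proof (rule that[of cut dcut])
    show "continuous_on \<Omega> (cut i)" for i unfolding cut_def using S0 by (intro continuous_intros bc Sc) force
    show "continuous_on \<Omega> (dcut i)" for i unfolding dcut_def using S0 by (intro continuous_intros bc Sc) force+
    show "0 \<le> cut i x" if "x \<in> \<Omega>" for i x using S0[OF that] bnn by (simp add: cut_def)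
    show "cut i x = 0 \<and> dcut i x = 0" if "x \<notin> ball i (rad i)" for i x
      using out[OF that] by (simp add: cut_def dcut_def)
    show s: "(\<Sum>i\<in>I. cut i x) = 1" if "x \<in> \<Omega>" for x
      using S0[OF that] by (simp add: cut_def sum_divide_distrib[symmetric] S_def[symmetric])
    show "(\<Sum>i\<in>I. dcut i x) = 0" if "x \<in> \<Omega>" for x
    proof -
      have "(\<Sum>i\<in>I. dcut i x) = (1 / S x) *\<^sub>R dS x - (S x / (S x)\<^sup>2) *\<^sub>R dS x"
        unfolding dcut_def sum_subtractf scaleR_sum_right[symmetric] scaleR_sum_left[symmetric]
          sum_divide_distrib[symmetric] S_def[symmetric] dS_def[symmetric] ..
      then show ?thesis using S0[OF that] by (simp add: power2_eq_square)
    qed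
    show "GDERIV (cut i) x :> dcut i x" if "x \<in> \<Omega>" for i x
    proof -
      have "GDERIV (\<lambda>x. b i x * inverse (S x)) x :> b i x *\<^sub>R (- (inverse (S x))\<^sup>2 *\<^sub>R dS x) + inverse (S x) *\<^sub>R db i x"
        by (rule GDERIV_mult[OF b GDERIV_inverse[OF Sd]]) (use S0[OF that] in auto)
      then show ?thesis unfolding cut_def dcut_def by (simp add: divide_inverse power_inverse)
    qed
  qed
qed


subsection \<open>Transport along a shrinking kernel\<close>

text \<open>A W^{1,p} function on the interior together with its continuous representative
  \<open>g\<close> on \<Omega>. \<open>G\<close> is a Borel function on the whole space, so that
  pairings with fields vanishing outside the interior are plain \<open>lborel\<close> integrals,
  open to Fubini. The weak identity constrains \<open>G\<close> only inside the interior.\<close>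

definition weak_test :: "'a::euclidean_space set \<Rightarrow> real \<Rightarrow> ('a \<Rightarrow> real) \<Rightarrow> ('a \<Rightarrow> 'a) \<Rightarrow> bool" where
  "weak_test \<Omega> p g G \<longleftrightarrow> continuous_on \<Omega> g \<and> G \<in> borel_measurable borel \<and> integrable lborel G \<and>
     integrable lborel (\<lambda>x. norm (G x) powr p) \<and>
     (\<forall>\<psi>\<in>Cc_infinity (interior \<Omega>). \<forall>b\<in>Basis.
        (LINT x|lborel. (indicator (interior \<Omega>) x * g x) * frechet_derivative \<psi> (at x) b)
          = - (LINT x|lborel. (G x \<bullet> b) * \<psi> x))"

definition smooth_kernel :: "real \<Rightarrow> ('a::euclidean_space \<Rightarrow> real) \<Rightarrow> bool" where
  "smooth_kernel \<delta> K \<longleftrightarrow> K \<in> Cc_infinity UNIV \<and> (\<forall>x. 0 \<le> K x) \<and> (LINT x|lborel. K x) = 1 \<and>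
     (\<forall>x\<in>supp K. norm x \<le> \<delta>)"

text \<open>With \<open>K\<^sub>u(z) = u\<^bsup>-md\<^esup> K(z/u\<^sup>m)\<close>, the flow is the flux of the continuity equation
  \<open>\<partial>\<^sub>u K\<^sub>u + div ((m z/u) K\<^sub>u) = 0\<close>.  The exponent \<open>m\<close> reparametrizes time so that, for large \<open>m\<close>, the
  \<open>L\<^sup>p\<close> norms of the flow stay bounded as \<open>u\<close> tends to \<open>0\<close>.\<close>

definition kernel_at :: "nat \<Rightarrow> ('a::euclidean_space \<Rightarrow> real) \<Rightarrow> real \<Rightarrow> 'a \<Rightarrow> real" where
  "kernel_at m K u z = (1/u)^(m * DIM('a)) * K ((1/u)^m *\<^sub>R z)"

definition kernel_flow :: "nat \<Rightarrow> ('a::euclidean_space \<Rightarrow> real) \<Rightarrow> real \<Rightarrow> 'a \<Rightarrow> 'a" where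
  "kernel_flow m K u z = (real m / u * kernel_at m K u z) *\<^sub>R z"

text \<open>The divergence of y K(y). By scaling, the divergence of \<open>kernel_flow\<close> at
  time u, and up to sign the u-derivative of \<open>kernel_at\<close>, is this function at z / u^m
  times m / u^(md+1).\<close>

definition kernel_div :: "('a::euclidean_space \<Rightarrow> real) \<Rightarrow> 'a \<Rightarrow> real" where
  "kernel_div K y = real DIM('a) * K y + (\<Sum>b\<in>Basis. (y \<bullet> b) * frechet_derivative K (at y) b)"

lemma frechet_derivative_eq_0_outside_supp:
  fixes \<psi> :: "'a::euclidean_space \<Rightarrow> real"
  assumes "\<psi> \<in> Cc_infinity U" "x \<notin> supp \<psi>"
  shows "frechet_derivative \<psi> (at x) h = 0"
proof -
  note D = Cc_infinityD[OF assms(1)]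
  have "((\<lambda>x. 0) has_derivative frechet_derivative \<psi> (at x)) (at x)"
  proof (rule has_derivative_transform_within_open)
    show "(\<psi> has_derivative frechet_derivative \<psi> (at x)) (at x)"
      using D(6) by (simp add: frechet_derivative_works[symmetric])
    show "open (- supp \<psi>)" using D(2) by (simp add: open_Compl compact_imp_closed)
  qed (use assms(2) D(4) in auto)
  then have "frechet_derivative \<psi> (at x) = (\<lambda>h. 0)" by (rule has_derivative_unique[OF _ has_derivative_const])
  then show ?thesis by simp
qed

lemma compact_support_bounded:
  fixes f :: "'a::euclidean_space \<Rightarrow> 'b::real_normed_vector"
  assumes "continuous_on UNIV f" "compact S" "\<And>x. x \<notin> S \<Longrightarrow> f x = 0"
  obtains M where "0 \<le> M" "\<And>x. norm (f x) \<le> M"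
proof -
  have "compact (f ` S)" by (rule compact_continuous_image[OF continuous_on_subset[OF assms(1)] assms(2)]) simp
  then obtain B where B: "\<And>y. y \<in> f ` S \<Longrightarrow> norm y \<le> B" using compact_imp_bounded bounded_iff by metis
  have "norm (f x) \<le> max B 0" for x using B[of "f x"] assms(3)[of x] by (cases "x \<in> S") auto
  then show ?thesis using that[of "max B 0"] by auto
qed

section \<open>Scaling of the kernel and its continuity equation\<close>

context
  fixes m :: nat and \<delta> :: real and K :: "'a::euclidean_space \<Rightarrow> real"
  assumes m: "0 < m" and K: "smooth_kernel \<delta> K"
begin

lemma smooth_kernelD:
  "K \<in> Cc_infinity UNIV" "0 \<le> K x" "(LINT x|lborel. K x) = 1" "x \<in> supp K \<Longrightarrow> norm x \<le> \<delta>"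
  "continuous_on UNIV K" "K \<in> borel_measurable borel" "K x \<noteq> 0 \<Longrightarrow> x \<in> supp K"
  using K Cc_infinityD(5)[of K UNIV] Cc_infinityD(4)[of K UNIV x] borel_measurable_continuous_onI[of K]
  unfolding smooth_kernel_def by auto

lemma kernel_nonneg: "0 \<le> \<delta>"
proof -
  have "\<exists>x. K x \<noteq> 0"
  proof (rule ccontr)
    assume "\<not> ?thesis"
    then have "(LINT x|lborel. K x) = 0" by simp
    then show False using smooth_kernelD(3) by simp
  qed
  then obtain x where "K x \<noteq> 0" ..
  then have "norm x \<le> \<delta>" by (intro smooth_kernelD(4) smooth_kernelD(7))
  then show ?thesis using norm_ge_zero[of x] by linarith
qed

lemma kernel_bounded: obtains M where "0 \<le> M" "\<And>x. \<bar>K x\<bar> \<le> M"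
  using compact_support_bounded[OF smooth_kernelD(5) Cc_infinityD(2)[OF smooth_kernelD(1)]] smooth_kernelD(7)
  by (metis real_norm_def)

lemma kernel_div_props:
  "continuous_on UNIV (kernel_div K)" "x \<notin> supp K \<Longrightarrow> kernel_div K x = 0"
proof -
  show "continuous_on UNIV (kernel_div K)" unfolding kernel_div_def
    by (intro continuous_intros smooth_kernelD(5) Cc_infinityD(7)[OF smooth_kernelD(1)])
  show "kernel_div K x = 0" if "x \<notin> supp K"
    using that smooth_kernelD(7)[of x] frechet_derivative_eq_0_outside_supp[OF smooth_kernelD(1) that]
    unfolding kernel_div_def by auto
qed

lemma kernel_div_bounded: obtains M where "0 \<le> M" "\<And>x. \<bar>kernel_div K x\<bar> \<le> M"
  using compact_support_bounded[OF kernel_div_props(1) Cc_infinityD(2)[OF smooth_kernelD(1)]] kernel_div_props(2)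
  by (metis real_norm_def)

lemma kernel_measurable [measurable]:
  "K \<in> borel_measurable borel" "kernel_div K \<in> borel_measurable borel"
  "(\<lambda>(u, z). kernel_at m K u z) \<in> borel_measurable (borel \<Otimes>\<^sub>M borel)"
  "(\<lambda>(u, z). kernel_flow m K u z) \<in> borel_measurable (borel \<Otimes>\<^sub>M borel)"
proof -
  show [measurable]: "K \<in> borel_measurable borel" by (rule smooth_kernelD(6))
  show "kernel_div K \<in> borel_measurable borel"
    by (rule borel_measurable_continuous_onI[OF kernel_div_props(1)])
  show [measurable]: "(\<lambda>(u, z). kernel_at m K u z) \<in> borel_measurable (borel \<Otimes>\<^sub>M borel)"
    unfolding kernel_at_def by measurable
  show "(\<lambda>(u, z). kernel_flow m K u z) \<in> borel_measurable (borel \<Otimes>\<^sub>M borel)"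
    unfolding kernel_flow_def kernel_at_def by measurable
qed

lemma kernel_at_1 [simp]: "kernel_at m K 1 z = K z"
  by (simp add: kernel_at_def)

lemma kernel_at_nonneg: "0 < u \<Longrightarrow> 0 \<le> kernel_at m K u z"
  using smooth_kernelD(2) by (simp add: kernel_at_def)

lemma kernel_at_support:
  assumes "0 < u" "kernel_at m K u z \<noteq> 0"
  shows "\<exists>a\<in>supp K. z = u^m *\<^sub>R a" "norm z \<le> u^m * \<delta>"
proof -
  have "K ((1/u)^m *\<^sub>R z) \<noteq> 0" using assms by (simp add: kernel_at_def)
  then have a: "(1/u)^m *\<^sub>R z \<in> supp K" by (rule smooth_kernelD(7))
  have z: "z = u^m *\<^sub>R ((1/u)^m *\<^sub>R z)" using assms(1) by (simp add: power_one_over)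
  with a show "\<exists>a\<in>supp K. z = u^m *\<^sub>R a" by blast
  have "norm z = u^m * norm ((1/u)^m *\<^sub>R z)" using assms(1) by (subst z, simp)
  also have "\<dots> \<le> u^m * \<delta>" by (rule mult_left_mono[OF smooth_kernelD(4)[OF a]]) (use assms in auto)
  finally show "norm z \<le> u^m * \<delta>" .
qed

lemma kernel_flow_nz: "kernel_flow m K u z \<noteq> 0 \<Longrightarrow> kernel_at m K u z \<noteq> 0"
  by (auto simp: kernel_flow_def)

lemma integral_kernel_at:
  assumes u: "0 < u"
  shows "integrable lborel (\<lambda>z. kernel_at m K u (z - x))" "(LINT z|lborel. kernel_at m K u (z - x)) = 1"
proof -
  let ?c = "(1/u)^m"
  have c: "?c \<noteq> 0" using u by simp
  obtain M where M: "\<And>x. \<bar>K x\<bar> \<le> M" using kernel_bounded by metis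
  have Ki: "integrable lborel K"
  proof (rule integrable_lborel_bounded_support[OF smooth_kernelD(6)])
    show "bounded (supp K)" by (rule compact_imp_bounded[OF Cc_infinityD(2)[OF smooth_kernelD(1)]])
    show "K x = 0" if "x \<notin> supp K" for x using smooth_kernelD(7) that by metis
    show "norm (K x) \<le> M" for x using M by simp
  qed
  have e: "kernel_at m K u (z - x) = \<bar>?c\<bar>^DIM('a) * K ((- (?c *\<^sub>R x)) + ?c *\<^sub>R z)" for z
    using u by (simp add: kernel_at_def scaleR_diff_right power_mult[symmetric] power_abs)
  have "integrable (density (distr lborel borel (\<lambda>z. (- (?c *\<^sub>R x)) + ?c *\<^sub>R z)) (\<lambda>_. \<bar>?c\<bar>^DIM('a))) K"
    using Ki lborel_affine[OF c, of "- (?c *\<^sub>R x)"] by simp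
  then show "integrable lborel (\<lambda>z. kernel_at m K u (z - x))"
    unfolding e by (subst (asm) integrable_density) (auto simp: integrable_distr_eq)
  have "1 = (LINT z|density (distr lborel borel (\<lambda>z. (- (?c *\<^sub>R x)) + ?c *\<^sub>R z)) (\<lambda>_. \<bar>?c\<bar>^DIM('a)). K z)"
    using lborel_affine[OF c, of "- (?c *\<^sub>R x)"] smooth_kernelD(3) by simp
  also have "\<dots> = (LINT z|lborel. kernel_at m K u (z - x))"
    unfolding e by (subst integral_density) (auto simp: integral_distr)
  finally show "(LINT z|lborel. kernel_at m K u (z - x)) = 1" by simp
qed

text \<open>The chain rule applied to K(z / u^m) yields the radial derivative y . grad K(y), and the
  factor 1 / u^(md) yields d K(y); together they form \<open>kernel_div\<close>.\<close>

lemma kernel_at_derivative: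
  assumes u: "0 < u"
  shows "((\<lambda>u. kernel_at m K u z) has_real_derivative
     - (real m / u) * (1/u)^(m * DIM('a)) * kernel_div K ((1/u)^m *\<^sub>R z)) (at u)"
proof -
  let ?y = "(1/u)^m *\<^sub>R z"
  let ?D = "frechet_derivative K (at ?y)"
  have Kd: "(K has_derivative ?D) (at ?y)"
    using Cc_infinityD(6)[OF smooth_kernelD(1)] by (simp add: frechet_derivative_works[symmetric])
  have l: "linear ?D" using Kd has_derivative_linear by blast
  have p: "((\<lambda>u. (1/u)^k) has_real_derivative - (real k / u) * (1/u)^k) (at u)" for k
  proof -
    have "((\<lambda>u. (1/u)^k) has_real_derivative real k * (1/u)^(k-1) * (- 1 / (u * u))) (at u)"
      by (rule derivative_eq_intros refl | use u in simp)+
    moreover have "real k * (1/u)^(k-1) * (- 1 / (u * u)) = - (real k / u) * (1/u)^k"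
      using u by (cases k) (auto simp: field_simps)
    ultimately show ?thesis by simp
  qed
  have "((\<lambda>u. (1/u)^m *\<^sub>R z) has_derivative (\<lambda>h. (h * (- (real m / u) * (1/u)^m)) *\<^sub>R z)) (at u)"
    by (rule has_derivative_scaleR_left)
       (rule has_derivative_eq_rhs[OF p[of m, unfolded has_field_derivative_def]], simp add: fun_eq_iff mult.commute)
  from has_derivative_compose[OF this Kd]
  have K': "((\<lambda>u. K ((1/u)^m *\<^sub>R z)) has_real_derivative (- (real m / u) * ?D ?y)) (at u)"
    unfolding has_field_derivative_def
    by (rule has_derivative_eq_rhs) (auto simp: fun_eq_iff linear_cmul[OF l] linear_neg[OF l] algebra_simps)
  have Dy: "?D ?y = (\<Sum>b\<in>Basis. (?y \<bullet> b) * ?D b)"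
    by (subst euclidean_representation[of ?y, symmetric], subst linear_sum[OF l])
       (simp only: linear_cmul[OF l] real_scaleR_def)
  show ?thesis unfolding kernel_at_def
    by (rule DERIV_cong[OF DERIV_mult[OF p K']])
       (unfold kernel_div_def Dy[symmetric], simp add: algebra_simps)
qed

lemma kernel_flow_eq:
  "kernel_flow m K u (z - x) \<bullet> b = (real m / u * (1/u)^(m * DIM('a))) *
     (K ((1/u)^m *\<^sub>R z + (- ((1/u)^m *\<^sub>R x))) * (z \<bullet> b + - (x \<bullet> b)))"
  by (simp add: kernel_flow_def kernel_at_def scaleR_diff_right inner_diff_left algebra_simps diff_divide_distrib)

lemma kernel_flow_test:
  assumes u: "0 < u" and x: "\<And>a. a \<in> supp K \<Longrightarrow> x + u^m *\<^sub>R a \<in> V"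
  shows "(\<lambda>z. kernel_flow m K u (z - x) \<bullet> b) \<in> Cc_infinity V"
proof (rule Cc_infinityI[where S="(\<lambda>a. x + u^m *\<^sub>R a) ` supp K"])
  show "Ck k (\<lambda>z. kernel_flow m K u (z - x) \<bullet> b)" for k
    unfolding kernel_flow_eq
    by (rule Ck_mult[OF Ck_const Ck_mult[OF Ck_affine[OF Cc_infinityD(1)[OF smooth_kernelD(1)]] Ck_add[OF Ck_inner Ck_const]]])
  show "compact ((\<lambda>a. x + u^m *\<^sub>R a) ` supp K)"
    by (intro compact_continuous_image continuous_intros Cc_infinityD(2)[OF smooth_kernelD(1)])
  show "(\<lambda>a. x + u^m *\<^sub>R a) ` supp K \<subseteq> V" using x by auto
  fix z assume "kernel_flow m K u (z - x) \<bullet> b \<noteq> 0"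
  then have "kernel_at m K u (z - x) \<noteq> 0" using kernel_flow_nz by force
  then obtain a where "a \<in> supp K" "z - x = u^m *\<^sub>R a" using kernel_at_support(1)[OF u] by auto
  then show "z \<in> (\<lambda>a. x + u^m *\<^sub>R a) ` supp K" by (intro image_eqI[of _ _ a]) (auto simp: diff_eq_eq add.commute)
qed

lemma kernel_flow_derivative:
  assumes b: "b \<in> Basis"
  shows "frechet_derivative (\<lambda>z. kernel_flow m K u (z - x) \<bullet> b) (at z) b =
    (real m / u * (1/u)^(m * DIM('a))) * (K ((1/u)^m *\<^sub>R (z - x)) +
       ((1/u)^m *\<^sub>R (z - x) \<bullet> b) * frechet_derivative K (at ((1/u)^m *\<^sub>R (z - x))) b)"
proof -
  let ?c = "(1/u)^m"
  let ?y = "?c *\<^sub>R z + (- (?c *\<^sub>R x))"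
  have y: "?y = ?c *\<^sub>R (z - x)" by (simp add: scaleR_diff_right)
  have d: "((\<lambda>z. K (?c *\<^sub>R z + (- (?c *\<^sub>R x)))) has_derivative (\<lambda>h. ?c * frechet_derivative K (at ?y) h)) (at z)"
    by (rule has_derivative_frechet_affine[OF Cc_infinityD(6)[OF smooth_kernelD(1)]])
  have e: "((\<lambda>z. z \<bullet> b + - (x \<bullet> b)) has_derivative (\<lambda>h. h \<bullet> b)) (at z)"
    by (auto intro!: derivative_eq_intros)
  have "((\<lambda>z. kernel_flow m K u (z - x) \<bullet> b) has_derivative
    (\<lambda>h. (real m / u * (1/u)^(m * DIM('a))) *
       (K ?y * (h \<bullet> b) + ?c * frechet_derivative K (at ?y) h * (z \<bullet> b + - (x \<bullet> b))))) (at z)"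
    unfolding kernel_flow_eq by (rule has_derivative_mult_right[OF has_derivative_mult[OF d e]])
  then have "frechet_derivative (\<lambda>z. kernel_flow m K u (z - x) \<bullet> b) (at z) =
    (\<lambda>h. (real m / u * (1/u)^(m * DIM('a))) *
       (K ?y * (h \<bullet> b) + ?c * frechet_derivative K (at ?y) h * (z \<bullet> b + - (x \<bullet> b))))"
    by (rule frechet_derivative_at[symmetric])
  then show ?thesis unfolding y using b by (simp add: inner_diff_left algebra_simps)
qed

lemma integrable_inner_test:
  assumes "integrable lborel G" "\<psi> \<in> Cc_infinity V" "b \<in> Basis"
  shows "integrable lborel (\<lambda>z. (G z \<bullet> b) * \<psi> z)"
proof -
  note D = Cc_infinityD[OF assms(2)]
  obtain M where M: "0 \<le> M" "\<And>z. norm (\<psi> z) \<le> M"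
    using compact_support_bounded[OF D(5) D(2)] D(4) by metis
  show ?thesis
  proof (rule Bochner_Integration.integrable_bound[OF integrable_mult_right[of M lborel "\<lambda>z. norm (G z)"]])
    show "integrable lborel (\<lambda>z. norm (G z))" using assms(1) by (rule integrable_norm)
    show "(\<lambda>z. (G z \<bullet> b) * \<psi> z) \<in> borel_measurable lborel"
      using assms(1) borel_measurable_continuous_onI[OF D(5)] by (auto intro!: borel_measurable_times)
    show "AE z in lborel. norm ((G z \<bullet> b) * \<psi> z) \<le> norm (M * norm (G z))"
    proof (rule AE_I2)
      fix z
      have "\<bar>G z \<bullet> b\<bar> * \<bar>\<psi> z\<bar> \<le> norm (G z) * M"
        by (rule mult_mono) (use Basis_le_norm[OF assms(3)] M in auto)
      then show "norm ((G z \<bullet> b) * \<psi> z) \<le> norm (M * norm (G z))" using M(1) by (simp add: abs_mult mult.commute)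
    qed
  qed
qed

lemma weak_test_bounded:
  assumes w: "weak_test \<Omega> p g G" and \<Omega>: "compact \<Omega>"
  obtains M where "0 \<le> M" "\<And>z. \<bar>indicator (interior \<Omega>) z * g z\<bar> \<le> M" "\<And>z. z \<in> \<Omega> \<Longrightarrow> \<bar>g z\<bar> \<le> M"
    "(\<lambda>z. indicator (interior \<Omega>) z * g z :: real) \<in> borel_measurable borel"
proof -
  have g: "continuous_on \<Omega> g" using w by (simp add: weak_test_def)
  have "compact (g ` \<Omega>)" by (rule compact_continuous_image[OF g \<Omega>])
  then obtain B where B: "\<And>y. y \<in> g ` \<Omega> \<Longrightarrow> norm y \<le> B" using compact_imp_bounded bounded_iff by metis
  show ?thesis
  proof (rule that[of "max B 0"])
    show gM: "\<bar>g z\<bar> \<le> max B 0" if "z \<in> \<Omega>" for z using B[of "g z"] that by auto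
    show "\<bar>indicator (interior \<Omega>) z * g z\<bar> \<le> max B 0" for z
      using gM[of z] interior_subset[of \<Omega>] by (auto simp: indicator_def)
    show "(\<lambda>z. indicator (interior \<Omega>) z * g z :: real) \<in> borel_measurable borel"
      using continuous_on_indicator_borel[of "interior \<Omega>" g] continuous_on_subset[OF g interior_subset] by simp
  qed simp
qed

text \<open>Each component of the flow is a test function, because x + u^m supp K stays in the
  interior. The weak gradient identity for the component \<open>b\<close> in direction
  \<open>b\<close>, summed over the basis, brings in the divergence of the flow, so the pairing with
  \<open>G\<close> becomes the integral of \<open>g\<close> against the time derivative of the
  kernel.\<close>

lemma kernel_flow_weak_divergence:
  assumes w: "weak_test \<Omega> p g G" and \<Omega>: "compact \<Omega>" and u: "0 < u"
    and x: "\<And>a. a \<in> supp K \<Longrightarrow> x + u^m *\<^sub>R a \<in> interior \<Omega>"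
  shows "(LINT z|lborel. G z \<bullet> kernel_flow m K u (z - x)) =
    (LINT z|lborel. (indicator (interior \<Omega>) z * g z) *
       (- (real m / u) * (1/u)^(m * DIM('a)) * kernel_div K ((1/u)^m *\<^sub>R (z - x))))"
proof -
  let ?\<psi> = "\<lambda>b z. kernel_flow m K u (z - x) \<bullet> b"
  let ?H = "\<lambda>z. indicator (interior \<Omega>) z * g z"
  have \<psi>: "?\<psi> b \<in> Cc_infinity (interior \<Omega>)" for b by (rule kernel_flow_test[OF u x])
  have Gi: "integrable lborel G" using w by (simp add: weak_test_def)
  obtain M where M: "0 \<le> M" "\<And>z. \<bar>?H z\<bar> \<le> M" "?H \<in> borel_measurable borel"
    using weak_test_bounded[OF w \<Omega>] by metis
  have Hi: "integrable lborel (\<lambda>z. ?H z * frechet_derivative (?\<psi> b) (at z) b)" if b: "b \<in> Basis" for b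
  proof -
    note D = Cc_infinityD[OF \<psi>[of b]]
    have c: "continuous_on UNIV (\<lambda>z. frechet_derivative (?\<psi> b) (at z) b)" by (rule D(7)[OF b])
    obtain M' where M': "0 \<le> M'" "\<And>z. norm (frechet_derivative (?\<psi> b) (at z) b) \<le> M'"
      using compact_support_bounded[OF c D(2)] frechet_derivative_eq_0_outside_supp[OF \<psi>] by metis
    show ?thesis
    proof (rule integrable_lborel_bounded_support[where M="M * M'"])
      show "(\<lambda>z. ?H z * frechet_derivative (?\<psi> b) (at z) b) \<in> borel_measurable borel"
        by (intro borel_measurable_times M(3) borel_measurable_continuous_onI[OF c])
      show "bounded (supp (?\<psi> b))" using D(2) by (rule compact_imp_bounded)
      show "?H z * frechet_derivative (?\<psi> b) (at z) b = 0" if "z \<notin> supp (?\<psi> b)" for z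
        using frechet_derivative_eq_0_outside_supp[OF \<psi> that] by simp
      show "norm (?H z * frechet_derivative (?\<psi> b) (at z) b) \<le> M * M'" for z
        using mult_mono[OF M(2)[of z] M'(2)[of z, unfolded real_norm_def] M(1) abs_ge_zero]
        by (simp only: real_norm_def abs_mult)
    qed
  qed
  have "(LINT z|lborel. G z \<bullet> kernel_flow m K u (z - x)) = (LINT z|lborel. (\<Sum>b\<in>Basis. (G z \<bullet> b) * ?\<psi> b z))"
    by (subst euclidean_inner) simp
  also have "\<dots> = (\<Sum>b\<in>Basis. (LINT z|lborel. (G z \<bullet> b) * ?\<psi> b z))"
    by (rule Bochner_Integration.integral_sum) (rule integrable_inner_test[OF Gi \<psi>])
  also have "\<dots> = (\<Sum>b\<in>Basis. - (LINT z|lborel. ?H z * frechet_derivative (?\<psi> b) (at z) b))"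
    using w \<psi> unfolding weak_test_def by (intro sum.cong refl) simp
  also have "\<dots> = - (LINT z|lborel. (\<Sum>b\<in>Basis. ?H z * frechet_derivative (?\<psi> b) (at z) b))"
    by (simp only: sum_negf Bochner_Integration.integral_sum[OF Hi])
  also have "\<dots> = (LINT z|lborel. - (\<Sum>b\<in>Basis. ?H z * frechet_derivative (?\<psi> b) (at z) b))"
    by (rule Bochner_Integration.integral_minus[symmetric])
  also have "\<dots> = (LINT z|lborel. ?H z *
       (- (real m / u) * (1/u)^(m * DIM('a)) * kernel_div K ((1/u)^m *\<^sub>R (z - x))))"
  proof (rule Bochner_Integration.integral_cong[OF refl])
    fix z
    let ?y = "(1/u)^m *\<^sub>R (z - x)"
    have "(\<Sum>b\<in>Basis. ?H z * frechet_derivative (?\<psi> b) (at z) b) =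
      (\<Sum>b\<in>Basis. ?H z * ((real m / u * (1/u)^(m * DIM('a))) * (K ?y + (?y \<bullet> b) * frechet_derivative K (at ?y) b)))"
      by (intro sum.cong refl arg_cong2[where f="(*)"] kernel_flow_derivative)
    also have "\<dots> = ?H z * ((real m / u * (1/u)^(m * DIM('a))) * kernel_div K ?y)"
      by (simp only: sum_distrib_left[symmetric] sum.distrib kernel_div_def sum_constant)
    finally show "- (\<Sum>b\<in>Basis. ?H z * frechet_derivative (?\<psi> b) (at z) b) = ?H z *
       (- (real m / u) * (1/u)^(m * DIM('a)) * kernel_div K ?y)" by simp
  qed
  finally show ?thesis .
qed

text \<open>Fubini and the fundamental theorem of calculus in u. Stopping at s > 0 keeps the
  integrand bounded, as the flow is singular at u = 0.\<close>

lemma kernel_flow_integral_truncated: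
  assumes w: "weak_test \<Omega> p g G" and \<Omega>: "compact \<Omega>" and s: "0 < s" "s \<le> 1"
    and x: "\<And>a t. a \<in> supp K \<Longrightarrow> 0 < t \<Longrightarrow> t \<le> 1 \<Longrightarrow> x + t *\<^sub>R a \<in> interior \<Omega>"
  shows "(LINT u|lborel. indicator {s..1} u * (LINT z|lborel. G z \<bullet> kernel_flow m K u (z - x))) =
    (LINT z|lborel. (indicator (interior \<Omega>) z * g z) * K (z - x)) -
    (LINT z|lborel. (indicator (interior \<Omega>) z * g z) * kernel_at m K s (z - x))"
proof -
  let ?H = "\<lambda>z. indicator (interior \<Omega>) z * g z"
  let ?D = "\<lambda>u z. - (real m / u) * (1/u)^(m * DIM('a)) * kernel_div K ((1/u)^m *\<^sub>R (z - x))"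
  obtain M where M: "0 \<le> M" "\<And>z. \<bar>?H z\<bar> \<le> M" and Hm[measurable]: "?H \<in> borel_measurable borel"
    using weak_test_bounded[OF w \<Omega>] by metis
  obtain M' where M': "0 \<le> M'" "\<And>y. \<bar>kernel_div K y\<bar> \<le> M'" using kernel_div_bounded by metis
  have int: "integrable (lborel \<Otimes>\<^sub>M lborel) (\<lambda>(u, z). indicator {s..1} u * (?H z * ?D u z))"
    unfolding lborel_prod
  proof (rule integrable_lborel_bounded_support[where S="{s..1} \<times> \<Omega>"])
    show "(\<lambda>(u, z). indicator {s..1} u * (?H z * ?D u z)) \<in> borel_measurable borel"
      unfolding borel_prod[symmetric] by measurable
    show "bounded ({s..1} \<times> \<Omega>)" using compact_imp_bounded[OF \<Omega>] by (intro bounded_Times) auto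
    show "(\<lambda>(u, z). indicator {s..1} u * (?H z * ?D u z)) y = 0" if "y \<notin> {s..1} \<times> \<Omega>" for y
      using that interior_subset[of \<Omega>] by (cases y) (auto simp: indicator_def)
    show "norm ((\<lambda>(u, z). indicator {s..1} u * (?H z * ?D u z)) y) \<le> M * ((real m / s) * (1/s)^(m * DIM('a)) * M')" for y
    proof (cases y)
      case (Pair u z)
      show ?thesis
      proof (cases "u \<in> {s..1}")
        case True
        have "\<bar>?D u z\<bar> \<le> (real m / s) * (1/s)^(m * DIM('a)) * M'"
          unfolding abs_mult using True s M'
          by (intro mult_mono) (auto intro!: divide_left_mono power_mono)
        then have "\<bar>?H z\<bar> * \<bar>?D u z\<bar> \<le> M * ((real m / s) * (1/s)^(m * DIM('a)) * M')"
          using M by (intro mult_mono) auto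
        then show ?thesis using True by (simp add: Pair abs_mult)
      next
        case False
        then show ?thesis using M M' s by (simp add: Pair)
      qed
    qed
  qed
  have "(LINT u|lborel. indicator {s..1} u * (LINT z|lborel. G z \<bullet> kernel_flow m K u (z - x))) =
     (LINT u|lborel. (LINT z|lborel. indicator {s..1} u * (?H z * ?D u z)))"
  proof (rule Bochner_Integration.integral_cong[OF refl])
    fix u
    show "indicator {s..1} u * (LINT z|lborel. G z \<bullet> kernel_flow m K u (z - x)) =
      (LINT z|lborel. indicator {s..1} u * (?H z * ?D u z))"
    proof (cases "u \<in> {s..1}")
      case True
      then have "0 < u" using s by simp
      have "(LINT z|lborel. G z \<bullet> kernel_flow m K u (z - x)) = (LINT z|lborel. ?H z * ?D u z)"
        by (rule kernel_flow_weak_divergence[OF w \<Omega> \<open>0 < u\<close>])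
           (rule x; use True s in \<open>simp add: power_le_one\<close>)
      then show ?thesis using True by simp
    qed simp
  qed
  also have "\<dots> = (LINT z|lborel. (LINT u|lborel. indicator {s..1} u * (?H z * ?D u z)))"
    by (rule lborel_pair.Fubini_integral[OF int, symmetric])
  also have "\<dots> = (LINT z|lborel. ?H z * (K (z - x) - kernel_at m K s (z - x)))"
  proof (rule Bochner_Integration.integral_cong[OF refl])
    fix z
    have "(LINT u|lborel. indicator {s..1} u *\<^sub>R ?D u z) = kernel_at m K 1 (z - x) - kernel_at m K s (z - x)"
    proof (rule integral_FTC_atLeastAtMost[OF s(2)])
      show "((\<lambda>u. kernel_at m K u (z - x)) has_vector_derivative ?D u z) (at u within {s..1})"
        if "s \<le> u" "u \<le> 1" for u
        using kernel_at_derivative[of u "z - x"] that s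
        by (simp add: has_real_derivative_iff_has_vector_derivative has_vector_derivative_at_within)
      show "continuous_on {s..1} (\<lambda>u. ?D u z)"
        using s by (intro continuous_intros continuous_on_compose2[OF kernel_div_props(1)]) auto
    qed
    then show "(LINT u|lborel. indicator {s..1} u * (?H z * ?D u z)) = ?H z * (K (z - x) - kernel_at m K s (z - x))"
    proof -
      assume e: "(LINT u|lborel. indicator {s..1} u *\<^sub>R ?D u z) = kernel_at m K 1 (z - x) - kernel_at m K s (z - x)"
      have "(LINT u|lborel. indicator {s..1} u * (?H z * ?D u z)) = (LINT u|lborel. ?H z * (indicator {s..1} u *\<^sub>R ?D u z))"
        by (intro Bochner_Integration.integral_cong refl) simp
      also have "\<dots> = ?H z * (kernel_at m K 1 (z - x) - kernel_at m K s (z - x))"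
        unfolding e[symmetric] by (rule integral_mult_right_zero)
      finally show ?thesis by simp
    qed
  qed
  also have "\<dots> = (LINT z|lborel. ?H z * K (z - x)) - (LINT z|lborel. ?H z * kernel_at m K s (z - x))"
  proof -
    have "integrable lborel (\<lambda>z. ?H z * kernel_at m K v (z - x))" if v: "0 < v" for v
    proof (rule Bochner_Integration.integrable_bound[OF integrable_mult_right[of M lborel "\<lambda>z. kernel_at m K v (z - x)"]])
      show "integrable lborel (\<lambda>z. kernel_at m K v (z - x))" by (rule integral_kernel_at(1)[OF v])
      then show "(\<lambda>z. ?H z * kernel_at m K v (z - x)) \<in> borel_measurable lborel" by measurable
      show "AE z in lborel. norm (?H z * kernel_at m K v (z - x)) \<le> norm (M * kernel_at m K v (z - x))"
        using M by (intro AE_I2) (simp only: real_norm_def abs_mult, intro mult_right_mono, auto)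
    qed
    from this[of 1] this[OF s(1)] show ?thesis by (simp add: right_diff_distrib)
  qed
  finally show ?thesis .
qed

text \<open>\<open>x\<close> may lie on the boundary, where cutting \<open>g\<close> off outside the
  interior could spoil an average; but the kernel at \<open>x\<close> charges only points of the
  interior, so it does not see the cutoff.\<close>

lemma kernel_approximates_identity:
  assumes w: "weak_test \<Omega> p g G" and \<Omega>: "compact \<Omega>" and xO: "x \<in> \<Omega>"
    and x: "\<And>a t. a \<in> supp K \<Longrightarrow> 0 < t \<Longrightarrow> t \<le> 1 \<Longrightarrow> x + t *\<^sub>R a \<in> interior \<Omega>"
    and s: "\<And>n. 0 < s n" "\<And>n. s n \<le> 1" "s \<longlonglongrightarrow> 0"
  shows "(\<lambda>n. LINT z|lborel. (indicator (interior \<Omega>) z * g z) * kernel_at m K (s n) (z - x)) \<longlonglongrightarrow> g x"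
proof (rule LIMSEQ_I)
  let ?H = "\<lambda>z. indicator (interior \<Omega>) z * g z"
  fix e :: real assume e: "0 < e"
  have "continuous_on \<Omega> g" using w by (simp add: weak_test_def)
  then obtain d where d: "0 < d" "\<And>z. z \<in> \<Omega> \<Longrightarrow> dist z x < d \<Longrightarrow> dist (g z) (g x) < e/2"
    using e xO unfolding continuous_on_iff by (metis half_gt_zero)
  have "(\<lambda>n. s n * \<delta>) \<longlonglongrightarrow> 0 * \<delta>" by (rule tendsto_mult[OF s(3) tendsto_const])
  then have "\<forall>\<^sub>F n in sequentially. s n * \<delta> < d" using d(1) by (intro order_tendstoD(2)[of _ 0]) auto
  then obtain N where N: "\<And>n. n \<ge> N \<Longrightarrow> s n * \<delta> < d" unfolding eventually_sequentially by auto
  obtain M where M: "0 \<le> M" "\<And>z. \<bar>?H z\<bar> \<le> M" and Hm[measurable]: "?H \<in> borel_measurable borel"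
    using weak_test_bounded[OF w \<Omega>] by metis
  show "\<exists>N. \<forall>n\<ge>N. norm ((LINT z|lborel. ?H z * kernel_at m K (s n) (z - x)) - g x) < e"
  proof (intro exI[of _ N] allI impI)
    fix n assume n: "N \<le> n"
    let ?k = "\<lambda>z. kernel_at m K (s n) (z - x)"
    note ki = integral_kernel_at[OF s(1), of n x]
    have Hk: "integrable lborel (\<lambda>z. ?H z * ?k z)"
    proof (rule Bochner_Integration.integrable_bound[OF integrable_mult_right[OF ki(1), of M]])
      show "(\<lambda>z. ?H z * ?k z) \<in> borel_measurable lborel" using ki(1) by measurable
      show "AE z in lborel. norm (?H z * ?k z) \<le> norm (M * ?k z)"
        using M by (intro AE_I2) (simp only: real_norm_def abs_mult, intro mult_right_mono, auto)
    qed
    have "(LINT z|lborel. ?H z * ?k z) - g x = (LINT z|lborel. ?H z * ?k z - g x * ?k z)"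
      using Hk ki by simp
    also have "norm \<dots> \<le> (LINT z|lborel. e/2 * ?k z)"
    proof (rule Bochner_Integration.integral_norm_bound_integral)
      show "integrable lborel (\<lambda>z. ?H z * ?k z - g x * ?k z)" using Hk ki by simp
      show "integrable lborel (\<lambda>z. e/2 * ?k z)" using ki by simp
      fix z
      show "norm (?H z * ?k z - g x * ?k z) \<le> e/2 * ?k z"
      proof (cases "?k z = 0")
        case False
        obtain a where a: "a \<in> supp K" "z - x = s n ^ m *\<^sub>R a" "norm (z - x) \<le> s n ^ m * \<delta>"
          using kernel_at_support[OF s(1) False] by blast
        \<comment> \<open>The support has radius s^m \<delta>, which for s \<le> 1 is at most s
          \<delta>, the quantity controlled by the choice of \<open>N\<close>.\<close>
        have sm: "s n ^ m \<le> s n" using s(1,2)[of n] m by (metis One_nat_def Suc_leI less_imp_le power_decreasing power_one_right)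
        have zU: "z \<in> interior \<Omega>"
          using x[OF a(1), of "s n ^ m"] s(1,2)[of n] a(2) by (simp add: power_le_one add.commute diff_eq_eq)
        have "dist z x \<le> s n * \<delta>"
          using a(3) mult_right_mono[OF sm kernel_nonneg] by (simp add: dist_norm)
        then have "dist z x < d" using N[OF n] by simp
        then have "\<bar>g z - g x\<bar> < e/2" using d(2)[of z] zU interior_subset by (auto simp: dist_real_def)
        moreover have "?H z * ?k z - g x * ?k z = (g z - g x) * ?k z" using zU by (simp add: algebra_simps)
        ultimately show ?thesis
          using mult_right_mono[of "\<bar>g z - g x\<bar>" "e/2" "?k z"] kernel_at_nonneg[OF s(1), of n "z - x"]
          by (simp add: abs_mult)
      qed simp
    qed
    also have "\<dots> = e/2" using ki by simp
    also have "\<dots> < e" using e by simp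
    finally show "norm ((LINT z|lborel. ?H z * ?k z) - g x) < e" .
  qed
qed

text \<open>The truncation is sent to 0: dominated convergence on the flow side, approximation of
  the identity on the kernel side. In the later superposition, the integrability asked for here
  comes from Fubini for almost every starting point.\<close>

lemma kernel_flow_integral:
  assumes w: "weak_test \<Omega> p g G" and \<Omega>: "compact \<Omega>" and xO: "x \<in> \<Omega>"
    and x: "\<And>a t. a \<in> supp K \<Longrightarrow> 0 < t \<Longrightarrow> t \<le> 1 \<Longrightarrow> x + t *\<^sub>R a \<in> interior \<Omega>"
    and int: "integrable lborel (\<lambda>u. indicator {0<..1} u * (LINT z|lborel. G z \<bullet> kernel_flow m K u (z - x)))"
  shows "(LINT u|lborel. indicator {0<..1} u * (LINT z|lborel. G z \<bullet> kernel_flow m K u (z - x))) =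
    (LINT z|lborel. (indicator (interior \<Omega>) z * g z) * K (z - x)) - g x"
proof -
  let ?A = "\<lambda>u. LINT z|lborel. G z \<bullet> kernel_flow m K u (z - x)"
  let ?H = "\<lambda>z. indicator (interior \<Omega>) z * g z"
  define s where "s n = 1 / real (Suc n)" for n
  have s: "0 < s n" "s n \<le> 1" for n by (auto simp: s_def field_simps)
  have s0: "s \<longlonglongrightarrow> 0" unfolding s_def by (rule LIMSEQ_inverse_real_of_nat[simplified inverse_eq_divide])
  have [measurable]: "G \<in> borel_measurable borel" using w by (simp add: weak_test_def)
  have "(\<lambda>n. LINT u|lborel. indicator {s n..1} u * ?A u) \<longlonglongrightarrow> (LINT u|lborel. indicator {0<..1} u * ?A u)"
  proof (rule integral_dominated_convergence[where w="\<lambda>u. \<bar>indicator {0<..1} u * ?A u\<bar>"])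
    show "integrable lborel (\<lambda>u. \<bar>indicator {0<..1} u * ?A u\<bar>)" using int by (rule integrable_abs)
    have [measurable]: "?A \<in> borel_measurable borel"
    proof -
      have "(\<lambda>(u, z). G z \<bullet> kernel_flow m K u (z - x)) \<in> borel_measurable (borel \<Otimes>\<^sub>M lborel)"
        unfolding kernel_flow_def kernel_at_def by measurable
      then show ?thesis by (intro lborel.borel_measurable_lebesgue_integral) simp
    qed
    show "(\<lambda>u. indicator {s n..1} u * ?A u) \<in> borel_measurable lborel" for n by measurable
    show "(\<lambda>u. indicator {0<..1} u * ?A u) \<in> borel_measurable lborel" by measurable
    show "AE u in lborel. norm (indicator {s n..1} u * ?A u) \<le> \<bar>indicator {0<..1} u * ?A u\<bar>" for n
      using s(1)[of n] by (intro AE_I2) (auto simp: indicator_def)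
    show "AE u in lborel. (\<lambda>n. indicator {s n..1} u * ?A u) \<longlonglongrightarrow> indicator {0<..1} u * ?A u"
    proof (rule AE_I2)
      fix u :: real
      have "\<forall>\<^sub>F n in sequentially. indicator {s n..1} u * ?A u = indicator {0<..1} u * ?A u"
      proof (cases "0 < u")
        case True
        then have "\<forall>\<^sub>F n in sequentially. s n < u" using s0 by (rule order_tendstoD(2)[rotated])
        then show ?thesis by eventually_elim (use True in \<open>auto simp: indicator_def\<close>)
      next
        case False
        then show ?thesis using s(1) by (intro always_eventually) (auto simp: indicator_def dest: less_le_trans)
      qed
      then show "(\<lambda>n. indicator {s n..1} u * ?A u) \<longlonglongrightarrow> indicator {0<..1} u * ?A u"
        by (rule tendsto_eventually)
    qed
  qed
  moreover have "(\<lambda>n. LINT u|lborel. indicator {s n..1} u * ?A u) \<longlonglongrightarrow> (LINT z|lborel. ?H z * K (z - x)) - g x"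
  proof -
    have "(LINT u|lborel. indicator {s n..1} u * ?A u) =
      (LINT z|lborel. ?H z * K (z - x)) - (LINT z|lborel. ?H z * kernel_at m K (s n) (z - x))" for n
      by (rule kernel_flow_integral_truncated[OF w \<Omega> s]) (rule x)
    moreover have "(\<lambda>n. LINT z|lborel. ?H z * kernel_at m K (s n) (z - x)) \<longlonglongrightarrow> g x"
      by (rule kernel_approximates_identity[OF w \<Omega> xO _ s s0]) (rule x)
    ultimately show ?thesis by (simp only:) (intro tendsto_diff tendsto_const)
  qed
  ultimately show ?thesis by (rule LIMSEQ_unique)
qed

end

subsection \<open>Superpositions of vector fields\<close>

text \<open>The tangent line at c of the convex function y^p, read off from Young's inequality with
  the conjugate exponent.\<close>

lemma powr_tangent:
  fixes y c p :: real
  assumes "1 < p" "0 \<le> y" "0 \<le> c"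
  shows "c powr p + p * c powr (p - 1) * (y - c) \<le> y powr p"
proof (cases "c = 0")
  case False
  then have c: "0 < c" using assms by simp
  define q where "q = p / (p - 1)"
  have q: "1 < q" "1/p + 1/q = 1" using assms by (auto simp: q_def field_simps)
  have "y * c powr (p - 1) \<le> y powr p / p + (c powr (p - 1)) powr q / q"
    by (rule Youngs_inequality) (use assms q in auto)
  also have "(c powr (p - 1)) powr q = c powr p" using assms by (simp add: powr_powr q_def)
  finally have "p * (y * c powr (p - 1)) \<le> p * (y powr p / p + c powr p / q)"
    by (rule mult_left_mono) (use assms in simp)
  also have "\<dots> = y powr p + (p * (1/q)) * c powr p" using assms by (simp add: distrib_left)
  also have "p * (1/q) = p - 1" using assms by (simp add: q_def)
  finally have "p * c powr (p - 1) * y \<le> y powr p + (p - 1) * c powr p" by (simp add: mult_ac)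
  moreover have "c powr (p - 1) * c = c powr p" using c by (simp add: powr_diff)
  ultimately show ?thesis by (simp add: algebra_simps)
qed (use assms in auto)

text \<open>Jensen's inequality for an unnormalized finite measure: integrate the tangent inequality
  at the mean of \<open>f\<close>.\<close>

lemma powr_integral_le:
  fixes f :: "'w \<Rightarrow> real"
  assumes N: "finite_measure N" and p: "1 < p"
    and f: "integrable N f" "\<And>w. 0 \<le> f w" and fp: "integrable N (\<lambda>w. f w powr p)"
  shows "(LINT w|N. f w) powr p \<le> measure N (space N) powr (p - 1) * (LINT w|N. f w powr p)"
proof -
  interpret finite_measure N by fact
  define n where "n = measure N (space N)"
  show ?thesis
  proof (cases "n = 0")
    case True
    then have "emeasure N (space N) = 0" by (simp add: n_def emeasure_eq_measure)
    then have "(LINT w|N. f w) = 0"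
      by (intro integral_eq_zero_AE AE_I[of _ _ "space N"]) auto
    then show ?thesis using p by (simp add: Bochner_Integration.integral_nonneg)
  next
    case False
    then have n: "0 < n" by (simp add: n_def zero_less_measure_iff measure_nonneg less_le)
    define c where "c = (LINT w|N. f w) / n"
    have c: "0 \<le> c" unfolding c_def using f(2) n by (intro divide_nonneg_nonneg Bochner_Integration.integral_nonneg) auto
    have "(LINT w|N. c powr p + p * c powr (p - 1) * (f w - c)) \<le> (LINT w|N. f w powr p)"
      by (rule integral_mono) (use f fp c p powr_tangent in auto)
    moreover have "(LINT w|N. c powr p + p * c powr (p - 1) * (f w - c)) = n * c powr p"
    proof -
      have "(LINT w|N. c powr p + p * c powr (p - 1) * (f w - c)) =
        n * c powr p + p * c powr (p - 1) * ((LINT w|N. f w) - n * c)"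
        using f(1) by (simp add: n_def)
      also have "n * c = (LINT w|N. f w)" using n by (simp add: c_def)
      finally show ?thesis by simp
    qed
    ultimately have "n * c powr p \<le> (LINT w|N. f w powr p)" by simp
    then have "n powr (p - 1) * (n * c powr p) \<le> n powr (p - 1) * (LINT w|N. f w powr p)"
      by (rule mult_left_mono) simp
    moreover have "n powr (p - 1) * (n * c powr p) = (LINT w|N. f w) powr p"
    proof -
      have "n powr (p - 1) * n = n powr p" using n by (simp add: powr_diff)
      then have "n powr (p - 1) * (n * c powr p) = (n * c) powr p"
        using n c by (simp add: powr_mult)
      also have "n * c = (LINT w|N. f w)" using n by (simp add: c_def)
      finally show ?thesis .
    qed
    ultimately show ?thesis by (simp add: n_def)
  qed
qed

lemma conj_exp_props:
  assumes "1 < p" shows "1 < conj_exp p" "1 / p + 1 / conj_exp p = 1" "conj_exp (conj_exp p) = p"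
  using assms by (auto simp: conj_exp_def field_simps)

text \<open>Young's inequality with the factors 1/p and 1/q estimated by 1; it serves to make
  pairings of L^p with L^q fields integrable.\<close>

lemma abs_inner_le_powr:
  assumes "1 < p"
  shows "\<bar>a \<bullet> b\<bar> \<le> norm a powr p + norm b powr (conj_exp p)"
proof -
  note q = conj_exp_props[OF assms]
  have "\<bar>a \<bullet> b\<bar> \<le> norm a * norm b" by (rule Cauchy_Schwarz_ineq2)
  also have "\<dots> \<le> norm a powr p / p + norm b powr (conj_exp p) / conj_exp p"
    by (rule Youngs_inequality[OF assms q(1,2)]) auto
  also have "\<dots> \<le> norm a powr p + norm b powr (conj_exp p)"
    using assms q(1) by (intro add_mono) (auto simp: divide_le_eq mult_le_cancel_left1)
  finally show ?thesis .
qed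

text \<open>Jensen in \<open>w\<close> turns an L^p bound on the single fields, uniform in
  \<open>w\<close>, into L^p integrability of their mean. Bounded support and |F| \<le> 1 + |F|^p
  give joint integrability, and Fubini yields the weighted mass and the pairings. On the null set of
  points z where F is not integrable in \<open>w\<close>, \<open>P z\<close> is 0.\<close>

lemma superposition_field:
  fixes N :: "'w measure" and F :: "'w \<Rightarrow> 'a::euclidean_space \<Rightarrow> 'a"
  assumes N: "finite_measure N" and p: "1 < p" and U: "open U" "bounded U"
    and Fm: "(\<lambda>(w, z). F w z) \<in> borel_measurable (N \<Otimes>\<^sub>M borel)"
    and Fz: "\<And>w z. z \<notin> U \<Longrightarrow> F w z = 0"
    and Fp: "\<And>w. w \<in> space N \<Longrightarrow> integrable lborel (\<lambda>z. norm (F w z) powr p)"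
      "\<And>w. w \<in> space N \<Longrightarrow> (LINT z|lborel. norm (F w z) powr p) \<le> C"
  defines "P \<equiv> (\<lambda>z. LINT w|N. F w z)"
  shows "P \<in> borel_measurable borel" "\<And>z. z \<notin> U \<Longrightarrow> P z = 0"
    "integrable lborel (\<lambda>z. norm (P z) powr p)"
    "\<And>v B. v \<in> borel_measurable borel \<Longrightarrow> (\<And>z. 0 \<le> v z \<and> v z \<le> B) \<Longrightarrow>
       (LINT z|lborel. v z * norm (P z)) \<le> (LINT w|N. (LINT z|lborel. v z * norm (F w z)))"
    "\<And>v B. v \<in> borel_measurable borel \<Longrightarrow> (\<And>z. 0 \<le> v z \<and> v z \<le> B) \<Longrightarrow>
       integrable N (\<lambda>w. LINT z|lborel. v z * norm (F w z))"
    "\<And>G. G \<in> borel_measurable borel \<Longrightarrow> integrable lborel (\<lambda>z. norm (G z) powr conj_exp p) \<Longrightarrow>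
       (LINT z|lborel. P z \<bullet> G z) = (LINT w|N. (LINT z|lborel. F w z \<bullet> G z)) \<and>
       integrable N (\<lambda>w. LINT z|lborel. F w z \<bullet> G z)"
proof -
  interpret N: finite_measure N by fact
  interpret NL: pair_sigma_finite N lborel ..
  interpret LN: pair_sigma_finite lborel N ..
  have [measurable]: "(\<lambda>(w, z). F w z) \<in> borel_measurable (N \<Otimes>\<^sub>M lborel)" using Fm by simp
  have [measurable]: "U \<in> sets borel" using U by simp
  have sw: "(\<lambda>(z, w). F w z) \<in> borel_measurable (borel \<Otimes>\<^sub>M N)"
    using measurable_pair_swap[OF Fm] by simp
  show Pm[measurable]: "P \<in> borel_measurable borel"
    unfolding P_def by (rule N.borel_measurable_lebesgue_integral[OF sw])
  show "P z = 0" if "z \<notin> U" for z using Fz[OF that] by (simp add: P_def)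
  have C0: "0 \<le> C \<or> space N = {}"
    using Fp(2) by (meson Bochner_Integration.integral_nonneg equals0I order_trans powr_ge_zero)
  have iFp: "integrable (N \<Otimes>\<^sub>M lborel) (\<lambda>(w, z). norm (F w z) powr p)"
  proof (rule NL.Fubini_integrable)
    show "integrable N (\<lambda>w. LINT z|lborel. norm (case (w, z) of (w, z) \<Rightarrow> norm (F w z) powr p))"
    proof (rule N.integrable_const_bound[of _ C])
      show "AE w in N. norm (LINT z|lborel. norm (case (w, z) of (w, z) \<Rightarrow> norm (F w z) powr p)) \<le> C"
        using Fp(2) by (intro AE_I2) (simp add: Bochner_Integration.integral_nonneg)
    qed measurable
    show "AE w in N. integrable lborel (\<lambda>z. case (w, z) of (w, z) \<Rightarrow> norm (F w z) powr p)"
      using Fp(1) by (intro AE_I2) simp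
  qed measurable
  have iconst: "integrable (N \<Otimes>\<^sub>M lborel) (\<lambda>(w, z). f z)" if f: "integrable lborel f" for f :: "'a \<Rightarrow> real"
  proof (rule NL.Fubini_integrable)
    have [measurable]: "f \<in> borel_measurable lborel" using f by simp
    show "(\<lambda>(w, z). f z) \<in> borel_measurable (N \<Otimes>\<^sub>M lborel)" by measurable
  qed (use f in auto)
  have iU: "integrable lborel (indicator U :: 'a \<Rightarrow> real)"
    by (rule integrable_lborel_bounded_support[OF _ U(2), where M=1]) (auto simp: indicator_def)
  have powr1: "norm x \<le> 1 + norm x powr p" for x :: 'a
  proof (cases "norm x \<le> 1")
    case False
    then have "norm x powr 1 \<le> norm x powr p" using p by (intro powr_mono) auto
    then show ?thesis using False by simp
  qed (simp add: add_increasing2)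
  have iF: "integrable (N \<Otimes>\<^sub>M lborel) (\<lambda>(w, z). F w z)"
  proof (rule Bochner_Integration.integrable_bound[OF Bochner_Integration.integrable_add[OF iconst[OF iU] iFp]])
    show "AE x in N \<Otimes>\<^sub>M lborel. norm (case x of (w, z) \<Rightarrow> F w z)
        \<le> norm ((case x of (w, z) \<Rightarrow> indicator U z) + (case x of (w, z) \<Rightarrow> norm (F w z) powr p))"
    proof (rule AE_I2, clarify)
      fix w z show "norm (F w z) \<le> norm (indicator U z + norm (F w z) powr p)"
        using powr1[of "F w z"] Fz[of z w] by (cases "z \<in> U") auto
    qed
  qed measurable
  have swap: "integrable (lborel \<Otimes>\<^sub>M N) (\<lambda>(z, w). f w z)" if "integrable (N \<Otimes>\<^sub>M lborel) (\<lambda>(w, z). f w z)"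
    for f :: "'w \<Rightarrow> 'a \<Rightarrow> 'z::{banach, second_countable_topology}"
    using NL.integrable_product_swap[OF that] by simp
  have aeF: "AE z in lborel. integrable N (\<lambda>w. F w z)"
    using LN.AE_integrable_fst'[OF swap[OF iF]] by simp
  have aeFp: "AE z in lborel. integrable N (\<lambda>w. norm (F w z) powr p)"
    using LN.AE_integrable_fst'[OF swap[OF iFp]] by simp
  show "integrable lborel (\<lambda>z. norm (P z) powr p)"
  proof (rule Bochner_Integration.integrable_bound)
    show "integrable lborel (\<lambda>z. measure N (space N) powr (p - 1) * (LINT w|N. norm (F w z) powr p))"
      using LN.integrable_fst'[OF swap[OF iFp]] by (intro integrable_mult_right) simp
    show "AE z in lborel. norm (norm (P z) powr p) \<le> norm (measure N (space N) powr (p - 1) * (LINT w|N. norm (F w z) powr p))"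
      using aeF aeFp
    proof eventually_elim
      fix z assume a: "integrable N (\<lambda>w. F w z)" "integrable N (\<lambda>w. norm (F w z) powr p)"
      have "norm (P z) powr p \<le> (LINT w|N. norm (F w z)) powr p"
        unfolding P_def using p by (intro powr_mono2 integral_norm_bound) auto
      also have "\<dots> \<le> measure N (space N) powr (p - 1) * (LINT w|N. norm (F w z) powr p)"
        by (rule powr_integral_le[OF N p]) (use a in auto)
      finally show "norm (norm (P z) powr p) \<le> norm (measure N (space N) powr (p - 1) * (LINT w|N. norm (F w z) powr p))"
        by simp
    qed
  qed measurable
  {
    fix v :: "'a \<Rightarrow> real" and B assume [measurable]: "v \<in> borel_measurable borel" and v: "\<And>z. 0 \<le> v z \<and> v z \<le> B"
    have ivF: "integrable (N \<Otimes>\<^sub>M lborel) (\<lambda>(w, z). v z * norm (F w z))"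
    proof (rule Bochner_Integration.integrable_bound[OF integrable_mult_right[OF integrable_norm[OF iF], of B]])
      show "AE x in N \<Otimes>\<^sub>M lborel. norm (case x of (w, z) \<Rightarrow> v z * norm (F w z)) \<le> norm (B * norm (case x of (w, z) \<Rightarrow> F w z))"
      proof (rule AE_I2, clarify)
        fix w z show "norm (v z * norm (F w z)) \<le> norm (B * norm (F w z))"
          using v[of z] by (simp add: abs_mult mult_right_mono)
      qed
    qed measurable
    show "integrable N (\<lambda>w. LINT z|lborel. v z * norm (F w z))"
      using NL.integrable_fst'[OF ivF] by simp
    have "(LINT z|lborel. v z * norm (P z)) \<le> (LINT z|lborel. (LINT w|N. v z * norm (F w z)))"
    proof (rule integral_mono_AE')
      show "integrable lborel (\<lambda>z. LINT w|N. v z * norm (F w z))"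
        using LN.integrable_fst'[OF swap[OF ivF]] by simp
      show "AE z in lborel. v z * norm (P z) \<le> (LINT w|N. v z * norm (F w z))"
        using v by (intro AE_I2) (auto simp: P_def intro!: mult_left_mono integral_norm_bound)
      show "AE z in lborel. 0 \<le> (LINT w|N. v z * norm (F w z))"
        using v by (intro AE_I2 Bochner_Integration.integral_nonneg) auto
    qed
    also have "\<dots> = (LINT w|N. (LINT z|lborel. v z * norm (F w z)))"
      using NL.Fubini_integral[OF ivF] by simp
    finally show "(LINT z|lborel. v z * norm (P z)) \<le> (LINT w|N. (LINT z|lborel. v z * norm (F w z)))" .
  }
  fix G :: "'a \<Rightarrow> 'a" assume [measurable]: "G \<in> borel_measurable borel"
    and G: "integrable lborel (\<lambda>z. norm (G z) powr conj_exp p)"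
  have iFG: "integrable (N \<Otimes>\<^sub>M lborel) (\<lambda>(w, z). F w z \<bullet> G z)"
  proof (rule Bochner_Integration.integrable_bound[OF Bochner_Integration.integrable_add[OF iFp iconst[OF G]]])
    show "AE x in N \<Otimes>\<^sub>M lborel. norm (case x of (w, z) \<Rightarrow> F w z \<bullet> G z)
        \<le> norm ((case x of (w, z) \<Rightarrow> norm (F w z) powr p) + (case x of (w, z) \<Rightarrow> norm (G z) powr conj_exp p))"
      by (rule AE_I2, clarify) (use abs_inner_le_powr[OF p] in simp)
  qed measurable
  have "(LINT z|lborel. P z \<bullet> G z) = (LINT z|lborel. (LINT w|N. F w z \<bullet> G z))"
  proof (rule integral_cong_AE)
    show "(\<lambda>z. LINT w|N. F w z \<bullet> G z) \<in> borel_measurable lborel"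
      using borel_measurable_integrable[OF LN.integrable_fst'[OF swap[OF iFG]]] by simp
    show "AE z in lborel. P z \<bullet> G z = (LINT w|N. F w z \<bullet> G z)"
      using aeF by eventually_elim (simp add: P_def)
  qed measurable
  also have "\<dots> = (LINT w|N. (LINT z|lborel. F w z \<bullet> G z))"
    using NL.Fubini_integral[OF iFG] by simp
  finally show "(LINT z|lborel. P z \<bullet> G z) = (LINT w|N. (LINT z|lborel. F w z \<bullet> G z)) \<and>
       integrable N (\<lambda>w. LINT z|lborel. F w z \<bullet> G z)"
    using NL.integrable_fst'[OF iFG] by simp
qed

subsection \<open>Convolution with a smooth kernel\<close>

lemma continuous_on_convolution:
  fixes f :: "'a::euclidean_space \<Rightarrow> real"
  assumes H: "integrable lborel H" and f: "continuous_on UNIV f" "\<And>x. \<bar>f x\<bar> \<le> M"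
  shows "continuous_on UNIV (\<lambda>x. LINT z|lborel. H z * f (z - x))"
proof (rule continuous_on_sequentiallyI)
  fix u :: "nat \<Rightarrow> 'a" and a assume u: "u \<longlonglongrightarrow> a"
  have [measurable]: "f \<in> borel_measurable borel" "H \<in> borel_measurable borel"
    using borel_measurable_continuous_onI[OF f(1)] H by auto
  show "(\<lambda>n. LINT z|lborel. H z * f (z - u n)) \<longlonglongrightarrow> (LINT z|lborel. H z * f (z - a))"
  proof (rule integral_dominated_convergence[where w="\<lambda>z. M * \<bar>H z\<bar>"])
    show "AE z in lborel. (\<lambda>n. H z * f (z - u n)) \<longlonglongrightarrow> H z * f (z - a)"
      by (intro AE_I2 tendsto_mult tendsto_const continuous_on_tendsto_compose[OF f(1)] tendsto_diff u) auto
    show "AE z in lborel. norm (H z * f (z - u n)) \<le> M * \<bar>H z\<bar>" for n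
      using f(2) by (intro AE_I2) (simp add: abs_mult mult.commute[of "\<bar>H _\<bar>"] mult_right_mono)
  qed (use H in auto)
qed

text \<open>Differentiation under the integral: \<open>K\<close> is Lipschitz with constant
  \<open>L\<close>, so the difference quotient minus its limit is dominated by 2 L |H|. The minus
  sign comes from x entering as z - x.\<close>

lemma GDERIV_convolution:
  fixes K :: "'a::euclidean_space \<Rightarrow> real"
  assumes K: "K \<in> Cc_infinity UNIV" and H: "integrable lborel H"
  shows "GDERIV (\<lambda>x. LINT z|lborel. H z * K (z - x)) x :>
    (\<Sum>b\<in>Basis. - (LINT z|lborel. H z * frechet_derivative K (at (z - x)) b) *\<^sub>R b)"
proof -
  note D = Cc_infinityD[OF K]
  let ?D = "\<lambda>y. frechet_derivative K (at y)"
  have Kd: "(K has_derivative ?D y) (at y)" for y using D(6) by (simp add: frechet_derivative_works[symmetric])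
  have l: "linear (?D y)" for y using Kd has_derivative_linear by blast
  have rep: "?D y h = (\<Sum>b\<in>Basis. (h \<bullet> b) * ?D y b)" for y h
    by (subst euclidean_representation[of h, symmetric], subst linear_sum[OF l])
       (simp only: linear_cmul[OF l] real_scaleR_def)
  have "\<exists>M. 0 \<le> M \<and> (\<forall>y. \<bar>?D y b\<bar> \<le> M)" if "b \<in> Basis" for b
    using compact_support_bounded[OF D(7)[OF that] D(2)] frechet_derivative_eq_0_outside_supp[OF K]
    by (metis real_norm_def)
  then obtain M where M: "\<And>b. b \<in> Basis \<Longrightarrow> 0 \<le> M b" "\<And>b y. b \<in> Basis \<Longrightarrow> \<bar>?D y b\<bar> \<le> M b" by metis
  define L where "L = (\<Sum>b\<in>Basis. M b)"
  have L0: "0 \<le> L" unfolding L_def using M(1) by (rule sum_nonneg)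
  have DL: "\<bar>?D y h\<bar> \<le> L * norm h" for y h
  proof -
    have "\<bar>?D y h\<bar> \<le> (\<Sum>b\<in>Basis. \<bar>(h \<bullet> b) * ?D y b\<bar>)" unfolding rep[of y h] by (rule sum_abs)
    also have "\<dots> \<le> (\<Sum>b\<in>Basis. norm h * M b)"
      unfolding abs_mult by (intro sum_mono mult_mono) (use M Basis_le_norm in auto)
    finally show ?thesis by (simp add: L_def sum_distrib_left mult.commute)
  qed
  have lip: "\<bar>K y - K z\<bar> \<le> L * norm (y - z)" for y z
    using differentiable_bound[of UNIV K "\<lambda>y. ?D y" L y z] Kd onorm_bound[OF L0, of "?D _"] DL by simp
  have Hm[measurable]: "H \<in> borel_measurable borel" using H by simp
  have Km[measurable]: "K \<in> borel_measurable borel" using D(5) by (rule borel_measurable_continuous_onI)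
  have Dm[measurable]: "(\<lambda>y. ?D y b) \<in> borel_measurable borel" if "b \<in> Basis" for b
    using D(7)[OF that] by (rule borel_measurable_continuous_onI)
  obtain MK where MK: "\<And>y. \<bar>K y\<bar> \<le> MK" using compact_support_bounded[OF D(5) D(2)] D(4) by (metis real_norm_def)
  have iHf: "integrable lborel (\<lambda>z. H z * f (z - x))" if "f \<in> borel_measurable borel" "\<And>y. \<bar>f y\<bar> \<le> B" for f B x
  proof (rule Bochner_Integration.integrable_bound[OF integrable_mult_right[OF integrable_abs[OF H], of B]])
    have [measurable]: "f \<in> borel_measurable borel" by fact
    show "(\<lambda>z. H z * f (z - x)) \<in> borel_measurable lborel" by measurable
    have "0 \<le> B" using that(2)[of 0] by linarith
    then show "AE z in lborel. norm (H z * f (z - x)) \<le> norm (B * \<bar>H z\<bar>)"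
      using that(2) by (intro AE_I2) (simp add: abs_mult mult.commute[of "\<bar>H _\<bar>"] mult_right_mono)
  qed
  have iK: "integrable lborel (\<lambda>z. H z * K (z - x))" for x by (rule iHf[OF Km MK])
  have iD: "integrable lborel (\<lambda>z. H z * ?D (z - x) b)" if "b \<in> Basis" for b x
    by (rule iHf[OF Dm[OF that] M(2)[OF that]])
  have repI: "(LINT z|lborel. H z * ?D (z - x) h) = (\<Sum>b\<in>Basis. (h \<bullet> b) * (LINT z|lborel. H z * ?D (z - x) b))"
    and iDh: "integrable lborel (\<lambda>z. H z * ?D (z - x) h)" for h
  proof -
    have e: "H z * ?D (z - x) h = (\<Sum>b\<in>Basis. (h \<bullet> b) * (H z * ?D (z - x) b))" for z
      by (subst rep) (simp add: sum_distrib_left mult_ac)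
    show "(LINT z|lborel. H z * ?D (z - x) h) = (\<Sum>b\<in>Basis. (h \<bullet> b) * (LINT z|lborel. H z * ?D (z - x) b))"
      unfolding e using iD by (subst Bochner_Integration.integral_sum) auto
    show "integrable lborel (\<lambda>z. H z * ?D (z - x) h)"
      unfolding e using iD by (intro Bochner_Integration.integrable_sum integrable_mult_right) auto
  qed
  let ?G = "\<Sum>b\<in>Basis. - (LINT z|lborel. H z * ?D (z - x) b) *\<^sub>R b"
  have Gh: "h \<bullet> ?G = - (LINT z|lborel. H z * ?D (z - x) h)" for h
    unfolding repI[of h] by (simp add: inner_sum_right sum_negf mult.commute)
  show ?thesis
    unfolding gderiv_def has_derivative_within
  proof (intro conjI bounded_linear_inner_left)
    show "((\<lambda>y. (1 / norm (y - x)) *\<^sub>R ((LINT z|lborel. H z * K (z - y)) -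
        ((LINT z|lborel. H z * K (z - x)) + (y - x) \<bullet> ?G))) \<longlongrightarrow> 0) (at x)"
      unfolding tendsto_at_iff_sequentially comp_def
    proof (intro allI impI)
      fix X :: "nat \<Rightarrow> 'a" assume X: "\<forall>i. X i \<in> UNIV - {x}" "X \<longlonglongrightarrow> x"
      define E where "E n z = H z * ((1 / norm (X n - x)) * (K (z - X n) - (K (z - x) - ?D (z - x) (X n - x))))" for n z
      have "(\<lambda>n. LINT z|lborel. E n z) \<longlonglongrightarrow> (LINT z|(lborel::'a measure). (0::real))"
      proof (rule integral_dominated_convergence[where w="\<lambda>z. (2 * L) * \<bar>H z\<bar>"])
        show "E n \<in> borel_measurable lborel" for n
          unfolding E_def using iDh[of "X n - x"]
        proof -
          have "(\<lambda>z. ?D (z - x) (X n - x)) \<in> borel_measurable borel"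
            by (subst rep) (auto intro!: borel_measurable_sum borel_measurable_times measurable_compose[OF _ Dm])
          then show "(\<lambda>z. H z * (1 / norm (X n - x) * (K (z - X n) - (K (z - x) - ?D (z - x) (X n - x))))) \<in> borel_measurable lborel"
            by measurable
        qed
        show "AE z in lborel. (\<lambda>n. E n z) \<longlonglongrightarrow> 0"
        proof (rule AE_I2)
          fix z
          have "((\<lambda>y. K (z - y)) has_derivative (\<lambda>h. ?D (z - x) (- h))) (at x)"
          proof -
            have "((\<lambda>y. z - y) has_derivative (\<lambda>h. - h)) (at x)" by (auto intro!: derivative_eq_intros)
            from has_derivative_compose[OF this Kd] show ?thesis by simp
          qed
          then have "((\<lambda>y. (1 / norm (y - x)) *\<^sub>R (K (z - y) - (K (z - x) + ?D (z - x) (- (y - x))))) \<longlongrightarrow> 0) (at x)"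
            unfolding has_derivative_within by blast
          then have "(\<lambda>n. (1 / norm (X n - x)) *\<^sub>R (K (z - X n) - (K (z - x) + ?D (z - x) (- (X n - x))))) \<longlonglongrightarrow> 0"
            unfolding tendsto_at_iff_sequentially comp_def using X by blast
          moreover have "?D (z - x) (- (X n - x)) = - ?D (z - x) (X n - x)" for n by (rule linear_neg[OF l])
          ultimately have "(\<lambda>n. (1 / norm (X n - x)) * (K (z - X n) - (K (z - x) - ?D (z - x) (X n - x)))) \<longlonglongrightarrow> 0"
            by simp
          from tendsto_mult[OF tendsto_const[of "H z"] this]
          show "(\<lambda>n. E n z) \<longlonglongrightarrow> 0" by (simp add: E_def)
        qed
        show "AE z in lborel. norm (E n z) \<le> (2 * L) * \<bar>H z\<bar>" for n
        proof (rule AE_I2)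
          fix z
          have nz: "0 < norm (X n - x)" using X(1) by simp
          have "\<bar>K (z - X n) - (K (z - x) - ?D (z - x) (X n - x))\<bar> \<le> 2 * L * norm (X n - x)"
            using lip[of "z - X n" "z - x"] DL[of "z - x" "X n - x"] by (simp add: norm_minus_commute)
          then have "\<bar>(1 / norm (X n - x)) * (K (z - X n) - (K (z - x) - ?D (z - x) (X n - x)))\<bar> \<le> 2 * L"
            using nz by (simp add: abs_mult divide_le_eq)
          then have "\<bar>H z\<bar> * \<bar>(1 / norm (X n - x)) * (K (z - X n) - (K (z - x) - ?D (z - x) (X n - x)))\<bar> \<le> \<bar>H z\<bar> * (2 * L)"
            by (rule mult_left_mono) simp
          then show "norm (E n z) \<le> (2 * L) * \<bar>H z\<bar>" unfolding E_def real_norm_def abs_mult by (simp only: mult.commute)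
        qed
      qed (use H in auto)
      moreover have "(LINT z|lborel. E n z) = (1 / norm (X n - x)) *\<^sub>R ((LINT z|lborel. H z * K (z - X n)) -
        ((LINT z|lborel. H z * K (z - x)) + (X n - x) \<bullet> ?G))" for n
      proof -
        have "E n z = (1 / norm (X n - x)) * (H z * K (z - X n) - (H z * K (z - x) - H z * ?D (z - x) (X n - x)))" for z
          by (simp add: E_def algebra_simps diff_divide_distrib)
        then have "(LINT z|lborel. E n z) = (1 / norm (X n - x)) *
           ((LINT z|lborel. H z * K (z - X n)) - ((LINT z|lborel. H z * K (z - x)) - (LINT z|lborel. H z * ?D (z - x) (X n - x))))"
          using iK iDh by simp
        then show ?thesis unfolding Gh by simp
      qed
      ultimately show "(\<lambda>n. (1 / norm (X n - x)) *\<^sub>R ((LINT z|lborel. H z * K (z - X n)) -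
        ((LINT z|lborel. H z * K (z - x)) + (X n - x) \<bullet> ?G))) \<longlonglongrightarrow> 0" by simp
    qed
  qed
qed


subsection \<open>Fields with prescribed divergence\<close>

text \<open>\<open>L g G\<close> is the weak form of minus the divergence of \<open>P\<close>. It
  takes the gradient as a second argument because the functional of a smoothed field is first known
  in terms of \<open>G\<close> and only later rewritten through \<open>g\<close>. Since
  \<open>P\<close> vanishes outside the interior, extension by zero to a larger domain keeps the
  functional.\<close>

definition flux_field :: "'a::euclidean_space set \<Rightarrow> real \<Rightarrow> ('a \<Rightarrow> 'a) \<Rightarrow> (('a \<Rightarrow> real) \<Rightarrow> ('a \<Rightarrow> 'a) \<Rightarrow> real) \<Rightarrow> bool" where
  "flux_field \<Omega> p P L \<longleftrightarrow> P \<in> borel_measurable borel \<and> (\<forall>z. z \<notin> interior \<Omega> \<longrightarrow> P z = 0) \<and>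
     integrable lborel (\<lambda>z. norm (P z) powr p) \<and>
     (\<forall>g G. weak_test \<Omega> (conj_exp p) g G \<longrightarrow> (LINT z|lborel. P z \<bullet> G z) = L g G)"

lemma flux_field_integrable:
  assumes P: "flux_field \<Omega> p P L" and \<Omega>: "compact \<Omega>" and p: "1 < p"
    and v: "v \<in> borel_measurable borel" "\<And>z. \<bar>v z\<bar> \<le> B"
  shows "integrable lborel (\<lambda>z. v z * norm (P z))"
proof -
  have [measurable]: "P \<in> borel_measurable borel" "v \<in> borel_measurable borel"
    and Pz: "\<And>z. z \<notin> interior \<Omega> \<Longrightarrow> P z = 0" and Pp: "integrable lborel (\<lambda>z. norm (P z) powr p)"
    using P v by (auto simp: flux_field_def)
  have iU: "integrable lborel (indicator (interior \<Omega>) :: 'a \<Rightarrow> real)"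
    by (rule integrable_lborel_bounded_support[OF _ bounded_interior[OF compact_imp_bounded[OF \<Omega>]], where M=1])
       (auto simp: indicator_def)
  have powr1: "norm x \<le> 1 + norm x powr p" for x :: 'a
  proof (cases "norm x \<le> 1")
    case False
    then have "norm x powr 1 \<le> norm x powr p" using p by (intro powr_mono) auto
    then show ?thesis using False by simp
  qed (simp add: add_increasing2)
  have B: "0 \<le> B" using v(2)[of 0] by linarith
  show ?thesis
  proof (rule Bochner_Integration.integrable_bound[OF integrable_mult_right[OF Bochner_Integration.integrable_add[OF iU Pp], of B]])
    show "AE z in lborel. norm (v z * norm (P z)) \<le> norm (B * (indicator (interior \<Omega>) z + norm (P z) powr p))"
    proof (rule AE_I2)
      fix z
      have "norm (P z) \<le> indicator (interior \<Omega>) z + norm (P z) powr p"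
        using powr1[of "P z"] Pz[of z] by (cases "z \<in> interior \<Omega>") auto
      then have "\<bar>v z\<bar> * norm (P z) \<le> B * (indicator (interior \<Omega>) z + norm (P z) powr p)"
        using v(2)[of z] B by (intro mult_mono) auto
      then show "norm (v z * norm (P z)) \<le> norm (B * (indicator (interior \<Omega>) z + norm (P z) powr p))"
        using B by (simp add: abs_mult)
    qed
  qed measurable
qed

lemma flux_field_inner_integrable:
  assumes P: "flux_field \<Omega> p P L" and p: "1 < p" and w: "weak_test \<Omega> (conj_exp p) g G"
  shows "integrable lborel (\<lambda>z. P z \<bullet> G z)"
proof -
  have [measurable]: "P \<in> borel_measurable borel" "G \<in> borel_measurable borel"
    and i: "integrable lborel (\<lambda>z. norm (P z) powr p)" "integrable lborel (\<lambda>z. norm (G z) powr conj_exp p)"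
    using P w by (auto simp: flux_field_def weak_test_def)
  show ?thesis
    by (rule Bochner_Integration.integrable_bound[OF Bochner_Integration.integrable_add[OF i]])
       (use abs_inner_le_powr[OF p] in \<open>auto intro!: AE_I2\<close>)
qed

lemma norm_add_powr_le:
  fixes a b :: "'a::real_normed_vector"
  assumes p: "1 < p"
  shows "norm (a + b) powr p \<le> 2 powr p * (norm a powr p + norm b powr p)"
proof -
  have "norm (a + b) powr p \<le> (2 * max (norm a) (norm b)) powr p"
    using p norm_triangle_ineq[of a b] by (intro powr_mono2) auto
  also have "\<dots> = 2 powr p * max (norm a) (norm b) powr p" by (simp add: powr_mult)
  also have "max (norm a) (norm b) powr p \<le> norm a powr p + norm b powr p"
    by (auto simp: max_def)
  finally show ?thesis by simp
qed

lemma flux_field_add: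
  assumes P: "flux_field \<Omega> p P L" and Q: "flux_field \<Omega> p Q M" and p: "1 < p"
  shows "flux_field \<Omega> p (\<lambda>z. P z + Q z) (\<lambda>g G. L g G + M g G)"
  unfolding flux_field_def
proof (intro conjI allI impI)
  have [measurable]: "P \<in> borel_measurable borel" "Q \<in> borel_measurable borel"
    and i: "integrable lborel (\<lambda>z. norm (P z) powr p)" "integrable lborel (\<lambda>z. norm (Q z) powr p)"
    using P Q by (auto simp: flux_field_def)
  show "(\<lambda>z. P z + Q z) \<in> borel_measurable borel" by measurable
  show "P z + Q z = 0" if "z \<notin> interior \<Omega>" for z using P Q that by (simp add: flux_field_def)
  show "integrable lborel (\<lambda>z. norm (P z + Q z) powr p)"
    by (rule Bochner_Integration.integrable_bound[OF integrable_mult_right[OF Bochner_Integration.integrable_add[OF i], of "2 powr p"]])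
       (use norm_add_powr_le[OF p] in \<open>auto intro!: AE_I2\<close>)
  fix g G assume w: "weak_test \<Omega> (conj_exp p) g G"
  show "(LINT z|lborel. (P z + Q z) \<bullet> G z) = L g G + M g G"
    unfolding inner_add_left
    by (subst Bochner_Integration.integral_add[OF flux_field_inner_integrable[OF P p w] flux_field_inner_integrable[OF Q p w]])
       (use P Q w in \<open>simp add: flux_field_def\<close>)
qed

lemma flux_field_sum:
  assumes "finite I" "\<And>i. i \<in> I \<Longrightarrow> flux_field \<Omega> p (P i) (L i)" and p: "1 < p"
  shows "flux_field \<Omega> p (\<lambda>z. \<Sum>i\<in>I. P i z) (\<lambda>g G. \<Sum>i\<in>I. L i g G)"
  using assms(1,2)
proof (induction I rule: finite_induct)
  case empty
  show ?case using p by (simp add: flux_field_def)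
next
  case (insert i I)
  then show ?case using flux_field_add[OF insert(4)[of i] insert(3) p] by simp
qed

text \<open>The uniform law on (0, 1], open at 0 where the flow is singular; with it, time becomes
  one more coordinate of a superposition over a finite measure.\<close>

definition unit_time :: "real measure" where
  "unit_time = density lborel (\<lambda>u. ennreal (indicator {0<..1} u))"

lemma sets_unit_time [simp, measurable_cong]: "sets unit_time = sets borel"
  by (simp add: unit_time_def)

lemma emeasure_unit_time: "emeasure unit_time (space unit_time) = 1"
  unfolding unit_time_def by (subst emeasure_density) (auto simp: ennreal_indicator)

lemma prob_space_unit_time: "prob_space unit_time"
  by (rule prob_spaceI) (rule emeasure_unit_time)

lemma integral_unit_time:
  fixes f :: "real \<Rightarrow> 'b::{banach, second_countable_topology}"
  assumes "f \<in> borel_measurable borel"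
  shows "(LINT u|unit_time. f u) = (LINT u|lborel. indicator {0<..1} u *\<^sub>R f u)"
    "integrable unit_time f \<longleftrightarrow> integrable lborel (\<lambda>u. indicator {0<..1} u *\<^sub>R f u)"
  unfolding unit_time_def using assms by (subst integral_density integrable_density; simp)+

section \<open>Mass and L^p bounds for the flow, and the fields obtained by superposing it\<close>

context
  fixes m :: nat and \<delta> :: real and K :: "'a::euclidean_space \<Rightarrow> real"
  assumes m: "0 < m" and K: "smooth_kernel \<delta> K"
begin

lemma norm_kernel_flow_le:
  assumes u: "0 < u" "u \<le> 1"
  shows "norm (kernel_flow m K u z) \<le> real m * \<delta> * kernel_at m K u z / u * u^m"
proof (cases "kernel_at m K u z = 0")
  case False
  have "norm z \<le> u^m * \<delta>" by (rule kernel_at_support(2)[OF m K u(1) False])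
  then have "(real m / u * kernel_at m K u z) * norm z \<le> (real m / u * kernel_at m K u z) * (u^m * \<delta>)"
    using kernel_at_nonneg[OF m K u(1), of z] u(1) by (intro mult_left_mono) auto
  then show ?thesis
    using kernel_at_nonneg[OF m K u(1), of z] u(1) by (simp add: kernel_flow_def abs_mult mult_ac)
qed (simp add: kernel_flow_def)

text \<open>On the support the displacement is at most u^m \<delta>, and u^m / u \<le> 1, so the
  mass of the flow is at most m \<delta> at every time: transport is cheap for small
  kernels.\<close>

lemma kernel_flow_L1:
  assumes u: "0 < u" "u \<le> 1"
  shows "(LINT z|lborel. norm (kernel_flow m K u (z - x))) \<le> real m * \<delta>"
proof -
  note k = integral_kernel_at[OF m K u(1), of x]
  have "(LINT z|lborel. norm (kernel_flow m K u (z - x))) \<le> (LINT z|lborel. real m * \<delta> * kernel_at m K u (z - x))"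
  proof (rule integral_mono_AE')
    show "integrable lborel (\<lambda>z. real m * \<delta> * kernel_at m K u (z - x))" using k by simp
    show "AE z in lborel. norm (kernel_flow m K u (z - x)) \<le> real m * \<delta> * kernel_at m K u (z - x)"
    proof (rule AE_I2)
      fix z
      have "u^m \<le> u" using u m by (metis One_nat_def Suc_leI less_imp_le power_decreasing power_one_right)
      then have "u^m / u \<le> 1" using u by simp
      then have "(real m * \<delta> * kernel_at m K u (z - x)) * (u^m / u) \<le> (real m * \<delta> * kernel_at m K u (z - x)) * 1"
        using kernel_at_nonneg[OF m K u(1), of "z - x"] kernel_nonneg[OF m K] by (intro mult_left_mono) auto
      then show "norm (kernel_flow m K u (z - x)) \<le> real m * \<delta> * kernel_at m K u (z - x)"
        using norm_kernel_flow_le[OF u, of "z - x"] by simp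
    qed
    show "AE z in lborel. 0 \<le> real m * \<delta> * kernel_at m K u (z - x)"
      using kernel_at_nonneg[OF m K u(1)] kernel_nonneg[OF m K] by auto
  qed
  then show ?thesis using k by simp
qed

text \<open>The flow has size u^(m-1-md) on a ball of volume u^(md), so the integral of its p-th
  power scales like u to the power (m-1-md) p + md. This exponent is nonnegative exactly when p
  \<le> m (p + d - d p), which some \<open>m\<close> satisfies as soon as p + d - d p > 0, that is,
  below the critical exponent d/(d-1).\<close>

lemma kernel_flow_Lp:
  fixes p M u :: real
  assumes p: "1 < p" "p \<le> real m * (p + DIM('a) - DIM('a) * p)" and MK: "0 \<le> M" "\<And>x. \<bar>K x\<bar> \<le> M" and u: "0 < u" "u \<le> 1"
  shows "integrable lborel (\<lambda>z. norm (kernel_flow m K u (z - x)) powr p)"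
    "(LINT z|lborel. norm (kernel_flow m K u (z - x)) powr p) \<le>
      (real m * \<delta> * M) powr p * measure lborel (cball (0::'a) \<delta>)"
proof -
  let ?d = "DIM('a)"
  define A where "A = real m * \<delta> * M * ((1/u)^(m * ?d) / u * u^m)"
  have d0: "0 \<le> \<delta>" by (rule kernel_nonneg[OF m K])
  have bnd: "norm (kernel_flow m K u (z - x)) powr p \<le> A powr p * indicator (cball x (u^m * \<delta>)) z" for z
  proof (cases "z \<in> cball x (u^m * \<delta>)")
    case True
    have "kernel_at m K u (z - x) \<le> (1/u)^(m * ?d) * M"
      unfolding kernel_at_def using MK(2)[of "(1/u)^m *\<^sub>R (z - x)"] u by (intro mult_left_mono) auto
    then have "(real m * \<delta> / u * u^m) * kernel_at m K u (z - x) \<le> (real m * \<delta> / u * u^m) * ((1/u)^(m * ?d) * M)"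
      using d0 u by (intro mult_left_mono) auto
    then have "norm (kernel_flow m K u (z - x)) \<le> A"
      using norm_kernel_flow_le[OF u, of "z - x"] by (simp add: A_def mult_ac)
    then show ?thesis using True p by (simp add: powr_mono2)
  next
    case False
    then have "kernel_at m K u (z - x) = 0"
      using kernel_at_support(2)[OF m K u(1), of "z - x"] by (force simp: dist_norm norm_minus_commute)
    then show ?thesis by (simp add: kernel_flow_def)
  qed
  have ind: "integrable lborel (\<lambda>z. A powr p * indicator (cball x (u^m * \<delta>)) z)"
    by (intro integrable_mult_right integrable_real_indicator) (use emeasure_lborel_cball_finite in auto)
  have meas: "(\<lambda>z. norm (kernel_flow m K u (z - x)) powr p) \<in> borel_measurable lborel"
    using smooth_kernelD(6)[OF m K] unfolding kernel_flow_def kernel_at_def by measurable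
  show "integrable lborel (\<lambda>z. norm (kernel_flow m K u (z - x)) powr p)"
    by (rule Bochner_Integration.integrable_bound[OF ind meas]) (use bnd in auto)
  have "(LINT z|lborel. norm (kernel_flow m K u (z - x)) powr p) \<le> (LINT z|lborel. A powr p * indicator (cball x (u^m * \<delta>)) z)"
    by (rule integral_mono_AE'[OF ind]) (use bnd in auto)
  also have "\<dots> = A powr p * measure lborel (cball x (u^m * \<delta>))" by simp
  also have "measure lborel (cball x (u^m * \<delta>)) = (u^m)^?d * measure lborel (cball (0::'a) \<delta>)"
    using u d0 by (simp add: content_cball power_mult_distrib)
  also have "A powr p = (real m * \<delta> * M) powr p * ((1/u)^(m * ?d) / u * u^m) powr p"
    unfolding A_def by (rule powr_mult)
  also have "\<dots> * ((u^m)^?d * measure lborel (cball (0::'a) \<delta>)) =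
     (real m * \<delta> * M) powr p * measure lborel (cball (0::'a) \<delta>) * (((1/u)^(m * ?d) / u * u^m) powr p * (u^m)^?d)"
    by (simp only: mult_ac)
  also have "\<dots> \<le> (real m * \<delta> * M) powr p * measure lborel (cball (0::'a) \<delta>) * 1"
  proof (rule mult_left_mono)
    have "(1/u)^(m * ?d) / u * u^m = u powr (real m - 1 - real m * ?d)"
      using u by (simp add: powr_diff powr_realpow power_one_over divide_simps flip: of_nat_mult)
    moreover have "(u^m)^?d = u powr (real m * ?d)"
      using u by (simp add: powr_realpow power_mult flip: of_nat_mult)
    ultimately have "((1/u)^(m * ?d) / u * u^m) powr p * (u^m)^?d = u powr ((real m - 1 - real m * ?d) * p + real m * ?d)"
      using u by (simp add: powr_powr powr_add)
    also have "\<dots> \<le> 1"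
    proof (rule powr_le1)
      show "0 \<le> (real m - 1 - real m * ?d) * p + real m * ?d" using p(2) by (simp add: algebra_simps)
    qed (use u in auto)
    finally show "((1/u)^(m * ?d) / u * u^m) powr p * (u^m)^?d \<le> 1" .
  qed simp
  finally show "(LINT z|lborel. norm (kernel_flow m K u (z - x)) powr p) \<le>
      (real m * \<delta> * M) powr p * measure lborel (cball (0::'a) \<delta>)" by simp
qed

text \<open>Superposition of the flows over starting points and times with a signed weight
  \<open>k\<close>: it carries the weight from each \<open>X w\<close> to its smoothed copy. The
  mass bound is linear in \<delta>, while of the L^p norm only finiteness is kept. The geometric
  hypotheses are asked where \<open>k\<close> is nonzero, so that a cutoff can localize
  them.\<close>

lemma transport_field:
  fixes N :: "'w measure" and X :: "'w \<Rightarrow> 'a" and k :: "'w \<Rightarrow> real" and p :: real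
  assumes \<Omega>: "compact \<Omega>" and p: "1 < p" "p \<le> real m * (p + DIM('a) - DIM('a) * p)"
    and N: "finite_measure N" and Xm: "X \<in> borel_measurable N" and km: "k \<in> borel_measurable N"
    and kB: "\<And>w. \<bar>k w\<bar> \<le> B"
    and XO: "\<And>w. k w \<noteq> 0 \<Longrightarrow> X w \<in> \<Omega>"
    and inw: "\<And>w a t. k w \<noteq> 0 \<Longrightarrow> a \<in> supp K \<Longrightarrow> 0 < t \<Longrightarrow> t \<le> 1 \<Longrightarrow> X w + t *\<^sub>R a \<in> interior \<Omega>"
  obtains P where
    "flux_field \<Omega> p P (\<lambda>g G. LINT w|N. k w *
       ((LINT z|lborel. (indicator (interior \<Omega>) z * g z) * K (z - X w)) - g (X w)))"
    "(LINT z|lborel. norm (P z)) \<le> real m * \<delta> * (LINT w|N. \<bar>k w\<bar>)"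
proof -
  interpret N: finite_measure N by fact
  interpret T: prob_space unit_time by (rule prob_space_unit_time)
  interpret NT: pair_sigma_finite N unit_time ..
  note [measurable] = Xm km kernel_measurable(1)[OF m K]
  define F where "F = (\<lambda>(w, u) z. (k w * indicator {0<..1} u) *\<^sub>R kernel_flow m K u (z - X w))"
  define P where "P z = (LINT wu|(N \<Otimes>\<^sub>M unit_time). F wu z)" for z
  have fin: "finite_measure (N \<Otimes>\<^sub>M unit_time)"
    by (rule finite_measure_pair_measure) (unfold_locales)
  have Fm: "(\<lambda>(wu, z). F wu z) \<in> borel_measurable ((N \<Otimes>\<^sub>M unit_time) \<Otimes>\<^sub>M borel)"
    unfolding F_def kernel_flow_def kernel_at_def split_beta' by measurable
  have oU: "open (interior \<Omega>)" "bounded (interior \<Omega>)" using \<Omega> by (auto intro: bounded_interior compact_imp_bounded)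
  have Fz: "F wu z = 0" if "z \<notin> interior \<Omega>" for wu z
  proof (cases wu)
    case (Pair w u)
    show ?thesis
    proof (rule ccontr)
      assume nz: "F wu z \<noteq> 0"
      then have kw: "k w \<noteq> 0" and u: "0 < u" "u \<le> 1" and f: "kernel_flow m K u (z - X w) \<noteq> 0"
        by (auto simp: F_def Pair indicator_def split: if_splits)
      obtain a where a: "a \<in> supp K" "z - X w = u^m *\<^sub>R a"
        using kernel_at_support(1)[OF m K u(1) kernel_flow_nz[OF m K f]] by auto
      have "X w + u^m *\<^sub>R a \<in> interior \<Omega>" by (rule inw[OF kw a(1)]) (use u in \<open>auto simp: power_le_one\<close>)
      then show False using that a(2) by (simp add: diff_eq_eq add.commute)
    qed
  qed
  obtain M where M: "0 \<le> M" "\<And>x. \<bar>K x\<bar> \<le> M" using kernel_bounded[OF m K] by metis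
  have B0: "0 \<le> B" using kB[of undefined] by linarith
  define C where "C = B powr p * ((real m * \<delta> * M) powr p * measure lborel (cball (0::'a) \<delta>))"
  have Fp: "integrable lborel (\<lambda>z. norm (F wu z) powr p)" "(LINT z|lborel. norm (F wu z) powr p) \<le> C" for wu
  proof -
    obtain w u where wu: "wu = (w, u)" by (cases wu)
    have C0: "0 \<le> C" by (simp add: C_def)
    have "integrable lborel (\<lambda>z. norm (F wu z) powr p) \<and> (LINT z|lborel. norm (F wu z) powr p) \<le> C"
    proof (cases "u \<in> {0<..1}")
      case True
      then have u: "0 < u" "u \<le> 1" by auto
      have e: "norm (F wu z) powr p = \<bar>k w\<bar> powr p * norm (kernel_flow m K u (z - X w)) powr p" for z
        using True by (simp add: F_def wu powr_mult)
      have "\<bar>k w\<bar> powr p \<le> B powr p" using kB p by (intro powr_mono2) auto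
      then have "\<bar>k w\<bar> powr p * (LINT z|lborel. norm (kernel_flow m K u (z - X w)) powr p) \<le> C"
        unfolding C_def by (intro mult_mono kernel_flow_Lp(2)[OF p M u]) (auto intro!: Bochner_Integration.integral_nonneg)
      then show ?thesis unfolding e using kernel_flow_Lp(1)[OF p M u] by simp
    qed (use C0 p in \<open>simp add: F_def wu\<close>)
    then show "integrable lborel (\<lambda>z. norm (F wu z) powr p)" "(LINT z|lborel. norm (F wu z) powr p) \<le> C" by auto
  qed
  note S = superposition_field[OF fin p(1) oU Fm Fz Fp, folded P_def]
  have S6: "(LINT z|lborel. P z \<bullet> G z) = (LINT w|N. k w *
       ((LINT z|lborel. (indicator (interior \<Omega>) z * g z) * K (z - X w)) - g (X w)))"
    if w: "weak_test \<Omega> (conj_exp p) g G" for g G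
  proof -
    have [measurable]: "G \<in> borel_measurable borel" and Gp: "integrable lborel (\<lambda>z. norm (G z) powr conj_exp p)"
      using w by (auto simp: weak_test_def)
    let ?A = "\<lambda>x u. LINT z|lborel. G z \<bullet> kernel_flow m K u (z - x)"
    define Q where "Q wu = (LINT z|lborel. F wu z \<bullet> G z)" for wu
    have Qe: "Q (w, u) = k w * (indicator {0<..1} u * ?A (X w) u)" for w u
      by (simp add: Q_def F_def inner_commute mult.assoc)
    have P1: "(LINT z|lborel. P z \<bullet> G z) = (LINT wu|(N \<Otimes>\<^sub>M unit_time). Q wu)"
      and Qi: "integrable (N \<Otimes>\<^sub>M unit_time) Q"
      using S(6)[OF _ _ Gp] by (auto simp: Q_def[abs_def])
    have Am: "(\<lambda>u. ?A x u) \<in> borel_measurable borel" for x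
    proof -
      have "(\<lambda>(u, z). G z \<bullet> kernel_flow m K u (z - x)) \<in> borel_measurable (borel \<Otimes>\<^sub>M lborel)"
        unfolding kernel_flow_def kernel_at_def by measurable
      then show ?thesis by (intro lborel.borel_measurable_lebesgue_integral) simp
    qed
    have Qm: "(\<lambda>u. Q (w, u)) \<in> borel_measurable borel" for w
      unfolding Qe using Am by measurable
    note P1
    also have "(LINT wu|(N \<Otimes>\<^sub>M unit_time). Q wu) = (LINT w|N. (LINT u|unit_time. Q (w, u)))"
      by (rule NT.integral_fst'[OF Qi, symmetric])
    also have "\<dots> = (LINT w|N. k w *
       ((LINT z|lborel. (indicator (interior \<Omega>) z * g z) * K (z - X w)) - g (X w)))"
    proof (rule integral_cong_AE)
      show "(\<lambda>w. LINT u|unit_time. Q (w, u)) \<in> borel_measurable N"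
        using borel_measurable_integrable[OF NT.integrable_fst'[OF Qi]] .
      show "(\<lambda>w. k w * ((LINT z|lborel. (indicator (interior \<Omega>) z * g z) * K (z - X w)) - g (X w))) \<in> borel_measurable N"
      proof -
        let ?H = "\<lambda>z. indicator (interior \<Omega>) z * g z"
        obtain M where Hm[measurable]: "?H \<in> borel_measurable borel"
          using weak_test_bounded[OF m K w \<Omega>] by metis
        have "(\<lambda>(x, z). ?H z * K (z - x)) \<in> borel_measurable (borel \<Otimes>\<^sub>M lborel)" by measurable
        then have [measurable]: "(\<lambda>x. LINT z|lborel. ?H z * K (z - x)) \<in> borel_measurable borel"
          by (intro lborel.borel_measurable_lebesgue_integral) simp
        have [measurable]: "(\<lambda>x. indicator \<Omega> x *\<^sub>R g x) \<in> borel_measurable borel"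
          using w \<Omega> by (intro continuous_on_indicator_borel) (auto simp: weak_test_def compact_imp_closed)
        \<comment> \<open>\<open>g\<close> is continuous on \<Omega> only; the indicator makes the
          composite measurable and changes nothing where \<open>k w\<close> is nonzero.\<close>
        have e: "k w * ((LINT z|lborel. ?H z * K (z - X w)) - g (X w)) =
           k w * ((LINT z|lborel. ?H z * K (z - X w)) - indicator \<Omega> (X w) *\<^sub>R g (X w))" for w
          using XO[of w] by (cases "k w = 0") auto
        show ?thesis unfolding e by measurable
      qed
      show "AE w in N. (LINT u|unit_time. Q (w, u)) =
         k w * ((LINT z|lborel. (indicator (interior \<Omega>) z * g z) * K (z - X w)) - g (X w))"
        using NT.AE_integrable_fst'[OF Qi]
      proof eventually_elim
        fix w assume "integrable unit_time (\<lambda>u. Q (w, u))"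
        then have i: "integrable lborel (\<lambda>u. indicator {0<..1} u * (k w * (indicator {0<..1} u * ?A (X w) u)))"
          unfolding integral_unit_time(2)[OF Qm] unfolding Qe by simp
        have e: "indicator {0<..1} u * (k w * (indicator {0<..1} u * ?A (X w) u)) = k w * (indicator {0<..1} u * ?A (X w) u)" for u
          by (simp add: indicator_def)
        have "(LINT u|unit_time. Q (w, u)) = k w * (LINT u|lborel. indicator {0<..1} u * ?A (X w) u)"
          unfolding integral_unit_time(1)[OF Qm] unfolding Qe real_scaleR_def e by simp
        also have "\<dots> = k w * ((LINT z|lborel. (indicator (interior \<Omega>) z * g z) * K (z - X w)) - g (X w))"
        proof (cases "k w = 0")
          case False
          have "integrable lborel (\<lambda>u. indicator {0<..1} u * ?A (X w) u)"
            using i False unfolding e by simp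
          then show ?thesis
            by (subst kernel_flow_integral[OF m K w \<Omega> XO[OF False]]) (auto intro: inw[OF False])
        qed simp
        finally show "(LINT u|unit_time. Q (w, u)) =
         k w * ((LINT z|lborel. (indicator (interior \<Omega>) z * g z) * K (z - X w)) - g (X w))" .
      qed
    qed
    finally show ?thesis .
  qed
  have "flux_field \<Omega> p P (\<lambda>g G. LINT w|N. k w *
       ((LINT z|lborel. (indicator (interior \<Omega>) z * g z) * K (z - X w)) - g (X w)))"
    unfolding flux_field_def
  proof (intro conjI allI impI)
    show "P \<in> borel_measurable borel" by (rule S(1))
    show "P z = 0" if "z \<notin> interior \<Omega>" for z by (rule S(2)[OF _ that])
    show "integrable lborel (\<lambda>z. norm (P z) powr p)" by (rule S(3))
  qed (rule S6)
  moreover have "(LINT z|lborel. norm (P z)) \<le> real m * \<delta> * (LINT w|N. \<bar>k w\<bar>)"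
  proof -
    have i: "integrable N (\<lambda>w. \<bar>k w\<bar>)" by (rule N.integrable_const_bound[of _ B]) (use kB in auto)
    have i2: "integrable (N \<Otimes>\<^sub>M unit_time) (\<lambda>(w, u). real m * \<delta> * \<bar>k w\<bar>)"
      by (rule NT.Fubini_integrable) (use i in \<open>auto simp: T.prob_space abs_mult\<close>)
    have "(LINT z|lborel. norm (P z)) \<le> (LINT wu|(N \<Otimes>\<^sub>M unit_time). (LINT z|lborel. norm (F wu z)))"
      using S(4)[of "\<lambda>z. 1" 1] by simp
    also have "\<dots> \<le> (LINT wu|(N \<Otimes>\<^sub>M unit_time). (case wu of (w, u) \<Rightarrow> real m * \<delta> * \<bar>k w\<bar>))"
    proof (rule integral_mono[OF _ i2])
      show "integrable (N \<Otimes>\<^sub>M unit_time) (\<lambda>wu. LINT z|lborel. norm (F wu z))"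
        using S(5)[of "\<lambda>z. 1" 1] by simp
      fix wu
      show "(LINT z|lborel. norm (F wu z)) \<le> (case wu of (w, u) \<Rightarrow> real m * \<delta> * \<bar>k w\<bar>)"
      proof (cases wu)
        case (Pair w u)
        show ?thesis
        proof (cases "u \<in> {0<..1}")
          case True
          then have "(LINT z|lborel. norm (F wu z)) = \<bar>k w\<bar> * (LINT z|lborel. norm (kernel_flow m K u (z - X w)))"
            by (simp add: F_def Pair)
          also have "\<dots> \<le> \<bar>k w\<bar> * (real m * \<delta>)"
            by (rule mult_left_mono[OF kernel_flow_L1]) (use True in auto)
          finally show ?thesis by (simp add: Pair mult_ac)
        next
          case False
          then show ?thesis using kernel_nonneg[OF m K] by (simp add: F_def Pair)
        qed
      qed
    qed
    also have "\<dots> = (LINT w|N. (LINT u|unit_time. real m * \<delta> * \<bar>k w\<bar>))"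
      using NT.integral_fst'[OF i2] by simp
    also have "\<dots> = real m * \<delta> * (LINT w|N. \<bar>k w\<bar>)" by (simp add: T.prob_space)
    finally show ?thesis .
  qed
  ultimately show ?thesis using that by blast
qed

text \<open>Convolution of the vector measure k V N, pushed by X, with the kernel. The mass bound is
  kept for an arbitrary weight \<open>v\<close> because the leading part of the cost is read off
  from this field; the transport fields are small and may be estimated crudely.\<close>

lemma smoothing_field:
  fixes N :: "'w measure" and X V :: "'w \<Rightarrow> 'a" and k :: "'w \<Rightarrow> real"
  assumes \<Omega>: "compact \<Omega>" and p: "1 < p"
    and N: "finite_measure N" and Xm: "X \<in> borel_measurable N" and Vm: "V \<in> borel_measurable N" and km: "k \<in> borel_measurable N"
    and kB: "\<And>w. 0 \<le> k w \<and> k w \<le> B" and VB: "\<And>w. norm (V w) \<le> C"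
    and inw: "\<And>w a. k w \<noteq> 0 \<Longrightarrow> a \<in> supp K \<Longrightarrow> X w + a \<in> interior \<Omega>"
  obtains P where
    "flux_field \<Omega> p P (\<lambda>g G. LINT w|N. k w * (V w \<bullet> (LINT z|lborel. K (z - X w) *\<^sub>R G z)))"
    "\<And>v B. v \<in> borel_measurable borel \<Longrightarrow> (\<And>z. 0 \<le> v z \<and> v z \<le> B) \<Longrightarrow>
       (LINT z|lborel. v z * norm (P z)) \<le> (LINT w|N. k w * norm (V w) * (LINT z|lborel. v z * K (z - X w))) \<and>
       integrable N (\<lambda>w. k w * norm (V w) * (LINT z|lborel. v z * K (z - X w)))"
proof -
  interpret N: finite_measure N by fact
  note [measurable] = Xm Vm km kernel_measurable(1)[OF m K]
  define F where "F w z = (k w * K (z - X w)) *\<^sub>R V w" for w z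
  define P where "P z = (LINT w|N. F w z)" for z
  have Fm: "(\<lambda>(w, z). F w z) \<in> borel_measurable (N \<Otimes>\<^sub>M borel)" unfolding F_def by measurable
  have bU: "bounded (interior \<Omega>)" using \<Omega> by (auto intro: bounded_interior compact_imp_bounded)
  have Fz: "F w z = 0" if "z \<notin> interior \<Omega>" for w z
  proof (rule ccontr)
    assume "F w z \<noteq> 0"
    then have "k w \<noteq> 0" "K (z - X w) \<noteq> 0" by (auto simp: F_def)
    then have "X w + (z - X w) \<in> interior \<Omega>" by (intro inw smooth_kernelD(7)[OF m K])
    then show False using that by simp
  qed
  obtain M where M: "0 \<le> M" "\<And>x. \<bar>K x\<bar> \<le> M" using kernel_bounded[OF m K] by metis
  have B0: "0 \<le> B" using kB[of undefined] by linarith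
  have C0: "0 \<le> C" using VB[of undefined] norm_ge_zero[of "V undefined"] by linarith
  have FB: "norm (F w z) \<le> B * M * C" for w z
    unfolding F_def norm_scaleR abs_mult using kB M VB B0 by (intro mult_mono) auto
  have ind: "integrable lborel (\<lambda>z. (B * M * C) powr p * indicator (interior \<Omega>) z)"
  proof (rule integrable_mult_right)
    show "integrable lborel (indicator (interior \<Omega>) :: 'a \<Rightarrow> real)"
      by (rule integrable_lborel_bounded_support[OF _ bU, where M=1]) (auto simp: indicator_def)
  qed
  have Fb: "norm (F w z) powr p \<le> (B * M * C) powr p * indicator (interior \<Omega>) z" for w z
    using FB[of w z] Fz[of z w] p by (cases "z \<in> interior \<Omega>") (auto intro: powr_mono2)
  have Fp: "integrable lborel (\<lambda>z. norm (F w z) powr p)" for w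
    by (rule Bochner_Integration.integrable_bound[OF ind]) (use Fb in \<open>auto simp: F_def\<close>)
  have Fp2: "(LINT z|lborel. norm (F w z) powr p) \<le> (LINT z|lborel. (B * M * C) powr p * indicator (interior \<Omega>) z)" for w
    by (rule integral_mono[OF Fp ind Fb])
  note S = superposition_field[OF N p open_interior bU Fm Fz Fp Fp2, folded P_def]
  have "(LINT z|lborel. P z \<bullet> G z) = (LINT w|N. k w * (V w \<bullet> (LINT z|lborel. K (z - X w) *\<^sub>R G z)))"
    if w: "weak_test \<Omega> (conj_exp p) g G" for g G
  proof -
    have Gm[measurable]: "G \<in> borel_measurable borel" and Gp: "integrable lborel (\<lambda>z. norm (G z) powr conj_exp p)"
      and Gi: "integrable lborel G"
      using w by (auto simp: weak_test_def)
    have i: "integrable lborel (\<lambda>z. K (z - x) *\<^sub>R G z)" for x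
      by (rule Bochner_Integration.integrable_bound[OF integrable_mult_right[OF integrable_norm[OF Gi], of M]])
         (use M in \<open>auto intro!: mult_right_mono AE_I2\<close>)
    have "(LINT z|lborel. F w z \<bullet> G z) = k w * (V w \<bullet> (LINT z|lborel. K (z - X w) *\<^sub>R G z))" for w
      by (subst integral_inner_right[symmetric, OF i]) (simp add: F_def mult_ac)
    then show ?thesis using S(6)[OF _ Gm Gp] by simp
  qed
  note S6 = this
  have "flux_field \<Omega> p P (\<lambda>g G. LINT w|N. k w * (V w \<bullet> (LINT z|lborel. K (z - X w) *\<^sub>R G z)))"
    unfolding flux_field_def
  proof (intro conjI allI impI)
    show "P \<in> borel_measurable borel" by (rule S(1))
    show "P z = 0" if "z \<notin> interior \<Omega>" for z by (rule S(2)[OF _ that])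
    show "integrable lborel (\<lambda>z. norm (P z) powr p)" by (rule S(3))
  qed (rule S6)
  moreover have "(LINT z|lborel. v z * norm (P z)) \<le> (LINT w|N. k w * norm (V w) * (LINT z|lborel. v z * K (z - X w))) \<and>
       integrable N (\<lambda>w. k w * norm (V w) * (LINT z|lborel. v z * K (z - X w)))"
    if v: "v \<in> borel_measurable borel" "\<And>z. 0 \<le> v z \<and> v z \<le> B'" for v B'
  proof -
    have "(LINT z|lborel. v z * norm (F w z)) = k w * norm (V w) * (LINT z|lborel. v z * K (z - X w))" for w
    proof -
      have "v z * norm (F w z) = k w * norm (V w) * (v z * K (z - X w))" for z
        using kB[of w] smooth_kernelD(2)[OF m K, of "z - X w"] by (simp add: F_def abs_mult mult_ac)
      then have "(LINT z|lborel. v z * norm (F w z)) = (LINT z|lborel. k w * norm (V w) * (v z * K (z - X w)))"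
        by (intro Bochner_Integration.integral_cong refl)
      then show ?thesis by simp
    qed
    then show ?thesis using S(4)[OF _ v] S(5)[OF _ v] by simp
  qed
  ultimately show ?thesis using that by blast
qed

end

subsection \<open>Competitors in the regularized problem\<close>

lemma compact_continuous_bound:
  fixes f :: "'a::euclidean_space \<Rightarrow> 'b::real_normed_vector"
  assumes "compact \<Omega>" "continuous_on \<Omega> f"
  obtains M where "0 \<le> M" "\<And>x. x \<in> \<Omega> \<Longrightarrow> norm (f x) \<le> M"
proof -
  have "compact (f ` \<Omega>)" by (rule compact_continuous_image[OF assms(2,1)])
  then obtain B where "\<And>y. y \<in> f ` \<Omega> \<Longrightarrow> norm y \<le> B" using compact_imp_bounded bounded_iff by metis
  then have "norm (f x) \<le> max B 0" if "x \<in> \<Omega>" for x using that by (meson image_eqI le_max_iff_disj)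
  then show ?thesis using that[of "max B 0"] by simp
qed

lemma continuous_comp_measurable:
  fixes f :: "'a::euclidean_space \<Rightarrow> 'b::euclidean_space"
  assumes X: "X \<in> borel_measurable N" "\<And>w. w \<in> space N \<Longrightarrow> X w \<in> \<Omega>"
    and \<Omega>: "compact \<Omega>" and f: "continuous_on \<Omega> f"
  shows "(\<lambda>w. f (X w)) \<in> borel_measurable N"
proof -
  have "(\<lambda>x. indicator \<Omega> x *\<^sub>R f x) \<in> borel_measurable borel"
    using f \<Omega> by (intro continuous_on_indicator_borel) (auto simp: compact_imp_closed)
  then have "(\<lambda>w. indicator \<Omega> (X w) *\<^sub>R f (X w)) \<in> borel_measurable N"
    using X(1) by (rule measurable_compose[rotated])
  then show ?thesis by (rule measurable_cong[THEN iffD1, rotated]) (use X(2) in auto)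
qed

lemma integrable_continuous_inner:
  fixes f :: "'a::euclidean_space \<Rightarrow> 'b::euclidean_space"
  assumes N: "finite_measure N" and X: "X \<in> borel_measurable N" "\<And>w. w \<in> space N \<Longrightarrow> X w \<in> \<Omega>"
    and \<Omega>: "compact \<Omega>" and f: "continuous_on \<Omega> f"
    and V: "V \<in> borel_measurable N" "\<And>w. norm (V w) \<le> C"
  shows "integrable N (\<lambda>w. f (X w) \<bullet> V w)"
proof -
  interpret finite_measure N by fact
  note [measurable] = continuous_comp_measurable[OF X \<Omega> f] V(1)
  obtain M where M: "0 \<le> M" "\<And>x. x \<in> \<Omega> \<Longrightarrow> norm (f x) \<le> M" using compact_continuous_bound[OF \<Omega> f] by metis
  show ?thesis
  proof (rule integrable_const_bound[of _ "M * C"])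
    show "AE w in N. norm (f (X w) \<bullet> V w) \<le> M * C"
    proof (rule AE_I2)
      fix w assume "w \<in> space N"
      have "\<bar>f (X w) \<bullet> V w\<bar> \<le> norm (f (X w)) * norm (V w)" by (rule Cauchy_Schwarz_ineq2)
      also have "\<dots> \<le> M * C" by (rule mult_mono) (use M X(2) \<open>w \<in> space N\<close> V(2) in auto)
      finally show "norm (f (X w) \<bullet> V w) \<le> M * C" by simp
    qed
  qed measurable
qed

lemma integrable_continuous_comp:
  fixes f :: "'a::euclidean_space \<Rightarrow> real"
  assumes "finite_measure N" "X \<in> borel_measurable N" "\<And>w. w \<in> space N \<Longrightarrow> X w \<in> \<Omega>"
    "compact \<Omega>" "continuous_on \<Omega> f"
  shows "integrable N (\<lambda>w. f (X w))"
  using integrable_continuous_inner[OF assms(1,2) _ assms(4,5), of "\<lambda>_. 1" 1] assms(3) by simp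

lemma flux_field_cong:
  assumes "flux_field \<Omega> p P L" "\<And>g G. weak_test \<Omega> (conj_exp p) g G \<Longrightarrow> L g G = L' g G"
  shows "flux_field \<Omega> p P L'"
  using assms by (simp add: flux_field_def)

lemma smooth_kernel_translate:
  assumes k: "smooth_kernel \<delta> k"
  shows "smooth_kernel (\<delta> + norm c) (\<lambda>y. k (y - c))" "\<And>a. a \<in> supp (\<lambda>y. k (y - c)) \<Longrightarrow> a - c \<in> supp k"
proof -
  have k: "k \<in> Cc_infinity UNIV" "\<And>x. 0 \<le> k x" "(LINT x|lborel. k x) = 1" "\<And>x. x \<in> supp k \<Longrightarrow> norm x \<le> \<delta>"
    using k by (auto simp: smooth_kernel_def)
  note D = Cc_infinityD[OF k(1)]
  let ?S = "(\<lambda>y. y + c) ` supp k"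
  have S: "compact ?S" by (intro compact_continuous_image continuous_intros D(2))
  have nz: "x \<in> ?S" if "k (x - c) \<noteq> 0" for x
    using D(4)[OF that] by (intro image_eqI[of _ _ "x - c"]) auto
  have "(\<lambda>y. k (y - c)) \<in> Cc_infinity UNIV"
  proof (rule Cc_infinityI[OF _ S _ nz])
    show "Ck j (\<lambda>y. k (y - c))" for j using Ck_affine[OF D(1), of j 1 "- c"] by simp
  qed auto
  moreover have "supp (\<lambda>y. k (y - c)) \<subseteq> ?S" unfolding supp_def[of "\<lambda>y. k (y - c)"] support_on_def
    by (rule closure_minimal) (use nz S in \<open>auto simp: compact_imp_closed\<close>)
  then show a: "a - c \<in> supp k" if "a \<in> supp (\<lambda>y. k (y - c))" for a using that by auto
  moreover have "(LINT x|lborel. k (x - c)) = 1"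
    using integral_lborel_translate[of k "- c"] borel_measurable_continuous_onI[OF D(5)] k(3) by simp
  moreover have "norm x \<le> \<delta> + norm c" if "x \<in> supp (\<lambda>y. k (y - c))" for x
    using k(4)[OF a[OF that]] norm_triangle_sub[of x c] by simp
  ultimately show "smooth_kernel (\<delta> + norm c) (\<lambda>y. k (y - c))" using k(2) by (simp add: smooth_kernel_def)
qed

text \<open>A mollifier of radius s \<rho> moved to s e is supported in s times the ball of radius
  \<rho> around e, hence in the cone of inner directions, and so are its dilates by t \<le> 1. The
  radius r is chosen before \<delta>, since cover and cutoffs are fixed before \<delta>.\<close>

lemma inward_kernels:
  fixes \<Omega> :: "'a::euclidean_space set"
  assumes \<Omega>: "compact \<Omega>" "bounded_lipschitz_domain (interior \<Omega>)" "strictly_star_shaped \<Omega>" and x: "x \<in> \<Omega>"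
    and moll: "\<And>r. 0 < r \<Longrightarrow> \<exists>k. k \<in> Cc_infinity (UNIV :: 'a set) \<and> (\<forall>x. 0 \<le> k x) \<and> (LINT x|lborel. k x) = 1 \<and> supp k \<subseteq> ball 0 r"
  shows "\<exists>r>0. \<forall>\<delta>>0. \<exists>K. smooth_kernel \<delta> K \<and>
    (\<forall>z\<in>\<Omega> \<inter> ball x r. \<forall>a\<in>supp K. \<forall>t. 0 < t \<and> t \<le> 1 \<longrightarrow> z + t *\<^sub>R a \<in> interior \<Omega>)"
proof -
  obtain r \<rho> h e where r: "0 < r" and \<rho>: "0 < \<rho>" and h: "0 < h" and e: "norm e \<le> 1"
    and cone: "\<forall>z\<in>\<Omega> \<inter> ball x r. \<forall>t. 0 < t \<and> t \<le> h \<longrightarrow> (\<forall>v\<in>ball e \<rho>. z + t *\<^sub>R v \<in> interior \<Omega>)"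
    using interior_cone_at[OF \<Omega> x] by metis
  have "\<exists>K. smooth_kernel \<delta> K \<and>
    (\<forall>z\<in>\<Omega> \<inter> ball x r. \<forall>a\<in>supp K. \<forall>t. 0 < t \<and> t \<le> 1 \<longrightarrow> z + t *\<^sub>R a \<in> interior \<Omega>)" if \<delta>: "0 < \<delta>" for \<delta>
  proof -
    \<comment> \<open>The bound by h keeps the steps short enough for the cone, and s (1 + \<rho>)
      \<le> \<delta> controls the support of the shifted kernel.\<close>
    define s where "s = min h (\<delta> / (1 + \<rho>))"
    have s: "0 < s" "s \<le> h" using h \<rho> \<delta> by (auto simp: s_def)
    have "s \<le> \<delta> / (1 + \<rho>)" by (simp add: s_def)
    then have s3: "s * (1 + \<rho>) \<le> \<delta>" using \<rho> by (simp add: pos_le_divide_eq)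
    obtain k :: "'a \<Rightarrow> real" where k: "k \<in> Cc_infinity UNIV" "\<forall>x. 0 \<le> k x" "(LINT x|lborel. k x) = 1" "supp k \<subseteq> ball 0 (s * \<rho>)"
      using moll[of "s * \<rho>"] s \<rho> by auto
    have k': "smooth_kernel (s * \<rho>) k" unfolding smooth_kernel_def using k by (auto simp: subset_iff less_imp_le)
    define K where "K = (\<lambda>y. k (y - s *\<^sub>R e))"
    have "smooth_kernel (s * \<rho> + norm (s *\<^sub>R e)) K" unfolding K_def by (rule smooth_kernel_translate(1)[OF k'])
    moreover have "s * \<rho> + norm (s *\<^sub>R e) \<le> \<delta>"
    proof -
      have "norm (s *\<^sub>R e) \<le> s * 1" using s(1) e by (simp add: mult_left_le)
      then show ?thesis using s3 by (simp add: distrib_left)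
    qed
    ultimately have "smooth_kernel \<delta> K" unfolding smooth_kernel_def by fastforce
    moreover have "z + t *\<^sub>R a \<in> interior \<Omega>" if z: "z \<in> \<Omega> \<inter> ball x r" and a: "a \<in> supp K" and t: "0 < t" "t \<le> 1" for z a t
    proof -
      have "a - s *\<^sub>R e \<in> supp k" using smooth_kernel_translate(2)[OF k'] a unfolding K_def by blast
      then have "norm (a - s *\<^sub>R e) < s * \<rho>" using k(4) by auto
      moreover have "a - s *\<^sub>R e = s *\<^sub>R ((1/s) *\<^sub>R a - e)" using s(1) by (simp add: scaleR_diff_right)
      ultimately have "norm ((1/s) *\<^sub>R a - e) < \<rho>" using s(1) by simp
      then have "(1/s) *\<^sub>R a \<in> ball e \<rho>" by (simp add: dist_norm norm_minus_commute)
      moreover have "t * s \<le> 1 * s" by (rule mult_right_mono) (use t s in auto)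
      then have "t * s \<le> h" using s by linarith
      moreover have "0 < t * s" using t s by simp
      ultimately have "z + (t * s) *\<^sub>R ((1/s) *\<^sub>R a) \<in> interior \<Omega>" using cone z by blast
      then show ?thesis using s(1) by simp
    qed
    ultimately show ?thesis by blast
  qed
  then show ?thesis using r by blast
qed

text \<open>Let Ph be the average of g under the kernel. Testing the constraint with c Ph expresses
  the pairing of the smoothed piece, which is the integral of c grad Ph against the vector measure,
  through Ph tested with c \<mu> and with grad c times the vector measure. Three transport fields
  replace Ph by g in these terms. There remain -c \<mu> and the grad c term, both tested with g
  itself; the latter cancels after summation over the cutoffs. Only the smoothed piece carries
  leading cost, the transports cost a multiple of \<delta>.\<close>

lemma local_competitor:
  fixes \<Omega> :: "'a::euclidean_space set" and N :: "'w measure" and X V :: "'w \<Rightarrow> 'a" and p :: real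
  assumes \<Omega>: "compact \<Omega>" and p: "1 < p" "p \<le> real m * (p + DIM('a) - DIM('a) * p)"
    and m: "0 < m" and K: "smooth_kernel \<delta> K"
    and \<mu>p: "prob_space \<mu>p" "sets \<mu>p = sets (restrict_space borel \<Omega>)"
    and \<mu>m: "prob_space \<mu>m" "sets \<mu>m = sets (restrict_space borel \<Omega>)"
    and N: "finite_measure N" and X: "X \<in> borel_measurable N" "\<And>w. w \<in> space N \<Longrightarrow> X w \<in> \<Omega>"
    and V: "V \<in> borel_measurable N" "\<And>w. norm (V w) \<le> C"
    and dv: "\<And>\<phi> G. C1_on \<Omega> \<phi> G \<Longrightarrow>
        - (LINT w|N. G (X w) \<bullet> V w) = (LINT x|\<mu>p. \<phi> x) - (LINT x|\<mu>m. \<phi> x)"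
    and c: "continuous_on \<Omega> c" "continuous_on \<Omega> dc" "\<And>x. x \<in> \<Omega> \<Longrightarrow> GDERIV c x :> dc x"
      "\<And>x. x \<in> \<Omega> \<Longrightarrow> 0 \<le> c x \<and> c x \<le> 1"
    and inw: "\<And>x a t. x \<in> \<Omega> \<Longrightarrow> c x \<noteq> 0 \<or> dc x \<noteq> 0 \<Longrightarrow> a \<in> supp K \<Longrightarrow> 0 < t \<Longrightarrow> t \<le> 1 \<Longrightarrow> x + t *\<^sub>R a \<in> interior \<Omega>"
    and v: "v \<in> borel_measurable borel" "\<And>z. 0 \<le> v z \<and> v z \<le> B"
    and om: "continuous_on \<Omega> om" "\<And>x z. x \<in> \<Omega> \<Longrightarrow> z \<in> \<Omega> \<Longrightarrow> dist z x \<le> \<delta> \<Longrightarrow> v z \<le> om x"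
  obtains P where
    "flux_field \<Omega> p P (\<lambda>g G. - (LINT x|\<mu>p. c x * g x) + (LINT x|\<mu>m. c x * g x) - (LINT w|N. (g (X w) *\<^sub>R dc (X w)) \<bullet> V w))"
    "(LINT z|lborel. v z * norm (P z)) \<le> (LINT w|N. c (X w) * norm (V w) * om (X w)) +
       B * (real m * \<delta> * (2 + (LINT w|N. \<bar>dc (X w) \<bullet> V w\<bar>)))"
proof -
  interpret N: finite_measure N by fact
  interpret p: prob_space \<mu>p by fact
  interpret m: prob_space \<mu>m by fact
  have spp: "space \<mu>p = \<Omega>" "space \<mu>m = \<Omega>" using sets_eq_imp_space_eq[OF \<mu>p(2)] sets_eq_imp_space_eq[OF \<mu>m(2)] by auto
  have "(\<lambda>x. x) \<in> borel_measurable (restrict_space borel \<Omega>)" by (rule measurable_restrict_space1) simp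
  then have id: "(\<lambda>x. x) \<in> borel_measurable \<mu>p" "(\<lambda>x. x) \<in> borel_measurable \<mu>m"
    by (simp_all add: measurable_cong_sets[OF \<mu>p(2) refl] measurable_cong_sets[OF \<mu>m(2) refl])
  have intp: "integrable \<mu>p f" and intm: "integrable \<mu>m f" if "continuous_on \<Omega> f" for f :: "'a \<Rightarrow> real"
    using integrable_continuous_comp[OF p.finite_measure_axioms id(1) _ \<Omega> that]
      integrable_continuous_comp[OF m.finite_measure_axioms id(2) _ \<Omega> that] spp by auto
  have intN: "integrable N (\<lambda>w. f (X w) \<bullet> V w)" if "continuous_on \<Omega> f" for f :: "'a \<Rightarrow> 'a"
    by (rule integrable_continuous_inner[OF N X \<Omega> that V])
  note KD = smooth_kernelD[OF m K]
  obtain Md where Md: "0 \<le> Md" "\<And>x. x \<in> \<Omega> \<Longrightarrow> norm (dc x) \<le> Md" using compact_continuous_bound[OF \<Omega> c(2)] by metis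
  have C0: "0 \<le> C" using V(2)[of undefined] norm_ge_zero[of "V undefined"] by linarith
  define k where "k x = indicator \<Omega> x * c x" for x
  define k3 where "k3 w = indicator (space N) w * (dc (X w) \<bullet> V w)" for w
  have km: "k \<in> borel_measurable borel"
    unfolding k_def using continuous_on_indicator_borel[OF _ c(1)] \<Omega> by (simp add: compact_imp_closed)
  have kb: "0 \<le> k x \<and> k x \<le> 1" for x using c(4)[of x] by (simp add: k_def indicator_def)
  have kp: "k \<in> borel_measurable \<mu>p" "k \<in> borel_measurable \<mu>m"
    using measurable_compose[OF id(1) km] measurable_compose[OF id(2) km] by auto
  have kX: "(\<lambda>w. indicator (space N) w * k (X w)) \<in> borel_measurable N"
    using measurable_compose[OF X(1) km] by measurable
  have k3m: "k3 \<in> borel_measurable N"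
    unfolding k3_def using borel_measurable_integrable[OF intN[OF c(2)]] by measurable
  have k3b: "\<bar>k3 w\<bar> \<le> Md * C" for w
  proof (cases "w \<in> space N")
    case True
    have "\<bar>dc (X w) \<bullet> V w\<bar> \<le> norm (dc (X w)) * norm (V w)" by (rule Cauchy_Schwarz_ineq2)
    also have "\<dots> \<le> Md * C" by (rule mult_mono) (use Md X(2)[OF True] V(2) in auto)
    finally show ?thesis using True by (simp add: k3_def)
  qed (use Md C0 in \<open>simp add: k3_def\<close>)
  have inwk: "x + t *\<^sub>R a \<in> interior \<Omega>" if "k x \<noteq> 0" "a \<in> supp K" "0 < t" "t \<le> 1" for x a t
    by (rule inw) (use that in \<open>auto simp: k_def indicator_def split: if_splits\<close>)
  have kO: "x \<in> \<Omega>" if "k x \<noteq> 0" for x using that by (auto simp: k_def indicator_def split: if_splits)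
  obtain P0 where P0: "flux_field \<Omega> p P0 (\<lambda>g G. LINT w|N. indicator (space N) w * k (X w) * (V w \<bullet> (LINT z|lborel. K (z - X w) *\<^sub>R G z)))"
    and P0b: "\<And>v B. v \<in> borel_measurable borel \<Longrightarrow> (\<And>z. 0 \<le> v z \<and> v z \<le> B) \<Longrightarrow>
       (LINT z|lborel. v z * norm (P0 z)) \<le> (LINT w|N. indicator (space N) w * k (X w) * norm (V w) * (LINT z|lborel. v z * K (z - X w))) \<and>
       integrable N (\<lambda>w. indicator (space N) w * k (X w) * norm (V w) * (LINT z|lborel. v z * K (z - X w)))"
  proof (rule smoothing_field[OF m K \<Omega> p(1) N X(1) V(1) kX, of 1 C])
    show "0 \<le> indicator (space N) w * k (X w) \<and> indicator (space N) w * k (X w) \<le> 1" for w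
      using kb[of "X w"] by (simp add: indicator_def)
    show "X w + a \<in> interior \<Omega>" if "indicator (space N) w * k (X w) \<noteq> 0" "a \<in> supp K" for w a
      using inwk[of "X w" a 1] that by simp
  qed (rule V(2), blast)
  obtain P1 where P1: "flux_field \<Omega> p P1 (\<lambda>g G. LINT x|\<mu>p. k x *
       ((LINT z|lborel. (indicator (interior \<Omega>) z * g z) * K (z - x)) - g x))"
    and P1b: "(LINT z|lborel. norm (P1 z)) \<le> real m * \<delta> * (LINT x|\<mu>p. \<bar>k x\<bar>)"
    by (rule transport_field[OF m K \<Omega> p p.finite_measure_axioms id(1) kp(1), of 1])
       (use kb in \<open>auto intro: inwk kO\<close>)
  obtain P2 where P2: "flux_field \<Omega> p P2 (\<lambda>g G. LINT x|\<mu>m. - k x *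
       ((LINT z|lborel. (indicator (interior \<Omega>) z * g z) * K (z - x)) - g x))"
    and P2b: "(LINT z|lborel. norm (P2 z)) \<le> real m * \<delta> * (LINT x|\<mu>m. \<bar>- k x\<bar>)"
    by (rule transport_field[OF m K \<Omega> p m.finite_measure_axioms id(2) borel_measurable_uminus[OF kp(2)], of 1])
       (use kb in \<open>auto intro: inwk kO\<close>)
  obtain P3 where P3: "flux_field \<Omega> p P3 (\<lambda>g G. LINT w|N. k3 w *
       ((LINT z|lborel. (indicator (interior \<Omega>) z * g z) * K (z - X w)) - g (X w)))"
    and P3b: "(LINT z|lborel. norm (P3 z)) \<le> real m * \<delta> * (LINT w|N. \<bar>k3 w\<bar>)"
  proof (rule transport_field[OF m K \<Omega> p N X(1) k3m k3b])
    show "X w \<in> \<Omega>" if "k3 w \<noteq> 0" for w using that X(2) by (auto simp: k3_def indicator_def split: if_splits)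
    show "X w + t *\<^sub>R a \<in> interior \<Omega>" if "k3 w \<noteq> 0" "a \<in> supp K" "0 < t" "t \<le> 1" for w a t
      by (rule inw) (use that X(2) in \<open>auto simp: k3_def indicator_def split: if_splits\<close>)
  qed blast
  define P where "P z = P0 z + (P1 z + (P2 z + P3 z))" for z
  have P: "flux_field \<Omega> p P (\<lambda>g G. (LINT w|N. indicator (space N) w * k (X w) * (V w \<bullet> (LINT z|lborel. K (z - X w) *\<^sub>R G z))) +
     ((LINT x|\<mu>p. k x * ((LINT z|lborel. (indicator (interior \<Omega>) z * g z) * K (z - x)) - g x)) +
     ((LINT x|\<mu>m. - k x * ((LINT z|lborel. (indicator (interior \<Omega>) z * g z) * K (z - x)) - g x)) +
     (LINT w|N. k3 w * ((LINT z|lborel. (indicator (interior \<Omega>) z * g z) * K (z - X w)) - g (X w))))))"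
    unfolding P_def by (intro flux_field_add P0 P1 P2 P3 p(1))
  have L: "(LINT w|N. indicator (space N) w * k (X w) * (V w \<bullet> (LINT z|lborel. K (z - X w) *\<^sub>R G z))) +
     ((LINT x|\<mu>p. k x * ((LINT z|lborel. (indicator (interior \<Omega>) z * g z) * K (z - x)) - g x)) +
     ((LINT x|\<mu>m. - k x * ((LINT z|lborel. (indicator (interior \<Omega>) z * g z) * K (z - x)) - g x)) +
     (LINT w|N. k3 w * ((LINT z|lborel. (indicator (interior \<Omega>) z * g z) * K (z - X w)) - g (X w)))))
    = - (LINT x|\<mu>p. c x * g x) + (LINT x|\<mu>m. c x * g x) - (LINT w|N. (g (X w) *\<^sub>R dc (X w)) \<bullet> V w)"
    if w: "weak_test \<Omega> (conj_exp p) g G" for g G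
  proof -
    let ?H = "\<lambda>z. indicator (interior \<Omega>) z * g z"
    define Ph where "Ph x = (LINT z|lborel. ?H z * K (z - x))" for x
    define Ga where "Ga x = (\<Sum>b\<in>Basis. - (LINT z|lborel. ?H z * frechet_derivative K (at (z - x)) b) *\<^sub>R b)" for x
    have gc: "continuous_on \<Omega> g" and Gi: "integrable lborel G" using w by (auto simp: weak_test_def)
    obtain M where M: "0 \<le> M" "\<And>z. \<bar>?H z\<bar> \<le> M" and Hm: "?H \<in> borel_measurable borel"
      using weak_test_bounded[OF m K w \<Omega>] by metis
    have Hi: "integrable lborel ?H"
      by (rule integrable_lborel_bounded_support[OF Hm bounded_interior[OF compact_imp_bounded[OF \<Omega>]]]) (use M in auto)
    obtain MK where MK0: "0 \<le> MK" and MK: "\<And>x. \<bar>K x\<bar> \<le> MK" using kernel_bounded[OF m K] by metis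
    have Phc: "continuous_on \<Omega> Ph" unfolding Ph_def
      by (rule continuous_on_subset[OF continuous_on_convolution[OF Hi KD(5) MK]]) simp
    have Gac: "continuous_on \<Omega> Ga"
      unfolding Ga_def
    proof (intro continuous_intros)
      fix b :: 'a assume b: "b \<in> Basis"
      obtain M' where M': "\<And>y. \<bar>frechet_derivative K (at y) b\<bar> \<le> M'"
        using compact_support_bounded[OF Cc_infinityD(7)[OF KD(1) b] Cc_infinityD(2)[OF KD(1)]]
          frechet_derivative_eq_0_outside_supp[OF KD(1)] by (metis real_norm_def)
      show "continuous_on \<Omega> (\<lambda>x. LINT z|lborel. ?H z * frechet_derivative K (at (z - x)) b)"
        by (rule continuous_on_subset[OF continuous_on_convolution[OF Hi Cc_infinityD(7)[OF KD(1) b] M']]) simp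
    qed
    have Gad: "GDERIV Ph x :> Ga x" for x
      unfolding Ph_def Ga_def by (rule GDERIV_convolution[OF KD(1) Hi])
    \<comment> \<open>Where \<open>k x\<close> is nonzero the shifted kernel is a test function for
      the interior, so averaging \<open>G\<close> gives the gradient of the average of
      \<open>g\<close>. At the remaining points the weight is 0.\<close>
    have Ge: "(LINT z|lborel. K (z - x) *\<^sub>R G z) = Ga x" if x: "k x \<noteq> 0" for x
    proof (rule euclidean_eqI)
      fix b :: 'a assume b: "b \<in> Basis"
      have i: "integrable lborel (\<lambda>z. K (z - x) *\<^sub>R G z)"
        by (rule Bochner_Integration.integrable_bound[OF integrable_mult_right[OF integrable_norm[OF Gi], of MK]])
           (use MK MK0 KD(6) Gi in \<open>auto simp: abs_mult intro!: mult_right_mono AE_I2\<close>)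
      have t: "(\<lambda>z. K (z - x)) \<in> Cc_infinity (interior \<Omega>)"
      proof (rule Cc_infinityI[where S="(\<lambda>a. x + a) ` supp K"])
        show "Ck j (\<lambda>z. K (z - x))" for j using Ck_affine[OF Cc_infinityD(1)[OF KD(1)], of j 1 "- x"] by simp
        show "compact ((\<lambda>a. x + a) ` supp K)"
          by (intro compact_continuous_image continuous_intros Cc_infinityD(2)[OF KD(1)])
        show "(\<lambda>a. x + a) ` supp K \<subseteq> interior \<Omega>" using inwk[OF x, of _ 1] by auto
        show "z \<in> (\<lambda>a. x + a) ` supp K" if "K (z - x) \<noteq> 0" for z
          using KD(7)[OF that] by (intro image_eqI[of _ _ "z - x"]) auto
      qed
      have fd: "frechet_derivative (\<lambda>z. K (z - x)) (at z) b = frechet_derivative K (at (z - x)) b" for z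
        using fun_cong[OF frechet_derivative_at[OF has_derivative_frechet_affine[of K 1 z "- x"]], of b]
          Cc_infinityD(6)[OF KD(1)] by simp
      have "(LINT z|lborel. K (z - x) *\<^sub>R G z) \<bullet> b = (LINT z|lborel. (G z \<bullet> b) * K (z - x))"
        by (subst integral_inner_left[symmetric, OF i]) (simp add: mult.commute)
      also have "\<dots> = - (LINT z|lborel. ?H z * frechet_derivative (\<lambda>z. K (z - x)) (at z) b)"
        using w t b unfolding weak_test_def by simp
      also have "\<dots> = Ga x \<bullet> b"
        unfolding fd Ga_def using b by (simp add: inner_sum_left inner_Basis if_distrib cong: if_cong)
      finally show "(LINT z|lborel. K (z - x) *\<^sub>R G z) \<bullet> b = Ga x \<bullet> b" .
    qed
    \<comment> \<open>The cutoff times the average is C^1 up to the boundary although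
      \<open>g\<close> need not be differentiable; this is the one test function inserted into the
      constraint.\<close>
    have C1: "C1_on \<Omega> (\<lambda>x. c x * Ph x) (\<lambda>x. c x *\<^sub>R Ga x + Ph x *\<^sub>R dc x)"
      unfolding C1_on_def
    proof (intro conjI ballI)
      show "continuous_on \<Omega> (\<lambda>x. c x * Ph x)" "continuous_on \<Omega> (\<lambda>x. c x *\<^sub>R Ga x + Ph x *\<^sub>R dc x)"
        by (intro continuous_intros c Phc Gac)+
      show "GDERIV (\<lambda>x. c x * Ph x) x :> c x *\<^sub>R Ga x + Ph x *\<^sub>R dc x" if "x \<in> interior \<Omega>" for x
        by (rule GDERIV_mult[OF c(3) Gad]) (use that interior_subset in blast)
    qed
    have i1: "integrable N (\<lambda>w. (c (X w) *\<^sub>R Ga (X w)) \<bullet> V w)" by (intro intN continuous_intros c Gac)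
    have i2: "integrable N (\<lambda>w. (Ph (X w) *\<^sub>R dc (X w)) \<bullet> V w)" by (intro intN continuous_intros c Phc)
    have i3: "integrable N (\<lambda>w. (g (X w) *\<^sub>R dc (X w)) \<bullet> V w)" by (intro intN continuous_intros c gc)
    have "- (LINT w|N. (c (X w) *\<^sub>R Ga (X w) + Ph (X w) *\<^sub>R dc (X w)) \<bullet> V w) = (LINT x|\<mu>p. c x * Ph x) - (LINT x|\<mu>m. c x * Ph x)"
      by (rule dv[OF C1])
    then have D: "- (LINT w|N. (c (X w) *\<^sub>R Ga (X w)) \<bullet> V w) - (LINT w|N. (Ph (X w) *\<^sub>R dc (X w)) \<bullet> V w)
        = (LINT x|\<mu>p. c x * Ph x) - (LINT x|\<mu>m. c x * Ph x)"
      using i1 i2 by (simp add: inner_add_left)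
    have T0: "(LINT w|N. indicator (space N) w * k (X w) * (V w \<bullet> (LINT z|lborel. K (z - X w) *\<^sub>R G z))) =
      (LINT w|N. (c (X w) *\<^sub>R Ga (X w)) \<bullet> V w)"
    proof (rule Bochner_Integration.integral_cong[OF refl])
      fix w assume w: "w \<in> space N"
      show "indicator (space N) w * k (X w) * (V w \<bullet> (LINT z|lborel. K (z - X w) *\<^sub>R G z)) = (c (X w) *\<^sub>R Ga (X w)) \<bullet> V w"
        using w X(2)[OF w] Ge[of "X w"] by (cases "k (X w) = 0") (auto simp: k_def inner_commute)
    qed
    have T1: "(LINT x|\<mu>p. k x * (Ph x - g x)) = (LINT x|\<mu>p. c x * Ph x) - (LINT x|\<mu>p. c x * g x)"
    proof -
      have "(LINT x|\<mu>p. k x * (Ph x - g x)) = (LINT x|\<mu>p. c x * Ph x - c x * g x)"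
        by (rule Bochner_Integration.integral_cong) (auto simp: spp k_def algebra_simps)
      then show ?thesis using intp[of "\<lambda>x. c x * Ph x"] intp[of "\<lambda>x. c x * g x"] c(1) Phc gc
        by (simp add: continuous_on_mult)
    qed
    have T2: "(LINT x|\<mu>m. - k x * (Ph x - g x)) = - (LINT x|\<mu>m. c x * Ph x) + (LINT x|\<mu>m. c x * g x)"
    proof -
      have "(LINT x|\<mu>m. - k x * (Ph x - g x)) = (LINT x|\<mu>m. c x * g x - c x * Ph x)"
        by (rule Bochner_Integration.integral_cong) (auto simp: spp k_def algebra_simps)
      then show ?thesis using intm[of "\<lambda>x. c x * Ph x"] intm[of "\<lambda>x. c x * g x"] c(1) Phc gc
        by (simp add: continuous_on_mult)
    qed
    have T3: "(LINT w|N. k3 w * (Ph (X w) - g (X w))) =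
        (LINT w|N. (Ph (X w) *\<^sub>R dc (X w)) \<bullet> V w) - (LINT w|N. (g (X w) *\<^sub>R dc (X w)) \<bullet> V w)"
    proof -
      have "(LINT w|N. k3 w * (Ph (X w) - g (X w))) =
        (LINT w|N. (Ph (X w) *\<^sub>R dc (X w)) \<bullet> V w - (g (X w) *\<^sub>R dc (X w)) \<bullet> V w)"
        by (rule Bochner_Integration.integral_cong) (auto simp: k3_def algebra_simps)
      then show ?thesis using i2 i3 by simp
    qed
    show ?thesis unfolding Ph_def[symmetric] T0 T1 T2 T3 using D by linarith
  qed
  have "flux_field \<Omega> p P (\<lambda>g G. - (LINT x|\<mu>p. c x * g x) + (LINT x|\<mu>m. c x * g x) - (LINT w|N. (g (X w) *\<^sub>R dc (X w)) \<bullet> V w))"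
    by (rule flux_field_cong[OF P L])
  moreover have "(LINT z|lborel. v z * norm (P z)) \<le> (LINT w|N. c (X w) * norm (V w) * om (X w)) +
       B * (real m * \<delta> * (2 + (LINT w|N. \<bar>dc (X w) \<bullet> V w\<bar>)))"
  proof -
    have B0: "0 \<le> B" using v(2)[of undefined] by linarith
    have md: "0 \<le> real m * \<delta>" using kernel_nonneg[OF m K] by simp
    have va: "\<bar>v z\<bar> \<le> B" for z using v(2)[of z] by simp
    note fi = flux_field_integrable[OF _ \<Omega> p(1) v(1) va]
    have one: "\<bar>1::real\<bar> \<le> 1" by simp
    note fi1 = flux_field_integrable[OF _ \<Omega> p(1) borel_measurable_const one, simplified]
    have "(LINT z|lborel. v z * norm (P z)) \<le> (LINT z|lborel. v z * norm (P0 z) + (v z * norm (P1 z) + (v z * norm (P2 z) + v z * norm (P3 z))))"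
    proof (rule integral_mono)
      show "integrable lborel (\<lambda>z. v z * norm (P z))" by (rule fi[OF P])
      show "integrable lborel (\<lambda>z. v z * norm (P0 z) + (v z * norm (P1 z) + (v z * norm (P2 z) + v z * norm (P3 z))))"
        using fi[OF P0] fi[OF P1] fi[OF P2] fi[OF P3] by simp
      fix z
      have "norm (P z) \<le> norm (P0 z) + (norm (P1 z) + (norm (P2 z) + norm (P3 z)))"
        unfolding P_def by (intro order_trans[OF norm_triangle_ineq] add_left_mono) simp
      then have "v z * norm (P z) \<le> v z * (norm (P0 z) + (norm (P1 z) + (norm (P2 z) + norm (P3 z))))"
        using v(2)[of z] by (intro mult_left_mono) auto
      then show "v z * norm (P z) \<le> v z * norm (P0 z) + (v z * norm (P1 z) + (v z * norm (P2 z) + v z * norm (P3 z)))"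
        by (simp add: distrib_left)
    qed
    also have "\<dots> = (LINT z|lborel. v z * norm (P0 z)) + ((LINT z|lborel. v z * norm (P1 z)) + ((LINT z|lborel. v z * norm (P2 z)) + (LINT z|lborel. v z * norm (P3 z))))"
      using fi[OF P0] fi[OF P1] fi[OF P2] fi[OF P3] by simp
    also have "\<dots> \<le> (LINT w|N. c (X w) * norm (V w) * om (X w)) +
       (B * (real m * \<delta> * 1) + (B * (real m * \<delta> * 1) + B * (real m * \<delta> * (LINT w|N. \<bar>dc (X w) \<bullet> V w\<bar>))))"
    proof (intro add_mono)
      have vB: "(LINT z|lborel. v z * norm (Q z)) \<le> B * y" if Q: "flux_field \<Omega> p Q LL" and y: "(LINT z|lborel. norm (Q z)) \<le> y" for Q LL y
      proof -
        have "(LINT z|lborel. v z * norm (Q z)) \<le> (LINT z|lborel. B * norm (Q z))"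
          by (rule integral_mono[OF fi[OF Q]]) (use fi1[OF Q] v(2) in \<open>auto intro: mult_right_mono\<close>)
        also have "\<dots> \<le> B * y" using y B0 by (simp add: mult_left_mono)
        finally show ?thesis .
      qed
      have k1: "(LINT x|\<mu>p. \<bar>k x\<bar>) \<le> 1"
      proof -
        have "(LINT x|\<mu>p. \<bar>k x\<bar>) \<le> (LINT x|\<mu>p. 1)"
          by (rule integral_mono) (use kb kp(1) in \<open>auto intro!: p.integrable_const_bound[of _ 1]\<close>)
        then show ?thesis by (simp add: p.prob_space)
      qed
      have k2: "(LINT x|\<mu>m. \<bar>- k x\<bar>) \<le> 1"
      proof -
        have "(LINT x|\<mu>m. \<bar>- k x\<bar>) \<le> (LINT x|\<mu>m. 1)"
          by (rule integral_mono) (use kb kp(2) in \<open>auto intro!: m.integrable_const_bound[of _ 1]\<close>)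
        then show ?thesis by (simp add: m.prob_space)
      qed
      have k3: "(LINT w|N. \<bar>k3 w\<bar>) = (LINT w|N. \<bar>dc (X w) \<bullet> V w\<bar>)"
        by (rule Bochner_Integration.integral_cong) (auto simp: k3_def)
      show "(LINT z|lborel. v z * norm (P1 z)) \<le> B * (real m * \<delta> * 1)"
        by (rule vB[OF P1 order_trans[OF P1b mult_left_mono[OF k1 md]]])
      show "(LINT z|lborel. v z * norm (P2 z)) \<le> B * (real m * \<delta> * 1)"
        by (rule vB[OF P2 order_trans[OF P2b mult_left_mono[OF k2 md]]])
      show "(LINT z|lborel. v z * norm (P3 z)) \<le> B * (real m * \<delta> * (LINT w|N. \<bar>dc (X w) \<bullet> V w\<bar>))"
        by (rule vB[OF P3]) (use P3b k3 in simp)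
      have "(LINT z|lborel. v z * norm (P0 z)) \<le> (LINT w|N. indicator (space N) w * k (X w) * norm (V w) * (LINT z|lborel. v z * K (z - X w)))"
        using P0b[OF v] by blast
      \<comment> \<open>The kernel is a probability density carried by points of \<Omega> within
        \<delta> of \<open>X w\<close>, where v \<le> om (X w); so the average of \<open>v\<close>
        is at most om (X w).\<close>
      also have "\<dots> \<le> (LINT w|N. c (X w) * norm (V w) * om (X w))"
      proof (rule integral_mono)
        show "integrable N (\<lambda>w. indicator (space N) w * k (X w) * norm (V w) * (LINT z|lborel. v z * K (z - X w)))"
          using P0b[OF v] by blast
        have "integrable N (\<lambda>w. (c (X w) * om (X w)) \<bullet> norm (V w))"
          by (rule integrable_continuous_inner[OF N X \<Omega>, of "\<lambda>x. c x * om x"])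
             (use c om V in \<open>auto intro!: continuous_intros\<close>)
        then show "integrable N (\<lambda>w. c (X w) * norm (V w) * om (X w))" by (simp add: mult_ac)
        fix w assume w: "w \<in> space N"
        show "indicator (space N) w * k (X w) * norm (V w) * (LINT z|lborel. v z * K (z - X w)) \<le> c (X w) * norm (V w) * om (X w)"
        proof (cases "k (X w) = 0")
          case True
          then show ?thesis using X(2)[OF w] by (simp add: k_def)
        next
          case False
          have iK: "integrable lborel (\<lambda>z. K (z - X w))" "(LINT z|lborel. K (z - X w)) = 1"
            using integral_kernel_at[OF m K, of 1 "X w"] by (simp_all add: kernel_at_1[OF m K])
          have "(LINT z|lborel. v z * K (z - X w)) \<le> (LINT z|lborel. om (X w) * K (z - X w))"
          proof (rule integral_mono)
            show "integrable lborel (\<lambda>z. om (X w) * K (z - X w))" using iK by simp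
            show "integrable lborel (\<lambda>z. v z * K (z - X w))"
              by (rule Bochner_Integration.integrable_bound[OF integrable_mult_right[OF iK(1), of B]])
                 (use v va iK(1) B0 in \<open>auto simp: abs_mult intro!: AE_I2 mult_right_mono\<close>)
            fix z
            show "v z * K (z - X w) \<le> om (X w) * K (z - X w)"
            proof (cases "K (z - X w) = 0")
              case nz: False
              have s: "z - X w \<in> supp K" by (rule KD(7)[OF nz])
              have "X w + 1 *\<^sub>R (z - X w) \<in> interior \<Omega>" by (rule inwk[OF False s]) auto
              then have "z \<in> \<Omega>" using interior_subset by auto
              moreover have "dist z (X w) \<le> \<delta>" using KD(4)[OF s] by (simp add: dist_norm)
              ultimately have "v z \<le> om (X w)" using om(2) X(2)[OF w] by blast
              then show ?thesis using KD(2) by (rule mult_right_mono)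
            qed simp
          qed
          also have "\<dots> = om (X w)" using iK by simp
          finally have "(LINT z|lborel. v z * K (z - X w)) \<le> om (X w)" .
          then have "(c (X w) * norm (V w)) * (LINT z|lborel. v z * K (z - X w)) \<le> (c (X w) * norm (V w)) * om (X w)"
            using c(4)[OF X(2)[OF w]] by (intro mult_left_mono) auto
          then show ?thesis using w X(2)[OF w] by (simp add: k_def)
        qed
      qed
      finally show "(LINT z|lborel. v z * norm (P0 z)) \<le> (LINT w|N. c (X w) * norm (V w) * om (X w))" .
    qed
    also have "\<dots> = (LINT w|N. c (X w) * norm (V w) * om (X w)) +
       B * (real m * \<delta> * (2 + (LINT w|N. \<bar>dc (X w) \<bullet> V w\<bar>)))"
      by (simp add: algebra_simps)
    finally show ?thesis .
  qed
  ultimately show ?thesis by (rule that)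
qed

text \<open>The vector measure to be approximated is presented as the image of \<open>V N\<close> under \<open>X\<close>.\<close>

lemma beckmann_competitor:
  fixes \<Omega> :: "'a::euclidean_space set" and N :: "'w measure" and X V :: "'w \<Rightarrow> 'a" and p :: real
  assumes \<Omega>: "compact \<Omega>" "bounded_lipschitz_domain (interior \<Omega>)" "strictly_star_shaped \<Omega>"
    and p: "1 < p" "DIM('a) \<ge> 2 \<Longrightarrow> p < real DIM('a) / (real DIM('a) - 1)"
    and w: "continuous_on \<Omega> w" "\<And>x. x \<in> \<Omega> \<Longrightarrow> 0 \<le> w x"
    and moll: "\<And>r. 0 < r \<Longrightarrow> \<exists>k. k \<in> Cc_infinity (UNIV :: 'a set) \<and> (\<forall>x. 0 \<le> k x) \<and> (LINT x|lborel. k x) = 1 \<and> supp k \<subseteq> ball 0 r"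
    and \<mu>p: "prob_space \<mu>p" "sets \<mu>p = sets (restrict_space borel \<Omega>)"
    and \<mu>m: "prob_space \<mu>m" "sets \<mu>m = sets (restrict_space borel \<Omega>)"
    and N: "finite_measure N" and X: "X \<in> borel_measurable N" "\<And>w. w \<in> space N \<Longrightarrow> X w \<in> \<Omega>"
    and V: "V \<in> borel_measurable N" "\<And>w. norm (V w) \<le> C"
    and dv: "\<And>\<phi> G. C1_on \<Omega> \<phi> G \<Longrightarrow>
        - (LINT w|N. G (X w) \<bullet> V w) = (LINT x|\<mu>p. \<phi> x) - (LINT x|\<mu>m. \<phi> x)"
    and \<eta>: "0 < \<eta>"
  obtains P where
    "flux_field \<Omega> p P (\<lambda>g G. - ((LINT x|\<mu>p. g x) - (LINT x|\<mu>m. g x)))"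
    "(LINT z|lborel. (indicator \<Omega> z * w z) * norm (P z)) \<le> (LINT y|N. w (X y) * norm (V y)) + \<eta>"
proof -
  interpret N: finite_measure N by fact
  interpret p: prob_space \<mu>p by fact
  interpret m: prob_space \<mu>m by fact
  have spp: "space \<mu>p = \<Omega>" "space \<mu>m = \<Omega>" using sets_eq_imp_space_eq[OF \<mu>p(2)] sets_eq_imp_space_eq[OF \<mu>m(2)] by auto
  have "(\<lambda>x. x) \<in> borel_measurable (restrict_space borel \<Omega>)" by (rule measurable_restrict_space1) simp
  then have id: "(\<lambda>x. x) \<in> borel_measurable \<mu>p" "(\<lambda>x. x) \<in> borel_measurable \<mu>m"
    by (simp_all add: measurable_cong_sets[OF \<mu>p(2) refl] measurable_cong_sets[OF \<mu>m(2) refl])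
  have intp: "integrable \<mu>p f" and intm: "integrable \<mu>m f" if "continuous_on \<Omega> f" for f :: "'a \<Rightarrow> real"
    using integrable_continuous_comp[OF p.finite_measure_axioms id(1) _ \<Omega>(1) that]
      integrable_continuous_comp[OF m.finite_measure_axioms id(2) _ \<Omega>(1) that] spp by auto
  have intN: "integrable N (\<lambda>y. f (X y) \<bullet> V y)" if "continuous_on \<Omega> f" for f :: "'a \<Rightarrow> 'a"
    by (rule integrable_continuous_inner[OF N X \<Omega>(1) that V])
  have normV: "integrable N (\<lambda>y. norm (V y))"
    by (rule N.integrable_const_bound[of _ C]) (use V in auto)
  have intNV: "integrable N (\<lambda>y. f (X y) * norm (V y))" if "continuous_on \<Omega> f" for f :: "'a \<Rightarrow> real"
    using integrable_continuous_inner[OF N X \<Omega>(1) that, of "\<lambda>y. norm (V y)" C] V by simp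
  \<comment> \<open>Such an \<open>m\<close> exists because p + d - d p > 0: in dimension 1 this
    expression equals 1, otherwise it is the assumption p < d/(d-1).\<close>
  obtain m :: nat where m: "0 < m" "p \<le> real m * (p + DIM('a) - DIM('a) * p)"
  proof -
    define e where "e = p + DIM('a) - DIM('a) * p"
    have e: "0 < e"
    proof (cases "DIM('a) \<ge> 2")
      case True
      then have "p * (real DIM('a) - 1) < real DIM('a)"
        using p(2)[OF True] by (simp add: pos_less_divide_eq)
      then show ?thesis by (simp add: e_def algebra_simps)
    next
      case False
      then have "DIM('a) = 1" using DIM_positive[where 'a='a] by linarith
      then show ?thesis by (simp add: e_def)
    qed
    obtain n where "p / e \<le> real n" using real_arch_simple by blast
    then have "p / e \<le> real (Suc n)" by simp
    then have "p \<le> real (Suc n) * e" using e by (simp only: pos_divide_le_eq)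
    then show ?thesis using that[of "Suc n"] by (simp only: e_def)
  qed
  obtain r where r: "\<And>x. x \<in> \<Omega> \<Longrightarrow> 0 < r x"
    and rK: "\<And>x \<delta>. x \<in> \<Omega> \<Longrightarrow> 0 < \<delta> \<Longrightarrow> \<exists>K. smooth_kernel \<delta> K \<and>
    (\<forall>z\<in>\<Omega> \<inter> ball x (r x). \<forall>a\<in>supp K. \<forall>t. 0 < t \<and> t \<le> 1 \<longrightarrow> z + t *\<^sub>R a \<in> interior \<Omega>)"
    using inward_kernels[OF \<Omega> _ moll] by metis
  obtain I where I: "I \<subseteq> \<Omega>" "finite I" "\<Omega> \<subseteq> (\<Union>i\<in>I. ball i (r i))"
  proof (rule compactE_image[OF \<Omega>(1), of \<Omega> "\<lambda>x. ball x (r x)"])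
    show "\<Omega> \<subseteq> (\<Union>x\<in>\<Omega>. ball x (r x))" using r by force
  qed auto
  obtain cut :: "'a \<Rightarrow> 'a \<Rightarrow> real" and dcut where
    cc: "\<And>i. i \<in> I \<Longrightarrow> continuous_on \<Omega> (cut i)" "\<And>i. i \<in> I \<Longrightarrow> continuous_on \<Omega> (dcut i)"
    and cd: "\<And>i x. i \<in> I \<Longrightarrow> x \<in> \<Omega> \<Longrightarrow> GDERIV (cut i) x :> dcut i x"
    and cnn: "\<And>i x. i \<in> I \<Longrightarrow> x \<in> \<Omega> \<Longrightarrow> 0 \<le> cut i x"
    and cz: "\<And>i x. i \<in> I \<Longrightarrow> x \<in> \<Omega> \<Longrightarrow> x \<notin> ball i (r i) \<Longrightarrow> cut i x = 0 \<and> dcut i x = 0"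
    and cs: "\<And>x. x \<in> \<Omega> \<Longrightarrow> (\<Sum>i\<in>I. cut i x) = 1" and ds: "\<And>x. x \<in> \<Omega> \<Longrightarrow> (\<Sum>i\<in>I. dcut i x) = 0"
  proof (rule C1_partition_of_unity[OF I(2,3)])
    fix cut dcut
    assume "\<And>i. i \<in> I \<Longrightarrow> continuous_on \<Omega> (cut i)" "\<And>i. i \<in> I \<Longrightarrow> continuous_on \<Omega> (dcut i)"
      "\<And>i x. i \<in> I \<Longrightarrow> x \<in> \<Omega> \<Longrightarrow> GDERIV (cut i) x :> dcut i x"
      "\<And>i x. i \<in> I \<Longrightarrow> x \<in> \<Omega> \<Longrightarrow> 0 \<le> cut i x"
      "\<And>i x. i \<in> I \<Longrightarrow> x \<in> \<Omega> \<Longrightarrow> x \<notin> ball i (r i) \<Longrightarrow> cut i x = 0 \<and> dcut i x = 0"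
      "\<And>x. x \<in> \<Omega> \<Longrightarrow> (\<Sum>i\<in>I. cut i x) = 1" "\<And>x. x \<in> \<Omega> \<Longrightarrow> (\<Sum>i\<in>I. dcut i x) = 0"
    then show thesis by (rule that)
  qed
  have c1: "cut i x \<le> 1" if "i \<in> I" "x \<in> \<Omega>" for i x
    using member_le_sum[of i I "\<lambda>i. cut i x"] that cnn I(2) cs by fastforce
  obtain W where W: "0 \<le> W" "\<And>x. x \<in> \<Omega> \<Longrightarrow> norm (w x) \<le> W" using compact_continuous_bound[OF \<Omega>(1) w(1)] by metis
  define E where "E = (LINT y|N. norm (V y))"
  have E0: "0 \<le> E" unfolding E_def by (intro Bochner_Integration.integral_nonneg) simp
  \<comment> \<open>Allowed oscillation of \<open>w\<close> over the distance \<delta>. Dividing by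
    E + 1 makes its total effect at most \<eta>/2, also when E = 0.\<close>
  define \<eta>' where "\<eta>' = \<eta> / (2 * (E + 1))"
  have \<eta>': "0 < \<eta>'" "\<eta>' * E \<le> \<eta> / 2" using \<eta> E0 by (auto simp: \<eta>'_def field_simps)
  obtain d1 where d1: "0 < d1" "\<And>x z. x \<in> \<Omega> \<Longrightarrow> z \<in> \<Omega> \<Longrightarrow> dist z x < d1 \<Longrightarrow> dist (w z) (w x) < \<eta>'"
    using compact_uniformly_continuous[OF w(1) \<Omega>(1)] \<eta>'(1) unfolding uniformly_continuous_on_def by metis
  define A where "A = (\<Sum>i\<in>I. 2 + (LINT y|N. \<bar>dcut i (X y) \<bullet> V y\<bar>))"
  have A0: "0 \<le> A" unfolding A_def by (intro sum_nonneg add_nonneg_nonneg Bochner_Integration.integral_nonneg) auto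
  \<comment> \<open>Half of d1 turns the strict modulus of continuity into one valid up to distance
    \<delta>; the second entry makes all transport costs together at most \<eta>/2.\<close>
  define \<delta> where "\<delta> = min (d1 / 2) (\<eta> / (2 * (W * (real m * A) + 1)))"
  have den: "0 < 2 * (W * (real m * A) + 1)" using W(1) A0 by (intro mult_pos_pos add_nonneg_pos mult_nonneg_nonneg) auto
  have \<delta>: "0 < \<delta>" "\<delta> < d1" using d1(1) \<eta> den by (auto simp: \<delta>_def)
  have \<delta>A: "W * (real m * \<delta> * A) \<le> \<eta> / 2"
  proof -
    have "\<delta> \<le> \<eta> / (2 * (W * (real m * A) + 1))" by (simp add: \<delta>_def)
    then have "\<delta> * (2 * (W * (real m * A) + 1)) \<le> \<eta>" using den by (simp only: pos_le_divide_eq)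
    then have "2 * (W * (real m * \<delta> * A)) + 2 * \<delta> \<le> \<eta>" by (simp add: algebra_simps)
    then show ?thesis using \<delta>(1) by simp
  qed
  define v where "v z = indicator \<Omega> z * w z" for z
  have vm: "v \<in> borel_measurable borel" unfolding v_def
    using continuous_on_indicator_borel[OF _ w(1)] \<Omega>(1) by (simp add: compact_imp_closed)
  have vb: "0 \<le> v z \<and> v z \<le> W" for z using w(2)[of z] W(2)[of z] W(1) by (auto simp: v_def indicator_def)
  define good where "good i P \<longleftrightarrow> flux_field \<Omega> p P (\<lambda>g G. - (LINT x|\<mu>p. cut i x * g x) + (LINT x|\<mu>m. cut i x * g x) - (LINT y|N. (g (X y) *\<^sub>R dcut i (X y)) \<bullet> V y)) \<and>
    (LINT z|lborel. v z * norm (P z)) \<le> (LINT y|N. cut i (X y) * norm (V y) * (w (X y) + \<eta>')) +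
       W * (real m * \<delta> * (2 + (LINT y|N. \<bar>dcut i (X y) \<bullet> V y\<bar>)))" for i P
  have ex: "\<exists>P. good i P" if i: "i \<in> I" for i
  proof -
    have iO: "i \<in> \<Omega>" using i I(1) by auto
    obtain K where K: "smooth_kernel \<delta> K"
      and Ki: "\<forall>z\<in>\<Omega> \<inter> ball i (r i). \<forall>a\<in>supp K. \<forall>t. 0 < t \<and> t \<le> 1 \<longrightarrow> z + t *\<^sub>R a \<in> interior \<Omega>"
      using rK[OF iO \<delta>(1)] by metis
    show ?thesis
    proof (rule local_competitor[OF \<Omega>(1) p(1) m(2,1) K \<mu>p \<mu>m N X V, where c="cut i" and dc="dcut i" and v=v and B=W and om="\<lambda>x. w x + \<eta>'"])
      show "- (LINT w|N. G (X w) \<bullet> V w) = (LINT x|\<mu>p. \<phi> x) - (LINT x|\<mu>m. \<phi> x)" if "C1_on \<Omega> \<phi> G" for \<phi> G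
        by (rule dv[OF that])
      show "x + t *\<^sub>R a \<in> interior \<Omega>" if "x \<in> \<Omega>" "cut i x \<noteq> 0 \<or> dcut i x \<noteq> 0" "a \<in> supp K" "0 < t" "t \<le> 1" for x a t
      proof -
        have "x \<in> ball i (r i)" using cz[OF i that(1)] that(2) by blast
        then show ?thesis using Ki that by blast
      qed
      show "continuous_on \<Omega> (\<lambda>x. w x + \<eta>')" using w(1) by (intro continuous_intros)
      show "v z \<le> w x + \<eta>'" if "x \<in> \<Omega>" "z \<in> \<Omega>" "dist z x \<le> \<delta>" for x z
        using d1(2)[OF that(1,2)] that \<delta>(2) by (simp add: v_def dist_real_def)
      fix P
      assume "flux_field \<Omega> p P (\<lambda>g G. - (LINT x|\<mu>p. cut i x * g x) + (LINT x|\<mu>m. cut i x * g x) - (LINT y|N. (g (X y) *\<^sub>R dcut i (X y)) \<bullet> V y))"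
        "(LINT z|lborel. v z * norm (P z)) \<le> (LINT y|N. cut i (X y) * norm (V y) * (w (X y) + \<eta>')) +
       W * (real m * \<delta> * (2 + (LINT y|N. \<bar>dcut i (X y) \<bullet> V y\<bar>)))"
      then have "good i P" unfolding good_def by (rule conjI)
      then show "\<exists>P. good i P" by (rule exI[of _ P])
    qed (use cc[OF i] cd[OF i] cnn[OF i] c1[OF i] vm vb in auto)
  qed
  obtain P where good: "\<And>i. i \<in> I \<Longrightarrow> good i (P i)" using ex by metis
  note P = good[unfolded good_def, THEN conjunct1] and Pb = good[unfolded good_def, THEN conjunct2]
  define Q where "Q z = (\<Sum>i\<in>I. P i z)" for z
  have Q0: "flux_field \<Omega> p Q (\<lambda>g G. \<Sum>i\<in>I. - (LINT x|\<mu>p. cut i x * g x) + (LINT x|\<mu>m. cut i x * g x) - (LINT y|N. (g (X y) *\<^sub>R dcut i (X y)) \<bullet> V y))"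
    unfolding Q_def by (rule flux_field_sum[OF I(2) P p(1)])
  have Q: "flux_field \<Omega> p Q (\<lambda>g G. - ((LINT x|\<mu>p. g x) - (LINT x|\<mu>m. g x)))"
  proof (rule flux_field_cong[OF Q0])
    fix g :: "'a \<Rightarrow> real" and G :: "'a \<Rightarrow> 'a" assume "weak_test \<Omega> (conj_exp p) g G"
    then have gc: "continuous_on \<Omega> g" by (simp add: weak_test_def)
    have 1: "(\<Sum>i\<in>I. LINT x|\<mu>p. cut i x * g x) = (LINT x|\<mu>p. g x)"
    proof -
      have "(\<Sum>i\<in>I. LINT x|\<mu>p. cut i x * g x) = (LINT x|\<mu>p. (\<Sum>i\<in>I. cut i x * g x))"
        by (rule Bochner_Integration.integral_sum[symmetric]) (intro intp continuous_on_mult cc gc)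
      also have "\<dots> = (LINT x|\<mu>p. g x)"
        by (rule Bochner_Integration.integral_cong) (auto simp: spp cs sum_distrib_right[symmetric])
      finally show ?thesis .
    qed
    have 2: "(\<Sum>i\<in>I. LINT x|\<mu>m. cut i x * g x) = (LINT x|\<mu>m. g x)"
    proof -
      have "(\<Sum>i\<in>I. LINT x|\<mu>m. cut i x * g x) = (LINT x|\<mu>m. (\<Sum>i\<in>I. cut i x * g x))"
        by (rule Bochner_Integration.integral_sum[symmetric]) (intro intm continuous_on_mult cc gc)
      also have "\<dots> = (LINT x|\<mu>m. g x)"
        by (rule Bochner_Integration.integral_cong) (auto simp: spp cs sum_distrib_right[symmetric])
      finally show ?thesis .
    qed
    \<comment> \<open>Exact cancellation, for every \<delta>: the gradients of the cutoffs add up to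
      0 at each point, so no error in the divergence survives.\<close>
    have 3: "(\<Sum>i\<in>I. LINT y|N. (g (X y) *\<^sub>R dcut i (X y)) \<bullet> V y) = 0"
    proof -
      have "(\<Sum>i\<in>I. LINT y|N. (g (X y) *\<^sub>R dcut i (X y)) \<bullet> V y) = (LINT y|N. (\<Sum>i\<in>I. (g (X y) *\<^sub>R dcut i (X y)) \<bullet> V y))"
        by (rule Bochner_Integration.integral_sum[symmetric]) (intro intN continuous_on_scaleR cc gc)
      also have "\<dots> = (LINT y|N. 0)"
        by (rule Bochner_Integration.integral_cong[OF refl])
           (use ds X(2) in \<open>simp add: inner_sum_left[symmetric] scaleR_sum_right[symmetric] del: inner_scaleR_left\<close>)
      finally show ?thesis by simp
    qed
    show "(\<Sum>i\<in>I. - (LINT x|\<mu>p. cut i x * g x) + (LINT x|\<mu>m. cut i x * g x) - (LINT y|N. (g (X y) *\<^sub>R dcut i (X y)) \<bullet> V y))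
      = - ((LINT x|\<mu>p. g x) - (LINT x|\<mu>m. g x))"
      unfolding sum_subtractf sum.distrib sum_negf 1 2 3 by simp
  qed
  have va: "\<bar>v z\<bar> \<le> W" for z using vb[of z] by simp
  have "(LINT z|lborel. v z * norm (Q z)) \<le> (LINT z|lborel. (\<Sum>i\<in>I. v z * norm (P i z)))"
  proof (rule integral_mono)
    show "integrable lborel (\<lambda>z. v z * norm (Q z))" by (rule flux_field_integrable[OF Q \<Omega>(1) p(1) vm va])
    show "integrable lborel (\<lambda>z. \<Sum>i\<in>I. v z * norm (P i z))"
      by (intro Bochner_Integration.integrable_sum flux_field_integrable[OF P \<Omega>(1) p(1) vm va])
    show "v z * norm (Q z) \<le> (\<Sum>i\<in>I. v z * norm (P i z))" for z
      unfolding Q_def sum_distrib_left[symmetric] using vb[of z] by (intro mult_left_mono norm_sum) auto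
  qed
  also have "\<dots> = (\<Sum>i\<in>I. (LINT z|lborel. v z * norm (P i z)))"
    by (rule Bochner_Integration.integral_sum) (rule flux_field_integrable[OF P \<Omega>(1) p(1) vm va])
  also have "\<dots> \<le> (\<Sum>i\<in>I. (LINT y|N. cut i (X y) * norm (V y) * (w (X y) + \<eta>')) +
       W * (real m * \<delta> * (2 + (LINT y|N. \<bar>dcut i (X y) \<bullet> V y\<bar>))))"
    by (rule sum_mono) (rule Pb)
  also have "\<dots> = (\<Sum>i\<in>I. (LINT y|N. cut i (X y) * norm (V y) * (w (X y) + \<eta>'))) + W * (real m * \<delta> * A)"
    unfolding A_def sum_distrib_left by (simp only: sum.distrib)
  also have "(\<Sum>i\<in>I. (LINT y|N. cut i (X y) * norm (V y) * (w (X y) + \<eta>'))) = (LINT y|N. w (X y) * norm (V y)) + \<eta>' * E"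
  proof -
    have i: "integrable N (\<lambda>y. cut i (X y) * norm (V y) * (w (X y) + \<eta>'))" if "i \<in> I" for i
      using intNV[of "\<lambda>x. cut i x * (w x + \<eta>')"] cc[OF that] w(1)
      by (simp add: continuous_intros mult_ac)
    have "(\<Sum>i\<in>I. (LINT y|N. cut i (X y) * norm (V y) * (w (X y) + \<eta>'))) =
      (LINT y|N. (\<Sum>i\<in>I. cut i (X y) * norm (V y) * (w (X y) + \<eta>')))"
      by (rule Bochner_Integration.integral_sum[symmetric]) (rule i)
    also have "\<dots> = (LINT y|N. w (X y) * norm (V y) + \<eta>' * norm (V y))"
    proof (rule Bochner_Integration.integral_cong[OF refl])
      fix y assume "y \<in> space N"
      then have "(\<Sum>i\<in>I. cut i (X y)) = 1" using cs X(2) by blast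
      then show "(\<Sum>i\<in>I. cut i (X y) * norm (V y) * (w (X y) + \<eta>')) = w (X y) * norm (V y) + \<eta>' * norm (V y)"
        by (simp only: sum_distrib_right[symmetric]) (simp add: algebra_simps)
    qed
    also have "\<dots> = (LINT y|N. w (X y) * norm (V y)) + \<eta>' * E"
      unfolding E_def using intNV[OF w(1)] normV by simp
    finally show ?thesis .
  qed
  finally have "(LINT z|lborel. v z * norm (Q z)) \<le> (LINT y|N. w (X y) * norm (V y)) + \<eta>"
    using \<eta>'(2) \<delta>A by linarith
  then show ?thesis using that[OF Q] by (simp add: v_def)
qed


subsection \<open>Superpositions of curves as vector measures\<close>

text \<open>Provides a feasible vector measure of finite mass: couple the two measures
  independently, go from x along its radius to 0, then out to y. Apart from its end points each path
  runs in the interior, which is where \<open>C1_on\<close> provides a derivative.\<close>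

lemma star_shaped_radial_field:
  fixes \<Omega> :: "'a::euclidean_space set"
  assumes \<Omega>: "compact \<Omega>" "strictly_star_shaped \<Omega>"
    and \<mu>p: "prob_space \<mu>p" "sets \<mu>p = sets (restrict_space borel \<Omega>)"
    and \<mu>m: "prob_space \<mu>m" "sets \<mu>m = sets (restrict_space borel \<Omega>)"
  obtains N :: "(('a \<times> 'a) \<times> real) measure" and X V C where
    "finite_measure N" "X \<in> borel_measurable N" "\<And>w. w \<in> space N \<Longrightarrow> X w \<in> \<Omega>"
    "V \<in> borel_measurable N" "\<And>w. norm (V w) \<le> C"
    "\<And>\<phi> G. C1_on \<Omega> \<phi> G \<Longrightarrow>
        - (LINT w|N. G (X w) \<bullet> V w) = (LINT x|\<mu>p. \<phi> x) - (LINT x|\<mu>m. \<phi> x)"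
proof -
  interpret p: prob_space \<mu>p by fact
  interpret m: prob_space \<mu>m by fact
  interpret T: prob_space unit_time by (rule prob_space_unit_time)
  interpret pm: pair_prob_space \<mu>p \<mu>m ..
  interpret PT: pair_sigma_finite "\<mu>p \<Otimes>\<^sub>M \<mu>m" unit_time ..
  have spp: "space \<mu>p = \<Omega>" "space \<mu>m = \<Omega>" using sets_eq_imp_space_eq[OF \<mu>p(2)] sets_eq_imp_space_eq[OF \<mu>m(2)] by auto
  have "(\<lambda>x. x) \<in> borel_measurable (restrict_space borel \<Omega>)" by (rule measurable_restrict_space1) simp
  then have id: "(\<lambda>x. x) \<in> borel_measurable \<mu>p" "(\<lambda>x. x) \<in> borel_measurable \<mu>m"
    by (simp_all add: measurable_cong_sets[OF \<mu>p(2) refl] measurable_cong_sets[OF \<mu>m(2) refl])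
  have intp: "integrable \<mu>p f" and intm: "integrable \<mu>m f" if "continuous_on \<Omega> f" for f :: "'a \<Rightarrow> real"
    using integrable_continuous_comp[OF p.finite_measure_axioms id(1) _ \<Omega>(1) that]
      integrable_continuous_comp[OF m.finite_measure_axioms id(2) _ \<Omega>(1) that] spp by auto
  have \<Omega>b[measurable]: "\<Omega> \<in> sets borel" using \<Omega>(1) by (simp add: compact_imp_closed)
  obtain R where R: "\<And>x. x \<in> \<Omega> \<Longrightarrow> norm x \<le> R" using compact_imp_bounded[OF \<Omega>(1)] bounded_iff by metis
  have star: "l *\<^sub>R x \<in> interior \<Omega>" if "x \<in> \<Omega>" "0 \<le> l" "l < 1" for l x
    using \<Omega>(2) that unfolding strictly_star_shaped_def by blast
  define N where "N = (\<mu>p \<Otimes>\<^sub>M \<mu>m) \<Otimes>\<^sub>M unit_time"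
  define path where "path x y t = (if t \<le> 1/2 then (1 - 2 * t) *\<^sub>R x else (2 * t - 1) *\<^sub>R y)" for x y :: 'a and t :: real
  define vel where "vel x y t = (if t \<le> 1/2 then - 2 *\<^sub>R x else 2 *\<^sub>R y)" for x y :: 'a and t :: real
  \<comment> \<open>The space of \<open>unit_time\<close> is the whole line. At times outside (0,
    1], which carry no mass, \<open>X\<close> is set to x so that it stays in \<Omega>.\<close>
  define X where "X = (\<lambda>((x, y), t). if t \<in> {0<..1} then path x y t else x)"
  define V where "V = (\<lambda>((x, y), t). if x \<in> \<Omega> \<and> y \<in> \<Omega> then vel x y t else 0)"
  have sN: "space N = (\<Omega> \<times> \<Omega>) \<times> UNIV"
    using sets_eq_imp_space_eq[OF sets_unit_time] by (simp add: N_def space_pair_measure spp)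
  have fN: "finite_measure N" unfolding N_def by (rule finite_measure_pair_measure) unfold_locales
  have [measurable]: "(\<lambda>w. fst (fst w)) \<in> borel_measurable N" "(\<lambda>w. snd (fst w)) \<in> borel_measurable N"
    "(\<lambda>w. snd w) \<in> borel_measurable N"
  proof -
    show "(\<lambda>w. fst (fst w)) \<in> borel_measurable N" unfolding N_def
      by (rule measurable_compose[OF measurable_compose[OF measurable_fst measurable_fst] id(1)])
    show "(\<lambda>w. snd (fst w)) \<in> borel_measurable N" unfolding N_def
      by (rule measurable_compose[OF measurable_compose[OF measurable_fst measurable_snd] id(2)])
    have "(\<lambda>w. snd w) \<in> measurable N unit_time" unfolding N_def by (rule measurable_snd)
    then show "(\<lambda>w. snd w) \<in> borel_measurable N" by (simp add: measurable_cong_sets[OF refl sets_unit_time])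
  qed
  have Xm: "X \<in> borel_measurable N" unfolding X_def path_def split_beta' by measurable
  have Vm: "V \<in> borel_measurable N" unfolding V_def vel_def split_beta' by measurable
  have pathO: "path x y t \<in> \<Omega>" if "x \<in> \<Omega>" "y \<in> \<Omega>" "0 \<le> t" "t \<le> 1" for x y t
  proof -
    have "l *\<^sub>R z \<in> \<Omega>" if "z \<in> \<Omega>" "0 \<le> l" "l \<le> 1" for l z
      using star[OF that(1,2)] that interior_subset[of \<Omega>] by (cases "l = 1") auto
    then show ?thesis using that by (auto simp: path_def)
  qed
  have XO: "X w \<in> \<Omega>" if "w \<in> space N" for w
    using that pathO by (auto simp: sN X_def)
  have VC: "norm (V w) \<le> 2 * max R 0" for w
  proof -
    obtain x y t where fields: "w = ((x, y), t)" by (metis surj_pair)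
    show ?thesis
    proof (cases "x \<in> \<Omega> \<and> y \<in> \<Omega>")
      case True
      then show ?thesis using R[of x] R[of y] by (auto simp: fields V_def vel_def)
    next
      case False
      then have "V w = 0" by (auto simp: fields V_def)
      then show ?thesis by simp
    qed
  qed
  have dv: "- (LINT w|N. G (X w) \<bullet> V w) = (LINT x|\<mu>p. \<phi> x) - (LINT x|\<mu>m. \<phi> x)" if C1: "C1_on \<Omega> \<phi> G" for \<phi> G
  proof -
    have \<phi>: "continuous_on \<Omega> \<phi>" and G: "continuous_on \<Omega> G" and d: "\<And>x. x \<in> interior \<Omega> \<Longrightarrow> GDERIV \<phi> x :> G x"
      using C1 by (auto simp: C1_on_def)
    have i: "integrable N (\<lambda>w. G (X w) \<bullet> V w)" by (rule integrable_continuous_inner[OF fN Xm XO \<Omega>(1) G Vm VC])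
    have inner: "(LINT t|unit_time. G (X (xy, t)) \<bullet> V (xy, t)) = \<phi> (snd xy) - \<phi> (fst xy)" if xy: "xy \<in> space (\<mu>p \<Otimes>\<^sub>M \<mu>m)"
      "integrable unit_time (\<lambda>t. G (X (xy, t)) \<bullet> V (xy, t))" for xy
    proof -
      obtain x y where xye: "xy = (x, y)" by (cases xy)
      have x: "x \<in> \<Omega>" and y: "y \<in> \<Omega>" using xy by (auto simp: xye space_pair_measure spp)
      let ?f = "\<lambda>t. G (path x y t) \<bullet> vel x y t"
      have fe: "G (X (xy, t)) \<bullet> V (xy, t) = ?f t" if "t \<in> {0<..1}" for t using that x y by (simp add: X_def V_def xye)
      have pc: "continuous_on {0..1} (path x y)"
      proof -
        have "continuous_on ({0..1/2} \<union> {1/2..1}) (\<lambda>t. if t \<le> 1/2 then (1 - 2 * t) *\<^sub>R x else (2 * t - 1) *\<^sub>R y)"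
        proof (rule continuous_on_If)
          fix t :: real assume "t \<in> {0..1/2}" "\<not> t \<le> 1/2"
          then show "(1 - 2 * t) *\<^sub>R x = (2 * t - 1) *\<^sub>R y" by simp
        next
          fix t :: real assume "t \<in> {1/2..1}" "t \<le> 1/2"
          then have "2 * t = 1" by simp
          then show "(1 - 2 * t) *\<^sub>R x = (2 * t - 1) *\<^sub>R y" by simp
        qed (auto intro!: continuous_intros)
        moreover have "{0..1/2} \<union> {1/2..1} = {0..1::real}" by auto
        ultimately show ?thesis by (simp add: path_def[abs_def])
      qed
      have "(?f has_integral (\<phi> (path x y 1) - \<phi> (path x y 0))) {0..1}"
      \<comment> \<open>The path has a corner at t = 1/2 and its ends may touch the boundary;
        continuity on [0, 1] and derivatives at all other times suffice.\<close>
      proof (rule fundamental_theorem_of_calculus_interior_strong[of "{1/2}"])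
        show "continuous_on {0..1} (\<lambda>t. \<phi> (path x y t))"
          by (rule continuous_on_compose2[OF \<phi> pc]) (use pathO x y in auto)
        fix t :: real assume t: "t \<in> {0<..<1} - {1/2}"
        have pi: "path x y t \<in> interior \<Omega>" using t x y star by (auto simp: path_def)
        have pd: "(path x y has_derivative (\<lambda>h. h *\<^sub>R vel x y t)) (at t)"
        proof (cases "t < 1/2")
          case True
          have "((\<lambda>t. (1 - 2 * t) *\<^sub>R x) has_derivative (\<lambda>h. h *\<^sub>R vel x y t)) (at t)"
            using True by (auto intro!: derivative_eq_intros simp: vel_def)
          then show ?thesis
            by (rule has_derivative_transform_within_open[of _ _ _ _ "{..<1/2}"]) (use True in \<open>auto simp: path_def\<close>)
        next
          case False
          then have t2: "1/2 < t" using t by auto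
          have "((\<lambda>t. (2 * t - 1) *\<^sub>R y) has_derivative (\<lambda>h. h *\<^sub>R vel x y t)) (at t)"
            using t2 by (auto intro!: derivative_eq_intros simp: vel_def)
          then show ?thesis
            by (rule has_derivative_transform_within_open[of _ _ _ _ "{1/2<..}"]) (use t2 in \<open>auto simp: path_def\<close>)
        qed
        show "((\<lambda>t. \<phi> (path x y t)) has_vector_derivative ?f t) (at t)"
          using has_derivative_compose[OF pd d[OF pi, unfolded gderiv_def]]
          by (simp add: has_vector_derivative_def inner_commute)
      qed auto
      then have h1: "(?f has_integral (\<phi> y - \<phi> x)) {0..1}" by (simp add: path_def)
      have meas: "(\<lambda>t. G (X (xy, t)) \<bullet> V (xy, t)) \<in> borel_measurable borel"
        using borel_measurable_integrable[OF xy(2)] by simp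
      have "integrable lborel (\<lambda>t. indicator {0<..1} t *\<^sub>R (G (X (xy, t)) \<bullet> V (xy, t)))"
        using xy(2) unfolding integral_unit_time(2)[OF meas] .
      from has_integral_integral_lborel[OF this]
      have "((\<lambda>t. indicator {0<..1} t *\<^sub>R (G (X (xy, t)) \<bullet> V (xy, t))) has_integral (LINT t|unit_time. G (X (xy, t)) \<bullet> V (xy, t))) UNIV"
        unfolding integral_unit_time(1)[OF meas] .
      then have "((\<lambda>t. if t \<in> {0..1} then ?f t else 0) has_integral (LINT t|unit_time. G (X (xy, t)) \<bullet> V (xy, t))) UNIV"
        by (rule has_integral_spike[OF negligible_sing[of "0::real"], rotated])
           (use fe in \<open>auto simp: indicator_def\<close>)
      then have "(?f has_integral (LINT t|unit_time. G (X (xy, t)) \<bullet> V (xy, t))) {0..1}"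
        by (simp only: has_integral_restrict_UNIV)
      from has_integral_unique[OF this h1] show ?thesis by (simp add: xye)
    qed
    have "(LINT w|N. G (X w) \<bullet> V w) = (LINT xy|(\<mu>p \<Otimes>\<^sub>M \<mu>m). (LINT t|unit_time. G (X (xy, t)) \<bullet> V (xy, t)))"
      using PT.integral_fst'[OF i[unfolded N_def]] unfolding N_def by simp
    also have "\<dots> = (LINT xy|(\<mu>p \<Otimes>\<^sub>M \<mu>m). \<phi> (snd xy) - \<phi> (fst xy))"
    proof (rule integral_cong_AE)
      show "(\<lambda>xy. LINT t|unit_time. G (X (xy, t)) \<bullet> V (xy, t)) \<in> borel_measurable (\<mu>p \<Otimes>\<^sub>M \<mu>m)"
        using borel_measurable_integrable[OF PT.integrable_fst'[OF i[unfolded N_def]]] .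
      show "(\<lambda>xy. \<phi> (snd xy) - \<phi> (fst xy)) \<in> borel_measurable (\<mu>p \<Otimes>\<^sub>M \<mu>m)"
        using intp[OF \<phi>] intm[OF \<phi>] by measurable
      show "AE xy in \<mu>p \<Otimes>\<^sub>M \<mu>m. (LINT t|unit_time. G (X (xy, t)) \<bullet> V (xy, t)) = \<phi> (snd xy) - \<phi> (fst xy)"
        using PT.AE_integrable_fst'[OF i[unfolded N_def]] AE_space by eventually_elim (rule inner)
    qed
    also have "\<dots> = (LINT x|\<mu>m. \<phi> x) - (LINT x|\<mu>p. \<phi> x)"
    proof -
      have 1: "integrable (\<mu>p \<Otimes>\<^sub>M \<mu>m) (\<lambda>xy. \<phi> (fst xy))"
        using pm.Fubini_integrable[of "\<lambda>xy. \<phi> (fst xy)"] intp[OF \<phi>] by (simp add: m.prob_space)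
      have 2: "integrable (\<mu>p \<Otimes>\<^sub>M \<mu>m) (\<lambda>xy. \<phi> (snd xy))"
        using pm.Fubini_integrable[of "\<lambda>xy. \<phi> (snd xy)"] intm[OF \<phi>] by simp
      have "(LINT xy|(\<mu>p \<Otimes>\<^sub>M \<mu>m). \<phi> (fst xy)) = (LINT x|\<mu>p. \<phi> x)"
        using pm.integral_fst'[OF 1] by (simp add: m.prob_space)
      moreover have "(LINT xy|(\<mu>p \<Otimes>\<^sub>M \<mu>m). \<phi> (snd xy)) = (LINT x|\<mu>m. \<phi> x)"
        using pm.integral_fst'[OF 2] by (simp add: p.prob_space)
      ultimately show ?thesis using 1 2 by simp
    qed
    finally show ?thesis by simp
  qed
  show ?thesis by (rule that[OF fN Xm XO Vm VC dv])
qed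

lemma pushforward_vector_measure:
  fixes X :: "'w \<Rightarrow> 'a::euclidean_space" and V :: "'w \<Rightarrow> 'a"
  assumes X: "X \<in> measurable N (restrict_space borel K)" and Vi: "integrable N V"
    and q: "\<And>A. A \<in> sets (restrict_space borel K) \<Longrightarrow> q A = (LINT w|N. indicator A (X w) *\<^sub>R V w)"
  shows "q \<in> vector_measures K"
  unfolding vector_measures_def
proof (intro CollectI allI impI, elim conjE)
  fix A :: "nat \<Rightarrow> _" assume A: "range A \<subseteq> sets (restrict_space borel K)" "disjoint_family A"
  define B where "B i = X -` A i \<inter> space N" for i
  have AiT: "A i \<in> sets (restrict_space borel K)" for i using A by auto
  have B: "range B \<subseteq> sets N" using AiT measurable_sets[OF X] by (auto simp: B_def)
  have Bd: "disjoint_family B"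
    unfolding disjoint_family_on_def
  proof (intro ballI impI)
    show "B i \<inter> B j = {}" if "i \<noteq> j" for i j
      using disjoint_family_onD[OF A(2) _ _ that] by (auto simp: B_def)
  qed
  have e: "(LINT w:X -` S \<inter> space N|N. V w) = (LINT w|N. indicator S (X w) *\<^sub>R V w)" for S
    unfolding set_lebesgue_integral_def by (rule Bochner_Integration.integral_cong) (auto simp: indicator_def)
  have UB: "(\<Union>i. B i) = X -` (\<Union>i. A i) \<inter> space N" by (auto simp: B_def)
  have UT: "(\<Union>i. A i) \<in> sets (restrict_space borel K)" using AiT by auto
  have "(\<lambda>i. LINT w:B i|N. V w) sums (LINT w:(\<Union>i. B i)|N. V w)" by (rule set_integral_sums[OF Vi B Bd])
  then show "(\<lambda>i. q (A i)) sums q (\<Union>i. A i)"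
    unfolding UB unfolding B_def e q[OF AiT] q[OF UT] .
qed

text \<open>Each component of \<open>q\<close> has a density \<open>k b\<close> against the law
  \<open>T\<close> of \<open>X\<close>. It is compared with V . b through positive measures: 1 + k b
  and 1 + V . b are nonnegative, the measures they define agree on all sets, hence so do integrals,
  and the contribution of the added 1 is then subtracted.\<close>

lemma vintegral_pushforward:
  fixes X V :: "'w \<Rightarrow> 'a::euclidean_space"
  assumes N: "finite_measure N" and X: "X \<in> measurable N (restrict_space borel K)"
    and V: "V \<in> borel_measurable N" "\<And>w. norm (V w) \<le> 1"
    and q: "\<And>A. A \<in> sets (restrict_space borel K) \<Longrightarrow> q A = (LINT w|N. indicator A (X w) *\<^sub>R V w)"
    and f: "f \<in> borel_measurable (restrict_space borel K)" "\<And>x. x \<in> K \<Longrightarrow> norm (f x) \<le> C"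
  shows "vintegral K q f = (LINT w|N. f (X w) \<bullet> V w)"
proof -
  interpret N: finite_measure N by fact
  define T where "T = distr N (restrict_space borel K) X"
  interpret T: finite_measure T unfolding T_def by (rule N.finite_measure_distr[OF X])
  have sT: "sets T = sets (restrict_space borel K)" by (simp add: T_def)
  have Vi: "integrable N V" by (rule N.integrable_const_bound[of _ 1]) (use V in auto)
  have XA: "(\<lambda>w. indicator A (X w) :: real) \<in> borel_measurable N" if "A \<in> sets T" for A
    using that X sT by (intro measurable_compose[OF X]) auto
  have iA: "integrable N (\<lambda>w. indicator A (X w) *\<^sub>R V w)" if "A \<in> sets T" for A
    by (rule Bochner_Integration.integrable_bound[OF Vi]) (use XA[OF that] V in \<open>auto simp: indicator_def\<close>)
  have iA1: "integrable N (\<lambda>w. indicator A (X w) :: real)" if "A \<in> sets T" for A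
    by (rule N.integrable_const_bound[of _ 1]) (use XA[OF that] in \<open>auto simp: indicator_def\<close>)
  have mT: "measure T A = (LINT w|N. indicator A (X w))" if A: "A \<in> sets T" for A
  proof -
    have "measure T A = (LINT x|T. indicator A x)" using A by simp
    also have "\<dots> = (LINT w|N. indicator A (X w))"
      unfolding T_def by (rule integral_distr[OF X]) (use A sT in auto)
    finally show ?thesis .
  qed
  have qsums: "(\<lambda>i. q (A i)) sums q (\<Union>i. A i)" if "range A \<subseteq> sets T" "disjoint_family A" for A :: "nat \<Rightarrow> _"
    using vector_measure_sums[OF pushforward_vector_measure[OF X Vi q]] that sT by simp
  have qle: "norm (q A) \<le> measure T A" if A: "A \<in> sets T" for A
  proof -
    have "norm (q A) \<le> (LINT w|N. norm (indicator A (X w) *\<^sub>R V w))"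
      using A sT q by (simp only: q) (rule integral_norm_bound)
    also have "\<dots> \<le> (LINT w|N. indicator A (X w))"
    proof (rule integral_mono)
      show "integrable N (\<lambda>w. norm (indicator A (X w) *\<^sub>R V w))" using iA[OF A] by (rule integrable_norm)
      show "norm (indicator A (X w) *\<^sub>R V w) \<le> indicator A (X w)" for w
        using V(2)[of w] by (simp add: indicator_def)
    qed (rule iA1[OF A])
    finally show ?thesis using mT[OF A] by simp
  qed
  have "\<exists>k. integrable T k \<and> (\<forall>A\<in>sets T. q A \<bullet> b = (LINT x:A|T. k x))" if b: "b \<in> Basis" for b
  proof (rule dominated_set_function_density[OF T.finite_measure_axioms, of "\<lambda>A. q A \<bullet> b"])
    show "(\<lambda>i. q (A i) \<bullet> b) sums (q (\<Union>i. A i) \<bullet> b)" if "range A \<subseteq> sets T" "disjoint_family A" for A :: "nat \<Rightarrow> _"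
      by (rule bounded_linear.sums[OF bounded_linear_inner_left qsums[OF that]])
    show "\<bar>q A \<bullet> b\<bar> \<le> measure T A" if "A \<in> sets T" for A
      using Basis_le_norm[OF b, of "q A"] qle[OF that] by linarith
  qed blast
  then obtain k where k: "\<And>b. b \<in> Basis \<Longrightarrow> integrable T (k b)"
    "\<And>b A. b \<in> Basis \<Longrightarrow> A \<in> sets T \<Longrightarrow> q A \<bullet> b = (LINT x:A|T. k b x)" by metis
  have fT: "f \<in> borel_measurable T" using f(1) measurable_cong_sets[OF sT refl] by blast
  have spT: "space T = K" by (simp add: T_def)
  have XK: "X w \<in> K" if "w \<in> space N" for w using measurable_space[OF X that] by simp
  have "vintegral K q f = (\<Sum>b\<in>Basis. LINT x|T. (f x \<bullet> b) * k b x)"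
    unfolding vintegral_def
  proof (rule sum.cong[OF refl])
    fix b :: 'a assume b: "b \<in> Basis"
    show "(LINT x|pos_variation K (\<lambda>A. q A \<bullet> b). f x \<bullet> b) -
       (LINT x|pos_variation K (\<lambda>A. - (q A \<bullet> b)). f x \<bullet> b) = (LINT x|T. (f x \<bullet> b) * k b x)"
      by (rule integral_pos_variation_diff[OF sT k(1)[OF b] k(2)[OF b], of "\<lambda>x. f x \<bullet> b" C])
         (use fT f(2) Basis_le_norm[OF b] in \<open>auto intro: order_trans\<close>)
  qed
  also have "\<dots> = (\<Sum>b\<in>Basis. LINT w|N. (f (X w) \<bullet> b) * (V w \<bullet> b))"
  proof (rule sum.cong[OF refl])
    fix b :: 'a assume b: "b \<in> Basis"
    have Vb: "\<bar>V w \<bullet> b\<bar> \<le> 1" for w using Basis_le_norm[OF b, of "V w"] V(2)[of w] by linarith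
    have Vnn: "0 \<le> 1 + V w \<bullet> b" for w using Vb[of w] by linarith
    have "AE x in T. norm (k b x) \<le> 1"
    proof (rule norm_density_le_1[OF T.finite_measure_axioms k(1)[OF b]])
      fix A assume A: "A \<in> sets T"
      show "norm (LINT x:A|T. k b x) \<le> measure T A"
        using k(2)[OF b A] Basis_le_norm[OF b, of "q A"] qle[OF A] by simp
    qed
    then have kae: "AE x in T. 0 \<le> 1 + k b x" by eventually_elim (auto simp: abs_le_iff)
    have km[measurable]: "k b \<in> borel_measurable T" using k(1)[OF b] by simp
    note [measurable] = V(1) X
    have D: "density T (\<lambda>x. ennreal (1 + k b x)) = distr (density N (\<lambda>w. ennreal (1 + V w \<bullet> b))) (restrict_space borel K) X" (is "?D1 = ?D2")
    proof (rule measure_eqI)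
      show "sets ?D1 = sets ?D2" by (simp add: sT)
      fix A assume "A \<in> sets ?D1"
      then have A: "A \<in> sets T" by simp
      have i1: "integrable T (\<lambda>x. indicator A x * (1 + k b x))"
        using integrable_mult_indicator[OF A Bochner_Integration.integrable_add[OF T.integrable_const k(1)[OF b]], of 1] by simp
      have "emeasure ?D1 A = (\<integral>\<^sup>+x. ennreal (indicator A x * (1 + k b x)) \<partial>T)"
        using A by (subst emeasure_density) (auto intro!: nn_integral_cong simp: indicator_def)
      also have "\<dots> = ennreal (LINT x|T. indicator A x * (1 + k b x))"
        by (rule nn_integral_eq_integral[OF i1]) (use kae in \<open>eventually_elim, auto simp: indicator_def\<close>)
      also have "(LINT x|T. indicator A x * (1 + k b x)) = measure T A + q A \<bullet> b"
      proof -
        have "integrable T (indicator A :: _ \<Rightarrow> real)" 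
          by (intro integrable_real_indicator[OF A]) (metis T.emeasure_finite infinity_ennreal_def top.not_eq_extremum)
        moreover have "integrable T (\<lambda>x. indicator A x * k b x)" using integrable_mult_indicator[OF A k(1)[OF b]] by simp
        ultimately show ?thesis using A k(2)[OF b A] by (simp add: distrib_left set_lebesgue_integral_def)
      qed
      also have "measure T A + q A \<bullet> b = (LINT w|N. indicator A (X w) * (1 + V w \<bullet> b))"
      proof -
        have "q A \<bullet> b = (LINT w|N. indicator A (X w) * (V w \<bullet> b))"
          using A sT q[of A] integral_inner_left[OF iA[OF A], of b] by simp
        moreover have "integrable N (\<lambda>w. indicator A (X w) * (V w \<bullet> b))"
          using integrable_inner_left[of b, OF iA[OF A]] by simp
        ultimately show ?thesis using iA1[OF A] mT[OF A] by (simp add: distrib_left)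
      qed
      also have "ennreal \<dots> = (\<integral>\<^sup>+w. ennreal (indicator A (X w) * (1 + V w \<bullet> b)) \<partial>N)"
      proof (rule nn_integral_eq_integral[symmetric])
        have "integrable N (\<lambda>w. indicator A (X w) * (V w \<bullet> b))"
          using integrable_inner_left[of b, OF iA[OF A]] by simp
        then show "integrable N (\<lambda>w. indicator A (X w) * (1 + V w \<bullet> b))" using iA1[OF A] by (simp add: distrib_left)
        show "AE w in N. 0 \<le> indicator A (X w) * (1 + V w \<bullet> b)"
          using Vnn by (intro AE_I2 mult_nonneg_nonneg) auto
      qed
      also have "\<dots> = emeasure ?D2 A"
      proof -
        have AX: "X -` A \<inter> space N \<in> sets N" using A sT measurable_sets[OF X] by auto
        have "emeasure ?D2 A = emeasure (density N (\<lambda>w. ennreal (1 + V w \<bullet> b))) (X -` A \<inter> space N)"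
          using A sT by (subst emeasure_distr) auto
        also have "\<dots> = (\<integral>\<^sup>+w. ennreal (1 + V w \<bullet> b) * indicator (X -` A \<inter> space N) w \<partial>N)"
          by (rule emeasure_density) (use AX in auto)
        also have "\<dots> = (\<integral>\<^sup>+w. ennreal (indicator A (X w) * (1 + V w \<bullet> b)) \<partial>N)"
          by (rule nn_integral_cong) (auto simp: indicator_def)
        finally show ?thesis by simp
      qed
      finally show "emeasure ?D1 A = emeasure ?D2 A" .
    qed
    have fb: "\<bar>f x \<bullet> b\<bar> \<le> C" if "x \<in> K" for x using Basis_le_norm[OF b, of "f x"] f(2)[OF that] by linarith
    have fTb[measurable]: "(\<lambda>x. f x \<bullet> b) \<in> borel_measurable T" using fT by measurable
    have fXm[measurable]: "(\<lambda>w. f (X w) \<bullet> b) \<in> borel_measurable N"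
      using measurable_compose[OF X f(1)] by measurable
    have j1: "integrable T (\<lambda>x. f x \<bullet> b)" by (rule T.integrable_const_bound[of _ C]) (use fb spT in auto)
    have j2: "integrable T (\<lambda>x. (f x \<bullet> b) * k b x)"
    proof (rule Bochner_Integration.integrable_bound[OF integrable_mult_right[OF integrable_abs[OF k(1)[OF b]], of C]])
      show "AE x in T. norm ((f x \<bullet> b) * k b x) \<le> norm (C * \<bar>k b x\<bar>)"
      proof (rule AE_I2)
        fix x assume "x \<in> space T"
        then have "\<bar>f x \<bullet> b\<bar> \<le> C" using fb spT by simp
        then have "\<bar>f x \<bullet> b\<bar> * \<bar>k b x\<bar> \<le> C * \<bar>k b x\<bar>" by (rule mult_right_mono) simp
        moreover have "0 \<le> C" using \<open>\<bar>f x \<bullet> b\<bar> \<le> C\<close> by linarith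
        ultimately show "norm ((f x \<bullet> b) * k b x) \<le> norm (C * \<bar>k b x\<bar>)" by (simp add: abs_mult)
      qed
    qed measurable
    have l1: "integrable N (\<lambda>w. f (X w) \<bullet> b)" by (rule N.integrable_const_bound[of _ C]) (use fb XK in auto)
    have l2: "integrable N (\<lambda>w. (f (X w) \<bullet> b) * (V w \<bullet> b))"
    proof (rule N.integrable_const_bound[of _ C])
      show "AE w in N. norm ((f (X w) \<bullet> b) * (V w \<bullet> b)) \<le> C"
      proof (rule AE_I2)
        fix w assume "w \<in> space N"
        then have "\<bar>f (X w) \<bullet> b\<bar> * \<bar>V w \<bullet> b\<bar> \<le> C * 1"
          using fb XK Vb by (intro mult_mono) (auto intro: order_trans[OF abs_ge_zero])
        then show "norm ((f (X w) \<bullet> b) * (V w \<bullet> b)) \<le> C" by (simp add: abs_mult)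
      qed
    qed measurable
    have "(LINT x|T. (1 + k b x) * (f x \<bullet> b)) = (LINT x|?D1. f x \<bullet> b)"
      using kae by (subst integral_density) auto
    also have "\<dots> = (LINT w|density N (\<lambda>w. ennreal (1 + V w \<bullet> b)). f (X w) \<bullet> b)"
      unfolding D using f(1) by (intro integral_distr) auto
    also have "\<dots> = (LINT w|N. (1 + V w \<bullet> b) * (f (X w) \<bullet> b))"
      using Vnn by (subst integral_density) auto
    finally have "(LINT x|T. (1 + k b x) * (f x \<bullet> b)) = (LINT w|N. (1 + V w \<bullet> b) * (f (X w) \<bullet> b))" .
    moreover have "(1 + k b x) * (f x \<bullet> b) = f x \<bullet> b + (f x \<bullet> b) * k b x" for x by (simp add: algebra_simps)
    moreover have "(1 + V w \<bullet> b) * (f (X w) \<bullet> b) = f (X w) \<bullet> b + (f (X w) \<bullet> b) * (V w \<bullet> b)" for w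
      by (simp add: algebra_simps)
    ultimately have "(LINT x|T. (f x \<bullet> b)) + (LINT x|T. (f x \<bullet> b) * k b x) =
       (LINT w|N. f (X w) \<bullet> b) + (LINT w|N. (f (X w) \<bullet> b) * (V w \<bullet> b))"
      by (simp only: Bochner_Integration.integral_add[OF j1 j2] Bochner_Integration.integral_add[OF l1 l2])
    moreover have "(LINT x|T. (f x \<bullet> b)) = (LINT w|N. f (X w) \<bullet> b)"
      unfolding T_def using f(1) by (intro integral_distr[OF X]) auto
    ultimately show "(LINT x|T. (f x \<bullet> b) * k b x) = (LINT w|N. (f (X w) \<bullet> b) * (V w \<bullet> b))" by simp
  qed
  also have "\<dots> = (LINT w|N. (\<Sum>b\<in>Basis. (f (X w) \<bullet> b) * (V w \<bullet> b)))"
  proof (rule Bochner_Integration.integral_sum[symmetric])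
    fix b :: 'a assume b: "b \<in> Basis"
    have m: "(\<lambda>w. (f (X w) \<bullet> b) * (V w \<bullet> b)) \<in> borel_measurable N"
      using measurable_compose[OF X f(1)] V(1) by measurable
    show "integrable N (\<lambda>w. (f (X w) \<bullet> b) * (V w \<bullet> b))"
    proof (rule N.integrable_const_bound[of _ C, OF _ m], rule AE_I2)
      fix w assume w: "w \<in> space N"
      have "\<bar>f (X w) \<bullet> b\<bar> \<le> C" using Basis_le_norm[OF b, of "f (X w)"] f(2)[OF XK[OF w]] by linarith
      moreover have "\<bar>V w \<bullet> b\<bar> \<le> 1" using Basis_le_norm[OF b, of "V w"] V(2)[of w] by linarith
      ultimately have "\<bar>f (X w) \<bullet> b\<bar> * \<bar>V w \<bullet> b\<bar> \<le> C * 1" by (intro mult_mono) auto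
      then show "norm ((f (X w) \<bullet> b) * (V w \<bullet> b)) \<le> C" by (simp add: abs_mult)
    qed
  qed
  also have "\<dots> = (LINT w|N. f (X w) \<bullet> V w)" by (simp add: euclidean_inner[symmetric])
  finally show ?thesis .
qed


subsection \<open>Borel representatives\<close>

lemma lebesgue_on_transfer:
  fixes F F' :: "'a::euclidean_space \<Rightarrow> 'b::{banach, second_countable_topology}"
  assumes S: "S \<in> sets borel" and F: "F \<in> borel_measurable (lebesgue_on S)" and F': "F' \<in> borel_measurable borel"
    and ae: "AE x in lborel. indicator S x *\<^sub>R F x = F' x"
  shows "(LINT x|lebesgue_on S. F x) = (LINT x|lborel. F' x)" "integrable (lebesgue_on S) F \<longleftrightarrow> integrable lborel F'"
proof -
  have S': "S \<inter> space lebesgue \<in> sets lebesgue" using S by auto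
  have m: "(\<lambda>x. indicator S x *\<^sub>R F x) \<in> borel_measurable lebesgue"
    using F by (rule borel_measurable_restrict_space_iff[OF S', THEN iffD1])
  have F'l: "F' \<in> borel_measurable lborel" using F' by simp
  have ae': "AE x in lebesgue. indicator S x *\<^sub>R F x = F' x" using ae by (rule AE_completion)
  have "(LINT x|lebesgue_on S. F x) = (LINT x|lebesgue. indicator S x *\<^sub>R F x)"
    using integral_restrict_space[OF S', of F] by (simp add: set_lebesgue_integral_def)
  also have "\<dots> = (LINT x|lebesgue. F' x)"
    by (rule integral_cong_AE[OF m measurable_completion[OF F'l] ae'])
  also have "\<dots> = (LINT x|lborel. F' x)" by (rule integral_completion[OF F'l])
  finally show "(LINT x|lebesgue_on S. F x) = (LINT x|lborel. F' x)" .
  have "integrable (lebesgue_on S) F \<longleftrightarrow> integrable lebesgue (\<lambda>x. indicator S x *\<^sub>R F x)"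
    using integrable_restrict_space[OF S', of F] by (simp add: set_integrable_def)
  also have "\<dots> \<longleftrightarrow> integrable lebesgue F'"
    by (rule integrable_cong_AE[OF m measurable_completion[OF F'l] ae'])
  also have "\<dots> \<longleftrightarrow> integrable lborel F'" by (rule integrable_completion[OF F'l])
  finally show "integrable (lebesgue_on S) F \<longleftrightarrow> integrable lborel F'" .
qed

text \<open>The problem is stated for fields measurable with respect to the completed Lebesgue
  measure, whereas Fubini and the laws of fields are handled over Borel sets. Components are
  replaced one by one and the result is cut off outside \<open>S\<close>.\<close>

lemma borel_representative:
  fixes f :: "'a::euclidean_space \<Rightarrow> 'b::euclidean_space"
  assumes S: "S \<in> sets borel" and f: "f \<in> borel_measurable (lebesgue_on S)"
  obtains h where "h \<in> borel_measurable borel" "\<And>x. x \<notin> S \<Longrightarrow> h x = 0"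
    "AE x in lborel. indicator S x *\<^sub>R f x = h x"
proof -
  have S': "S \<inter> space lebesgue \<in> sets lebesgue" using S by auto
  have m: "(\<lambda>x. indicator S x *\<^sub>R f x) \<in> borel_measurable lebesgue"
    using f by (rule borel_measurable_restrict_space_iff[OF S', THEN iffD1])
  have "\<exists>g\<in>borel_measurable lborel. AE x in lborel. (indicator S x *\<^sub>R f x) \<bullet> b = g x" for b
    by (rule completion_ex_borel_measurable_real[OF borel_measurable_inner[OF m borel_measurable_const]])
  then obtain g where g: "\<And>b. g b \<in> borel_measurable lborel" "\<And>b. AE x in lborel. (indicator S x *\<^sub>R f x) \<bullet> b = g b x" by metis
  define h where "h x = indicator S x *\<^sub>R (\<Sum>b\<in>Basis. g b x *\<^sub>R b)" for x
  have [measurable]: "g b \<in> borel_measurable borel" for b using g(1)[of b] by simp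
  have "h \<in> borel_measurable borel" unfolding h_def using S by measurable
  moreover have "AE x in lborel. indicator S x *\<^sub>R f x = h x"
  proof -
    have "AE x in lborel. \<forall>b\<in>Basis. (indicator S x *\<^sub>R f x) \<bullet> b = g b x"
      using g(2) by (simp add: AE_finite_all)
    then show ?thesis
    proof eventually_elim
      fix x assume *: "\<forall>b\<in>Basis. (indicator S x *\<^sub>R f x) \<bullet> b = g b x"
      have "indicator S x *\<^sub>R f x = (\<Sum>b\<in>Basis. ((indicator S x *\<^sub>R f x) \<bullet> b) *\<^sub>R b)"
        by (rule euclidean_representation[symmetric])
      also have "\<dots> = (\<Sum>b\<in>Basis. g b x *\<^sub>R b)" by (rule sum.cong[OF refl]) (use * in simp)
      finally show "indicator S x *\<^sub>R f x = h x" by (cases "x \<in> S") (simp_all add: h_def)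
    qed
  qed
  ultimately show ?thesis using that[of h] by (simp add: h_def)
qed

text \<open>A test function of the interior of \<Omega> is one of the interior of \<open>K\<close>,
  so weak gradients restrict. The second conclusion moves pairings with fields living on \<Omega>
  from \<open>K\<close> to the whole space, which makes one such field admissible on every enlarged
  domain.\<close>

lemma sobolev_imp_weak_test:
  fixes \<Omega> K :: "'a::euclidean_space set"
  assumes K: "compact K" and \<Omega>: "compact \<Omega>" "\<Omega> \<subseteq> K" and p: "1 < p"
    and sob: "sobolev p K \<phi> G" and g: "continuous_on K g"
    and ae: "AE x in lebesgue_on (interior K). g x = \<phi> x"
  obtains G' where "weak_test \<Omega> p g G'"
    "\<And>P. P \<in> borel_measurable borel \<Longrightarrow> (\<And>x. x \<notin> interior \<Omega> \<Longrightarrow> P x = 0) \<Longrightarrow>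
       (LINT x|lebesgue_on K. P x \<bullet> G x) = (LINT x|lborel. P x \<bullet> G' x)"
proof -
  let ?V = "interior K" and ?U = "interior \<Omega>"
  have UV: "?U \<subseteq> ?V" by (rule interior_mono[OF \<Omega>(2)])
  have bV: "?V \<in> sets borel" by simp
  have Gm: "G \<in> borel_measurable (lebesgue_on ?V)" and Gp: "integrable (lebesgue_on ?V) (\<lambda>x. norm (G x) powr p)"
    and \<phi>m: "\<phi> \<in> borel_measurable (lebesgue_on ?V)" and wg: "has_weak_gradient ?V \<phi> G"
    using sob by (auto simp: sobolev_def Lp_space_def)
  obtain H where H[measurable]: "H \<in> borel_measurable borel" and Hz: "\<And>x. x \<notin> ?V \<Longrightarrow> H x = 0"
    and Hae: "AE x in lborel. indicator ?V x *\<^sub>R G x = H x" using borel_representative[OF bV Gm] by metis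
  have Hp: "integrable lborel (\<lambda>x. norm (H x) powr p)"
  proof -
    have "AE x in lborel. indicator ?V x *\<^sub>R (norm (G x) powr p) = norm (H x) powr p"
      using Hae by eventually_elim (use Hz p in \<open>auto simp: indicator_def split: if_splits\<close>)
    from lebesgue_on_transfer(2)[OF bV _ _ this] Gp show ?thesis by auto
  qed
  define G' where "G' x = indicator ?U x *\<^sub>R H x" for x
  have G'm[measurable]: "G' \<in> borel_measurable borel" unfolding G'_def by measurable
  have G'p: "integrable lborel (\<lambda>x. norm (G' x) powr p)"
  proof (rule Bochner_Integration.integrable_bound[OF Hp])
    show "(\<lambda>x. norm (G' x) powr p) \<in> borel_measurable lborel" by measurable
  qed (use p in \<open>auto simp: G'_def indicator_def\<close>)
  have iU: "integrable lborel (indicator ?U :: 'a \<Rightarrow> real)"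
    by (rule integrable_lborel_bounded_support[OF _ bounded_interior[OF compact_imp_bounded[OF \<Omega>(1)]], where M=1])
       (auto simp: indicator_def)
  have G'i: "integrable lborel G'"
  proof (rule Bochner_Integration.integrable_bound[OF Bochner_Integration.integrable_add[OF iU G'p]])
    show "AE x in lborel. norm (G' x) \<le> norm (indicator ?U x + norm (G' x) powr p)"
    proof (rule AE_I2)
      fix x
      have "norm (G' x) \<le> 1 + norm (G' x) powr p"
      proof (cases "norm (G' x) \<le> 1")
        case False
        then have "norm (G' x) powr 1 \<le> norm (G' x) powr p" using p by (intro powr_mono) auto
        then show ?thesis using False by simp
      qed (simp add: add_increasing2)
      then show "norm (G' x) \<le> norm (indicator ?U x + norm (G' x) powr p)"
        by (cases "x \<in> ?U") (auto simp: G'_def)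
    qed
  qed simp
  have gV: "continuous_on ?V g" using g interior_subset continuous_on_subset by blast
  have gaeL: "AE x in lborel. x \<in> ?V \<longrightarrow> g x = \<phi> x"
  proof -
    have "AE x in lebesgue. x \<in> ?V \<longrightarrow> g x = \<phi> x"
      using ae by (subst (asm) AE_restrict_space_iff) auto
    then show ?thesis by (simp add: AE_completion_iff)
  qed
  have weak: "(LINT x|lborel. (indicator ?U x * g x) * frechet_derivative \<psi> (at x) b) = - (LINT x|lborel. (G' x \<bullet> b) * \<psi> x)"
    if \<psi>: "\<psi> \<in> Cc_infinity ?U" and b: "b \<in> Basis" for \<psi> b
  proof -
    note D = Cc_infinityD[OF \<psi>]
    have z: "\<psi> x = 0" "frechet_derivative \<psi> (at x) b = 0" if "x \<notin> ?U" for x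
      using that D(3,4) frechet_derivative_eq_0_outside_supp[OF \<psi>] by blast+
    have [measurable]: "\<psi> \<in> borel_measurable borel" "(\<lambda>x. frechet_derivative \<psi> (at x) b) \<in> borel_measurable borel"
      by (rule borel_measurable_continuous_onI[OF D(5)] borel_measurable_continuous_onI[OF D(7)[OF b]])+
    have [measurable]: "(\<lambda>x. indicator ?V x *\<^sub>R g x) \<in> borel_measurable borel"
      by (rule continuous_on_indicator_borel[OF bV gV])
    have m1: "(\<lambda>x. frechet_derivative \<psi> (at x) b) \<in> borel_measurable (lebesgue_on ?V)" "\<psi> \<in> borel_measurable (lebesgue_on ?V)"
      by (auto intro!: measurable_restrict_space1 measurable_completion)
    have \<psi>V: "\<psi> \<in> Cc_infinity ?V" using \<psi> UV by (auto simp: Cc_infinity_def)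
    have "(LINT x|lebesgue_on ?V. \<phi> x * frechet_derivative \<psi> (at x) b) =
        (LINT x|lborel. (indicator ?V x *\<^sub>R g x) * frechet_derivative \<psi> (at x) b)"
    proof (rule lebesgue_on_transfer(1)[OF bV])
      show "(\<lambda>x. \<phi> x * frechet_derivative \<psi> (at x) b) \<in> borel_measurable (lebesgue_on ?V)"
        using \<phi>m m1 by (intro borel_measurable_times)
      show "AE x in lborel. indicator ?V x *\<^sub>R (\<phi> x * frechet_derivative \<psi> (at x) b) =
          (indicator ?V x *\<^sub>R g x) * frechet_derivative \<psi> (at x) b"
        using gaeL by eventually_elim (auto simp: indicator_def)
    qed measurable
    also have "\<dots> = (LINT x|lborel. (indicator ?U x * g x) * frechet_derivative \<psi> (at x) b)"
      by (rule Bochner_Integration.integral_cong[OF refl]) (use z UV in \<open>auto simp: indicator_def\<close>)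
    finally have 1: "(LINT x|lebesgue_on ?V. \<phi> x * frechet_derivative \<psi> (at x) b) =
      (LINT x|lborel. (indicator ?U x * g x) * frechet_derivative \<psi> (at x) b)" .
    have "(LINT x|lebesgue_on ?V. (G x \<bullet> b) * \<psi> x) = (LINT x|lborel. (G' x \<bullet> b) * \<psi> x)"
    proof (rule lebesgue_on_transfer(1)[OF bV])
      show "(\<lambda>x. (G x \<bullet> b) * \<psi> x) \<in> borel_measurable (lebesgue_on ?V)"
        using Gm m1 by (intro borel_measurable_times borel_measurable_inner) auto
      show "AE x in lborel. indicator ?V x *\<^sub>R ((G x \<bullet> b) * \<psi> x) = (G' x \<bullet> b) * \<psi> x"
        using Hae by eventually_elim (use z UV in \<open>auto simp: G'_def indicator_def split: if_splits\<close>)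
    qed measurable
    then show ?thesis using wg \<psi>V b 1 unfolding has_weak_gradient_def by simp
  qed
  have wt: "weak_test \<Omega> p g G'"
    unfolding weak_test_def using continuous_on_subset[OF g \<Omega>(2)] G'm G'i G'p weak by simp
  have "(LINT x|lebesgue_on K. P x \<bullet> G x) = (LINT x|lborel. P x \<bullet> G' x)"
    if P: "P \<in> borel_measurable borel" "\<And>x. x \<notin> ?U \<Longrightarrow> P x = 0" for P
  proof (rule lebesgue_on_transfer(1))
    show "K \<in> sets borel" using K by (simp add: compact_imp_closed)
    have GV: "(\<lambda>x. indicator ?V x *\<^sub>R G x) \<in> borel_measurable lebesgue"
      using Gm by (rule borel_measurable_restrict_space_iff[THEN iffD1, rotated]) simp
    have "P \<in> borel_measurable lborel" using P(1) by simp
    then have m: "(\<lambda>x. P x \<bullet> (indicator ?V x *\<^sub>R G x)) \<in> borel_measurable lebesgue"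
      by (rule borel_measurable_inner[OF measurable_completion GV])
    have e: "(\<lambda>x. P x \<bullet> (indicator ?V x *\<^sub>R G x)) = (\<lambda>x. P x \<bullet> G x)"
    proof
      show "P x \<bullet> (indicator ?V x *\<^sub>R G x) = P x \<bullet> G x" for x
      using P(2)[of x] subsetD[OF UV, of x] by (cases "x \<in> ?V"; cases "x \<in> ?U") auto
    qed
    show "(\<lambda>x. P x \<bullet> G x) \<in> borel_measurable (lebesgue_on K)"
      by (rule measurable_restrict_space1[OF m[unfolded e]])
    show "(\<lambda>x. P x \<bullet> G' x) \<in> borel_measurable borel" using P(1) by measurable
    show "AE x in lborel. indicator K x *\<^sub>R (P x \<bullet> G x) = P x \<bullet> G' x"
      using Hae
    proof eventually_elim
      fix x assume h: "indicator ?V x *\<^sub>R G x = H x"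
      show "indicator K x *\<^sub>R (P x \<bullet> G x) = P x \<bullet> G' x"
        using h P(2)[of x] UV interior_subset[of K] by (cases "x \<in> ?U") (auto simp: G'_def indicator_def split: if_splits)
    qed
  qed
  then show ?thesis using that[OF wt] by blast
qed

section \<open>Extension by zero and the regularized problem\<close>

lemma integral_measure_zero_ext:
  fixes g :: "'a::euclidean_space \<Rightarrow> real"
  assumes \<mu>: "sets \<mu> = sets (restrict_space borel \<Omega>)" and K: "compact K" "\<Omega> \<subseteq> K" "K \<subseteq> L" and g: "continuous_on K g"
  shows "(LINT x:K|measure_zero_ext L \<mu>. g x) = (LINT x|\<mu>. g x)"
proof -
  have sp: "space \<mu> = \<Omega>" using sets_eq_imp_space_eq[OF \<mu>] by simp
  have "(\<lambda>x. x) \<in> borel_measurable (restrict_space borel \<Omega>)" by (rule measurable_restrict_space1) simp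
  then have "(\<lambda>x. x) \<in> borel_measurable \<mu>" by (simp add: measurable_cong_sets[OF \<mu> refl])
  then have m: "(\<lambda>x. x) \<in> measurable \<mu> (restrict_space borel L)"
    using K sp by (intro measurable_restrict_space2) auto
  have gm: "(\<lambda>x. indicator K x *\<^sub>R g x) \<in> borel_measurable borel"
    using K g by (intro continuous_on_indicator_borel) (auto simp: compact_imp_closed)
  have "(LINT x:K|measure_zero_ext L \<mu>. g x) = (LINT x|\<mu>. indicator K x *\<^sub>R g x)"
    unfolding set_lebesgue_integral_def measure_zero_ext_def
    by (rule integral_distr[OF m measurable_restrict_space1[OF gm]])
  also have "\<dots> = (LINT x|\<mu>. g x)"
    by (rule Bochner_Integration.integral_cong) (use sp K in auto)
  finally show ?thesis .
qed

text \<open>One field built on \<Omega> competes in every regularized problem, always with the same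
  weighted mass and with an L^p part proportional to \<open>e\<close>.\<close>

lemma flux_field_reg_feasible:
  fixes \<Omega> :: "'a::euclidean_space set"
  assumes \<Omega>: "compact \<Omega>" "\<Omega> \<subseteq> K" and K: "compact K" "K \<subseteq> L" and p: "1 < p"
    and \<mu>p: "sets \<mu>p = sets (restrict_space borel \<Omega>)" and \<mu>m: "sets \<mu>m = sets (restrict_space borel \<Omega>)"
    and P: "flux_field \<Omega> p P (\<lambda>g G. - ((LINT x|\<mu>p. g x) - (LINT x|\<mu>m. g x)))"
    and w: "continuous_on K w" and e: "0 < e"
  shows "P \<in> reg_feasible p K (measure_zero_ext L \<mu>p) (measure_zero_ext L \<mu>m)"
    "reg_cost p e K w P = (LINT z|lborel. (indicator \<Omega> z * w z) * norm (P z)) + e / p * (LINT z|lborel. norm (P z) powr p)"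
proof -
  have Pm[measurable]: "P \<in> borel_measurable borel" and Pz: "\<And>z. z \<notin> interior \<Omega> \<Longrightarrow> P z = 0"
    and Pp: "integrable lborel (\<lambda>z. norm (P z) powr p)"
    using P by (auto simp: flux_field_def)
  have Kb[measurable]: "K \<in> sets borel" using K by (simp add: compact_imp_closed)
  have PzO: "P z = 0" if "z \<notin> \<Omega>" for z using Pz interior_subset that by blast
  have PKm: "P \<in> borel_measurable (lebesgue_on K)"
    by (intro measurable_restrict_space1 measurable_completion) simp
  have PpKm: "(\<lambda>z. norm (P z) powr p) \<in> borel_measurable (lebesgue_on K)" using PKm by measurable
  have aep: "AE x in lborel. indicator K x *\<^sub>R (norm (P x) powr p) = norm (P x) powr p"
    using PzO \<Omega>(2) p by (intro AE_I2) (auto simp: indicator_def)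
  have PpK: "integrable (lebesgue_on K) (\<lambda>z. norm (P z) powr p)"
    "(LINT z|lebesgue_on K. norm (P z) powr p) = (LINT z|lborel. norm (P z) powr p)"
    using lebesgue_on_transfer[OF Kb PpKm _ aep] Pp by auto
  have "div_eq_dual p K P (measure_zero_ext L \<mu>p) (measure_zero_ext L \<mu>m)"
    unfolding div_eq_dual_def
  proof (intro allI impI, elim conjE)
    fix \<phi> G g
    assume a: "sobolev_mean0 (conj_exp p) K \<phi> G" "continuous_on K g" "AE x in lebesgue_on (interior K). g x = \<phi> x"
    obtain G' where G': "weak_test \<Omega> (conj_exp p) g G'"
      "\<And>P. P \<in> borel_measurable borel \<Longrightarrow> (\<And>x. x \<notin> interior \<Omega> \<Longrightarrow> P x = 0) \<Longrightarrow>
       (LINT x|lebesgue_on K. P x \<bullet> G x) = (LINT x|lborel. P x \<bullet> G' x)"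
      using sobolev_imp_weak_test[OF K(1) \<Omega> conj_exp_props(1)[OF p] _ a(2,3)] a(1) unfolding sobolev_mean0_def by metis
    have "(LINT x|lebesgue_on K. P x \<bullet> G x) = (LINT x|lborel. P x \<bullet> G' x)" by (rule G'(2)[OF Pm Pz])
    also have "\<dots> = - ((LINT x|\<mu>p. g x) - (LINT x|\<mu>m. g x))" using P G'(1) by (simp add: flux_field_def)
    finally show "- (LINT x|lebesgue_on K. P x \<bullet> G x) =
       (LINT x:K|measure_zero_ext L \<mu>p. g x) - (LINT x:K|measure_zero_ext L \<mu>m. g x)"
      unfolding integral_measure_zero_ext[OF \<mu>p K(1) \<Omega>(2) K(2) a(2)] integral_measure_zero_ext[OF \<mu>m K(1) \<Omega>(2) K(2) a(2)]
      by simp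
  qed
  then show "P \<in> reg_feasible p K (measure_zero_ext L \<mu>p) (measure_zero_ext L \<mu>m)"
    unfolding reg_feasible_def Lp_space_def using PKm PpK(1) by simp
  have [measurable]: "(\<lambda>x. indicator K x *\<^sub>R w x) \<in> borel_measurable borel" by (rule continuous_on_indicator_borel[OF Kb w])
  have "(LINT x|lebesgue_on K. w x * norm (P x)) = (LINT z|lborel. (indicator K z *\<^sub>R w z) * norm (P z))"
  proof (rule lebesgue_on_transfer(1)[OF Kb])
    have "w \<in> borel_measurable (lebesgue_on K)"
      by (rule continuous_imp_measurable_on_sets_lebesgue[OF w]) simp
    then show "(\<lambda>x. w x * norm (P x)) \<in> borel_measurable (lebesgue_on K)" using PKm by measurable
    show "(\<lambda>z. (indicator K z *\<^sub>R w z) * norm (P z)) \<in> borel_measurable borel" by measurable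
  qed simp
  also have "\<dots> = (LINT z|lborel. (indicator \<Omega> z * w z) * norm (P z))"
    by (rule Bochner_Integration.integral_cong[OF refl]) (use PzO \<Omega>(2) in \<open>auto simp: indicator_def\<close>)
  finally show "reg_cost p e K w P = (LINT z|lborel. (indicator \<Omega> z * w z) * norm (P z)) + e / p * (LINT z|lborel. norm (P z) powr p)"
    using p PpK(2) by (simp add: reg_cost_def Lp_norm_def powr_powr Bochner_Integration.integral_nonneg)
qed

text \<open>A single Borel version serves the measure, the constraint and the cost. The last
  inequality drops the nonnegative L^p term, leaving the weighted mass below the regularized
  cost.\<close>

lemma density_vmeasure_representative:
  fixes q :: "'a::euclidean_space \<Rightarrow> 'a"
  assumes K: "compact K" "K \<subseteq> L" and L: "compact L" and p: "1 < p" and q: "q \<in> Lp_space p K"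
    and w: "continuous_on L w" "\<And>x. x \<in> L \<Longrightarrow> 0 \<le> w x" and e: "0 < e"
  obtains h where "h \<in> borel_measurable borel" "\<And>x. x \<notin> K \<Longrightarrow> h x = 0" "integrable lborel h"
    "\<And>f. continuous_on L f \<Longrightarrow> vintegral L (density_vmeasure K q) f = (LINT x|lborel. f x \<bullet> h x)"
    "\<And>f. continuous_on K f \<Longrightarrow> (LINT x|lebesgue_on K. q x \<bullet> f x) = (LINT x|lborel. h x \<bullet> f x)"
    "(LINT x|lborel. w x * norm (h x)) \<le> reg_cost p e K w q"
proof -
  have Kb: "K \<in> sets borel" and Lb: "L \<in> sets borel" using K L by (auto simp: compact_imp_closed)
  have qm: "q \<in> borel_measurable (lebesgue_on K)" and qp: "integrable (lebesgue_on K) (\<lambda>x. norm (q x) powr p)"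
    using q by (auto simp: Lp_space_def)
  obtain h where h[measurable]: "h \<in> borel_measurable borel" and hz: "\<And>x. x \<notin> K \<Longrightarrow> h x = 0"
    and hae: "AE x in lborel. indicator K x *\<^sub>R q x = h x" using borel_representative[OF Kb qm] by metis
  have hzL: "h x = 0" if "x \<notin> L" for x using hz[of x] K(2) that by blast
  have hp: "integrable lborel (\<lambda>x. norm (h x) powr p)"
  proof -
    have "AE x in lborel. indicator K x *\<^sub>R (norm (q x) powr p) = norm (h x) powr p"
      using hae by eventually_elim (use hz p in \<open>auto simp: indicator_def split: if_splits\<close>)
    from lebesgue_on_transfer(2)[OF Kb _ _ this] qp show ?thesis by auto
  qed
  have iK: "integrable lborel (indicator K :: 'a \<Rightarrow> real)"
    by (rule integrable_lborel_bounded_support[OF _ compact_imp_bounded[OF K(1)], where M=1]) (use Kb in \<open>auto simp: indicator_def\<close>)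
  have hi: "integrable lborel h"
  proof (rule Bochner_Integration.integrable_bound[OF Bochner_Integration.integrable_add[OF iK hp]])
    show "AE x in lborel. norm (h x) \<le> norm (indicator K x + norm (h x) powr p)"
    proof (rule AE_I2)
      fix x
      have "norm (h x) \<le> 1 + norm (h x) powr p"
      proof (cases "norm (h x) \<le> 1")
        case False
        then have "norm (h x) powr 1 \<le> norm (h x) powr p" using p by (intro powr_mono) auto
        then show ?thesis using False by simp
      qed (simp add: add_increasing2)
      then show "norm (h x) \<le> norm (indicator K x + norm (h x) powr p)" using hz[of x] by (cases "x \<in> K") auto
    qed
  qed simp
  have vi: "vintegral L (density_vmeasure K q) f = (LINT x|lborel. f x \<bullet> h x)" if f: "continuous_on L f" for f
  proof -
    define T where "T = restrict_space (lborel :: 'a measure) L"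
    have sT: "sets T = sets (restrict_space borel L)" unfolding T_def by (rule sets_restrict_space_cong) simp
    have L': "L \<inter> space lborel \<in> sets lborel" using Lb by simp
    have hT: "integrable T h" unfolding T_def
      using integrable_restrict_space[OF L', of h] integrable_mult_indicator[OF _ hi, of L] Lb by (simp add: set_integrable_def)
    obtain M where M: "\<And>x. x \<in> L \<Longrightarrow> norm (f x) \<le> M" using compact_continuous_bound[OF L f] by metis
    have "vintegral L (density_vmeasure K q) f = (LINT x|T. f x \<bullet> h x)"
    proof (rule vintegral_density[OF sT hT _ _ M])
      show "f \<in> borel_measurable T"
        using borel_measurable_continuous_on_restrict[OF f] measurable_cong_sets[OF sT refl] by blast
      fix A assume A: "A \<in> sets T"
      then have AL: "A \<in> sets borel" "A \<subseteq> L"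
        using Lb sT sets_restrict_space_iff[of L borel] by auto
      have AK: "A \<inter> K \<in> sets borel" using AL Kb by auto
      have "density_vmeasure K q A = (LINT x|lebesgue_on (A \<inter> K). q x)" by (simp add: density_vmeasure_def)
      also have "\<dots> = (LINT x|lborel. indicator A x *\<^sub>R h x)"
      proof (rule lebesgue_on_transfer(1)[OF AK])
        show "q \<in> borel_measurable (lebesgue_on (A \<inter> K))"
          by (rule measurable_restrict_mono[OF qm]) auto
        show "(\<lambda>x. indicator A x *\<^sub>R h x) \<in> borel_measurable borel" using AL by measurable
        show "AE x in lborel. indicator (A \<inter> K) x *\<^sub>R q x = indicator A x *\<^sub>R h x"
          using hae by eventually_elim (use hz in \<open>auto simp: indicator_def split: if_splits\<close>)
      qed
      also have "\<dots> = (LINT x:A|T. h x)"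
        unfolding set_lebesgue_integral_def T_def
        by (subst integral_restrict_space[OF L'])
           (use AL in \<open>auto simp: set_lebesgue_integral_def indicator_def intro!: Bochner_Integration.integral_cong\<close>)
      finally show "density_vmeasure K q A = (LINT x:A|T. h x)" .
    qed
    also have "\<dots> = (LINT x|lborel. f x \<bullet> h x)"
      unfolding T_def
      by (subst integral_restrict_space[OF L'])
         (use hzL in \<open>auto simp: set_lebesgue_integral_def indicator_def intro!: Bochner_Integration.integral_cong\<close>)
    finally show ?thesis .
  qed
  have ci: "(LINT x|lebesgue_on K. q x \<bullet> f x) = (LINT x|lborel. h x \<bullet> f x)" if f: "continuous_on K f" for f
  proof -
    have [measurable]: "(\<lambda>x. indicator K x *\<^sub>R f x) \<in> borel_measurable borel" by (rule continuous_on_indicator_borel[OF Kb f])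
    have "(LINT x|lebesgue_on K. q x \<bullet> f x) = (LINT x|lborel. h x \<bullet> (indicator K x *\<^sub>R f x))"
    proof (rule lebesgue_on_transfer(1)[OF Kb])
      have "f \<in> borel_measurable (lebesgue_on K)"
        by (rule continuous_imp_measurable_on_sets_lebesgue[OF f]) (use Kb in simp)
      then show "(\<lambda>x. q x \<bullet> f x) \<in> borel_measurable (lebesgue_on K)" using qm by (intro borel_measurable_inner)
      show "AE x in lborel. indicator K x *\<^sub>R (q x \<bullet> f x) = h x \<bullet> (indicator K x *\<^sub>R f x)"
        using hae by eventually_elim (use hz in \<open>auto simp: indicator_def split: if_splits\<close>)
    qed measurable
    also have "\<dots> = (LINT x|lborel. h x \<bullet> f x)"
      by (rule Bochner_Integration.integral_cong[OF refl]) (use hz in \<open>auto simp: indicator_def\<close>)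
    finally show ?thesis .
  qed
  have "(LINT x|lborel. w x * norm (h x)) \<le> reg_cost p e K w q"
  proof -
    have wK: "continuous_on K w" using w(1) K(2) continuous_on_subset by blast
    have [measurable]: "(\<lambda>x. indicator K x *\<^sub>R w x) \<in> borel_measurable borel" by (rule continuous_on_indicator_borel[OF Kb wK])
    have "(LINT x|lebesgue_on K. w x * norm (q x)) = (LINT x|lborel. (indicator K x *\<^sub>R w x) * norm (h x))"
    proof (rule lebesgue_on_transfer(1)[OF Kb])
      have "w \<in> borel_measurable (lebesgue_on K)"
        by (rule continuous_imp_measurable_on_sets_lebesgue[OF wK]) (use Kb in simp)
      then show "(\<lambda>x. w x * norm (q x)) \<in> borel_measurable (lebesgue_on K)" using qm by measurable
      show "AE x in lborel. indicator K x *\<^sub>R (w x * norm (q x)) = (indicator K x *\<^sub>R w x) * norm (h x)"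
        using hae by eventually_elim (use hz in \<open>auto simp: indicator_def split: if_splits\<close>)
    qed measurable
    also have "\<dots> = (LINT x|lborel. w x * norm (h x))"
      by (rule Bochner_Integration.integral_cong[OF refl]) (use hz in \<open>auto simp: indicator_def\<close>)
    finally have "reg_cost p e K w q = (LINT x|lborel. w x * norm (h x)) + e / p * Lp_norm p K q powr p"
      by (simp add: reg_cost_def)
    then show ?thesis using e p by simp
  qed
  with vi ci show ?thesis by (intro that[OF h hz hi]) auto
qed

subsection \<open>Limits of vector fields as Young measures\<close>

text \<open>The n-th law is that of (x, v), with x of density \<rho> and v = h / (B \<rho>) in the
  unit ball. Integrands positively homogeneous of degree 1 in v see only the product \<rho> v = h /
  B, so f(x) . v and f(x) |v| recover the integrals of f . h and f |h| exactly. Compactness of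
  \<open>L \<times> cball 0 1\<close> gives the subsequence.\<close>

lemma young_measure_limit:
  fixes h :: "nat \<Rightarrow> 'a::euclidean_space \<Rightarrow> 'a"
  assumes L: "compact L" "0 < measure lborel L" and B: "0 < B"
    and h: "\<And>n. h n \<in> borel_measurable borel" "\<And>n x. x \<notin> L \<Longrightarrow> h n x = 0" "\<And>n. integrable lborel (h n)"
      "\<And>n. (LINT x|lborel. norm (h n x)) \<le> B"
  obtains r :: "nat \<Rightarrow> nat" and \<Gamma> :: "('a \<times> 'a) measure" where
    "strict_mono r" "prob_space \<Gamma>" "sets \<Gamma> = sets borel" "AE z in \<Gamma>. z \<in> L \<times> cball 0 1"
    "\<And>f. continuous_on UNIV f \<Longrightarrow>
       (\<lambda>n. LINT x|lborel. f x \<bullet> h (r n) x) \<longlonglongrightarrow> B * (LINT z|\<Gamma>. f (fst z) \<bullet> snd z)"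
    "\<And>f. continuous_on UNIV f \<Longrightarrow>
       (\<lambda>n. LINT x|lborel. f x * norm (h (r n) x)) \<longlonglongrightarrow> B * (LINT z|\<Gamma>. f (fst z) * norm (snd z))"
proof -
  have clL: "closed L" using L(1) by (rule compact_imp_closed)
  have Lb[measurable]: "L \<in> sets borel" using clL by simp
  have emL: "emeasure lborel L < \<infinity>" using emeasure_compact_finite[OF L(1)] by simp
  have hn: "integrable lborel (\<lambda>x. norm (h n x))" for n using h(3) by (rule integrable_norm)
  have iL: "integrable lborel (indicator L :: 'a \<Rightarrow> real)" using Lb emL by (intro integrable_real_indicator) auto
  \<comment> \<open>The mass missing up to B is spread uniformly over \<open>L\<close>; this changes
    v but not the product \<rho> v.\<close>
  define c where "c n = (1 - (LINT x|lborel. norm (h n x)) / B) / measure lborel L" for n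
  have c: "0 \<le> c n" for n using h(4)[of n] B L(2) by (simp add: c_def)
  define \<rho> where "\<rho> n x = norm (h n x) / B + c n * indicator L x" for n x
  have \<rho>0: "0 \<le> \<rho> n x" for n x using c[of n] B by (simp add: \<rho>_def)
  have \<rho>m[measurable]: "\<rho> n \<in> borel_measurable borel" for n unfolding \<rho>_def using h(1) by measurable
  have \<rho>i: "integrable lborel (\<rho> n)" "(LINT x|lborel. \<rho> n x) = 1" for n
  proof -
    show "integrable lborel (\<rho> n)" unfolding \<rho>_def using hn iL by simp
    have "(LINT x|lborel. \<rho> n x) = (LINT x|lborel. norm (h n x)) / B + c n * measure lborel L"
      unfolding \<rho>_def using hn iL by simp
    then show "(LINT x|lborel. \<rho> n x) = 1" using L(2) by (simp add: c_def)
  qed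
  define D where "D n = density lborel (\<lambda>x. ennreal (\<rho> n x))" for n
  have prD: "prob_space (D n)" for n
  proof (rule prob_spaceI)
    have "emeasure (D n) (space (D n)) = (\<integral>\<^sup>+x. ennreal (\<rho> n x) \<partial>lborel)"
      unfolding D_def by (subst emeasure_density) auto
    also have "\<dots> = ennreal (LINT x|lborel. \<rho> n x)"
      by (rule nn_integral_eq_integral[OF \<rho>i(1)]) (use \<rho>0 in auto)
    finally show "emeasure (D n) (space (D n)) = 1" using \<rho>i(2) by simp
  qed
  define Y where "Y n x = (x, (1 / (B * \<rho> n x)) *\<^sub>R h n x)" for n x
  have Ym: "Y n \<in> borel_measurable borel" for n unfolding Y_def using h(1) by measurable
  have YmD: "Y n \<in> borel_measurable (D n)" for n using Ym by (simp add: D_def)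
  define M where "M n = distr (D n) borel (Y n)" for n
  have cC: "compact (L \<times> cball (0::'a) 1)" using L(1) by (intro compact_Times) auto
  have YC: "Y n x \<in> L \<times> cball 0 1" if "0 < \<rho> n x" for n x
  proof -
    have "x \<in> L"
    proof (rule ccontr)
      assume "x \<notin> L"
      then show False using that h(2)[of x n] by (simp add: \<rho>_def)
    qed
    moreover have "norm (h n x) \<le> B * \<rho> n x" using c[of n] B by (simp add: \<rho>_def distrib_left)
    then have "norm ((1 / (B * \<rho> n x)) *\<^sub>R h n x) \<le> 1" using that B by simp
    ultimately show ?thesis by (simp add: Y_def)
  qed
  have M: "prob_space (M n)" "sets (M n) = sets borel" "AE z in M n. z \<in> L \<times> cball 0 1" for n
  proof -
    show "prob_space (M n)" unfolding M_def by (rule prob_space.prob_space_distr[OF prD YmD])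
    show "sets (M n) = sets borel" by (simp add: M_def)
    have "AE x in D n. Y n x \<in> L \<times> cball 0 1"
      unfolding D_def by (subst AE_density) (use YC in auto)
    moreover have "{z \<in> space borel. z \<in> L \<times> cball (0::'a) 1} \<in> sets borel"
      using compact_imp_closed[OF cC] by simp
    ultimately show "AE z in M n. z \<in> L \<times> cball 0 1"
      unfolding M_def by (subst AE_distr_iff[OF YmD])
  qed
  obtain r \<Gamma> where r: "strict_mono r" and \<Gamma>: "prob_space \<Gamma>" "sets \<Gamma> = sets borel" "AE z in \<Gamma>. z \<in> L \<times> cball 0 1"
    and lim: "\<And>F :: 'a \<times> 'a \<Rightarrow> real. continuous_on UNIV F \<Longrightarrow> (\<lambda>n. LINT z|M (r n). F z) \<longlonglongrightarrow> (LINT z|\<Gamma>. F z)"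
  proof (rule compact_prob_weak_subseq[OF cC M])
    fix r \<Gamma>
    assume "strict_mono r" "prob_space \<Gamma>" "sets \<Gamma> = sets borel" "AE z in \<Gamma>. z \<in> L \<times> cball (0::'a) 1"
      "\<And>F :: 'a \<times> 'a \<Rightarrow> real. continuous_on UNIV F \<Longrightarrow> (\<lambda>n. LINT z|M (r n). F z) \<longlonglongrightarrow> (LINT z|\<Gamma>. F z)"
    then show thesis by (rule that)
  qed
  have key: "(\<lambda>n. LINT x|lborel. F (Y (r n) x) * \<rho> (r n) x) \<longlonglongrightarrow> (LINT z|\<Gamma>. F z)" if F: "continuous_on UNIV F" for F
  proof -
    have Fm: "F \<in> borel_measurable borel" using F by (rule borel_measurable_continuous_onI)
    have "(LINT z|M n. F z) = (LINT x|lborel. F (Y n x) * \<rho> n x)" for n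
    proof -
      have FY: "(\<lambda>x. F (Y n x)) \<in> borel_measurable lborel" using measurable_compose[OF Ym Fm] by simp
      have "(LINT z|M n. F z) = (LINT x|D n. F (Y n x))" unfolding M_def by (rule integral_distr[OF YmD Fm])
      also have "\<dots> = (LINT x|lborel. F (Y n x) * \<rho> n x)"
        unfolding D_def by (subst integral_density[OF FY]) (use \<rho>0 in \<open>auto simp: mult.commute\<close>)
      finally show ?thesis .
    qed
    then show ?thesis using lim[OF F] by simp
  qed
  \<comment> \<open>Where \<rho> is 0 the field \<open>h n\<close> vanishes too, so both sides are 0
    there; elsewhere \<rho> cancels.\<close>
  have sY: "\<rho> n x *\<^sub>R snd (Y n x) = (1 / B) *\<^sub>R h n x" for n x
  proof (cases "\<rho> n x = 0")
    case True
    then have "norm (h n x) / B = 0" using c[of n] B by (simp add: \<rho>_def add_nonneg_eq_0_iff)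
    then show ?thesis using B True by simp
  qed (use B in \<open>simp add: Y_def\<close>)
  have fY: "fst (Y n x) = x" for n x by (simp add: Y_def)
  have c1: "(\<lambda>n. LINT x|lborel. f x \<bullet> h (r n) x) \<longlonglongrightarrow> B * (LINT z|\<Gamma>. f (fst z) \<bullet> snd z)" if f: "continuous_on UNIV f" for f :: "'a \<Rightarrow> 'a"
  proof -
    have F: "continuous_on UNIV (\<lambda>z::'a \<times> 'a. f (fst z) \<bullet> snd z)"
      by (intro continuous_intros continuous_on_compose2[OF f]) auto
    have "f (fst (Y n x)) \<bullet> snd (Y n x) * \<rho> n x = (f x \<bullet> h n x) / B" for n x
    proof -
      have "f (fst (Y n x)) \<bullet> snd (Y n x) * \<rho> n x = f x \<bullet> (\<rho> n x *\<^sub>R snd (Y n x))" by (simp add: Y_def)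
      then show ?thesis unfolding sY by simp
    qed
    then have "(\<lambda>n. (LINT x|lborel. f x \<bullet> h (r n) x) / B) \<longlonglongrightarrow> (LINT z|\<Gamma>. f (fst z) \<bullet> snd z)"
      using key[OF F] by simp
    then have "(\<lambda>n. B * ((LINT x|lborel. f x \<bullet> h (r n) x) / B)) \<longlonglongrightarrow> B * (LINT z|\<Gamma>. f (fst z) \<bullet> snd z)"
      by (intro tendsto_mult tendsto_const)
    then show ?thesis using B by simp
  qed
  have c2: "(\<lambda>n. LINT x|lborel. f x * norm (h (r n) x)) \<longlonglongrightarrow> B * (LINT z|\<Gamma>. f (fst z) * norm (snd z))" if f: "continuous_on UNIV f" for f :: "'a \<Rightarrow> real"
  proof -
    have F: "continuous_on UNIV (\<lambda>z::'a \<times> 'a. f (fst z) * norm (snd z))"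
      by (intro continuous_intros continuous_on_compose2[OF f]) auto
    have "f (fst (Y n x)) * norm (snd (Y n x)) * \<rho> n x = (f x * norm (h n x)) / B" for n x
    proof -
      have "f (fst (Y n x)) * norm (snd (Y n x)) * \<rho> n x = f x * norm (\<rho> n x *\<^sub>R snd (Y n x))"
        using \<rho>0[of n x] by (simp add: fY)
      then show ?thesis unfolding sY using B by simp
    qed
    then have "(\<lambda>n. (LINT x|lborel. f x * norm (h (r n) x)) / B) \<longlonglongrightarrow> (LINT z|\<Gamma>. f (fst z) * norm (snd z))"
      using key[OF F] by simp
    then have "(\<lambda>n. B * ((LINT x|lborel. f x * norm (h (r n) x)) / B)) \<longlonglongrightarrow> B * (LINT z|\<Gamma>. f (fst z) * norm (snd z))"
      by (intro tendsto_mult tendsto_const)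
    then show ?thesis using B by simp
  qed
  show ?thesis by (rule that[OF r \<Gamma> c1 c2])
qed


subsection \<open>Passing to the limit\<close>

lemma measure_pos_if_interior:
  fixes K :: "'a::euclidean_space set"
  assumes "compact K" "interior K \<noteq> {}"
  shows "0 < measure lborel K"
proof -
  obtain x d where d: "0 < d" "ball x d \<subseteq> K"
    using assms(2) by (metis equals0I mem_interior)
  have "0 < measure lborel (ball x d)" by (rule content_ball_pos[OF d(1)])
  also have "\<dots> \<le> measure lborel K"
    using emeasure_compact_finite[OF assms(1)] assms(1) d(2)
    by (intro measure_mono_fmeasurable) (auto simp: fmeasurable_def compact_imp_closed)
  finally show ?thesis .
qed

text \<open>Neither gradients nor the difference of two probability measures see constants, so the
  mean-zero condition on test functions can be met by a shift.\<close>

lemma mean_zero_shift: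
  fixes K :: "'a::euclidean_space set" and f :: "'a \<Rightarrow> real"
  assumes K: "compact K" "interior K \<noteq> {}" and f: "continuous_on K f"
  obtains c where "(LINT x|lebesgue_on K. f x - c) = 0"
proof
  let ?m = "measure lborel K"
  have Kb: "K \<in> sets borel" using K by (simp add: compact_imp_closed)
  define c where "c = (LINT x|lborel. indicator K x *\<^sub>R f x) / ?m"
  have g: "continuous_on K (\<lambda>x. f x - c)" using f by (intro continuous_intros)
  have "(LINT x|lebesgue_on K. f x - c) = (LINT x|lborel. indicator K x *\<^sub>R (f x - c))"
    by (rule integrable_lebesgue_on_iff_lborel(2)[OF Kb continuous_on_indicator_borel[OF Kb g]])
  also have "\<dots> = (LINT x|lborel. indicator K x *\<^sub>R f x) - (LINT x|lborel. indicator K x *\<^sub>R c)"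
    using Bochner_Integration.integral_diff[OF borel_integrable_compact[OF K(1) f]
        borel_integrable_compact[OF K(1) continuous_on_const[of K c]]]
    by (simp add: scaleR_diff_right right_diff_distrib)
  also have "\<dots> = 0" using measure_pos_if_interior[OF K] Kb by (simp add: c_def)
  finally show "(LINT x|lebesgue_on K. f x - c) = 0" .
qed

lemma continuous_measurable_restrict:
  fixes f :: "'a::euclidean_space \<Rightarrow> 'b::euclidean_space"
  assumes "continuous_on K f"
  shows "f \<in> borel_measurable (restrict_space borel K)"
  by (rule borel_measurable_continuous_on_restrict[OF assms])

text \<open>Puts a competitor of finite variation into the form that
  \<open>beckmann_competitor\<close> expects, with the total variation as \<open>N\<close> and the
  identity as \<open>X\<close>, and frees its test functions from the mean-zero condition.\<close>

lemma beckmann_feasible_field: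
  fixes \<Omega> :: "'a::euclidean_space set"
  assumes \<Omega>: "compact \<Omega>" "interior \<Omega> \<noteq> {}"
    and \<mu>p: "prob_space \<mu>p" "sets \<mu>p = sets (restrict_space borel \<Omega>)"
    and \<mu>m: "prob_space \<mu>m" "sets \<mu>m = sets (restrict_space borel \<Omega>)"
    and q: "q \<in> beckmann_feasible \<Omega> \<mu>p \<mu>m" and fin: "emeasure (total_variation \<Omega> q) \<Omega> < \<infinity>"
  obtains h where "h \<in> borel_measurable (total_variation \<Omega> q)" "\<And>x. norm (h x) \<le> 1"
    "\<And>\<phi> G. C1_on \<Omega> \<phi> G \<Longrightarrow>
        - (LINT x|total_variation \<Omega> q. G x \<bullet> h x) = (LINT x|\<mu>p. \<phi> x) - (LINT x|\<mu>m. \<phi> x)"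
proof -
  interpret p: prob_space \<mu>p by fact
  interpret m: prob_space \<mu>m by fact
  have spp: "space \<mu>p = \<Omega>" "space \<mu>m = \<Omega>" using sets_eq_imp_space_eq[OF \<mu>p(2)] sets_eq_imp_space_eq[OF \<mu>m(2)] by auto
  have "(\<lambda>x. x) \<in> borel_measurable (restrict_space borel \<Omega>)" by (rule measurable_restrict_space1) simp
  then have id: "(\<lambda>x. x) \<in> borel_measurable \<mu>p" "(\<lambda>x. x) \<in> borel_measurable \<mu>m"
    by (simp_all add: measurable_cong_sets[OF \<mu>p(2) refl] measurable_cong_sets[OF \<mu>m(2) refl])
  have intp: "integrable \<mu>p f" and intm: "integrable \<mu>m f" if "continuous_on \<Omega> f" for f :: "'a \<Rightarrow> real"
    using integrable_continuous_comp[OF p.finite_measure_axioms id(1) _ \<Omega>(1) that]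
      integrable_continuous_comp[OF m.finite_measure_axioms id(2) _ \<Omega>(1) that] spp by auto
  let ?T = "total_variation \<Omega> q"
  interpret T: finite_measure ?T by (rule finite_measureI) (use fin in auto)
  have qv: "q \<in> vector_measures \<Omega>" and dq: "div_measure_eq \<Omega> q \<mu>p \<mu>m" using q by (auto simp: beckmann_feasible_def)
  obtain h where h: "h \<in> borel_measurable ?T" "\<And>x. norm (h x) \<le> 1"
    and qh: "\<And>A. A \<in> sets ?T \<Longrightarrow> q A = (LINT x:A|?T. h x)" using vector_measure_polar[OF qv fin] by metis
  have hi: "integrable ?T h" by (rule T.integrable_const_bound[of _ 1]) (use h in auto)
  have "- (LINT x|?T. G x \<bullet> h x) = (LINT x|\<mu>p. \<phi> x) - (LINT x|\<mu>m. \<phi> x)" if C1: "C1_on \<Omega> \<phi> G" for \<phi> G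
  proof -
    have \<phi>: "continuous_on \<Omega> \<phi>" and G: "continuous_on \<Omega> G" using C1 by (auto simp: C1_on_def)
    obtain c where c: "(LINT x|lebesgue_on \<Omega>. \<phi> x - c) = 0" using mean_zero_shift[OF \<Omega> \<phi>] by metis
    have "C1_on \<Omega> (\<lambda>x. \<phi> x - c) G"
      using C1 GDERIV_diff[OF _ GDERIV_const[of c]] unfolding C1_on_def by (fastforce intro!: continuous_intros)
    then have "- vintegral \<Omega> q G = (LINT x|\<mu>p. \<phi> x - c) - (LINT x|\<mu>m. \<phi> x - c)"
      using dq c unfolding div_measure_eq_def by blast
    also have "\<dots> = (LINT x|\<mu>p. \<phi> x) - (LINT x|\<mu>m. \<phi> x)"
      using intp[OF \<phi>] intm[OF \<phi>] by (simp add: p.prob_space m.prob_space)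
    also have "vintegral \<Omega> q G = (LINT x|?T. G x \<bullet> h x)"
    proof -
      obtain M where "\<And>x. x \<in> \<Omega> \<Longrightarrow> norm (G x) \<le> M" using compact_continuous_bound[OF \<Omega>(1) G] by metis
      then show ?thesis
        by (intro vintegral_density[OF sets_total_variation hi qh])
           (use continuous_measurable_restrict[OF G] in \<open>simp_all add: measurable_cong_sets[OF sets_total_variation refl]\<close>)
    qed
    finally show ?thesis .
  qed
  then show ?thesis using that h by blast
qed

text \<open>\<open>\<phi>\<close> lives on \<Omega>, while the constraint is tested on the larger
  \<open>K\<close>. Dilation by c maps \<Omega> onto \<open>K\<close> and transports
  \<open>\<phi>\<close> there, at the price of a factor 1/c in the gradient and of dilated arguments
  in the data.\<close>

lemma reg_feasible_scaled_test:
  fixes \<Omega> :: "'a::euclidean_space set"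
  assumes \<Omega>: "compact \<Omega>" "interior \<Omega> \<noteq> {}" and p: "1 < p" and c: "1 < c"
    and K: "K = (\<lambda>x. c *\<^sub>R x) ` \<Omega>" "\<Omega> \<subseteq> K" "K \<subseteq> L"
    and \<mu>p: "prob_space \<mu>p" "sets \<mu>p = sets (restrict_space borel \<Omega>)"
    and \<mu>m: "prob_space \<mu>m" "sets \<mu>m = sets (restrict_space borel \<Omega>)"
    and q: "q \<in> reg_feasible p K (measure_zero_ext L \<mu>p) (measure_zero_ext L \<mu>m)"
    and C1: "C1_on \<Omega> \<phi> G"
  shows "- (LINT x|lebesgue_on K. q x \<bullet> ((1/c) *\<^sub>R G ((1/c) *\<^sub>R x))) =
    (LINT x|\<mu>p. \<phi> ((1/c) *\<^sub>R x)) - (LINT x|\<mu>m. \<phi> ((1/c) *\<^sub>R x))"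
proof -
  interpret p: prob_space \<mu>p by fact
  interpret m: prob_space \<mu>m by fact
  have spp: "space \<mu>p = \<Omega>" "space \<mu>m = \<Omega>" using sets_eq_imp_space_eq[OF \<mu>p(2)] sets_eq_imp_space_eq[OF \<mu>m(2)] by auto
  have "(\<lambda>x. x) \<in> borel_measurable (restrict_space borel \<Omega>)" by (rule measurable_restrict_space1) simp
  then have id: "(\<lambda>x. x) \<in> borel_measurable \<mu>p" "(\<lambda>x. x) \<in> borel_measurable \<mu>m"
    by (simp_all add: measurable_cong_sets[OF \<mu>p(2) refl] measurable_cong_sets[OF \<mu>m(2) refl])
  have intp: "integrable \<mu>p f" and intm: "integrable \<mu>m f" if "continuous_on \<Omega> f" for f :: "'a \<Rightarrow> real"
    using integrable_continuous_comp[OF p.finite_measure_axioms id(1) _ \<Omega>(1) that]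
      integrable_continuous_comp[OF m.finite_measure_axioms id(2) _ \<Omega>(1) that] spp by auto
  have Kc: "compact K" unfolding K(1) by (intro compact_continuous_image continuous_intros \<Omega>)
  have sc: "(1/c) *\<^sub>R x \<in> \<Omega>" if "x \<in> K" for x using that c unfolding K(1) by auto
  have si: "(1/c) *\<^sub>R x \<in> interior \<Omega>" if "x \<in> interior K" for x
  proof (rule interiorI[of "(\<lambda>x. (1/c) *\<^sub>R x) ` interior K"])
    show "open ((\<lambda>x. (1/c) *\<^sub>R x) ` interior K)" by (rule open_scaling) (use c in auto)
    show "(\<lambda>x. (1/c) *\<^sub>R x) ` interior K \<subseteq> \<Omega>" using sc interior_subset by blast
  qed (use that in blast)
  have Ki: "interior K \<noteq> {}" using \<Omega>(2) interior_mono[OF K(2)] by blast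
  have \<phi>: "continuous_on \<Omega> \<phi>" and G: "continuous_on \<Omega> G" and d: "\<And>x. x \<in> interior \<Omega> \<Longrightarrow> GDERIV \<phi> x :> G x"
    using C1 by (auto simp: C1_on_def)
  have \<phi>K: "continuous_on K (\<lambda>x. \<phi> ((1/c) *\<^sub>R x))"
    by (rule continuous_on_compose2[OF \<phi>]) (use sc in \<open>auto intro!: continuous_intros\<close>)
  have GK: "continuous_on K (\<lambda>x. (1/c) *\<^sub>R G ((1/c) *\<^sub>R x))"
    by (intro continuous_intros continuous_on_compose2[OF G]) (use sc in \<open>auto intro!: continuous_intros\<close>)
  obtain a where a: "(LINT x|lebesgue_on K. \<phi> ((1/c) *\<^sub>R x) - a) = 0"
    using mean_zero_shift[OF Kc Ki \<phi>K] by metis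
  let ?\<phi> = "\<lambda>x. \<phi> ((1/c) *\<^sub>R x) - a"
  have "C1_on K ?\<phi> (\<lambda>x. (1/c) *\<^sub>R G ((1/c) *\<^sub>R x))"
    unfolding C1_on_def
  proof (intro conjI ballI)
    show "continuous_on K ?\<phi>" using \<phi>K by (intro continuous_intros)
    fix x assume "x \<in> interior K"
    then have D: "(\<phi> has_derivative (\<lambda>h. h \<bullet> G ((1/c) *\<^sub>R x))) (at ((1/c) *\<^sub>R x))"
      using d[OF si] by (simp add: gderiv_def)
    have "((\<lambda>x. (1/c) *\<^sub>R x) has_derivative (\<lambda>h. (1/c) *\<^sub>R h)) (at x)" by (auto intro!: derivative_eq_intros)
    from has_derivative_diff[OF has_derivative_compose[OF this D] has_derivative_const[of a]]
    show "GDERIV ?\<phi> x :> (1/c) *\<^sub>R G ((1/c) *\<^sub>R x)" by (simp add: gderiv_def)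
  qed (rule GK)
  from C1_on_imp_sobolev[OF Kc this conj_exp_props(1)[OF p]]
  have s: "sobolev_mean0 (conj_exp p) K ?\<phi> (\<lambda>x. (1/c) *\<^sub>R G ((1/c) *\<^sub>R x))"
    unfolding sobolev_mean0_def using a by blast
  have \<phi>aK: "continuous_on K ?\<phi>" using \<phi>K by (intro continuous_intros)
  have "- (LINT x|lebesgue_on K. q x \<bullet> ((1/c) *\<^sub>R G ((1/c) *\<^sub>R x))) =
     (LINT x:K|measure_zero_ext L \<mu>p. ?\<phi> x) - (LINT x:K|measure_zero_ext L \<mu>m. ?\<phi> x)"
  proof -
    have "div_eq_dual p K q (measure_zero_ext L \<mu>p) (measure_zero_ext L \<mu>m)" using q by (simp add: reg_feasible_def)
    from this[unfolded div_eq_dual_def, rule_format, OF conjI[OF s conjI[OF \<phi>aK]]]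
    show ?thesis by simp
  qed
  also have "\<dots> = (LINT x|\<mu>p. ?\<phi> x) - (LINT x|\<mu>m. ?\<phi> x)"
    unfolding integral_measure_zero_ext[OF \<mu>p(2) Kc K(2,3) \<phi>aK] integral_measure_zero_ext[OF \<mu>m(2) Kc K(2,3) \<phi>aK] ..
  also have "\<dots> = (LINT x|\<mu>p. \<phi> ((1/c) *\<^sub>R x)) - (LINT x|\<mu>m. \<phi> ((1/c) *\<^sub>R x))"
    using intp[OF continuous_on_subset[OF \<phi>K K(2)]] intm[OF continuous_on_subset[OF \<phi>K K(2)]]
    by (simp add: p.prob_space m.prob_space)
  finally show ?thesis .
qed

text \<open>\<open>s\<close> is known along the sequence \<tau> only, so smallness of \<epsilon> n
  has to be turned into a large index: the finitely many \<tau> k with k < k0 are bounded below by b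
  > 0, and \<epsilon> n < b forces k \<ge> k0.\<close>

lemma null_sequence_of_values:
  fixes \<tau> :: "nat \<Rightarrow> real" and s :: "real \<Rightarrow> real"
  assumes "\<And>k. 0 < \<tau> k" "(\<lambda>k. s (\<tau> k)) \<longlonglongrightarrow> 0" "\<And>t. t \<in> range \<tau> \<Longrightarrow> 0 < s t"
    "\<And>n. \<epsilon> n \<in> range \<tau>" "\<epsilon> \<longlonglongrightarrow> 0"
  shows "(\<lambda>n. s (\<epsilon> n)) \<longlonglongrightarrow> 0"
proof (rule LIMSEQ_I)
  fix d :: real assume d: "0 < d"
  obtain k0 where k0: "\<And>k. k \<ge> k0 \<Longrightarrow> s (\<tau> k) < d"
    using order_tendstoD(2)[OF assms(2) d] unfolding eventually_sequentially by auto
  \<comment> \<open>The inserted 1 keeps the minimum defined when k0 = 0.\<close>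
  define b where "b = Min (insert 1 (\<tau> ` {..<k0}))"
  have b: "0 < b" unfolding b_def using assms(1) by (subst Min_gr_iff) auto
  obtain N where N: "\<And>n. n \<ge> N \<Longrightarrow> \<epsilon> n < b"
    using order_tendstoD(2)[OF assms(5) b] unfolding eventually_sequentially by auto
  show "\<exists>N. \<forall>n\<ge>N. norm (s (\<epsilon> n) - 0) < d"
  proof (intro exI[of _ N] allI impI)
    fix n assume n: "N \<le> n"
    obtain k where k: "\<epsilon> n = \<tau> k" using assms(4)[of n] by auto
    have "\<not> k < k0"
    proof
      assume "k < k0"
      then have "b \<le> \<tau> k" unfolding b_def by (intro Min_le) auto
      then show False using N[OF n] k by simp
    qed
    then show "norm (s (\<epsilon> n) - 0) < d" using k0[of k] k assms(3)[of "\<epsilon> n"] assms(4)[of n] by simp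
  qed
qed

theorem corollary4p6:
  fixes \<Omega> :: "'a::euclidean_space set"
    and w w_hat :: "'a \<Rightarrow> real"
    and w_low \<alpha> :: real
    and \<mu>p \<mu>m :: "'a measure"
    and \<tau> :: "nat \<Rightarrow> real"
    and moll :: "real \<Rightarrow> 'a \<Rightarrow> real"
    and s :: "real \<Rightarrow> real"
    and \<epsilon> :: "nat \<Rightarrow> real"
    and q :: "nat \<Rightarrow> 'a \<Rightarrow> 'a"
  assumes "compact \<Omega>"
    and "bounded_lipschitz_domain (interior \<Omega>)"
    and "strictly_star_shaped \<Omega>"
    and "neumann_regular (conj_exp \<alpha>) \<Omega>"
    and "1 < \<alpha>"
    and "DIM('a) \<ge> 2 \<Longrightarrow> \<alpha> < real DIM('a) / (real DIM('a) - 1)"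
    and "continuous_on \<Omega> w"
    and "\<And>x. x \<in> \<Omega> \<Longrightarrow> 0 \<le> w x"
    and "0 < w_low"
    and "\<And>x. x \<in> \<Omega> \<Longrightarrow> w_low \<le> w x"
    and "prob_space \<mu>p" and "sets \<mu>p = sets (restrict_space borel \<Omega>)"
    and "prob_space \<mu>m" and "sets \<mu>m = sets (restrict_space borel \<Omega>)"
    and "\<And>k. 0 < \<tau> k" and "\<tau> \<longlonglongrightarrow> 0"
    and "\<And>t. t \<in> range \<tau> \<Longrightarrow> moll t \<in> Cc_infinity UNIV"
    and "\<And>t x. t \<in> range \<tau> \<Longrightarrow> 0 \<le> moll t x"
    and "\<And>t. t \<in> range \<tau> \<Longrightarrow> (LINT x|lebesgue. moll t x) = 1"
    and "\<And>r. 0 < r \<Longrightarrow> \<forall>\<^sub>F k in sequentially. supp (moll (\<tau> k)) \<subseteq> ball 0 r"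
    and "\<And>t. t \<in> range \<tau> \<Longrightarrow> 0 < s t" and "(\<lambda>k. s (\<tau> k)) \<longlonglongrightarrow> 0"
    and "\<And>t. t \<in> range \<tau> \<Longrightarrow> {x + y | x y. x \<in> \<Omega> \<and> y \<in> supp (moll t)} \<subseteq> enlarged s \<Omega> t"
    and "\<And>t t'. t \<in> range \<tau> \<Longrightarrow> t' \<in> range \<tau> \<Longrightarrow> t' < t \<Longrightarrow> enlarged s \<Omega> t' \<subseteq> enlarged s \<Omega> t"
    and "continuous_on (enlarged_union s \<Omega> (range \<tau>)) w_hat"
    and "\<And>x. x \<in> \<Omega> \<Longrightarrow> w_hat x = w x"
    and "Inf (w_hat ` enlarged_union s \<Omega> (range \<tau>)) = Inf (w ` \<Omega>)"
    and "\<And>n. \<epsilon> n \<in> range \<tau>" and "\<epsilon> \<longlonglongrightarrow> 0"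
    and "\<And>n. reg_solution \<alpha> (\<epsilon> n) (enlarged s \<Omega> (\<epsilon> n)) w_hat
           (measure_zero_ext (enlarged_union s \<Omega> (range \<tau>)) \<mu>p)
           (measure_zero_ext (enlarged_union s \<Omega> (range \<tau>)) \<mu>m) (q n)"
  shows "\<exists>r q0. strict_mono r \<and> beckmann_solution \<Omega> w \<mu>p \<mu>m q0 \<and>
    weak_star_tendsto (enlarged_union s \<Omega> (range \<tau>))
      (\<lambda>n. density_vmeasure (enlarged s \<Omega> (\<epsilon> (r n))) (q (r n)))
      (vmeasure_zero_ext \<Omega> q0)"
proof -
  note a = assms
  have \<Omega>: "compact \<Omega>" and star: "strictly_star_shaped \<Omega>" using a by blast+
  have \<mu>p: "prob_space \<mu>p" "sets \<mu>p = sets (restrict_space borel \<Omega>)" by (rule a(11), rule a(12))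
  have \<mu>m: "prob_space \<mu>m" "sets \<mu>m = sets (restrict_space borel \<Omega>)" by (rule a(13), rule a(14))
  interpret p: prob_space \<mu>p by fact
  interpret m: prob_space \<mu>m by fact
  have spp: "space \<mu>p = \<Omega>" "space \<mu>m = \<Omega>" using sets_eq_imp_space_eq[OF \<mu>p(2)] sets_eq_imp_space_eq[OF \<mu>m(2)] by auto
  have \<Omega>ne: "\<Omega> \<noteq> {}" using p.not_empty spp by simp
  have int\<Omega>: "interior \<Omega> \<noteq> {}" using a(2) by (simp add: bounded_lipschitz_domain_def)
  have starD: "l *\<^sub>R x \<in> interior \<Omega>" if "x \<in> \<Omega>" "0 \<le> l" "l < 1" for l x
    using star that unfolding strictly_star_shaped_def by blast
  have zero\<Omega>: "0 \<in> \<Omega>" using starD[of _ 0] \<Omega>ne interior_subset by fastforce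

  \<comment> \<open>The enlarged domains and the extended weight\<close>
  define L where "L = enlarged_union s \<Omega> (range \<tau>)"
  define K where "K n = enlarged s \<Omega> (\<epsilon> n)" for n
  define c where "c n = 1 + s (\<epsilon> n)" for n
  have \<epsilon>0: "0 < \<epsilon> n" for n using a(28)[of n] a(15) by auto
  have s0: "(\<lambda>n. s (\<epsilon> n)) \<longlonglongrightarrow> 0" by (rule null_sequence_of_values[OF a(15,22,21,28,29)])
  have spos: "0 < s (\<epsilon> n)" for n using a(21)[OF a(28)] .
  have c1: "1 < c n" for n using spos[of n] by (simp add: c_def)
  have Kimg: "K n = (\<lambda>x. c n *\<^sub>R x) ` \<Omega>" for n by (simp add: K_def enlarged_def c_def)
  have cenl: "compact (enlarged s \<Omega> t)" for t unfolding enlarged_def by (intro compact_continuous_image continuous_intros \<Omega>)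
  have Kc: "compact (K n)" for n unfolding K_def by (rule cenl)
  have \<Omega>K: "\<Omega> \<subseteq> K n" for n
  proof
    fix x assume x: "x \<in> \<Omega>"
    have "(1 / c n) *\<^sub>R x \<in> \<Omega>" using starD[OF x, of "1 / c n"] c1[of n] interior_subset by auto
    moreover have "x = c n *\<^sub>R ((1 / c n) *\<^sub>R x)" using c1[of n] by simp
    ultimately show "x \<in> K n" unfolding Kimg by blast
  qed
  have KL: "K n \<subseteq> L" for n unfolding K_def L_def enlarged_union_def using a(28) by blast
  \<comment> \<open>The nested union equals its largest member: \<tau> is positive and tends to 0,
    so its maximum exists and is attained at one of the indices up to k0.\<close>
  have Lc: "compact L"
  proof -
    obtain k0 where k0: "\<And>k. k \<ge> k0 \<Longrightarrow> \<tau> k < \<tau> 0"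
      using order_tendstoD(2)[OF a(16) a(15)[of 0]] unfolding eventually_sequentially by auto
    define t where "t = Max (\<tau> ` {..k0})"
    have tr: "t \<in> range \<tau>" unfolding t_def using Max_in[of "\<tau> ` {..k0}"] image_mono[of "{..k0}" UNIV \<tau>] by blast
    have tmax: "\<tau> k \<le> t" for k
    proof (cases "k \<le> k0")
      case False
      then have "\<tau> k < \<tau> 0" using k0 by simp
      moreover have "\<tau> 0 \<le> t" unfolding t_def by (intro Max_ge) auto
      ultimately show ?thesis by simp
    qed (simp add: t_def)
    have "enlarged s \<Omega> (\<tau> k) \<subseteq> enlarged s \<Omega> t" for k
      using a(24)[OF tr, of "\<tau> k"] tmax[of k] by (cases "\<tau> k = t") auto
    then have "L = enlarged s \<Omega> t" unfolding L_def enlarged_union_def using tr by blast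
    then show ?thesis using cenl by simp
  qed
  have \<Omega>L: "\<Omega> \<subseteq> L" using \<Omega>K[of 0] KL[of 0] by blast
  have L0: "0 < measure lborel L"
    by (rule measure_pos_if_interior[OF Lc]) (use int\<Omega> interior_mono[OF \<Omega>L] in blast)
  have clL: "closed L" and Lb: "L \<in> sets borel" using Lc by (auto simp: compact_imp_closed)
  have wc: "continuous_on L w_hat" unfolding L_def by (rule a(25))
  \<comment> \<open>The extension keeps the infimum of the weight, so \<open>w_low\<close> bounds it
    from below on all of \<open>L\<close> and mass is controlled outside \<Omega> as well.\<close>
  have wlow: "w_low \<le> w_hat x" if "x \<in> L" for x
  proof -
    have "w_low \<le> Inf (w ` \<Omega>)" using a(10) \<Omega>ne by (intro cInf_greatest) auto
    also have "\<dots> = Inf (w_hat ` L)" unfolding L_def using a(27) by simp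
    also have "\<dots> \<le> w_hat x"
      using that compact_imp_bounded[OF compact_continuous_image[OF wc Lc]] by (intro cInf_lower bounded_imp_bdd_below) auto
    finally show ?thesis .
  qed
  have w0: "0 \<le> w_hat x" if "x \<in> L" for x using wlow[OF that] a(9) by linarith
  obtain W where W: "0 \<le> W" "\<And>x. x \<in> L \<Longrightarrow> norm (w_hat x) \<le> W" using compact_continuous_bound[OF Lc wc] by metis
  let ?Mp = "measure_zero_ext L \<mu>p" and ?Mm = "measure_zero_ext L \<mu>m"
  have qf: "q n \<in> reg_feasible \<alpha> (K n) ?Mp ?Mm" and
    qmin: "\<And>P. P \<in> reg_feasible \<alpha> (K n) ?Mp ?Mm \<Longrightarrow> reg_cost \<alpha> (\<epsilon> n) (K n) w_hat (q n) \<le> reg_cost \<alpha> (\<epsilon> n) (K n) w_hat P" for n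
    using a(30)[of n] unfolding reg_solution_def K_def L_def by blast+

  \<comment> \<open>Borel versions of the regularized solutions\<close>
  define rep where "rep n h \<longleftrightarrow> h \<in> borel_measurable borel \<and> (\<forall>x. x \<notin> K n \<longrightarrow> h x = 0) \<and> integrable lborel h \<and>
    (\<forall>f. continuous_on L f \<longrightarrow> vintegral L (density_vmeasure (K n) (q n)) f = (LINT x|lborel. f x \<bullet> h x)) \<and>
    (\<forall>f. continuous_on (K n) f \<longrightarrow> (LINT x|lebesgue_on (K n). q n x \<bullet> f x) = (LINT x|lborel. h x \<bullet> f x)) \<and>
    (LINT x|lborel. w_hat x * norm (h x)) \<le> reg_cost \<alpha> (\<epsilon> n) (K n) w_hat (q n)" for n and h :: "'a \<Rightarrow> 'a"
  have "\<exists>h. rep n h" for n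
  proof (rule density_vmeasure_representative[OF Kc KL Lc a(5) _ wc w0 \<epsilon>0])
    show "q n \<in> Lp_space \<alpha> (K n)" using qf by (simp add: reg_feasible_def)
    fix h assume "h \<in> borel_measurable borel" "\<And>x. x \<notin> K n \<Longrightarrow> h x = 0" "integrable lborel h"
      "\<And>f. continuous_on L f \<Longrightarrow> vintegral L (density_vmeasure (K n) (q n)) f = (LINT x|lborel. f x \<bullet> h x)"
      "\<And>f. continuous_on (K n) f \<Longrightarrow> (LINT x|lebesgue_on (K n). q n x \<bullet> f x) = (LINT x|lborel. h x \<bullet> f x)"
      "(LINT x|lborel. w_hat x * norm (h x)) \<le> reg_cost \<alpha> (\<epsilon> n) (K n) w_hat (q n)"
    then have "rep n h" by (simp add: rep_def)
    then show "\<exists>h. rep n h" by (rule exI[of _ h])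
  qed
  then obtain h where rep: "\<And>n. rep n (h n)" by metis
  have hm[measurable]: "h n \<in> borel_measurable borel" and hK: "\<And>x. x \<notin> K n \<Longrightarrow> h n x = 0" and hi: "integrable lborel (h n)"
    and hv: "\<And>f. continuous_on L f \<Longrightarrow> vintegral L (density_vmeasure (K n) (q n)) f = (LINT x|lborel. f x \<bullet> h n x)"
    and ht: "\<And>f. continuous_on (K n) f \<Longrightarrow> (LINT x|lebesgue_on (K n). q n x \<bullet> f x) = (LINT x|lborel. h n x \<bullet> f x)"
    and hcost: "(LINT x|lborel. w_hat x * norm (h n x)) \<le> reg_cost \<alpha> (\<epsilon> n) (K n) w_hat (q n)" for n
    using rep[of n] by (simp_all add: rep_def)
  have hL: "h n x = 0" if "x \<notin> L" for n x using hK[of x n] KL[of n] that by blast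
  have hni: "integrable lborel (\<lambda>x. norm (h n x))" for n using hi by (rule integrable_norm)
  have fhi: "integrable lborel (\<lambda>x. f x * norm (h n x))" if f: "continuous_on L f" for f :: "'a \<Rightarrow> real" and n
  proof -
    obtain M where M: "0 \<le> M" "\<And>x. x \<in> L \<Longrightarrow> norm (f x) \<le> M" using compact_continuous_bound[OF Lc f] by metis
    have [measurable]: "(\<lambda>x. indicator L x *\<^sub>R f x) \<in> borel_measurable borel" by (rule continuous_on_indicator_borel[OF Lb f])
    have "integrable lborel (\<lambda>x. (indicator L x *\<^sub>R f x) * norm (h n x))"
    proof (rule Bochner_Integration.integrable_bound[OF integrable_mult_right[OF hni, of M]])
      show "AE x in lborel. norm ((indicator L x *\<^sub>R f x) * norm (h n x)) \<le> norm (M * norm (h n x))"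
        using M by (intro AE_I2) (auto simp: abs_mult indicator_def intro!: mult_right_mono)
    qed measurable
    moreover have "(\<lambda>x. (indicator L x *\<^sub>R f x) * norm (h n x)) = (\<lambda>x. f x * norm (h n x))"
    proof
      show "(indicator L x *\<^sub>R f x) * norm (h n x) = f x * norm (h n x)" for x
        using hL[of x n] by (cases "x \<in> L") auto
    qed
    ultimately show ?thesis by (simp only:)
  qed
  have moll: "\<exists>k. k \<in> Cc_infinity (UNIV :: 'a set) \<and> (\<forall>x. 0 \<le> k x) \<and> (LINT x|lborel. k x) = 1 \<and> supp k \<subseteq> ball 0 r" if r: "0 < r" for r
  proof -
    obtain j where j: "supp (moll (\<tau> j)) \<subseteq> ball 0 r"
      using a(20)[OF r] unfolding eventually_sequentially by auto
    have mc: "moll (\<tau> j) \<in> Cc_infinity UNIV" by (rule a(17)) simp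
    have "moll (\<tau> j) \<in> borel_measurable lborel"
      using borel_measurable_continuous_onI[OF Cc_infinityD(5)[OF mc]] by simp
    then have "(LINT x|lborel. moll (\<tau> j) x) = 1" using a(19)[of "\<tau> j"] by (simp add: integral_completion)
    then show ?thesis using mc j a(18)[of "\<tau> j"] by (intro exI[of _ "moll (\<tau> j)"]) auto
  qed

  \<comment> \<open>Comparison with fixed fields on \<Omega>, and the uniform mass bound\<close>
  have upper: "(LINT x|lborel. w_hat x * norm (h n x)) \<le>
      (LINT z|lborel. (indicator \<Omega> z * w z) * norm (P z)) + \<epsilon> n / \<alpha> * (LINT z|lborel. norm (P z) powr \<alpha>)"
    if P: "flux_field \<Omega> \<alpha> P (\<lambda>g G. - ((LINT x|\<mu>p. g x) - (LINT x|\<mu>m. g x)))" for P n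
  proof -
    note F = flux_field_reg_feasible[OF \<Omega> \<Omega>K Kc KL a(5) \<mu>p(2) \<mu>m(2) P continuous_on_subset[OF wc KL] \<epsilon>0, of n]
    have "(\<lambda>z. indicator \<Omega> z * w_hat z) = (\<lambda>z. indicator \<Omega> z * w z)" using a(26) by (auto simp: indicator_def)
    then have "(LINT z|lborel. (indicator \<Omega> z * w_hat z) * norm (P z)) = (LINT z|lborel. (indicator \<Omega> z * w z) * norm (P z))"
      by metis
    then show ?thesis using order_trans[OF hcost qmin[OF F(1)]] F(2) by simp
  qed
  \<comment> \<open>Any field of finite regularized cost would do; here the radial one is
    approximated with error 1, and its cost, with \<epsilon> n replaced by an upper bound
    \<open>E\<close>, is divided by \<open>w_low\<close>.\<close>
  obtain B where B: "0 < B" "\<And>n. (LINT x|lborel. norm (h n x)) \<le> B"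
  proof -
    obtain N :: "(('a \<times> 'a) \<times> real) measure" and X V C where N: "finite_measure N" and X: "X \<in> borel_measurable N" "\<And>w. w \<in> space N \<Longrightarrow> X w \<in> \<Omega>"
      and V: "V \<in> borel_measurable N" "\<And>w. norm (V w) \<le> C"
      and dv: "\<And>\<phi> G. C1_on \<Omega> \<phi> G \<Longrightarrow> - (LINT w|N. G (X w) \<bullet> V w) = (LINT x|\<mu>p. \<phi> x) - (LINT x|\<mu>m. \<phi> x)"
    proof (rule star_shaped_radial_field[OF \<Omega> star \<mu>p \<mu>m])
      fix N :: "(('a \<times> 'a) \<times> real) measure" and X V C
      assume "finite_measure N" "X \<in> borel_measurable N" "\<And>w. w \<in> space N \<Longrightarrow> X w \<in> \<Omega>"
        "V \<in> borel_measurable N" "\<And>w. norm (V w) \<le> C"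
        "\<And>\<phi> G. C1_on \<Omega> \<phi> G \<Longrightarrow> - (LINT w|N. G (X w) \<bullet> V w) = (LINT x|\<mu>p. \<phi> x) - (LINT x|\<mu>m. \<phi> x)"
      then show thesis by (rule that)
    qed
    obtain P where P: "flux_field \<Omega> \<alpha> P (\<lambda>g G. - ((LINT x|\<mu>p. g x) - (LINT x|\<mu>m. g x)))"
    proof (rule beckmann_competitor[OF \<Omega> a(2,3,5,6,7,8) moll \<mu>p \<mu>m N X V _ zero_less_one])
      show "- (LINT w|N. G (X w) \<bullet> V w) = (LINT x|\<mu>p. \<phi> x) - (LINT x|\<mu>m. \<phi> x)" if "C1_on \<Omega> \<phi> G" for \<phi> G
        by (rule dv[OF that])
    qed
    define b where "b = (LINT z|lborel. norm (P z) powr \<alpha>)"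
    have b0: "0 \<le> b" unfolding b_def by (intro Bochner_Integration.integral_nonneg) simp
    obtain E where E: "\<And>n. \<epsilon> n \<le> E" using a(29) by (metis convergent_def convergent_imp_Bseq Bseq_def real_norm_def abs_le_D1)
    define B where "B = ((LINT z|lborel. (indicator \<Omega> z * w z) * norm (P z)) + E / \<alpha> * b) / w_low"
    have "(LINT x|lborel. norm (h n x)) \<le> B" for n
    proof -
      have "w_low * (LINT x|lborel. norm (h n x)) \<le> (LINT x|lborel. w_hat x * norm (h n x))"
      proof -
        have "(LINT x|lborel. w_low * norm (h n x)) \<le> (LINT x|lborel. w_hat x * norm (h n x))"
        proof (rule integral_mono)
          show "w_low * norm (h n x) \<le> w_hat x * norm (h n x)" for x
            using wlow[of x] hL[of x n] by (cases "x \<in> L") (auto intro: mult_right_mono)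
        qed (use hni fhi[OF wc] in auto)
        then show ?thesis by simp
      qed
      also have "\<dots> \<le> (LINT z|lborel. (indicator \<Omega> z * w z) * norm (P z)) + \<epsilon> n / \<alpha> * b"
        unfolding b_def by (rule upper[OF P])
      also have "\<dots> \<le> (LINT z|lborel. (indicator \<Omega> z * w z) * norm (P z)) + E / \<alpha> * b"
        using E[of n] b0 a(5) by (intro add_left_mono mult_right_mono divide_right_mono) auto
      finally show ?thesis using a(9) by (simp add: B_def pos_le_divide_eq mult.commute)
    qed
    \<comment> \<open>The bound is made positive because the Young measure is normalized by
      it.\<close>
    then show ?thesis using that[of "max B 1"] by (simp add: le_max_iff_disj)
  qed

  \<comment> \<open>The Young measure and its concentration over \<Omega>\<close>
  obtain r \<Gamma> where r: "strict_mono r" and \<Gamma>: "prob_space \<Gamma>" "sets \<Gamma> = sets borel" "AE z in \<Gamma>. z \<in> L \<times> cball 0 1"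
    and lim1: "\<And>f. continuous_on UNIV f \<Longrightarrow>
       (\<lambda>n. LINT x|lborel. f x \<bullet> h (r n) x) \<longlonglongrightarrow> B * (LINT z|\<Gamma>. f (fst z) \<bullet> snd z)"
    and lim2: "\<And>f. continuous_on UNIV f \<Longrightarrow>
       (\<lambda>n. LINT x|lborel. f x * norm (h (r n) x)) \<longlonglongrightarrow> B * (LINT z|\<Gamma>. f (fst z) * norm (snd z))"
  proof (rule young_measure_limit[OF Lc L0 B(1) hm hL hi B(2)])
    fix r \<Gamma>
    assume "strict_mono r" "prob_space \<Gamma>" "sets \<Gamma> = sets borel" "AE z in \<Gamma>. z \<in> L \<times> cball (0::'a) 1"
      "\<And>f. continuous_on UNIV f \<Longrightarrow>
         (\<lambda>n. LINT x|lborel. f x \<bullet> h (r n) x) \<longlonglongrightarrow> B * (LINT z|\<Gamma>. f (fst z) \<bullet> snd z)"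
      "\<And>f. continuous_on UNIV f \<Longrightarrow>
         (\<lambda>n. LINT x|lborel. f x * norm (h (r n) x)) \<longlonglongrightarrow> B * (LINT z|\<Gamma>. f (fst z) * norm (snd z))"
    then show thesis by (rule that)
  qed
  interpret G: prob_space \<Gamma> by (rule \<Gamma>(1))
  have fstm[measurable]: "fst \<in> borel_measurable \<Gamma>" "snd \<in> borel_measurable \<Gamma>"
    by (simp_all add: measurable_cong_sets[OF \<Gamma>(2) refl] borel_measurable_continuous_onI continuous_on_fst continuous_on_snd continuous_on_id)
  obtain R where R: "0 \<le> R" "\<And>x. x \<in> \<Omega> \<Longrightarrow> norm x \<le> R"
    using compact_continuous_bound[OF \<Omega> continuous_on_id] by metis
  \<comment> \<open>Points of \<open>K n\<close> are within s(\<epsilon> n) R of \<Omega>, so the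
    distance to \<Omega>, weighted with mass, tends to 0. The claim is limited to
    \<open>snd z \<noteq> 0\<close> because the filler mass of the laws is spread over all of
    \<open>L\<close>.\<close>
  have aeO: "AE z in \<Gamma>. snd z \<noteq> 0 \<longrightarrow> fst z \<in> \<Omega>"
  proof -
    have dc: "continuous_on UNIV (\<lambda>x. infdist x \<Omega>)" by (intro continuous_intros)
    have "(\<lambda>n. LINT x|lborel. infdist x \<Omega> * norm (h (r n) x)) \<longlonglongrightarrow> 0"
    proof (rule real_tendsto_sandwich[OF _ _ tendsto_const])
      show "\<forall>\<^sub>F n in sequentially. 0 \<le> (LINT x|lborel. infdist x \<Omega> * norm (h (r n) x))"
        by (intro always_eventually allI Bochner_Integration.integral_nonneg) (simp add: infdist_nonneg)
      show "\<forall>\<^sub>F n in sequentially. (LINT x|lborel. infdist x \<Omega> * norm (h (r n) x)) \<le> s (\<epsilon> (r n)) * R * B"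
      proof (intro always_eventually allI)
        fix n
        have "(LINT x|lborel. infdist x \<Omega> * norm (h (r n) x)) \<le> (LINT x|lborel. (s (\<epsilon> (r n)) * R) * norm (h (r n) x))"
        proof (rule integral_mono)
          show "integrable lborel (\<lambda>x. infdist x \<Omega> * norm (h (r n) x))" by (rule fhi[OF continuous_on_subset[OF dc]]) simp
          show "integrable lborel (\<lambda>x. (s (\<epsilon> (r n)) * R) * norm (h (r n) x))" using hni by simp
          fix x
          show "infdist x \<Omega> * norm (h (r n) x) \<le> (s (\<epsilon> (r n)) * R) * norm (h (r n) x)"
          proof (cases "x \<in> K (r n)")
            case True
            then obtain y where y: "y \<in> \<Omega>" "x = c (r n) *\<^sub>R y" unfolding Kimg by auto
            have "infdist x \<Omega> \<le> dist x y" by (rule infdist_le[OF y(1)])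
            also have "\<dots> = s (\<epsilon> (r n)) * norm y"
              using spos[of "r n"] by (simp add: y(2) dist_norm c_def scaleR_add_left)
            also have "\<dots> \<le> s (\<epsilon> (r n)) * R" using R(2)[OF y(1)] spos[of "r n"] by (intro mult_left_mono) auto
            finally show ?thesis by (rule mult_right_mono) simp
          qed (simp add: hK)
        qed
        also have "\<dots> = (s (\<epsilon> (r n)) * R) * (LINT x|lborel. norm (h (r n) x))" by simp
        also have "\<dots> \<le> s (\<epsilon> (r n)) * R * B" using B(2) R(1) spos[of "r n"] by (intro mult_left_mono) auto
        finally show "(LINT x|lborel. infdist x \<Omega> * norm (h (r n) x)) \<le> s (\<epsilon> (r n)) * R * B" .
      qed
      have "(\<lambda>n. s (\<epsilon> (r n)) * R * B) \<longlonglongrightarrow> 0 * R * B"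
        by (intro tendsto_mult tendsto_const LIMSEQ_subseq_LIMSEQ[OF s0 r, unfolded comp_def])
      then show "(\<lambda>n. s (\<epsilon> (r n)) * R * B) \<longlonglongrightarrow> 0" by simp
    qed
    from LIMSEQ_unique[OF this lim2[OF dc]] B(1)
    have z: "(LINT z|\<Gamma>. infdist (fst z) \<Omega> * norm (snd z)) = 0" by simp
    have im: "(\<lambda>z. infdist (fst z) \<Omega> * norm (snd z)) \<in> borel_measurable \<Gamma>"
      using measurable_compose[OF fstm(1) borel_measurable_continuous_onI[OF dc]] by measurable
    obtain M where M: "0 \<le> M" "\<And>x. x \<in> L \<Longrightarrow> norm (infdist x \<Omega>) \<le> M"
      using compact_continuous_bound[OF Lc continuous_on_subset[OF dc]] by (metis subset_UNIV)
    have "integrable \<Gamma> (\<lambda>z. infdist (fst z) \<Omega> * norm (snd z))"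
    proof (rule G.integrable_const_bound[OF _ im, of "M * 1"])
      show "AE z in \<Gamma>. norm (infdist (fst z) \<Omega> * norm (snd z)) \<le> M * 1"
        using \<Gamma>(3)
      proof eventually_elim
        fix z :: "'a \<times> 'a" assume "z \<in> L \<times> cball 0 1"
        then have "fst z \<in> L" "norm (snd z) \<le> 1" by auto
        then have "norm (infdist (fst z) \<Omega>) * norm (snd z) \<le> M * 1" using M by (intro mult_mono) auto
        then show "norm (infdist (fst z) \<Omega> * norm (snd z)) \<le> M * 1" by (simp add: abs_mult)
      qed
    qed
    then have "AE z in \<Gamma>. infdist (fst z) \<Omega> * norm (snd z) = 0"
      using z by (subst (asm) integral_nonneg_eq_0_iff_AE) (auto simp: infdist_nonneg)
    then show ?thesis
    proof eventually_elim
      fix z :: "'a \<times> 'a" assume "infdist (fst z) \<Omega> * norm (snd z) = 0"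
      then show "snd z \<noteq> 0 \<longrightarrow> fst z \<in> \<Omega>"
        using in_closed_iff_infdist_zero[OF compact_imp_closed[OF \<Omega>] \<Omega>ne] by auto
    qed
  qed
  have \<Omega>b: "\<Omega> \<in> sets borel" using \<Omega> by (simp add: compact_imp_closed)
  \<comment> \<open>\<open>X0\<close> and \<open>V0\<close> take values in \<Omega> and in the unit
    ball everywhere; the default 0 lies in \<Omega> by star-shapedness. Up to a null set,
    \<open>V0\<close> is \<open>snd\<close>, and \<open>X0\<close> differs from \<open>fst\<close>
    only where \<open>snd z = 0\<close>. The factor B in \<open>N0\<close> undoes the
    normalization.\<close>
  define X0 where "X0 z = (if fst z \<in> \<Omega> then fst z else 0)" for z :: "'a \<times> 'a"
  define V0 where "V0 z = (if fst z \<in> \<Omega> \<and> norm (snd z) \<le> 1 then snd z else 0)" for z :: "'a \<times> 'a"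
  define N0 where "N0 = density \<Gamma> (\<lambda>_. ennreal B)"
  have X0O: "X0 z \<in> \<Omega>" for z using zero\<Omega> by (simp add: X0_def)
  have V01: "norm (V0 z) \<le> 1" for z by (simp add: V0_def)
  have fO: "{z \<in> space \<Gamma>. fst z \<in> \<Omega>} \<in> sets \<Gamma>" using measurable_sets[OF fstm(1) \<Omega>b] by (simp add: vimage_def Int_def conj_commute)
  have X0m: "X0 \<in> borel_measurable \<Gamma>" unfolding X0_def by (rule measurable_If[OF fstm(1) _ fO]) simp
  have V0m: "V0 \<in> borel_measurable \<Gamma>"
  proof -
    have "{z \<in> space \<Gamma>. fst z \<in> \<Omega> \<and> norm (snd z) \<le> 1} \<in> sets \<Gamma>"
    proof -
      have "{z \<in> space \<Gamma>. norm (snd z) \<le> 1} \<in> sets \<Gamma>" by measurable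
      then have "{z \<in> space \<Gamma>. fst z \<in> \<Omega>} \<inter> {z \<in> space \<Gamma>. norm (snd z) \<le> 1} \<in> sets \<Gamma>" using fO by (intro sets.Int)
      moreover have "{z \<in> space \<Gamma>. fst z \<in> \<Omega>} \<inter> {z \<in> space \<Gamma>. norm (snd z) \<le> 1} = {z \<in> space \<Gamma>. fst z \<in> \<Omega> \<and> norm (snd z) \<le> 1}" by blast
      ultimately show ?thesis by simp
    qed
    then show ?thesis unfolding V0_def by (rule measurable_If[OF fstm(2)  borel_measurable_const])
  qed
  have sN0: "sets N0 = sets \<Gamma>" by (simp add: N0_def)
  have V0mN: "V0 \<in> borel_measurable N0" using V0m by (simp add: N0_def)
  have X0N: "X0 \<in> measurable N0 (restrict_space borel S)" if "\<Omega> \<subseteq> S" for S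
    using X0m X0O that by (intro measurable_restrict_space2) (auto simp: N0_def)
  have fN0: "finite_measure N0"
  proof (rule finite_measureI)
    have "emeasure N0 (space N0) = ennreal B * emeasure \<Gamma> (space \<Gamma>)"
      unfolding N0_def by (subst emeasure_density) (auto simp: nn_integral_cmult_indicator)
    then show "emeasure N0 (space N0) \<noteq> \<infinity>" by (simp add: G.emeasure_space_1)
  qed
  interpret N0: finite_measure N0 by (rule fN0)
  have aeV: "AE z in \<Gamma>. V0 z = snd z \<and> (snd z \<noteq> 0 \<longrightarrow> X0 z = fst z)"
    using aeO \<Gamma>(3)
  proof eventually_elim
    fix z :: "'a \<times> 'a" assume "snd z \<noteq> 0 \<longrightarrow> fst z \<in> \<Omega>" "z \<in> L \<times> cball 0 1"
    then show "V0 z = snd z \<and> (snd z \<noteq> 0 \<longrightarrow> X0 z = fst z)" by (auto simp: V0_def X0_def)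
  qed
  have lim1': "(\<lambda>n. LINT x|lborel. f x \<bullet> h (r n) x) \<longlonglongrightarrow> (LINT z|N0. f (X0 z) \<bullet> V0 z)" if f: "continuous_on UNIV f" for f
  proof -
    have [measurable]: "f \<in> borel_measurable borel" using f by (rule borel_measurable_continuous_onI)
    note [measurable] = X0m V0m
    have "(LINT z|N0. f (X0 z) \<bullet> V0 z) = B * (LINT z|\<Gamma>. f (X0 z) \<bullet> V0 z)"
      unfolding N0_def using B(1) by (subst integral_density) auto
    also have "(LINT z|\<Gamma>. f (X0 z) \<bullet> V0 z) = (LINT z|\<Gamma>. f (fst z) \<bullet> snd z)"
    proof (rule integral_cong_AE)
      show "AE z in \<Gamma>. f (X0 z) \<bullet> V0 z = f (fst z) \<bullet> snd z"
        using aeV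
      proof eventually_elim
        fix z assume "V0 z = snd z \<and> (snd z \<noteq> 0 \<longrightarrow> X0 z = fst z)"
        then show "f (X0 z) \<bullet> V0 z = f (fst z) \<bullet> snd z" by (cases "snd z = 0") auto
      qed
    qed measurable
    finally show ?thesis using lim1[OF f] by simp
  qed
  have lim2': "(\<lambda>n. LINT x|lborel. f x * norm (h (r n) x)) \<longlonglongrightarrow> (LINT z|N0. f (X0 z) * norm (V0 z))" if f: "continuous_on UNIV f" for f
  proof -
    have [measurable]: "f \<in> borel_measurable borel" using f by (rule borel_measurable_continuous_onI)
    note [measurable] = X0m V0m
    have "(LINT z|N0. f (X0 z) * norm (V0 z)) = B * (LINT z|\<Gamma>. f (X0 z) * norm (V0 z))"
      unfolding N0_def using B(1) by (subst integral_density) auto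
    also have "(LINT z|\<Gamma>. f (X0 z) * norm (V0 z)) = (LINT z|\<Gamma>. f (fst z) * norm (snd z))"
    proof (rule integral_cong_AE)
      show "AE z in \<Gamma>. f (X0 z) * norm (V0 z) = f (fst z) * norm (snd z)"
        using aeV
      proof eventually_elim
        fix z assume "V0 z = snd z \<and> (snd z \<noteq> 0 \<longrightarrow> X0 z = fst z)"
        then show "f (X0 z) * norm (V0 z) = f (fst z) * norm (snd z)" by (cases "snd z = 0") auto
      qed
    qed measurable
    finally show ?thesis using lim2[OF f] by simp
  qed
  \<comment> \<open>Young convergence is tested with functions continuous on the whole space;
    Tietze's theorem supplies them.\<close>
  have ext: "\<exists>f'. continuous_on UNIV f' \<and> (\<forall>x\<in>S. f' x = f x)" if "compact S" "continuous_on S f" for S and f :: "'a \<Rightarrow> 'b::euclidean_space"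
  proof -
    have "closedin (top_of_set UNIV) S" using compact_imp_closed[OF that(1)] by simp
    from Tietze_unbounded[OF that(2) this] show ?thesis by metis
  qed

  \<comment> \<open>The barycentre as a vector measure, and weak-* convergence\<close>
  define q0 where "q0 A = (LINT z|N0. indicator A (X0 z) *\<^sub>R V0 z)" for A
  have V0i: "integrable N0 V0" by (rule N0.integrable_const_bound[of _ 1]) (use V01 V0mN in auto)
  have q0v: "q0 \<in> vector_measures \<Omega>"
    by (rule pushforward_vector_measure[OF X0N[OF subset_refl] V0i]) (simp add: q0_def)
  have vO: "vintegral \<Omega> q0 f = (LINT z|N0. f (X0 z) \<bullet> V0 z)" if f: "continuous_on \<Omega> f" for f
  proof -
    obtain M where "\<And>x. x \<in> \<Omega> \<Longrightarrow> norm (f x) \<le> M" using compact_continuous_bound[OF \<Omega> f] by metis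
    then show ?thesis
      by (intro vintegral_pushforward[OF fN0 X0N[OF subset_refl] V0mN V01 _ continuous_measurable_restrict[OF f]]) (simp_all add: q0_def)
  qed
  have vL: "vintegral L (vmeasure_zero_ext \<Omega> q0) f = (LINT z|N0. f (X0 z) \<bullet> V0 z)" if f: "continuous_on L f" for f
  proof -
    obtain M where "\<And>x. x \<in> L \<Longrightarrow> norm (f x) \<le> M" using compact_continuous_bound[OF Lc f] by metis
    then show ?thesis
      by (intro vintegral_pushforward[OF fN0 X0N[OF \<Omega>L] V0mN V01 _ continuous_measurable_restrict[OF f]])
         (simp_all add: q0_def vmeasure_zero_ext_def X0O indicator_inter_arith)
  qed
  have ws: "weak_star_tendsto L (\<lambda>n. density_vmeasure (K (r n)) (q (r n))) (vmeasure_zero_ext \<Omega> q0)"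
    unfolding weak_star_tendsto_def
  proof (intro allI impI)
    fix f :: "'a \<Rightarrow> 'a" assume f: "continuous_on L f"
    obtain f' where f': "continuous_on UNIV f'" "\<And>x. x \<in> L \<Longrightarrow> f' x = f x" using ext[OF Lc f] by blast
    have "(LINT x|lborel. f' x \<bullet> h n x) = vintegral L (density_vmeasure (K n) (q n)) f" for n
      unfolding hv[OF f] by (rule Bochner_Integration.integral_cong[OF refl]) (metis f'(2) hL inner_zero_right)
    moreover have "(LINT z|N0. f' (X0 z) \<bullet> V0 z) = vintegral L (vmeasure_zero_ext \<Omega> q0) f"
      unfolding vL[OF f] by (rule Bochner_Integration.integral_cong[OF refl]) (simp only: f'(2)[OF subsetD[OF \<Omega>L X0O]])
    ultimately show "(\<lambda>n. vintegral L (density_vmeasure (K (r n)) (q (r n))) f) \<longlonglongrightarrow> vintegral L (vmeasure_zero_ext \<Omega> q0) f"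
      using lim1'[OF f'(1)] by simp
  qed
  have "(\<lambda>x. x) \<in> borel_measurable (restrict_space borel \<Omega>)" by (rule measurable_restrict_space1) simp
  then have id: "(\<lambda>x. x) \<in> borel_measurable \<mu>p" "(\<lambda>x. x) \<in> borel_measurable \<mu>m"
    by (simp_all add: measurable_cong_sets[OF \<mu>p(2) refl] measurable_cong_sets[OF \<mu>m(2) refl])
  have cinv: "(\<lambda>n. 1 / c (r n)) \<longlonglongrightarrow> 1"
  proof -
    have "(\<lambda>n. 1 / (1 + s (\<epsilon> (r n)))) \<longlonglongrightarrow> 1 / (1 + 0)"
      by (intro tendsto_intros LIMSEQ_subseq_LIMSEQ[OF s0 r, unfolded comp_def]) auto
    then show ?thesis by (simp add: c_def)
  qed

  \<comment> \<open>The divergence constraint in the limit\<close>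
  have feas: "q0 \<in> beckmann_feasible \<Omega> \<mu>p \<mu>m"
    unfolding beckmann_feasible_def div_measure_eq_def
  proof (intro CollectI conjI q0v allI impI, elim conjE)
    fix \<phi> G assume C1: "C1_on \<Omega> \<phi> G"
    have \<phi>: "continuous_on \<Omega> \<phi>" and Gc: "continuous_on \<Omega> G" using C1 by (auto simp: C1_on_def)
    obtain G' where G': "continuous_on UNIV G'" "\<And>x. x \<in> \<Omega> \<Longrightarrow> G' x = G x" using ext[OF \<Omega> Gc] by blast
    obtain MG where MG: "0 \<le> MG" "\<And>x. x \<in> \<Omega> \<Longrightarrow> norm (G x) \<le> MG" using compact_continuous_bound[OF \<Omega> Gc] by metis
    let ?G = "\<lambda>n x. (1 / c n) *\<^sub>R G ((1 / c n) *\<^sub>R x)"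
    have sc: "(1 / c n) *\<^sub>R x \<in> \<Omega>" if "x \<in> K n" for n x using that c1[of n] unfolding Kimg by auto
    have GK: "continuous_on (K n) (?G n)" for n
      by (intro continuous_intros continuous_on_compose2[OF Gc]) (use sc in \<open>auto intro!: continuous_intros\<close>)
    have test: "- (LINT x|lborel. h n x \<bullet> ?G n x) = (LINT x|\<mu>p. \<phi> ((1 / c n) *\<^sub>R x)) - (LINT x|\<mu>m. \<phi> ((1 / c n) *\<^sub>R x))" for n
      using reg_feasible_scaled_test[OF \<Omega> int\<Omega> a(5) c1 Kimg \<Omega>K KL \<mu>p \<mu>m qf C1, of n] unfolding ht[OF GK] .
    have conv\<mu>: "(\<lambda>n. LINT x|\<mu>. \<phi> ((1 / c (r n)) *\<^sub>R x)) \<longlonglongrightarrow> (LINT x|\<mu>. \<phi> x)"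
      if \<mu>: "prob_space \<mu>" "space \<mu> = \<Omega>" "(\<lambda>x. x) \<in> borel_measurable \<mu>" for \<mu> :: "'a measure"
    proof -
      interpret \<mu>: prob_space \<mu> by fact
      obtain M where M: "\<And>x. x \<in> \<Omega> \<Longrightarrow> norm (\<phi> x) \<le> M" using compact_continuous_bound[OF \<Omega> \<phi>] by metis
      have in\<Omega>: "(1 / c n) *\<^sub>R x \<in> \<Omega>" if "x \<in> \<Omega>" for n x using sc \<Omega>K that by blast
      show ?thesis
      proof (rule integral_dominated_convergence[where w="\<lambda>_. M"])
        show "\<phi> \<in> borel_measurable \<mu>"
          using continuous_comp_measurable[OF \<mu>(3) _ \<Omega> \<phi>] \<mu>(2) by simp
        show "(\<lambda>x. \<phi> ((1 / c (r n)) *\<^sub>R x)) \<in> borel_measurable \<mu>" for n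
          by (rule continuous_comp_measurable[OF _ _ \<Omega> \<phi>]) (use \<mu> in\<Omega> in auto)
        show "AE x in \<mu>. (\<lambda>n. \<phi> ((1 / c (r n)) *\<^sub>R x)) \<longlonglongrightarrow> \<phi> x"
        proof (rule AE_I2)
          fix x assume "x \<in> space \<mu>"
          then have x: "x \<in> \<Omega>" using \<mu>(2) by simp
          have "(\<lambda>n. (1 / c (r n)) *\<^sub>R x) \<longlonglongrightarrow> 1 *\<^sub>R x" by (rule tendsto_scaleR[OF cinv tendsto_const])
          then have "(\<lambda>n. (1 / c (r n)) *\<^sub>R x) \<longlonglongrightarrow> x" by simp
          then show "(\<lambda>n. \<phi> ((1 / c (r n)) *\<^sub>R x)) \<longlonglongrightarrow> \<phi> x"
            by (rule continuous_on_tendsto_compose[OF \<phi> _ x]) (use in\<Omega>[OF x] in auto)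
        qed
        show "AE x in \<mu>. norm (\<phi> ((1 / c (r n)) *\<^sub>R x)) \<le> M" for n
          using M in\<Omega> \<mu>(2) by (intro AE_I2) auto
      qed simp
    qed
    \<comment> \<open>The dilated gradients are compared with one fixed continuous extension
      \<open>G'\<close>: first the factor 1/c is removed, then y is moved to x = c y by uniform
      continuity. The uniform error times the mass bound B is small.\<close>
    have close: "(\<lambda>n. (LINT x|lborel. h (r n) x \<bullet> ?G (r n) x) - (LINT x|lborel. G' x \<bullet> h (r n) x)) \<longlonglongrightarrow> 0"
    proof (rule LIMSEQ_I)
      fix e :: real assume e: "0 < e"
      define e' where "e' = e / (2 * (B + 1))"
      have e': "0 < e'" unfolding e'_def using e B(1) by simp
      moreover have "2 * (e' * B) + 2 * e' = e"
      proof -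
        have "e' * (2 * (B + 1)) = e" unfolding e'_def using B(1) by simp
        then show ?thesis by (simp add: algebra_simps)
      qed
      moreover have "0 < e' * B" using e' B(1) by simp
      ultimately have e': "0 < e'" "e' * B < e" by linarith+
      \<comment> \<open>Once s < 1 the factor c is below 2, so y and x = c y both lie in this
        ball.\<close>
      have "uniformly_continuous_on (cball 0 (2 * R)) G'"
        by (rule compact_uniformly_continuous[OF continuous_on_subset[OF G'(1)]]) auto
      then obtain d where d: "0 < d" "\<And>x y. x \<in> cball 0 (2 * R) \<Longrightarrow> y \<in> cball 0 (2 * R) \<Longrightarrow> dist y x < d \<Longrightarrow> dist (G' y) (G' x) < e' / 2"
        unfolding uniformly_continuous_on_def using e'(1) by (metis half_gt_zero)
      have sr: "(\<lambda>n. s (\<epsilon> (r n))) \<longlonglongrightarrow> 0" using LIMSEQ_subseq_LIMSEQ[OF s0 r] by (simp add: comp_def)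
      have "(\<lambda>n. s (\<epsilon> (r n)) * R) \<longlonglongrightarrow> 0 * R" by (intro tendsto_mult tendsto_const sr)
      then have ev1: "\<forall>\<^sub>F n in sequentially. s (\<epsilon> (r n)) * R < d" using d(1) by (intro order_tendstoD(2)[of _ 0]) auto
      have "(\<lambda>n. (1 - 1 / c (r n)) * MG) \<longlonglongrightarrow> (1 - 1) * MG" by (intro tendsto_intros cinv)
      then have ev2: "\<forall>\<^sub>F n in sequentially. (1 - 1 / c (r n)) * MG < e' / 2" using e'(1) by (intro order_tendstoD(2)[of _ 0]) auto
      have ev3: "\<forall>\<^sub>F n in sequentially. s (\<epsilon> (r n)) < 1" using sr by (intro order_tendstoD(2)[of _ 0]) auto
      have "\<forall>\<^sub>F n in sequentially. norm ((LINT x|lborel. h (r n) x \<bullet> ?G (r n) x) - (LINT x|lborel. G' x \<bullet> h (r n) x) - 0) < e"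
        using ev1 ev2 ev3
      proof eventually_elim
        fix n assume ev: "s (\<epsilon> (r n)) * R < d" "(1 - 1 / c (r n)) * MG < e' / 2" "s (\<epsilon> (r n)) < 1"
        let ?n = "r n"
        have bnd: "norm (?G ?n x - G' x) \<le> e'" if x: "x \<in> K ?n" for x
        proof -
          obtain y where y: "y \<in> \<Omega>" "x = c ?n *\<^sub>R y" using x unfolding Kimg by auto
          have ye: "(1 / c ?n) *\<^sub>R x = y" using c1[of ?n] y(2) by simp
          have "norm ((1 / c ?n) *\<^sub>R G y - G y) = (1 - 1 / c ?n) * norm (G y)"
          proof -
            have "(1 / c ?n) *\<^sub>R G y - G y = (1 / c ?n - 1) *\<^sub>R G y" by (simp add: scaleR_diff_left)
            then show ?thesis using c1[of ?n] by simp
          qed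
          also have "\<dots> \<le> (1 - 1 / c ?n) * MG" using MG(2)[OF y(1)] c1[of ?n] by (intro mult_left_mono) auto
          finally have 1: "norm ((1 / c ?n) *\<^sub>R G y - G y) \<le> e' / 2" using ev(2) by linarith
          have dxy: "dist x y = s (\<epsilon> ?n) * norm y"
            using spos[of ?n] by (simp add: y(2) dist_norm c_def scaleR_add_left)
          have "s (\<epsilon> ?n) * norm y \<le> s (\<epsilon> ?n) * R" using R(2)[OF y(1)] spos[of ?n] by (intro mult_left_mono) auto
          then have dd: "dist x y < d" using dxy ev(1) by simp
          have "norm x = c ?n * norm y" using c1[of ?n] by (simp add: y(2))
          also have "\<dots> \<le> 2 * R" using ev(3) R(2)[OF y(1)] c1[of ?n] by (intro mult_mono) (auto simp: c_def)
          finally have "x \<in> cball 0 (2 * R)" by simp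
          moreover have "y \<in> cball 0 (2 * R)" using R(1) R(2)[OF y(1)] by simp
          ultimately have "dist (G' x) (G' y) < e' / 2" using d(2) dd by blast
          then have 2: "norm (G y - G' x) \<le> e' / 2" using G'(2)[OF y(1)] by (simp add: dist_norm norm_minus_commute)
          have "?G ?n x - G' x = ((1 / c ?n) *\<^sub>R G y - G y) + (G y - G' x)" unfolding ye by simp
          then have "norm (?G ?n x - G' x) \<le> norm ((1 / c ?n) *\<^sub>R G y - G y) + norm (G y - G' x)"
            by (simp only: norm_triangle_ineq)
          then show ?thesis using 1 2 by linarith
        qed
        have GKb: "(\<lambda>x. indicator (K ?n) x *\<^sub>R ?G ?n x) \<in> borel_measurable borel"
          using Kc GK by (intro continuous_on_indicator_borel) (auto simp: compact_imp_closed)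
        have G'b: "G' \<in> borel_measurable borel" using G'(1) by (rule borel_measurable_continuous_onI)
        have ih: "integrable lborel (\<lambda>x. f x \<bullet> h ?n x)" if f: "f \<in> borel_measurable borel" "\<And>x. x \<in> K ?n \<Longrightarrow> norm (f x) \<le> M" "0 \<le> M" for f :: "'a \<Rightarrow> 'a" and M
        proof (rule Bochner_Integration.integrable_bound[OF integrable_mult_right[OF hni, of M ?n]])
          show "(\<lambda>x. f x \<bullet> h ?n x) \<in> borel_measurable lborel" using f(1) hm by measurable
          show "AE x in lborel. norm (f x \<bullet> h ?n x) \<le> norm (M * norm (h ?n x))"
          proof (rule AE_I2)
            fix x
            show "norm (f x \<bullet> h ?n x) \<le> norm (M * norm (h ?n x))"
            proof (cases "x \<in> K ?n")
              case True
              have "\<bar>f x \<bullet> h ?n x\<bar> \<le> norm (f x) * norm (h ?n x)" by (rule Cauchy_Schwarz_ineq2)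
              also have "\<dots> \<le> M * norm (h ?n x)" using f(2)[OF True] by (rule mult_right_mono) simp
              finally show ?thesis using f(3) by simp
            qed (simp add: hK)
          qed
        qed
        obtain M1 where M1: "0 \<le> M1" "\<And>x. x \<in> K ?n \<Longrightarrow> norm (?G ?n x) \<le> M1" using compact_continuous_bound[OF Kc GK] by metis
        obtain M2 where M2: "0 \<le> M2" "\<And>x. x \<in> K ?n \<Longrightarrow> norm (G' x) \<le> M2"
          using compact_continuous_bound[OF Kc continuous_on_subset[OF G'(1)]] by (metis subset_UNIV)
        have i1: "integrable lborel (\<lambda>x. (indicator (K ?n) x *\<^sub>R ?G ?n x) \<bullet> h ?n x)" by (rule ih[OF GKb _ M1(1)]) (use M1 in auto)
        have i2: "integrable lborel (\<lambda>x. G' x \<bullet> h ?n x)" by (rule ih[OF G'b M2(2,1)])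
        have eq: "(LINT x|lborel. h ?n x \<bullet> ?G ?n x) = (LINT x|lborel. (indicator (K ?n) x *\<^sub>R ?G ?n x) \<bullet> h ?n x)"
          by (rule Bochner_Integration.integral_cong[OF refl]) (use hK in \<open>auto simp: indicator_def inner_commute\<close>)
        have "norm ((LINT x|lborel. h ?n x \<bullet> ?G ?n x) - (LINT x|lborel. G' x \<bullet> h ?n x)) =
          norm (LINT x|lborel. (indicator (K ?n) x *\<^sub>R ?G ?n x) \<bullet> h ?n x - G' x \<bullet> h ?n x)"
          unfolding eq using i1 i2 by simp
        also have "\<dots> \<le> (LINT x|lborel. e' * norm (h ?n x))"
        proof (rule Bochner_Integration.integral_norm_bound_integral)
          show "integrable lborel (\<lambda>x. (indicator (K ?n) x *\<^sub>R ?G ?n x) \<bullet> h ?n x - G' x \<bullet> h ?n x)" using i1 i2 by simp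
          show "integrable lborel (\<lambda>x. e' * norm (h ?n x))" using hni by simp
          fix x
          show "norm ((indicator (K ?n) x *\<^sub>R ?G ?n x) \<bullet> h ?n x - G' x \<bullet> h ?n x) \<le> e' * norm (h ?n x)"
          proof (cases "x \<in> K ?n")
            case True
            have "(indicator (K ?n) x *\<^sub>R ?G ?n x) \<bullet> h ?n x - G' x \<bullet> h ?n x = (?G ?n x - G' x) \<bullet> h ?n x"
              using True by (simp add: inner_diff_left)
            also have "norm \<dots> \<le> norm (?G ?n x - G' x) * norm (h ?n x)" by (simp add: Cauchy_Schwarz_ineq2)
            also have "\<dots> \<le> e' * norm (h ?n x)" using bnd[OF True] by (rule mult_right_mono) simp
            finally show ?thesis .
          qed (simp add: hK)
        qed
        also have "\<dots> = e' * (LINT x|lborel. norm (h ?n x))" by simp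
        also have "\<dots> \<le> e' * B" using B(2) e'(1) by (intro mult_left_mono) auto
        also have "\<dots> < e" by (rule e'(2))
        finally show "norm ((LINT x|lborel. h ?n x \<bullet> ?G ?n x) - (LINT x|lborel. G' x \<bullet> h ?n x) - 0) < e" by simp
      qed
      then show "\<exists>N. \<forall>n\<ge>N. norm ((LINT x|lborel. h (r n) x \<bullet> ?G (r n) x) - (LINT x|lborel. G' x \<bullet> h (r n) x) - 0) < e"
        unfolding eventually_sequentially .
    qed
    have "(\<lambda>n. - (LINT x|lborel. h (r n) x \<bullet> ?G (r n) x)) \<longlonglongrightarrow> - (0 + (LINT z|N0. G' (X0 z) \<bullet> V0 z))"
      using tendsto_minus[OF tendsto_add[OF close lim1'[OF G'(1)]]] by simp
    moreover have "(\<lambda>n. - (LINT x|lborel. h (r n) x \<bullet> ?G (r n) x)) \<longlonglongrightarrow> (LINT x|\<mu>p. \<phi> x) - (LINT x|\<mu>m. \<phi> x)"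
      unfolding test by (intro tendsto_diff conv\<mu> \<mu>p(1) \<mu>m(1) spp id)
    ultimately have "- (LINT z|N0. G' (X0 z) \<bullet> V0 z) = (LINT x|\<mu>p. \<phi> x) - (LINT x|\<mu>m. \<phi> x)"
      using LIMSEQ_unique by fastforce
    moreover have "(LINT z|N0. G' (X0 z) \<bullet> V0 z) = vintegral \<Omega> q0 G"
      unfolding vO[OF Gc] by (rule Bochner_Integration.integral_cong[OF refl]) (simp only: G'(2)[OF X0O])
    ultimately show "- vintegral \<Omega> q0 G = (LINT x|\<mu>p. \<phi> x) - (LINT x|\<mu>m. \<phi> x)" by simp
  qed

  \<comment> \<open>The cost of the limit and its optimality\<close>
  define J where "J = (LINT z|N0. w (X0 z) * norm (V0 z))"
  have wX: "(\<lambda>z. w (X0 z)) \<in> borel_measurable N0"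
    by (rule continuous_comp_measurable[OF _ _ \<Omega> a(7)]) (use X0m X0O in \<open>auto simp: N0_def\<close>)
  have Ji: "integrable N0 (\<lambda>z. w (X0 z) * norm (V0 z))"
  proof -
    obtain M where M: "0 \<le> M" "\<And>x. x \<in> \<Omega> \<Longrightarrow> norm (w x) \<le> M" using compact_continuous_bound[OF \<Omega> a(7)] by metis
    show ?thesis
    proof (rule N0.integrable_const_bound[of _ "M * 1"])
      show "(\<lambda>z. w (X0 z) * norm (V0 z)) \<in> borel_measurable N0"
        by (rule borel_measurable_times[OF wX]) (use V0mN in measurable)
      show "AE z in N0. norm (w (X0 z) * norm (V0 z)) \<le> M * 1"
      proof (rule AE_I2)
        fix z
        have "norm (w (X0 z)) * norm (V0 z) \<le> M * 1" using M(1) M(2)[OF X0O] V01 by (intro mult_mono) auto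
        then show "norm (w (X0 z) * norm (V0 z)) \<le> M * 1" by (simp add: abs_mult)
      qed
    qed
  qed
  \<comment> \<open>Directions above the same point may cancel in the barycentre, so only an
    inequality holds: the total variation is at most the pushforward of |V0|
    \<open>N0\<close>.\<close>
  have cost0: "beckmann_cost \<Omega> w q0 \<le> ennreal J"
  proof -
    define md where "md = distr (density N0 (\<lambda>z. ennreal (norm (V0 z)))) (restrict_space borel \<Omega>) X0"
    have smd: "sets md = sets (restrict_space borel \<Omega>)" by (simp add: md_def)
    have X0d: "X0 \<in> measurable (density N0 (\<lambda>z. ennreal (norm (V0 z)))) (restrict_space borel \<Omega>)"
      using X0N[OF subset_refl] by simp
    have "total_variation \<Omega> q0 \<le> md"
    proof (rule total_variation_le[OF q0v smd])
      fix A assume A: "A \<in> sets md"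
      then have A': "A \<in> sets (restrict_space borel \<Omega>)" by (simp add: smd)
      have XA: "X0 -` A \<inter> space N0 \<in> sets N0" by (rule measurable_sets[OF X0N[OF subset_refl] A'])
      have iA: "integrable N0 (\<lambda>z. indicator (X0 -` A \<inter> space N0) z *\<^sub>R V0 z)" by (rule integrable_mult_indicator[OF XA V0i])
      have "q0 A = (LINT z|N0. indicator (X0 -` A \<inter> space N0) z *\<^sub>R V0 z)"
        unfolding q0_def by (rule Bochner_Integration.integral_cong) (auto simp: indicator_def)
      then have "ennreal (norm (q0 A)) \<le> (\<integral>\<^sup>+z. ennreal (norm (indicator (X0 -` A \<inter> space N0) z *\<^sub>R V0 z)) \<partial>N0)"
        using integral_norm_bound_ennreal[OF iA] by simp
      also have "\<dots> = (\<integral>\<^sup>+z. ennreal (norm (V0 z)) * indicator (X0 -` A \<inter> space N0) z \<partial>N0)"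
        by (rule nn_integral_cong) (auto simp: indicator_def)
      also have "\<dots> = emeasure (density N0 (\<lambda>z. ennreal (norm (V0 z)))) (X0 -` A \<inter> space N0)"
        by (rule emeasure_density[symmetric]) (use XA V0mN in auto)
      also have "\<dots> = emeasure md A" unfolding md_def by (subst emeasure_distr[OF X0d A']) simp
      finally show "ennreal (norm (q0 A)) \<le> emeasure md A" .
    qed
    then have "beckmann_cost \<Omega> w q0 \<le> (\<integral>\<^sup>+x. ennreal (w x) \<partial>md)"
      unfolding beckmann_cost_def by (intro nn_integral_mono_measure) (simp_all add: smd)
    also have "\<dots> = (\<integral>\<^sup>+z. ennreal (w (X0 z)) \<partial>density N0 (\<lambda>z. ennreal (norm (V0 z))))"
      unfolding md_def
      by (rule nn_integral_distr[OF X0d]) (use continuous_measurable_restrict[OF a(7)] in measurable)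
    also have "\<dots> = (\<integral>\<^sup>+z. ennreal (norm (V0 z)) * ennreal (w (X0 z)) \<partial>N0)"
      by (rule nn_integral_density) (use V0mN wX in measurable)
    also have "\<dots> = (\<integral>\<^sup>+z. ennreal (w (X0 z) * norm (V0 z)) \<partial>N0)"
      using a(8)[OF X0O] by (intro nn_integral_cong) (simp add: ennreal_mult mult.commute)
    also have "\<dots> = ennreal J"
      unfolding J_def by (rule nn_integral_eq_integral[OF Ji]) (use a(8)[OF X0O] in auto)
    finally show ?thesis .
  qed
  have Jlim: "(\<lambda>n. LINT x|lborel. w_hat x * norm (h (r n) x)) \<longlonglongrightarrow> J"
  proof -
    obtain w' where w': "continuous_on UNIV w'" "\<And>x. x \<in> L \<Longrightarrow> w' x = w_hat x" using ext[OF Lc wc] by blast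
    have "(LINT x|lborel. w' x * norm (h n x)) = (LINT x|lborel. w_hat x * norm (h n x))" for n
      by (rule Bochner_Integration.integral_cong[OF refl]) (metis w'(2) hL norm_zero mult_zero_right)
    moreover have "(LINT z|N0. w' (X0 z) * norm (V0 z)) = J"
      unfolding J_def by (rule Bochner_Integration.integral_cong[OF refl]) (simp only: w'(2)[OF subsetD[OF \<Omega>L X0O]] a(26)[OF X0O])
    ultimately show ?thesis using lim2'[OF w'(1)] by simp
  qed
  have opt: "beckmann_cost \<Omega> w q0 \<le> beckmann_cost \<Omega> w P" if P: "P \<in> beckmann_feasible \<Omega> \<mu>p \<mu>m" for P
  \<comment> \<open>Finite cost and w \<ge> w_low > 0 force finite total variation, which the polar
    decomposition requires; against infinite cost the comparison is trivial.\<close>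
  proof (cases "beckmann_cost \<Omega> w P < \<infinity>")
    case True
    let ?T = "total_variation \<Omega> P"
    have wT: "w \<in> borel_measurable ?T"
      using continuous_measurable_restrict[OF a(7)] measurable_cong_sets[OF sets_total_variation refl] by blast
    have "ennreal w_low * emeasure ?T \<Omega> = (\<integral>\<^sup>+x. ennreal w_low * indicator (space ?T) x \<partial>?T)"
      by (subst nn_integral_cmult_indicator[OF sets.top]) simp
    also have "\<dots> \<le> beckmann_cost \<Omega> w P"
      unfolding beckmann_cost_def by (rule nn_integral_mono) (use a(10) in \<open>auto simp: ennreal_leI\<close>)
    finally have "ennreal w_low * emeasure ?T \<Omega> < \<infinity>" using True by (rule le_less_trans)
    then have fin: "emeasure ?T \<Omega> < \<infinity>" using a(9) by (auto simp: ennreal_mult_less_top)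
    interpret T: finite_measure ?T by (rule finite_measureI) (use fin in auto)
    obtain hp where hp: "hp \<in> borel_measurable ?T" "\<And>x. norm (hp x) \<le> 1"
      and dv: "\<And>\<phi> G. C1_on \<Omega> \<phi> G \<Longrightarrow> - (LINT x|?T. G x \<bullet> hp x) = (LINT x|\<mu>p. \<phi> x) - (LINT x|\<mu>m. \<phi> x)"
      using beckmann_feasible_field[OF \<Omega> int\<Omega> \<mu>p \<mu>m P fin] by blast
    have idT: "(\<lambda>x. x) \<in> borel_measurable ?T"
      using \<open>(\<lambda>x. x) \<in> borel_measurable (restrict_space borel \<Omega>)\<close> measurable_cong_sets[OF sets_total_variation refl] by blast
    have wi: "integrable ?T w"
      using integrable_continuous_comp[OF T.finite_measure_axioms idT _ \<Omega> a(7)] by simp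
    define S where "S = (LINT x|?T. w x)"
    have cP: "beckmann_cost \<Omega> w P = ennreal S"
      unfolding beckmann_cost_def S_def by (rule nn_integral_eq_integral[OF wi]) (use a(8) in auto)
    \<comment> \<open>Each regularized solution is compared with one fixed field Q, whose
      \<epsilon>-term vanishes along the subsequence; \<eta> is sent to 0 afterwards.\<close>
    have "J \<le> S + \<eta>" if \<eta>: "0 < \<eta>" for \<eta>
    proof -
      obtain Q where Q: "flux_field \<Omega> \<alpha> Q (\<lambda>g G. - ((LINT x|\<mu>p. g x) - (LINT x|\<mu>m. g x)))"
        and Qc: "(LINT z|lborel. (indicator \<Omega> z * w z) * norm (Q z)) \<le> (LINT y|?T. w y * norm (hp y)) + \<eta>"
      proof (rule beckmann_competitor[OF \<Omega> a(2,3,5,6,7,8) moll \<mu>p \<mu>m T.finite_measure_axioms idT _ hp _ \<eta>])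
        show "- (LINT x|?T. G x \<bullet> hp x) = (LINT x|\<mu>p. \<phi> x) - (LINT x|\<mu>m. \<phi> x)" if "C1_on \<Omega> \<phi> G" for \<phi> G
          by (rule dv[OF that])
      qed auto
      have "(\<lambda>n. (LINT z|lborel. (indicator \<Omega> z * w z) * norm (Q z)) + \<epsilon> (r n) / \<alpha> * (LINT z|lborel. norm (Q z) powr \<alpha>))
         \<longlonglongrightarrow> (LINT z|lborel. (indicator \<Omega> z * w z) * norm (Q z)) + 0 / \<alpha> * (LINT z|lborel. norm (Q z) powr \<alpha>)"
        using a(5) by (intro tendsto_intros LIMSEQ_subseq_LIMSEQ[OF a(29) r, unfolded comp_def]) auto
      then have "J \<le> (LINT z|lborel. (indicator \<Omega> z * w z) * norm (Q z)) + 0 / \<alpha> * (LINT z|lborel. norm (Q z) powr \<alpha>)"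
        by (rule LIMSEQ_le[OF Jlim]) (use upper[OF Q] in auto)
      also have "\<dots> \<le> (LINT y|?T. w y * norm (hp y)) + \<eta>" using Qc by simp
      also have "(LINT y|?T. w y * norm (hp y)) \<le> S"
        unfolding S_def
      proof (rule integral_mono[OF _ wi])
        show "integrable ?T (\<lambda>y. w y * norm (hp y))"
          by (rule Bochner_Integration.integrable_bound[OF wi])
             (use wT hp in \<open>auto simp: abs_mult mult_left_le intro!: AE_I2 borel_measurable_times\<close>)
        show "w y * norm (hp y) \<le> w y" if "y \<in> space ?T" for y
          using a(8)[of y] hp(2)[of y] that by (simp add: mult_left_le)
      qed
      finally show ?thesis by simp
    qed
    then have "J \<le> S" by (rule field_le_epsilon)
    then have "ennreal J \<le> beckmann_cost \<Omega> w P" unfolding cP by (rule ennreal_leI)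
    then show ?thesis using cost0 by (rule order_trans[rotated])
  qed (simp add: not_less top_unique)
  have "beckmann_solution \<Omega> w \<mu>p \<mu>m q0" unfolding beckmann_solution_def using feas opt by blast
  then show ?thesis using r ws unfolding L_def K_def by blast
qed


end
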